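(* Let $N_c\ge1$ be an integer, $N_f=N_c+1$, let $0\le t,\tilde t<1$, and let $x,y$ be $SU(N_f)$ fugacities. Then the Hilbert series of $U(N_c)=U(N_f-1)$ SQCD with $N_f$ flavours is $$g_{N_f,U(N_f-1)}(t,\tilde t,x,y)=\big(1-(t\tilde t)^{N_f}\big)\,\mathrm{PE}\big[[1,0,\dots,0;0,\dots,0,1]_{x;y}\,t\tilde t\,\big]=\sum_{n_1,\dots,n_{N_f-1}=0}^\infty[n_1,n_2,\dots,n_{N_f-1};n_{N_f-1},\dots,n_2,n_1]_{x;y}\,(t\tilde t)^{\sum_{j=1}^{N_f-1}jn_j}.$$ In particular, setting all $x$'s and $y$'s to $1$, $g_{N_f,U(N_f-1)}(t,\tilde t,1,1)=\dfrac{1-(t\tilde t)^{N_f}}{(1-t\tilde t)^{N_f^2}}$.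
   Context: Fugacities: $x=(x_1,\dots,x_{N_f-1})$ and $y=(y_1,\dots,y_{N_f-1})$ are complex numbers of modulus $1$. Put $\xi_1=x_1$, $\xi_k=x_k/x_{k-1}$ for $2\le k\le N_f-1$, $\xi_{N_f}=1/x_{N_f-1}$, and define $\eta_1,\dots,\eta_{N_f}$ from $y$ in the same way. Characters: $[a_1,\dots,a_{N_f-1};b_1,\dots,b_{N_f-1}]_{x;y}$ is the character of the irreducible representation of $SU(N_f)\times SU(N_f)$ with Dynkin labels $[a_1,\dots,a_{N_f-1}]$ and $[b_1,\dots,b_{N_f-1}]$, evaluated at $(\mathrm{diag}(\xi_i),\mathrm{diag}(\eta_j))$; the fundamental is $[1,0,\dots,0]$ with character $\sum_i\xi_i$ and the antifundamental is $[0,\dots,0,1]$ with character $\sum_j\eta_j^{-1}$ in the $y$ variables. The plethystic exponential is $\mathrm{PE}[g(t_1,\dots,t_n)]=\exp\big(\sum_{r\ge1}\frac1r g(t_1^r,\dots,t_n^r)\big)$, taken over all variables including $x,y$; thus $\mathrm{PE}\big[[1,0,\dots,0;0,\dots,0,1]_{x;y}t\tilde t\big]=\prod_{i,j=1}^{N_f}\frac{1}{1-t\tilde t\,\xi_i\eta_j^{-1}}$. Hilbert series: with $\phi(z)=\prod_{i=1}^{N_f}\frac{1}{1-t\xi_i z^{-1}}\prod_{j=1}^{N_f}\frac{1}{1-\tilde t\eta_j^{-1}z}$, $$g_{N_f,U(N_c)}(t,\tilde t,x,y)=\frac{1}{N_c!(2\pi i)^{N_c}}\oint_{|z_1|=1}\frac{dz_1}{z_1}\cdots\oint_{|z_{N_c}|=1}\frac{dz_{N_c}}{z_{N_c}}\prod_{1\le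 a<b\le N_c}|z_a-z_b|^2\prod_{a=1}^{N_c}\phi(z_a).$$ *)

theory Defs
  imports
    "HOL-Complex_Analysis.Contour_Integration"
    "HOL-Analysis.Infinite_Sum"
    "Jordan_Normal_Form.Schur_Decomposition"
begin

section \<open>Fugacities\<close>

text \<open>
  All variables carry the 1-based indices of the usual notation: \<open>x 1, ..., x (N - 1)\<close>,
  \<open>fug N x 1, ..., fug N x N\<close>, and Dynkin labels \<open>a 1, ..., a (N - 1)\<close>, always with \<open>N \<ge> 2\<close>.
  Values at other indices are irrelevant.
\<close>

definition fug :: "nat \<Rightarrow> (nat \<Rightarrow> complex) \<Rightarrow> nat \<Rightarrow> complex" where
  "fug N x k = (if k = 1 then x 1 else if k = N then 1 / x (N - 1) else x k / x (k - 1))"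

definition fugacities :: "nat \<Rightarrow> (nat \<Rightarrow> complex) \<Rightarrow> bool" where
  "fugacities N x \<longleftrightarrow> (\<forall>k\<in>{1..N - 1}. cmod (x k) = 1)"

definition torus_elt :: "nat \<Rightarrow> (nat \<Rightarrow> complex) \<Rightarrow> complex mat" where
  "torus_elt N x = mat_diag N (\<lambda>i. fug N x (i + 1))"


section \<open>Irreducible representations of $SU(N) \times SU(N)$\<close>

definition SU :: "nat \<Rightarrow> complex mat monoid" where
  "SU N = \<lparr>carrier = {A \<in> carrier_mat N N. mat_adjoint A * A = 1\<^sub>m N \<and> Determinant.det A = 1},
           monoid.mult = (*), one = 1\<^sub>m N\<rparr>"

definition GL :: "nat \<Rightarrow> complex mat monoid" where
  "GL d = units_of (ring_mat TYPE(complex) d ())"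

definition mat_tendsto :: "nat \<Rightarrow> (nat \<Rightarrow> complex mat) \<Rightarrow> complex mat \<Rightarrow> bool" where
  "mat_tendsto n A L \<longleftrightarrow> (\<forall>i<n. \<forall>j<n. (\<lambda>m. A m $$ (i, j)) \<longlonglongrightarrow> L $$ (i, j))"

text \<open>
  Finite-dimensional continuous representations. The matrix type carries no topology, so
  continuity is expressed by sequences, which is equivalent as the groups are metrizable.
  Continuous homomorphisms between Lie groups are automatically smooth.
\<close>

definition is_rep ::
    "nat \<Rightarrow> nat \<Rightarrow> (complex mat \<times> complex mat \<Rightarrow> complex mat) \<Rightarrow> bool" where
  "is_rep N d \<rho> \<longleftrightarrow>
     \<rho> \<in> hom (SU N \<times>\<times> SU N) (GL d) \<and>
     (\<forall>A B g h.
        (\<forall>m. A m \<in> carrier (SU N) \<and> B m \<in> carrier (SU N)) \<longrightarrow>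
        g \<in> carrier (SU N) \<longrightarrow> h \<in> carrier (SU N) \<longrightarrow>
        mat_tendsto N A g \<longrightarrow> mat_tendsto N B h \<longrightarrow>
        mat_tendsto d (\<lambda>m. \<rho> (A m, B m)) (\<rho> (g, h)))"

definition irreducible_rep ::
    "nat \<Rightarrow> nat \<Rightarrow> (complex mat \<times> complex mat \<Rightarrow> complex mat) \<Rightarrow> bool" where
  "irreducible_rep N d \<rho> \<longleftrightarrow>
     is_rep N d \<rho> \<and> d > 0 \<and>
     (\<forall>W. VectorSpace.subspace class_ring W (module_vec TYPE(complex) d) \<and>
          (\<forall>g\<in>carrier (SU N \<times>\<times> SU N). \<forall>v\<in>W. \<rho> g *\<^sub>v v \<in> W) \<longrightarrow>
          W = {0\<^sub>v d} \<or> W = carrier_vec d)"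

text \<open>
  Weights are given by their Dynkin labels. Since
  $\mathrm{diag}(\xi_i) = \prod_k \alpha_k^\vee(x_k)$ with $\alpha_k^\vee$ the simple coroots,
  the weight with labels \<open>p\<close> is the character $\prod_k x_k^{p_k}$ of the maximal torus.
\<close>

definition is_weight ::
    "nat \<Rightarrow> nat \<Rightarrow> (complex mat \<times> complex mat \<Rightarrow> complex mat) \<Rightarrow>
     (nat \<Rightarrow> int) \<Rightarrow> (nat \<Rightarrow> int) \<Rightarrow> bool" where
  "is_weight N d \<rho> p q \<longleftrightarrow>
     (\<exists>v\<in>carrier_vec d. v \<noteq> 0\<^sub>v d \<and>
        (\<forall>x y. fugacities N x \<and> fugacities N y \<longrightarrow>
           \<rho> (torus_elt N x, torus_elt N y) *\<^sub>v v =
             ((\<Prod>k=1..N - 1. x k powi p k) * (\<Prod>k=1..N - 1. y k powi q k)) \<cdot>\<^sub>v v))"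

definition cartan_A :: "nat \<Rightarrow> nat \<Rightarrow> int" where
  "cartan_A k j = (if k = j then 2 else if k = Suc j \<or> j = Suc k then - 1 else 0)"

text \<open>
  The dominance order: \<open>q - p\<close> is a sum of simple roots, the \<open>k\<close>-th simple root having
  Dynkin labels \<open>cartan_A k 1, ..., cartan_A k (N - 1)\<close>.
\<close>

definition weight_le :: "nat \<Rightarrow> (nat \<Rightarrow> int) \<Rightarrow> (nat \<Rightarrow> int) \<Rightarrow> bool" where
  "weight_le N p q \<longleftrightarrow>
     (\<exists>c :: nat \<Rightarrow> nat. \<forall>j\<in>{1..N - 1}. q j - p j = (\<Sum>k=1..N - 1. int (c k) * cartan_A k j))"

definition is_irrep ::
    "nat \<Rightarrow> (nat \<Rightarrow> nat) \<Rightarrow> (nat \<Rightarrow> nat) \<Rightarrow>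
     nat \<Rightarrow> (complex mat \<times> complex mat \<Rightarrow> complex mat) \<Rightarrow> bool" where
  "is_irrep N a b d \<rho> \<longleftrightarrow>
     irreducible_rep N d \<rho> \<and>
     is_weight N d \<rho> (\<lambda>k. int (a k)) (\<lambda>k. int (b k)) \<and>
     (\<forall>p q. is_weight N d \<rho> p q \<longrightarrow>
        weight_le N p (\<lambda>k. int (a k)) \<and> weight_le N q (\<lambda>k. int (b k)))"

text \<open>
  The irreducible representation with given Dynkin labels exists and is unique up to
  isomorphism (theorem of the highest weight), so the description below is a proper one.
\<close>

definition irrep_char ::
    "nat \<Rightarrow> (nat \<Rightarrow> nat) \<Rightarrow> (nat \<Rightarrow> nat) \<Rightarrow> (nat \<Rightarrow> complex) \<Rightarrow> (nat \<Rightarrow> complex) \<Rightarrow> complex" where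
  "irrep_char N a b x y =
     (THE c. \<exists>d \<rho>. is_irrep N a b d \<rho> \<and>
                   c = (\<Sum>i<d. \<rho> (torus_elt N x, torus_elt N y) $$ (i, i)))"


section \<open>Plethystic exponential\<close>

definition PE ::
    "(complex \<Rightarrow> complex \<Rightarrow> (nat \<Rightarrow> complex) \<Rightarrow> (nat \<Rightarrow> complex) \<Rightarrow> complex) \<Rightarrow>
     complex \<Rightarrow> complex \<Rightarrow> (nat \<Rightarrow> complex) \<Rightarrow> (nat \<Rightarrow> complex) \<Rightarrow> complex" where
  "PE g t s x y =
     exp (\<Sum>r. g (t ^ Suc r) (s ^ Suc r) (\<lambda>k. x k ^ Suc r) (\<lambda>k. y k ^ Suc r) / of_nat (Suc r))"


section \<open>Hilbert series\<close>

text \<open>Iterated integral $\oint \frac{dz_1}{z_1} \cdots \oint \frac{dz_n}{z_n} f(z_1,\dots,z_n)$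
  over unit circles; the head of the list is the variable of the outermost integral.\<close>

primrec iter_oint :: "nat \<Rightarrow> (complex list \<Rightarrow> complex) \<Rightarrow> complex" where
  "iter_oint 0 f = f []"
| "iter_oint (Suc n) f =
     contour_integral (circlepath 0 1) (\<lambda>w. iter_oint n (\<lambda>zs. f (w # zs)) / w)"

definition flavour_factor ::
    "nat \<Rightarrow> complex \<Rightarrow> complex \<Rightarrow> (nat \<Rightarrow> complex) \<Rightarrow> (nat \<Rightarrow> complex) \<Rightarrow> complex \<Rightarrow> complex" where
  "flavour_factor Nf t s x y z =
     (\<Prod>i=1..Nf. 1 / (1 - t * fug Nf x i * inverse z)) *
     (\<Prod>j=1..Nf. 1 / (1 - s * inverse (fug Nf y j) * z))"

definition hilbert_U ::
    "nat \<Rightarrow> nat \<Rightarrow> complex \<Rightarrow> complex \<Rightarrow> (nat \<Rightarrow> complex) \<Rightarrow> (nat \<Rightarrow> complex) \<Rightarrow> complex" where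
  "hilbert_U Nf Nc t s x y =
     1 / (fact Nc * (2 * of_real pi * \<i>) ^ Nc) *
     iter_oint Nc (\<lambda>z.
       (\<Prod>b<Nc. \<Prod>a<b. of_real ((cmod (z ! a - z ! b))\<^sup>2)) *
       (\<Prod>a<Nc. flavour_factor Nf t s x y (z ! a)))"

end

theory Submission
  imports Defs "Jordan_Normal_Form.Spectral_Radius" "HOL-Library.Product_Plus"
    "HOL-Complex_Analysis.Cauchy_Integral_Formula"
begin

text \<open>Expanding the Vandermonde factor turns the integral into the determinant of the Toeplitz matrix of \<phi> of
size N - 1, N the number of flavours. With u_i = t \<xi>_i and w_j = s / \<eta>_j, multiplying the Toeplitz matrix T of size N by the coefficient
matrices of the polynomials (1 - u_1 \<zeta>) ... (1 - u_N \<zeta>) / (1 - u_i \<zeta>), and likewise for w, gives the Cauchy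
matrix 1/(1 - u_i w_j). Lowering the corner entry of T by 1 replaces this by u_i w_j/(1 - u_i w_j);
the difference of the two determinants is the wanted minor.

On the character side, the coefficient of (t s)^k in the Cauchy product is the character of the k-th symmetric
power of the bifundamental. A highest weight vector of this power is a polynomial on matrices determined by its values on
diagonal matrices; hence the decomposition is multiplicity free, with the products of leading principal minors
as highest weight vectors, and the factor 1 - (t s)^N removes the powers of the full determinant. Irreducible
representations of equal highest weight have equal characters because the pair of their highest weight
vectors generates the graph of an isomorphism.\<close>

text \<open>The representations behind \<open>irrep_char\<close> are only continuous, so the Lie
  algebra action has to be produced before weights can be raised or lowered. Fourier coefficients
  diagonalize each circle of the torus; conjugation into the torus then gives a Lipschitz bound at
  the identity, and this bound makes the differential independent of the curve along which it is
  computed. Its complex linear extension lets the single matrix units \<open>Eu i j\<close> act.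

  Matrices of every shape live in the one type \<open>fmat\<close>, a ring without unit:
  \<open>msp S T\<close> records the shape, \<open>e S\<close> is the local unit, and column vectors
  are the elements of \<open>msp S {0}\<close>. A pair of group elements is one block diagonal
  matrix of size 2N.

  In the bifundamental the variable X(i,j) is paired with index i of the first block and with index
  2N - 1 - j, counted from the end, of the second. With this reversal every raising operator adds a
  multiple of an earlier row or column of X to a later one (up to sign), which is what Gaussian
  elimination does and what leaves leading principal minors unchanged.\<close>

abbreviation "Det == Determinant.det"

section \<open>Finitely supported matrices\<close>

typedef fmat = "{f :: nat => nat => complex. EX n. ALL i j. n <= i \<or> n <= j --> f i j = 0}"
 morphisms ent Fmat by (rule exI[of _ "%_ _. 0"]) auto

setup_lifting type_definition_fmat

lemma fmat_eqI: "(!!i j. ent A i j = ent B i j) ==> A = B" by (metis ent_inject ext)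

definition msp :: "nat set => nat set => fmat set" where
 "msp S T = {A. ALL i j. ent A i j ~= 0 --> i : S & j : T}"

lemma fmat_msp: "EX n. A : msp {..<n} {..<n}" using ent[of A] by (simp add: msp_def) (meson not_le)

lemma fmat_msp3: "EX n. A : msp {..<n} {..<n} & B : msp {..<n} {..<n} & C : msp {..<n} {..<n}"
proof -
 obtain a where "A : msp {..<a} {..<a}" using fmat_msp by blast
 moreover obtain b where "B : msp {..<b} {..<b}" using fmat_msp by blast
 moreover obtain c where "C : msp {..<c} {..<c}" using fmat_msp by blast
 ultimately show ?thesis by (intro exI[of _ "max a (max b c)"]) (fastforce simp: msp_def)
qed

instantiation fmat :: ring
begin

lift_definition zero_fmat :: fmat is "%_ _. 0" by auto

lift_definition plus_fmat :: "fmat => fmat => fmat" is "%f g i j. f i j + g i j"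
proof -
 fix f g :: "nat => nat => complex"
 assume "EX n. ALL i j. n <= i \<or> n <= j --> f i j = 0" "EX n. ALL i j. n <= i \<or> n <= j --> g i j = 0"
 then obtain n m where "ALL i j. n <= i \<or> n <= j --> f i j = 0" "ALL i j. m <= i \<or> m <= j --> g i j = 0" by blast
 thus "EX n. ALL i j. n <= i \<or> n <= j --> f i j + g i j = 0"
  by (intro exI[of _ "max n m"]) (metis add.right_neutral max.boundedE)
qed

lift_definition uminus_fmat :: "fmat => fmat" is "%f i j. - f i j" by auto

definition minus_fmat :: "fmat => fmat => fmat" where "minus_fmat A B = A + - B"

text \<open>Summing over the support of row i of the left factor keeps the index set finite without
  choosing a bound; \<open>ent_mult\<close> replaces it by any finite set containing the indices at
  which both factors are nonzero.\<close>

lift_definition times_fmat :: "fmat => fmat => fmat" is "%f g i j. \<Sum>k | f i k ~= 0. f i k * g k j"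
proof -
 fix f g :: "nat => nat => complex"
 assume "EX n. ALL i j. n <= i \<or> n <= j --> f i j = 0" "EX n. ALL i j. n <= i \<or> n <= j --> g i j = 0"
 then obtain n m where "ALL i j. n <= i \<or> n <= j --> f i j = 0" "ALL i j. m <= i \<or> m <= j --> g i j = 0" by blast
 thus "EX n. ALL i j. n <= i \<or> n <= j --> (\<Sum>k | f i k ~= 0. f i k * g k j) = 0"
  by (intro exI[of _ "max n m"]) (auto intro!: sum.neutral)
qed

lemma ent_simps [simp]:
 "ent 0 i j = 0" "ent (A + B) i j = ent A i j + ent B i j" "ent (- A) i j = - ent A i j"
 "ent (A - B) i j = ent A i j - ent B i j"
 by (auto simp: zero_fmat.rep_eq plus_fmat.rep_eq uminus_fmat.rep_eq minus_fmat_def)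

lemma ent_mult:
 assumes "finite K" "!!k. ent A i k ~= 0 ==> ent B k j ~= 0 ==> k : K"
 shows "ent (A * B) i j = (SUM k:K. ent A i k * ent B k j)"
proof -
 obtain n where n: "A : msp {..<n} {..<n}" using fmat_msp[of A] by (elim exE)
 have "{k. ent A i k ~= 0} \<subseteq> {..<n}" using n unfolding msp_def by blast
 hence "finite {k. ent A i k ~= 0}" using finite_lessThan by (rule finite_subset)
 hence "(\<Sum>k | ent A i k ~= 0. ent A i k * ent B k j) = (SUM k:K. ent A i k * ent B k j)"
  using assms by (intro sum.mono_neutral_cong) auto
 thus ?thesis by (simp add: times_fmat.rep_eq)
qed

instance
proof
 fix A B C :: fmat
 obtain n where n: "A : msp {..<n} {..<n}" "B : msp {..<n} {..<n}" "C : msp {..<n} {..<n}"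
  using fmat_msp3[of A B C] by blast
 have mA: "ent (A * Y) i j = (\<Sum>k<n. ent A i k * ent Y k j)" for Y i j
  using n by (intro ent_mult) (auto simp: msp_def)
 have mB: "ent (B * Y) i j = (\<Sum>k<n. ent B i k * ent Y k j)" for Y i j
  using n by (intro ent_mult) (auto simp: msp_def)
 have mC: "ent (Y * C) i j = (\<Sum>k<n. ent Y i k * ent C k j)" for Y i j
  using n by (intro ent_mult) (auto simp: msp_def)
 show "A * B * C = A * (B * C)"
 proof (rule fmat_eqI)
  fix i j
  have "ent (A * B * C) i j = (\<Sum>k<n. \<Sum>l<n. ent A i l * ent B l k * ent C k j)"
   by (simp add: mC mA sum_distrib_right)
  also have "... = (\<Sum>l<n. \<Sum>k<n. ent A i l * ent B l k * ent C k j)" by (rule sum.swap)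
  also have "... = ent (A * (B * C)) i j" by (simp add: mA mB sum_distrib_left mult.assoc)
  finally show "ent (A * B * C) i j = ent (A * (B * C)) i j" .
 qed
 show "(A + B) * C = A * C + B * C"
  by (rule fmat_eqI) (simp only: mC ent_simps distrib_right sum.distrib)
 show "A * (B + C) = A * B + A * C"
  by (rule fmat_eqI) (simp only: mA ent_simps distrib_left sum.distrib)
qed (auto intro!: fmat_eqI)

end

lift_definition csc :: "complex => fmat => fmat" is "%c f i j. c * f i j" by auto

lift_definition star :: "fmat => fmat" is "%f i j. cnj (f j i)" by auto

text \<open>For infinite S or T the result is 0, so that the bound required by the type always
  exists.\<close>

definition mk :: "nat set => nat set => (nat => nat => complex) => fmat" where
 "mk S T f = Fmat (%i j. if finite S & finite T & i : S & j : T then f i j else 0)"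

lemma mk_rep: "ent (mk S T f) = (%i j. if finite S & finite T & i : S & j : T then f i j else 0)"
proof -
 have "EX n. ALL i j. n <= i \<or> n <= j --> (if finite S & finite T & i : S & j : T then f i j else 0) = 0"
 proof (cases "finite S & finite T")
  case True
  then obtain n where "ALL i:S \<union> T. i < n" by (metis finite_Un finite_nat_set_iff_bounded)
  thus ?thesis by (intro exI[of _ n]) (metis UnI1 UnI2 leD)
 qed auto
 thus ?thesis by (simp add: mk_def Fmat_inverse)
qed

lemma ent_csc [simp]: "ent (csc c A) i j = c * ent A i j" by (simp add: csc.rep_eq)
lemma ent_star [simp]: "ent (star A) i j = cnj (ent A j i)" by (simp add: star.rep_eq)
lemma ent_mk: "finite S ==> finite T ==> ent (mk S T f) i j = (if i : S & j : T then f i j else 0)"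
 by (simp add: mk_rep)

definition dg :: "nat set => (nat => complex) => fmat" where
 "dg S f = mk S S (%i j. if i = j then f i else 0)"

abbreviation e :: "nat set => fmat" where "e S == dg S (%_. 1)"

lemma ent_dg: "finite S ==> ent (dg S f) i j = (if i : S & i = j then f i else 0)"
 by (auto simp: dg_def ent_mk)

lemma mspI: "(!!i j. ent A i j ~= 0 ==> i : S & j : T) ==> A : msp S T" by (auto simp: msp_def)
lemma mspD: "A : msp S T ==> ent A i j ~= 0 ==> i : S & j : T" by (auto simp: msp_def)
lemma mspD0: "A : msp S T ==> i \<notin> S \<or> j \<notin> T ==> ent A i j = 0" by (auto simp: msp_def)

lemma ent_mult_msp:
 assumes "finite K" "A : msp S K \<or> B : msp K T"
 shows "ent (A * B) i j = (SUM k:K. ent A i k * ent B k j)"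
 using assms by (intro ent_mult) (auto simp: msp_def)

lemma msp_mult [intro, simp]: "A : msp S T ==> B : msp T' U ==> A * B : msp S U"
proof (rule mspI)
 fix i j assume *: "A : msp S T" "B : msp T' U" "ent (A * B) i j ~= 0"
 obtain n where n: "A : msp {..<n} {..<n}" using fmat_msp[of A] by blast
 have "ent (A * B) i j = (\<Sum>k<n. ent A i k * ent B k j)"
  using n by (intro ent_mult) (auto simp: msp_def)
 with *(3) have "(\<Sum>k<n. ent A i k * ent B k j) ~= 0" by simp
 then obtain k where "ent A i k * ent B k j ~= 0" by (rule sum.not_neutral_contains_not_neutral)
 thus "i : S & j : U" using * by (auto simp: msp_def)
qed

lemma msp_closed [intro, simp]:
 "0 : msp S T" "A : msp S T ==> B : msp S T ==> A + B : msp S T"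
 "A : msp S T ==> B : msp S T ==> A - B : msp S T" "A : msp S T ==> - A : msp S T"
 "A : msp S T ==> csc c A : msp S T" "A : msp S T ==> star A : msp T S"
proof -
 assume A: "A : msp S T"
 show "- A : msp S T" "csc c A : msp S T" "star A : msp T S" using A by (auto simp: msp_def)
 assume B: "B : msp S T"
 have *: "ent A i j ~= 0 \<or> ent B i j ~= 0 ==> i : S & j : T" for i j using A B by (auto simp: msp_def)
 show "A + B : msp S T" "A - B : msp S T" by (rule mspI, rule *, force)+
qed (auto simp: msp_def)

lemma msp_sum [intro]: "(!!x. x : F ==> f x : msp S T) ==> sum f F : msp S T"
 by (induction F rule: infinite_finite_induct) auto

lemma msp_mk [intro, simp]: "mk S T f : msp S T" by (rule mspI) (auto simp: mk_rep split: if_splits)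

lemma msp_dg [intro, simp]: "dg S f : msp S S" by (simp add: dg_def)

lemma msp_mono: "A : msp S T ==> S \<subseteq> S' ==> T \<subseteq> T' ==> A : msp S' T'" by (auto simp: msp_def)

lemma csc_simps [simp]:
 "csc c 0 = 0" "csc 0 A = 0" "csc 1 A = A" "csc a (csc b A) = csc (a * b) A"
 "star (star A) = A" "star 0 = 0" "star (A + B) = star A + star B" "star (A - B) = star A - star B"
 "star (- A) = - star A" "star (csc c A) = csc (cnj c) (star A)" "csc (-1) A = - A"
 by (auto intro!: fmat_eqI)

lemma csc_mult [simp]: "csc c A * B = csc c (A * B)" "A * csc c B = csc c (A * B)"
proof -
 obtain n where n: "A : msp {..<n} {..<n}" using fmat_msp[of A] by blast
 have m: "ent (csc d A * X) i j = (\<Sum>k<n. ent (csc d A) i k * ent X k j)"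
   "ent (A * X) i j = (\<Sum>k<n. ent A i k * ent X k j)" for X i j d
  using n by (intro ent_mult; auto simp: msp_def)+
 show "csc c A * B = csc c (A * B)" "A * csc c B = csc c (A * B)"
  by (auto intro!: fmat_eqI simp: m sum_distrib_left mult_ac)
qed

lemma csc_distrib:
 "csc c (A + B) = csc c A + csc c B" "csc c (A - B) = csc c A - csc c B"
 "csc (a + b) A = csc a A + csc b A" "csc (a - b) A = csc a A - csc b A" "csc c (- A) = csc (- c) A"
 "csc (- c) A = - csc c A" by (auto intro!: fmat_eqI simp: algebra_simps)

lemma csc_eq_0: "csc c A = 0 \<longleftrightarrow> c = 0 \<or> A = 0"
proof -
 have "csc (1 / c) (csc c A) = A" if "c ~= 0" using that by simp
 thus ?thesis by (metis csc_simps(1,2))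
qed

lemma csc_sum: "csc c (sum f F) = (SUM x:F. csc c (f x))"
 by (induction F rule: infinite_finite_induct) (auto simp: csc_distrib)

lemma ent_sum: "ent (sum f F) i j = (SUM x:F. ent (f x) i j)"
 by (induction F rule: infinite_finite_induct) auto

lemma star_mult [simp]: "star (A * B) = star B * star A"
proof (rule fmat_eqI)
 fix i j
 obtain n where n: "A : msp {..<n} {..<n}" using fmat_msp[of A] by blast
 have "ent (A * B) j i = (\<Sum>k<n. ent A j k * ent B k i)"
  using n by (intro ent_mult) (auto simp: msp_def)
 moreover have "ent (star B * star A) i j = (\<Sum>k<n. ent (star B) i k * ent (star A) k j)"
  using n by (intro ent_mult) (auto simp: msp_def)
 ultimately show "ent (star (A * B)) i j = ent (star B * star A) i j" by (simp add: mult.commute)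
qed

lemma dg_mult: assumes "finite S" shows "dg S f * dg S g = dg S (%i. f i * g i)"
proof (rule fmat_eqI)
 fix i j
 have *: "ent (dg S f) i k * ent (dg S g) k j = (if k = i then (if i = j & i : S then f i * g i else 0) else 0)" for k
  using assms by (auto simp add: ent_dg)
 have "ent (dg S f * dg S g) i j = (SUM k:S. ent (dg S f) i k * ent (dg S g) k j)"
  using assms by (intro ent_mult_msp[of _ _ S]) auto
 also have "... = ent (dg S (%i. f i * g i)) i j" unfolding * using assms by (auto simp add: ent_dg)
 finally show "ent (dg S f * dg S g) i j = ent (dg S (%i. f i * g i)) i j" .
qed

lemma e_mult: assumes "finite S" "A : msp S T" shows "e S * A = A"
proof (rule fmat_eqI)
 fix i j
 have *: "ent (e S) i k * ent A k j = (if k = i then ent A i j else 0)" for k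
  using assms by (auto simp add: ent_dg msp_def)
 have "ent (e S * A) i j = (SUM k:S. ent (e S) i k * ent A k j)"
  using assms by (intro ent_mult_msp[of _ _ S]) auto
 also have "... = ent A i j" unfolding * using assms by (auto simp: msp_def)
 finally show "ent (e S * A) i j = ent A i j" .
qed

lemma star_dg [simp]: "star (dg S f) = dg S (%i. cnj (f i))"
 by (rule fmat_eqI) (auto simp: dg_def mk_rep)

lemma mult_e: "finite T ==> A : msp S T ==> A * e T = A"
proof -
 assume "finite T" "A : msp S T"
 hence "star (e T * star A) = A" by (subst e_mult) auto
 thus ?thesis by simp
qed

section \<open>Trace and entrywise norm\<close>

definition tr :: "fmat => complex" where "tr A = (\<Sum>i | ent A i i ~= 0. ent A i i)"

lemma tr_eq: "finite K ==> (!!i. ent A i i ~= 0 ==> i : K) ==> tr A = (SUM i:K. ent A i i)"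
 unfolding tr_def by (rule sum.mono_neutral_left) auto

lemma tr_msp: "finite S ==> A : msp S T \<or> A : msp T S ==> tr A = (SUM i:S. ent A i i)"
 by (rule tr_eq) (auto simp: msp_def)

lemma tr_comm: "tr (A * B) = tr (B * A)"
proof -
 obtain n where AB: "A : msp {..<n} {..<n}" "B : msp {..<n} {..<n}" using fmat_msp3[of A B] by blast
 hence "tr (A * B) = (\<Sum>i<n. \<Sum>k<n. ent A i k * ent B k i)"
  using tr_msp[of "{..<n}" "A * B" "{..<n}"] by (simp add: ent_mult_msp[of "{..<n}" _ "{..<n}"])
 also have "... = (\<Sum>k<n. \<Sum>i<n. ent B k i * ent A i k)" by (subst sum.swap) (simp add: mult.commute)
 also have "... = tr (B * A)"
  using AB tr_msp[of "{..<n}" "B * A" "{..<n}"] by (simp add: ent_mult_msp[of "{..<n}" _ "{..<n}"])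
 finally show ?thesis .
qed

lemma tr_add [simp]: "tr (A + B) = tr A + tr B"
proof -
 obtain n where AB: "A : msp {..<n} {..<n}" "B : msp {..<n} {..<n}" using fmat_msp3[of A B] by blast
 thus ?thesis by (simp add: tr_msp[of "{..<n}" _ "{..<n}"] sum.distrib)
qed

lemma tr_csc [simp]: "tr (csc c A) = c * tr A"
 by (cases "c = 0") (simp_all add: tr_def sum_distrib_left)

lemma tr_zero [simp]: "tr 0 = 0" by (simp add: tr_def)

lemma tr_sum: "tr (sum f F) = (SUM x:F. tr (f x))"
 by (induction F rule: infinite_finite_induct) auto

text \<open>The sum of the moduli of all entries. It is submultiplicative, which is what the
  estimates of orders in t rely on.\<close>

definition nrm :: "fmat => real" where
 "nrm A = (\<Sum>p | ent A (fst p) (snd p) ~= 0. cmod (ent A (fst p) (snd p)))"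

lemma nrm_eq: assumes "finite K" "!!i j. ent A i j ~= 0 ==> (i,j) : K"
 shows "nrm A = (\<Sum>(i,j)\<in>K. cmod (ent A i j))"
 unfolding nrm_def case_prod_unfold using assms by (intro sum.mono_neutral_left) auto

lemma nrm_msp: "finite S ==> finite T ==> A : msp S T ==> nrm A = (SUM i:S. SUM j:T. cmod (ent A i j))"
 by (subst sum.cartesian_product, rule nrm_eq) (auto simp: msp_def)

lemma nrm_ge0 [simp]: "0 <= nrm A" unfolding nrm_def by (rule sum_nonneg) auto

lemma nrm_0 [simp]: "nrm 0 = 0" by (simp add: nrm_def)

lemma nrm_ent: "cmod (ent A i j) <= nrm A"
proof -
 obtain n where n: "A : msp {..<n} {..<n}" using fmat_msp3[of A] by blast
 show ?thesis
 proof (cases "ent A i j = 0")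
  case False
  hence ij: "i : {..<n}" "j : {..<n}" using n by (auto simp: msp_def)
  have "cmod (ent A i j) <= (\<Sum>j<n. cmod (ent A i j))" using ij by (intro member_le_sum) auto
  also have "... <= (\<Sum>i<n. \<Sum>j<n. cmod (ent A i j))"
   by (rule member_le_sum[OF ij(1), of "%i. \<Sum>j<n. cmod (ent A i j)"]) (auto intro: sum_nonneg)
  finally show ?thesis using n by (subst nrm_msp) auto
 qed simp
qed

lemma nrm_eq_0: "nrm A <= 0 ==> A = 0"
 using nrm_ent[of A] by (intro fmat_eqI) (metis ent_simps(1) norm_le_zero_iff order_trans)

lemma nrm_add: "nrm (A + B) <= nrm A + nrm B"
proof -
 obtain n where n: "A : msp {..<n} {..<n}" "B : msp {..<n} {..<n}" using fmat_msp3[of A B] by blast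
 hence "nrm (A + B) = (\<Sum>i<n. \<Sum>j<n. cmod (ent A i j + ent B i j))"
  by (simp add: nrm_msp[of "{..<n}" "{..<n}"])
 also have "... <= (\<Sum>i<n. \<Sum>j<n. cmod (ent A i j) + cmod (ent B i j))"
  by (intro sum_mono norm_triangle_ineq)
 also have "... = nrm A + nrm B" using n by (simp add: nrm_msp[of "{..<n}" "{..<n}"] sum.distrib)
 finally show ?thesis .
qed

lemma nrm_csc [simp]: "nrm (csc c A) = cmod c * nrm A"
proof -
 obtain n where n: "A : msp {..<n} {..<n}" using fmat_msp3[of A] by blast
 thus ?thesis by (simp add: nrm_msp[of "{..<n}" "{..<n}"] norm_mult sum_distrib_left)
qed

lemma nrm_minus [simp]: "nrm (- A) = nrm A" by (simp add: nrm_def)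

lemma nrm_diff: "nrm (A - B) <= nrm A + nrm B" using nrm_add[of A "- B"] by simp

lemma nrm_mult: "nrm (A * B) <= nrm A * nrm B"
proof -
 obtain n where n: "A : msp {..<n} {..<n}" "B : msp {..<n} {..<n}" using fmat_msp3[of A B] by blast
 have "nrm (A * B) = (\<Sum>i<n. \<Sum>j<n. cmod (\<Sum>k<n. ent A i k * ent B k j))"
  using n by (simp add: nrm_msp[of "{..<n}" "{..<n}"] ent_mult_msp[of "{..<n}" _ "{..<n}"])
 also have "... <= (\<Sum>i<n. \<Sum>j<n. \<Sum>k<n. cmod (ent A i k) * (\<Sum>l<n. cmod (ent B l j)))"
  by (intro sum_mono order_trans[OF norm_sum])
   (simp add: norm_mult, intro mult_left_mono member_le_sum[of _ _ "%l. cmod (ent B l _)"], auto)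
 also have "... = nrm A * nrm B"
 proof -
  have "(\<Sum>j<n. \<Sum>k<n. cmod (ent A i k) * (\<Sum>l<n. cmod (ent B l j))) = (\<Sum>k<n. cmod (ent A i k)) * nrm B" for i
  proof -
   have "nrm B = (\<Sum>j<n. \<Sum>l<n. cmod (ent B l j))"
    using n by (subst nrm_msp[of "{..<n}" "{..<n}"]) (auto intro: sum.swap)
   thus ?thesis by (simp only: sum_product) (rule sum.swap)
  qed
  thus ?thesis using n by (simp add: nrm_msp[of "{..<n}" "{..<n}" A] sum_distrib_right)
 qed
 finally show ?thesis .
qed

lemma nrm_sum: "nrm (sum f F) <= (SUM x:F. nrm (f x))"
 by (induction F rule: infinite_finite_induct) (auto intro: order_trans[OF nrm_add])

lemma nrm_le: "finite S ==> finite T ==> A : msp S T ==> (!!i j. i : S ==> j : T ==> cmod (ent A i j) <= c)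
  ==> nrm A <= real (card S * card T) * c"
proof -
 assume *: "finite S" "finite T" "A : msp S T" "!!i j. i : S ==> j : T ==> cmod (ent A i j) <= c"
 have "nrm A <= (SUM i:S. SUM j:T. c)" unfolding nrm_msp[OF *(1-3)] by (intro sum_mono *(4))
 thus ?thesis by (simp add: mult.assoc)
qed

section \<open>Orthonormal systems and the spectral theorem\<close>

text \<open>The j-th diagonal entry of the product is the squared length of column j of A.\<close>

lemma star_mult_self_eq_0: assumes "star A * A = 0" shows "A = 0"
proof (rule fmat_eqI)
 fix i j
 obtain n where n: "A : msp {..<n} {..<n}" using fmat_msp by blast
 have "ent (star A * A) j j = (\<Sum>k<n. cnj (ent A k j) * ent A k j)"
  using n by (subst ent_mult_msp[of "{..<n}" _ "{..<n}"]) auto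
 hence "(\<Sum>k<n. of_real ((cmod (ent A k j))\<^sup>2)) = (0::complex)"
  using assms by (simp add: complex_norm_square[symmetric] mult.commute del: of_real_power)
 hence "(\<Sum>k<n. (cmod (ent A k j))\<^sup>2) = 0" by (metis of_real_eq_0_iff of_real_sum)
 hence *: "ALL k<n. ent A k j = 0" by (subst (asm) sum_nonneg_eq_0_iff) auto
 show "ent A i j = ent 0 i j" using * n by (cases "i < n") (auto simp: msp_def)
qed

lemma mat_ext_vec: assumes "X : msp S T" "!!w. w : msp T {0} ==> X * w = 0" shows "X = 0"
proof (rule fmat_eqI)
 fix i j
 show "ent X i j = ent 0 i j"
 proof (cases "j : T")
  case True
  let ?w = "mk {j} {0} (%_ _. 1)"
  have "?w : msp T {0}" using True by (auto intro: msp_mono[OF msp_mk])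
  hence "ent (X * ?w) i 0 = 0" using assms(2) by simp
  moreover have "ent (X * ?w) i 0 = ent X i j"
   by (subst ent_mult[of "{j}"]) (auto simp: ent_mk split: if_splits)
  ultimately show ?thesis by simp
 qed (use assms(1) in \<open>auto simp: msp_def\<close>)
qed

text \<open>Complex linear subspaces, applied to subsets of some \<open>msp S {0}\<close>.\<close>

definition csub :: "fmat set => bool" where
 "csub W \<longleftrightarrow> 0 : W & (ALL a:W. ALL b:W. a + b : W) & (ALL c. ALL a:W. csc c a : W)"

lemma csubD: "csub W ==> 0 : W" "csub W ==> a : W ==> b : W ==> a + b : W"
 "csub W ==> a : W ==> csc c a : W" "csub W ==> a : W ==> b : W ==> a - b : W"
 "csub W ==> a : W ==> - a : W"
proof -
 assume W: "csub W"
 show "0 : W" using W by (auto simp: csub_def)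
 assume a: "a : W"
 show "csc c a : W" using W a by (auto simp: csub_def)
 show m: "- a : W" using W a csc_simps(11)[of a] unfolding csub_def by metis
 assume b: "b : W"
 show "a + b : W" using W a b by (auto simp: csub_def)
 have "- b : W" using W b csc_simps(11)[of b] unfolding csub_def by metis
 thus "a - b : W" using W a unfolding csub_def by (metis diff_conv_add_uminus)
qed

lemma star_vec_vec:
 assumes "finite S" "v : msp S {0}" "v ~= 0"
 shows "\<exists>c>0. star v * v = csc (of_real c) (e {0})"
proof -
 let ?c = "SUM k:S. (cmod (ent v k 0))\<^sup>2"
 have "ent (star v * v) 0 0 = (SUM k:S. cnj (ent v k 0) * ent v k 0)"
  using assms by (subst ent_mult_msp[of S _ "{0}" _ "{0}"]) auto
 also have "... = of_real ?c" by (simp add: complex_norm_square[symmetric] mult.commute)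
 finally have 1: "ent (star v * v) 0 0 = of_real ?c" .
 have eq: "star v * v = csc (of_real ?c) (e {0})"
 proof (rule fmat_eqI)
  fix i j
  have "star v * v : msp {0} {0}" using assms by auto
  thus "ent (star v * v) i j = ent (csc (of_real ?c) (e {0})) i j"
   using 1 by (cases "i = 0 & j = 0") (auto simp: ent_dg msp_def)
 qed
 have "?c ~= 0"
 proof
  assume "?c = 0"
  hence "star v * v = 0" by (simp only: eq of_real_0 csc_simps)
  thus False using assms(3) star_mult_self_eq_0 by blast
 qed
 moreover have "?c >= 0" by (rule sum_nonneg) auto
 ultimately show ?thesis using eq by (intro exI[of _ ?c]) auto
qed

definition isometry :: "nat set => nat => fmat => bool" where
 "isometry S r B \<longleftrightarrow> B : msp S {..<r} & star B * B = e {..<r}"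

text \<open>\<open>?P\<close> is a self-adjoint idempotent of trace r on a space of dimension
  \<open>card S\<close>. A diagonal entry p of it satisfies p^2 <= p because p is the squared length
  of its row, so p <= 1.\<close>

lemma isometry_le_card: assumes S: "finite S" and B: "isometry S r B" shows "r <= card S"
proof -
 let ?P = "B * star B"
 have B': "B : msp S {..<r}" "star B * B = e {..<r}" using B by (auto simp: isometry_def)
 have P: "?P : msp S S" using B' by auto
 have PP: "?P * ?P = ?P" using B' by (metis mult.assoc mult_e finite_lessThan)
 have d: "Re (ent ?P i i) <= 1" for i
 proof -
  obtain n where n: "?P : msp {..<n} {..<n}" using fmat_msp by blast
  have st: "ent ?P k i = cnj (ent ?P i k)" for k by (metis csc_simps(5) ent_star star_mult)
  have "ent ?P i i = (\<Sum>k<n. ent ?P i k * ent ?P k i)"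
   using n by (subst PP[symmetric], subst ent_mult_msp[of "{..<n}" _ "{..<n}"]) auto
  also have "... = of_real (\<Sum>k<n. (cmod (ent ?P i k))\<^sup>2)"
   by (simp add: st complex_norm_square[symmetric])
  finally have eq: "ent ?P i i = of_real (\<Sum>k<n. (cmod (ent ?P i k))\<^sup>2)" .
  show ?thesis
  proof (cases "i < n")
   case True
   have "(cmod (ent ?P i i))\<^sup>2 <= (\<Sum>k<n. (cmod (ent ?P i k))\<^sup>2)"
    using True by (intro member_le_sum) auto
   hence "(Re (ent ?P i i))\<^sup>2 <= Re (ent ?P i i)"
    using eq by (metis Re_complex_of_real cmod_power2 le_add_same_cancel1 order_trans zero_le_power2)
   hence "Re (ent ?P i i) * Re (ent ?P i i) <= Re (ent ?P i i)" by (simp add: power2_eq_square)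
   thus ?thesis using mult_strict_right_mono[of 1 "Re (ent ?P i i)" "Re (ent ?P i i)"] by linarith
  next
   case False
   hence "ent ?P i i = 0" by (intro mspD0[OF n]) auto
   thus ?thesis by simp
  qed
 qed
 have "of_nat r = tr (star B * B)" using B' by (simp add: tr_msp[of "{..<r}" _ "{..<r}"] ent_dg)
 also have "... = tr ?P" by (rule tr_comm)
 also have "... = (SUM i:S. ent ?P i i)" using P S by (intro tr_msp) auto
 finally have "real r = (SUM i:S. Re (ent ?P i i))" by (metis Re_sum complex_Re_of_nat)
 also have "... <= (SUM i:S. 1)" by (intro sum_mono d)
 finally show ?thesis by simp
qed

lemma e_Suc: "e {..<Suc r} = e {..<r} + e {r}" by (rule fmat_eqI) (auto simp: ent_dg)

text \<open>One Gram-Schmidt step: c normalizes v, and the row matrix places the unit vector into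
  column r.\<close>

lemma isometry_extend:
 assumes S: "finite S" and B: "isometry S r B" and v: "v : msp S {0}" "v ~= 0" "star B * v = 0"
 obtains c B' where "isometry S (Suc r) B'" "B' = B + csc c v * mk {0} {r} (%_ _. 1)"
proof -
 obtain a where a: "a > 0" "star v * v = csc (of_real a) (e {0})"
  using star_vec_vec[OF S v(1,2)] by blast
 define c where "c = complex_of_real (1 / sqrt a)"
 define u where "u = mk {0} {r} (%_ _. 1)"
 define w where "w = csc c v"
 have B1: "B : msp S {..<r}" "star B * B = e {..<r}" using B by (auto simp: isometry_def)
 have u: "u : msp {0} {r}" by (simp add: u_def)
 have ww: "star w * w = e {0}"
  using a by (simp add: w_def c_def of_real_mult[symmetric] del: of_real_mult)
 have Bw: "star B * w = 0" using v by (simp add: w_def)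
 have wB: "star w * B = 0" using Bw by (metis csc_simps(5,6) star_mult)
 have uu: "star u * u = e {r}"
  by (rule fmat_eqI, subst ent_mult[of "{0}"]) (auto simp: u_def ent_mk ent_dg split: if_splits)
 have "star (B + w * u) * (B + w * u) = star B * B + (star B * w) * u + star u * (star w * B) + star u * (star w * w) * u"
  by (simp add: algebra_simps)
 also have "... = e {..<r} + star u * u"
  using u by (simp add: Bw wB ww B1 mult_e[of "{0}" "star u" "{r}"])
 finally have "star (B + w * u) * (B + w * u) = e {..<Suc r}" by (simp add: uu e_Suc)
 moreover have "B + w * u : msp S {..<Suc r}"
  using B1 v u by (auto simp: w_def intro!: msp_closed(2) intro: msp_mono[of _ S "{..<r}"] msp_mono[of _ S "{r}"])
 ultimately show ?thesis by (intro that[of "B + w * u" c]) (auto simp: isometry_def w_def u_def)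
qed

lemma isometry_0: "isometry S 0 0" by (auto simp: isometry_def intro!: fmat_eqI simp: ent_dg)

text \<open>An isometry into W of greatest rank; the rank is bounded by
  \<open>isometry_le_card\<close>. If some v in W were not fixed by the projection, its orthogonal
  remainder x would extend the isometry.\<close>

lemma onb_exists:
 assumes S: "finite S" and W: "csub W" "W \<subseteq> msp S {0}"
 obtains r B where "isometry S r B" "!!v. v : msp S {0} ==> v : W \<longleftrightarrow> B * star B * v = v"
  "!!w. w : msp {..<r} {0} ==> B * w : W"
proof -
 define P where "P r \<longleftrightarrow> (EX B. isometry S r B & (ALL w:msp {..<r} {0}. B * w : W))" for r
 have "P 0" unfolding P_def using isometry_0 W by (intro exI[of _ 0]) (auto intro: csubD)
 moreover have "ALL r. P r --> r <= card S" using isometry_le_card[OF S] by (auto simp: P_def)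
 ultimately obtain r where r: "P r" "!!r'. P r' ==> r' <= r"
  using GreatestI_nat[of P 0 "card S"] Greatest_le_nat[of P _ "card S"] by metis
 then obtain B where B: "isometry S r B" and BW: "!!w. w : msp {..<r} {0} ==> B * w : W"
  by (auto simp: P_def)
 have B1: "B : msp S {..<r}" "star B * B = e {..<r}" using B by (auto simp: isometry_def)
 have "B * star B * v = v" if "v : W" for v
 proof (rule ccontr)
  assume ne: "B * star B * v ~= v"
  define x where "x = v - B * star B * v"
  have v: "v : msp S {0}" using that W by auto
  have sv: "star B * v : msp {..<r} {0}" using v B1 by auto
  have x: "x : msp S {0}" "x ~= 0" using v B1 ne by (auto simp: x_def mult.assoc)
  have xW: "x : W" unfolding x_def mult.assoc by (rule csubD(4)[OF W(1) that BW[OF sv]])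
  have "star B * x = star B * v - (star B * B) * (star B * v)" by (simp add: x_def algebra_simps)
  also have "... = 0" using sv by (simp add: B1 e_mult)
  finally obtain c B' where B': "isometry S (Suc r) B'" "B' = B + csc c x * mk {0} {r} (%_ _. 1)"
   using isometry_extend[OF S B x(1,2)] by blast
  have "B' * w : W" if w: "w : msp {..<Suc r} {0}" for w
  proof -
   have "B * w = B * (e {..<r} * w)" using B1 by (simp add: mult.assoc[symmetric] mult_e)
   hence 1: "B * w : W" using BW[of "e {..<r} * w"] w by auto
   define y where "y = mk {0} {r} (%_ _. 1) * w"
   have "y : msp {0} {0}" using w by (auto simp: y_def)
   hence "y = csc (ent y 0 0) (e {0})" by (intro fmat_eqI) (auto simp: ent_dg msp_def)
   hence "x * y = csc (ent y 0 0) x" using x(1) by (metis csc_mult(2) finite.intros mult_e)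
   hence "csc c x * mk {0} {r} (%_ _. 1) * w : W"
    using xW W(1) by (simp add: y_def[symmetric] mult.assoc csubD)
   thus ?thesis using 1 W(1) by (simp add: B'(2) distrib_right csubD)
  qed
  hence "P (Suc r)" using B' unfolding P_def by blast
  thus False using r(2)[of "Suc r"] by simp
 qed
 moreover have "v : W" if "v : msp S {0}" "B * star B * v = v" for v
  using BW[of "star B * v"] that B1 by (auto simp: mult.assoc)
 ultimately show ?thesis using B BW that[of r B] by blast
qed

lemma eigenvector_exists:
 assumes A: "A : msp {..<r} {..<r}" and r: "r > 0"
 obtains c v where "v : msp {..<r} {0}" "v ~= 0" "A * v = csc c v"
proof -
 let ?M = "mat r r (%(i,j). ent A i j)"
 have M: "?M : carrier_mat r r" by auto
 obtain c where "eigenvalue ?M c" using spectrum_non_empty[OF M] r unfolding spectrum_def by auto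
 then obtain w where w: "w : carrier_vec r" "w ~= 0\<^sub>v r" "?M *\<^sub>v w = c \<cdot>\<^sub>v w"
  unfolding eigenvalue_def eigenvector_def by auto
 define v where "v = mk {..<r} {0} (%i _. w $ i)"
 have v: "v : msp {..<r} {0}" by (simp add: v_def)
 obtain i where "i < r" "w $ i ~= 0" using w(1,2) by (auto simp: vec_eq_iff)
 hence "ent v i 0 ~= 0" by (simp add: v_def ent_mk)
 hence "v ~= 0" by auto
 moreover have "A * v = csc c v"
 proof (rule fmat_eqI)
  fix i j
  have Av: "A * v : msp {..<r} {0}" using A v by auto
  show "ent (A * v) i j = ent (csc c v) i j"
  proof (cases "i < r & j = 0")
   case True
   have "ent (A * v) i j = (\<Sum>k<r. ent A i k * ent v k j)"
    using A v by (intro ent_mult_msp[of _ _ "{..<r}"]) auto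
   also have "... = (?M *\<^sub>v w) $ i"
    using True w(1) by (auto simp: scalar_prod_def v_def ent_mk lessThan_atLeast0 intro!: sum.cong)
   also have "... = ent (csc c v) i j" using True w by (simp add: v_def ent_mk)
   finally show ?thesis .
  next
   case False
   thus ?thesis using mspD0[OF Av, of i j] mspD0[OF v, of i j] by auto
  qed
 qed
 ultimately show ?thesis using that v by blast
qed

text \<open>The columns of B are orthonormal eigenvectors of a normal matrix. With \<open>?Z\<close>
  the difference of the two sides, normality makes \<open>star ?Z * ?Z\<close> cancel
  completely.\<close>

lemma normal_adjoint_eigen:
 assumes N: "star A * A = A * star A" and B: "B : msp S {..<r}" "star B * B = e {..<r}"
  and AB: "A * B = B * dg {..<r} f"
 shows "star A * B = B * dg {..<r} (%i. cnj (f i))"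
proof -
 let ?D = "dg {..<r} f" and ?D' = "dg {..<r} (%i. cnj (f i))"
 let ?Z = "star A * B - B * ?D'"
 have BAB: "star B * (A * B) = ?D" unfolding AB by (simp add: mult.assoc[symmetric] B e_mult[of _ _ "{..<r}"])
 have BAB': "star B * (star A * B) = ?D'" using arg_cong[OF BAB, of star] by (simp add: mult.assoc)
 have 1: "star B * (A * (star A * B)) = ?D' * ?D"
 proof -
  have "star B * (A * (star A * B)) = star B * (A * star A) * B" by (simp add: mult.assoc)
  also have "... = star (A * B) * (A * B)" by (simp add: N[symmetric] mult.assoc)
  also have "... = ?D' * (star B * B) * ?D" by (simp add: AB mult.assoc)
  finally show ?thesis by (simp add: B mult_e[of "{..<r}" _ "{..<r}"])
 qed
 have "star ?Z * ?Z = star B * (A * (star A * B)) - (star B * (A * B)) * ?D' - ?D * (star B * (star A * B)) + ?D * (star B * B) * ?D'"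
  by (simp add: left_diff_distrib right_diff_distrib mult.assoc)
 also have "... = ?D' * ?D - ?D * ?D' - ?D * ?D' + ?D * ?D'"
  unfolding 1 BAB BAB' B(2) by (simp add: mult_e[of "{..<r}" _ "{..<r}"])
 also have "... = 0" by (simp add: dg_mult mult.commute)
 finally have "?Z = 0" by (rule star_mult_self_eq_0)
 thus ?thesis by simp
qed

text \<open>Take an orthonormal system of eigenvectors of greatest length. Its orthogonal complement
  W is stable under A, because the columns of B are also eigenvectors of \<open>star A\<close>; an
  eigenvector of the compression of A to a nonzero W would prolong the system.\<close>

theorem spectral_normal:
 assumes A: "A : msp {..<n} {..<n}" and N: "star A * A = A * star A"
 obtains k f where "k : msp {..<n} {..<n}" "star k * k = e {..<n}" "k * star k = e {..<n}"
  "A = k * dg {..<n} f * star k"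
proof -
 let ?S = "{..<n}"
 have S: "finite ?S" by simp
 define P where "P r \<longleftrightarrow> (EX B f. isometry ?S r B & A * B = B * dg {..<r} f)" for r
 have "P 0" unfolding P_def using isometry_0 by (intro exI[of _ 0]) auto
 moreover have "ALL r. P r --> r <= n" using isometry_le_card[OF S] by (auto simp: P_def)
 ultimately obtain r where r: "P r" "!!r'. P r' ==> r' <= r"
  using GreatestI_nat[of P 0 n] Greatest_le_nat[of P _ n] by metis
 then obtain B f where iB: "isometry ?S r B" and AB: "A * B = B * dg {..<r} f" by (auto simp: P_def)
 have B: "B : msp ?S {..<r}" "star B * B = e {..<r}" using iB by (auto simp: isometry_def)
 have AB': "star A * B = B * dg {..<r} (%i. cnj (f i))" using normal_adjoint_eigen[OF N B AB] .
 define W where "W = {v : msp ?S {0}. star B * v = 0}"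
 have W: "csub W" "W \<subseteq> msp ?S {0}" by (auto simp: W_def csub_def distrib_left)
 obtain m C where C: "isometry ?S m C" "!!v. v : msp ?S {0} ==> v : W \<longleftrightarrow> C * star C * v = v"
  "!!w. w : msp {..<m} {0} ==> C * w : W" by (rule onb_exists[OF S W]) blast
 have C1: "C : msp ?S {..<m}" "star C * C = e {..<m}" using C by (auto simp: isometry_def)
 have "m = 0"
 proof (rule ccontr)
  assume "m ~= 0"
  hence m0: "m > 0" by simp
  have CAC: "star C * A * C : msp {..<m} {..<m}" using A C1 by auto
  obtain c w where w: "w : msp {..<m} {0}" "w ~= 0" "star C * A * C * w = csc c w"
   by (rule eigenvector_exists[OF CAC m0]) blast
  let ?v = "C * w"
  have v: "?v : msp ?S {0}" "star B * ?v = 0" using C(3)[OF w(1)] by (auto simp: W_def)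
  have "star C * ?v = w" using w C1 by (simp add: mult.assoc[symmetric] e_mult)
  hence v0: "?v ~= 0" using w(2) by auto
  have "star B * (A * ?v) = star (star A * B) * ?v" by (simp add: mult.assoc)
  also have "... = 0" by (simp add: AB' mult.assoc v(2))
  finally have "A * ?v : W" using A v by (auto simp: W_def)
  hence "A * ?v = C * (star C * A * C * w)" using C(2)[of "A * ?v"] A v(1) by (auto simp: mult.assoc)
  hence Av: "A * ?v = csc c ?v" by (simp add: w(3))
  obtain c' B' where B': "isometry ?S (Suc r) B'" "B' = B + csc c' ?v * mk {0} {r} (%_ _. 1)"
   using isometry_extend[OF S iB v(1) v0 v(2)] by blast
  let ?u = "mk {0} {r} (%_ _. 1)" and ?f = "f(r := c)"
  have u: "?u * dg {..<Suc r} ?f = csc c ?u"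
   by (rule fmat_eqI, subst ent_mult[of "{r}"]) (auto simp: ent_mk ent_dg split: if_splits)
  have d: "e {..<r} * dg {..<Suc r} ?f = dg {..<r} f"
   by (rule fmat_eqI) (subst ent_mult_msp[of "{..<r}" _ "{..<r}"], auto simp: ent_dg if_distrib[of "%x. x * _"] cong: if_cong)
  have "B * dg {..<Suc r} ?f = B * (e {..<r} * dg {..<Suc r} ?f)"
   using B by (simp add: mult.assoc[symmetric] mult_e)
  hence "A * B' = B' * dg {..<Suc r} ?f"
   by (simp add: B' algebra_simps u AB d) (simp add: mult.assoc[symmetric] Av[unfolded mult.assoc[symmetric]])
  hence "P (Suc r)" using B' unfolding P_def by blast
  thus False using r(2)[of "Suc r"] by simp
 qed
 have W0: "v = 0" if "v : W" for v
 proof -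
  have "C = 0" using C1(1) \<open>m = 0\<close> by (intro fmat_eqI) (auto simp: msp_def)
  thus ?thesis using that C(2)[of v] W(2) by auto
 qed
 have "e ?S - B * star B = 0"
 proof (rule mat_ext_vec[of _ ?S ?S])
  show "e ?S - B * star B : msp ?S ?S" using B by auto
  fix w assume w: "w : msp ?S {0}"
  have "star B * ((e ?S - B * star B) * w) = star B * (e ?S * w) - (star B * B) * (star B * w)"
   by (simp add: algebra_simps)
  also have "... = 0" using w msp_mult[OF msp_closed(6)[OF B(1)] w]
   by (simp add: B(2) e_mult[of _ _ "{0}"])
  finally have "(e ?S - B * star B) * w : W" using w B by (auto simp: W_def)
  thus "(e ?S - B * star B) * w = 0" by (rule W0)
 qed
 hence BB: "B * star B = e ?S" by simp
 have "of_nat r = tr (star B * B)" using B by (simp add: tr_msp[of "{..<r}" _ "{..<r}"] ent_dg)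
 also have "... = tr (e ?S)" by (subst tr_comm) (simp add: BB)
 also have "... = of_nat n" by (simp add: tr_msp[of "{..<n}" _ "{..<n}"] ent_dg)
 finally have rn: "r = n" using of_nat_eq_iff by blast
 have "A = A * (B * star B)" using A by (simp add: BB mult_e)
 also have "... = B * dg {..<n} f * star B" using AB rn by (simp add: mult.assoc[symmetric])
 finally show ?thesis using that[of B f] B BB rn by auto
qed

section \<open>Continuous representations of the circle\<close>

text \<open>Integration against normalized Haar measure of the circle; the Fourier coefficients are
  the means of \<open>z powi (- m) * h z\<close>.\<close>

definition circ_mean :: "(complex => complex) => complex" where
 "circ_mean h = integral {0..1} (%th. h (cis (2 * pi * th)))"

abbreviation ccont :: "(complex => complex) => bool" where "ccont h == continuous_on (sphere 0 1) h"

lemma cis_sphere [simp]: "cis t : sphere 0 1" by simp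

lemma unit_cis: assumes "cmod w = 1" obtains p where "0 <= p" "p <= 1" "w = cis (2 * pi * p)"
proof -
 have "w = of_real (cmod w) * exp (\<i> * of_real (Arg2pi w))" "0 <= Arg2pi w" "Arg2pi w < 2 * pi"
  using Arg2pi[of w] by (auto simp: is_Arg_def)
 thus ?thesis using assms by (intro that[of "Arg2pi w / (2 * pi)"]) (auto simp: cis_conv_exp)
qed

lemma ccont_cis: "ccont h ==> continuous_on A (%th. h (cis (2 * pi * (th::real))))"
 by (rule continuous_on_compose2[of "sphere 0 1" h]) (auto intro!: continuous_intros)

lemma ccont_int: "ccont h ==> (%th. h (cis (2 * pi * (th::real)))) integrable_on {a..b}"
 by (intro integrable_continuous_interval ccont_cis)

lemma circ_mean_add: "ccont f ==> ccont g ==> circ_mean (%z. f z + g z) = circ_mean f + circ_mean g"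
 unfolding circ_mean_def by (intro integral_add ccont_int)

lemma circ_mean_cmul: "circ_mean (%z. c * f z) = c * circ_mean f"
 unfolding circ_mean_def by (rule integral_mult_right)

lemma circ_mean_sum: "finite F ==> (!!x. x : F ==> ccont (f x)) ==>
  circ_mean (%z. SUM x:F. f x z) = (SUM x:F. circ_mean (f x))"
 unfolding circ_mean_def by (intro integral_sum ccont_int)

text \<open>A rotation shifts the interval of integration by p; the part beyond 1 is moved back by
  periodicity.\<close>

lemma circ_mean_shift:
 assumes h: "ccont h" and w: "cmod w = 1"
 shows "circ_mean (%z. h (w * z)) = circ_mean h"
proof -
 obtain p where p: "0 <= p" "p <= 1" "w = cis (2 * pi * p)" by (rule unit_cis[OF w])
 define g where "g th = h (cis (2 * pi * th))" for th :: real
 have per: "g (t + 1) = g t" for t by (simp add: g_def distrib_left cis_mult[symmetric])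
 have gc: "continuous_on A g" for A unfolding g_def using h by (rule ccont_cis)
 have gi: "g integrable_on {a..b}" for a b by (intro integrable_continuous_interval gc)
 have "circ_mean (%z. h (w * z)) = integral {0..1} (g \<circ> (%x. x + p))"
  unfolding circ_mean_def g_def o_def by (simp add: p cis_mult distrib_left add.commute)
 also have "... = integral {0 + p..1 + p} g" by (intro integral_shift gc)
 also have "... = integral {p..1} g + integral {1..1 + p} g"
  using p gi by (simp add: Henstock_Kurzweil_Integration.integral_combine)
 also have "integral {1..1 + p} g = integral {0..p} (g \<circ> (%x. x + 1))"
  by (subst integral_shift) (auto intro: gc simp: add.commute)
 also have "g \<circ> (%x. x + 1) = g" by (auto simp: per)
 also have "integral {p..1} g + integral {0..p} g = integral {0..1} g"
  using p gi by (metis Henstock_Kurzweil_Integration.integral_combine add.commute)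
 finally show ?thesis by (simp add: circ_mean_def g_def[abs_def])
qed

lemma ccont_powi: "ccont (%z. z powi m)"
 by (rule continuous_on_power_int) (auto intro!: continuous_intros)

lemma circ_mean_powi: "circ_mean (%z. z powi m) = (if m = 0 then 1 else 0)"
proof (cases "m = 0")
 case False
 \<comment> \<open>With w^m = -1, rotation by w turns the mean into its own negative.\<close>
 define w where "w = cis (pi / of_int m)"
 have "w powi m = cis (of_int m * (pi / of_int m))" by (simp only: w_def cis_power_int)
 hence w: "w powi m = -1" using False by simp
 have "circ_mean (%z. z powi m) = circ_mean (%z. (w * z) powi m)"
  by (rule circ_mean_shift[OF ccont_powi, symmetric]) (simp add: w_def)
 also have "... = - circ_mean (%z. z powi m)" by (simp add: power_int_mult_distrib w circ_mean_cmul[of "-1", simplified])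
 finally show ?thesis using False by simp
qed (simp add: circ_mean_def)

text \<open>Vanishing of all Fourier coefficients survives multiplication by z and by its conjugate,
  hence by polynomials in the real and imaginary part. By Stone-Weierstrass f is uniformly close to
  such a polynomial q, to which it is orthogonal, so the mean of |f|^2 is arbitrarily small.\<close>

lemma fourier_unique:
 assumes f: "ccont f" and coef: "!!m. circ_mean (%z. z powi m * f z) = 0" and z: "cmod z = 1"
 shows "f z = 0"
proof -
 define good where "good g \<longleftrightarrow> ccont g & (ALL m. circ_mean (%z. z powi m * g z) = 0)" for g
 have gadd: "good (%z. g z + h z)" if "good g" "good h" for g h using that unfolding good_def
  by (auto simp: distrib_left intro!: continuous_intros circ_mean_add[THEN trans] ccont_powi)
 have gcmul: "good (%z. c * g z)" if "good g" for g c using that unfolding good_def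
  by (auto simp: mult.left_commute[of _ c] circ_mean_cmul intro!: continuous_intros)
 have gz: "good (%z. z * g z)" if "good g" for g
 proof -
  have "circ_mean (%z. z powi m * (z * g z)) = circ_mean (%z. z powi (m + 1) * g z)" for m
   unfolding circ_mean_def by (intro integral_cong) (simp add: power_int_add cis_neq_zero mult.assoc)
  thus ?thesis using that unfolding good_def by (auto intro!: continuous_intros)
 qed
 have gcz: "good (%z. cnj z * g z)" if "good g" for g
 proof -
  have "circ_mean (%z. z powi m * (cnj z * g z)) = circ_mean (%z. z powi (m - 1) * g z)" for m
   unfolding circ_mean_def
   by (intro integral_cong) (simp add: power_int_diff cis_neq_zero cis_cnj divide_simps cis_inverse[symmetric])
  thus ?thesis using that unfolding good_def by (auto intro!: continuous_intros)
 qed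
 have gpoly: "good (%z. of_real (p z) * g z)" if "real_polynomial_function p" "good g" for p g
  using that
 proof (induction arbitrary: g rule: real_polynomial_function.induct)
  case (linear p)
  interpret bounded_linear p by fact
  \<comment> \<open>A real linear functional on the complex plane in terms of z and its
    conjugate.\<close>
  define a b where "a = (of_real (p 1) - \<i> * of_real (p \<i>)) / 2" "b = (of_real (p 1) + \<i> * of_real (p \<i>)) / 2"
  have p: "of_real (p z) = a * z + b * cnj z" for z
  proof -
   have "z = Re z *\<^sub>R 1 + Im z *\<^sub>R \<i>" by (simp add: complex_eq_iff)
   hence "p z = p (Re z *\<^sub>R 1 + Im z *\<^sub>R \<i>)" by (rule arg_cong)
   also have "... = Re z * p 1 + Im z * p \<i>" by (simp add: add scaleR)
   finally show ?thesis unfolding a_b_def by (simp add: complex_eq_iff field_simps)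
  qed
  have "(%z. of_real (p z) * g z) = (%z. a * (z * g z) + b * (cnj z * g z))"
   unfolding p by (simp add: algebra_simps)
  thus ?case
   using gadd[OF gcmul[OF gz[OF linear.prems], of a] gcmul[OF gcz[OF linear.prems], of b]] by simp
 next
  case (const c)
  thus ?case using gcmul by blast
 next
  case (add p q)
  thus ?case using gadd[OF add.IH(1)[OF add.prems] add.IH(2)[OF add.prems]] by (simp add: distrib_right)
 next
  case (mult p q)
  thus ?case using mult.IH(1)[OF mult.IH(2)[OF mult.prems]] by (simp add: mult.assoc)
 qed
 have gf: "good f" using f coef by (simp add: good_def)
 have zero: "circ_mean (%z. cnj (q z) * f z) = 0" if q: "polynomial_function q" for q :: "complex => complex"
 proof -
  have "real_polynomial_function (Re \<circ> q)" "real_polynomial_function (Im \<circ> q)"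
   using q bounded_linear_Re bounded_linear_Im unfolding polynomial_function_def by auto
  from gadd[OF gpoly[OF this(1) gf] gcmul[OF gpoly[OF this(2) gf], of "- \<i>"]]
  have "good (%z. of_real (Re (q z)) * f z + - \<i> * (of_real (Im (q z)) * f z))" by simp
  moreover have "(%z. of_real (Re (q z)) * f z + - \<i> * (of_real (Im (q z)) * f z)) = (%z. cnj (q z) * f z)"
   by (rule ext) (simp add: complex_eq_iff)
  ultimately have "good (%z. cnj (q z) * f z)" by simp
  hence "circ_mean (%z. z powi 0 * (cnj (q z) * f z)) = 0" unfolding good_def by blast
  thus ?thesis by simp
 qed
 define N where "N th = (cmod (f (cis (2 * pi * th))))\<^sup>2" for th
 have Nc: "continuous_on {0..1} N" unfolding N_def by (intro continuous_intros ccont_cis f)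
 have Nmean: "circ_mean (%z. cnj (f z) * f z) = of_real (integral {0..1} N)"
 proof -
  have "((%th. complex_of_real (N th)) has_integral of_real (integral {0..1} N)) {0..1}"
   using Nc by (intro has_integral_of_real integrable_integral integrable_continuous_interval)
  moreover have "circ_mean (%z. cnj (f z) * f z) = integral {0..1} (%th. complex_of_real (N th))"
   unfolding circ_mean_def N_def by (intro integral_cong) (simp only: complex_norm_square mult.commute)
  ultimately show ?thesis using integral_unique by simp
 qed
 obtain M where M: "M > 0" "!!z. z : sphere 0 1 ==> cmod (f z) <= M"
  using compact_imp_bounded[OF compact_continuous_image[OF f compact_sphere]]
  unfolding bounded_pos by auto
 have "integral {0..1} N <= ep * M" if eps: "ep > 0" for ep
 proof -
  obtain q where q: "polynomial_function q" "!!z. z : sphere 0 1 ==> cmod (f z - q z) < ep"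
   using Stone_Weierstrass_polynomial_function[OF compact_sphere f eps] by blast
  have qc: "ccont q" using q(1) by (rule continuous_on_polymonial_function)
  let ?d = "%z. cnj (f z - q z) * f z"
  have dc: "ccont ?d" by (intro continuous_intros f qc)
  have "circ_mean (%z. cnj (f z) * f z) = circ_mean (%z. ?d z + cnj (q z) * f z)"
   by (simp add: algebra_simps)
  also have "... = circ_mean ?d"
   by (subst circ_mean_add[OF dc]) (auto intro!: continuous_intros f qc simp: zero[OF q(1)])
  finally have eq: "of_real (integral {0..1} N) = circ_mean ?d" using Nmean by simp
  have "cmod (circ_mean ?d) <= ep * M * measure lborel (cbox 0 (1::real))" unfolding circ_mean_def
  proof (rule has_integral_bound)
   show "0 <= ep * M" using eps M by simp
   show "((%th. ?d (cis (2 * pi * th))) has_integral integral {0..1} (%th. ?d (cis (2 * pi * th)))) (cbox 0 1)"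
    unfolding cbox_interval by (intro integrable_integral ccont_int dc)
   show "cmod (?d (cis (2 * pi * th))) <= ep * M" for th unfolding norm_mult complex_mod_cnj
    by (intro mult_mono less_imp_le[OF q(2)] M(2)) (use eps in auto)
  qed
  hence "cmod (of_real (integral {0..1} N)) <= ep * M" by (simp add: eq)
  thus ?thesis by (simp only: norm_of_real)
 qed
 hence "integral {0..1} N <= 0"
 proof -
  assume *: "!!ep. ep > 0 ==> integral {0..1} N <= ep * M"
  show ?thesis
  proof (rule ccontr)
   assume "~ integral {0..1} N <= 0"
   thus False using *[of "integral {0..1} N / (2 * M)"] M(1) by (simp add: field_simps)
  qed
 qed
 moreover have "integral {0..1} N >= 0" using Nc by (intro integral_nonneg integrable_continuous_interval) (auto simp: N_def)
 ultimately have i0: "(N has_integral 0) (cbox 0 1)"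
  using integrable_integral[OF integrable_continuous_interval[OF Nc]] by simp
 obtain p where p: "0 <= p" "p <= 1" "z = cis (2 * pi * p)" by (rule unit_cis[OF z])
 have "N t >= 0" for t by (simp add: N_def)
 hence "N p = 0" using has_integral_0_cbox_imp_0[of 0 1 N p] i0 Nc p by simp
 thus ?thesis by (simp add: N_def p)
qed

text \<open>With B an orthonormal basis of the range, \<open>P * B = B\<close> and
  \<open>B * star B * P = P\<close>, so cyclicity of the trace gives the rank. This also covers
  idempotents that are not self-adjoint.\<close>

lemma idem_trace:
 assumes D: "finite D" and P: "P : msp D D" "P * P = P"
 shows "EX r. tr P = of_nat r & r <= card D & (r = 0 --> P = 0)"
proof -
 define W where "W = {v : msp D {0}. P * v = v}"
 have W: "csub W" "W \<subseteq> msp D {0}" by (auto simp: W_def csub_def distrib_left)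
 obtain r B where B: "isometry D r B" "!!v. v : msp D {0} ==> v : W \<longleftrightarrow> B * star B * v = v"
  "!!w. w : msp {..<r} {0} ==> B * w : W" by (rule onb_exists[OF D W]) blast
 have B1: "B : msp D {..<r}" "star B * B = e {..<r}" using B by (auto simp: isometry_def)
 have "P * B - B = 0"
 proof (rule mat_ext_vec[of _ D "{..<r}"])
  fix w assume "w : msp {..<r} {0}"
  hence "P * (B * w) = B * w" using B(3) by (auto simp: W_def)
  thus "(P * B - B) * w = 0" by (simp add: left_diff_distrib mult.assoc)
 qed (use B1 P in auto)
 hence PB: "P * B = B" by simp
 have "B * star B * P - P = 0"
 proof (rule mat_ext_vec[of _ D D])
  fix w assume w: "w : msp D {0}"
  have "P * w : W" using P w by (auto simp: W_def mult.assoc[symmetric])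
  hence "B * star B * (P * w) = P * w" using B(2) W(2) by blast
  thus "(B * star B * P - P) * w = 0" by (simp add: left_diff_distrib mult.assoc)
 qed (use B1 P in auto)
 hence BP: "B * star B * P = P" by simp
 have "tr P = tr (B * (star B * P))" by (simp add: BP mult.assoc[symmetric])
 also have "... = tr (star B * (P * B))" by (subst tr_comm) (simp add: mult.assoc)
 also have "... = of_nat r" using B1 by (simp add: PB tr_msp[of "{..<r}" _ "{..<r}"] ent_dg)
 finally have "tr P = of_nat r" .
 moreover have "P = 0" if "r = 0"
 proof -
  have "B = 0" using B1(1) that by (intro fmat_eqI) (auto simp: msp_def)
  thus ?thesis using BP by simp
 qed
 ultimately show ?thesis using isometry_le_card[OF D B(1)] by blast
qed

text \<open>Each nonzero \<open>P m\<close> has trace at least 1, while any finite partial sum is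
  again an idempotent and has trace at most \<open>card D\<close>.\<close>

lemma orthogonal_idempotents_finite:
 assumes D: "finite D" and P: "!!m. P m : msp D D" "!!m l. P m * P l = (if m = l then P m else 0)"
 shows "finite {m. P m ~= 0}"
proof (rule ccontr)
 assume "infinite {m. P m ~= 0}"
 then obtain F where F: "finite F" "card F = Suc (card D)" "F \<subseteq> {m. P m ~= 0}"
  using infinite_arbitrarily_large by blast
 let ?S = "sum P F"
 have "?S * ?S = (SUM m:F. SUM l:F. if m = l then P m else 0)" by (simp add: sum_product P(2))
 also have "... = ?S" using F(1) by simp
 finally obtain r where r: "tr ?S = of_nat r" "r <= card D" using idem_trace[OF D, of ?S] P(1) by blast
 have "\<exists>n\<ge>1. tr (P m) = of_nat n" if "m : F" for m
  using idem_trace[OF D P(1), of m] P(2)[of m m] that F(3) by (auto simp: Suc_le_eq)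
 then obtain n where n: "!!m. m : F ==> n m >= (1::nat) & tr (P m) = of_nat (n m)" by metis
 have "of_nat r = (of_nat (SUM m:F. n m) :: complex)" using n r by (simp add: tr_sum)
 hence "r = (SUM m:F. n m)" using of_nat_eq_iff by blast
 moreover have "(SUM m:F. 1) <= (SUM m:F. n m)" using n by (intro sum_mono) auto
 ultimately show False using F(2) r(2) by simp
qed

text \<open>\<open>P m\<close> is the m-th Fourier coefficient of R. Rotation invariance of the mean
  gives the weight and orthogonality relations. On the remainder Q all Fourier coefficients of
  \<open>R z * Q\<close> vanish, so it is 0, and z = 1 gives Q = 0. The last clause, that
  \<open>P m\<close> commutes with whatever commutes with R, is what allows several circles to be
  combined.\<close>

lemma circle_rep:
 assumes D: "finite D" and R: "!!z. cmod z = 1 ==> R z : msp D D"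
  and R1: "R 1 = e D" and mult: "!!z w. cmod z = 1 ==> cmod w = 1 ==> R (z * w) = R z * R w"
  and cont: "!!i j. ccont (%z. ent (R z) i j)"
 shows "EX F P. finite (F :: int set) & (ALL m. P m : msp D D) & (ALL m l. P m * P l = (if m = l then P m else 0)) &
   sum P F = e D & (ALL z m. cmod z = 1 --> R z * P m = csc (z powi m) (P m)) &
   (ALL A:msp D D. (ALL z. cmod z = 1 --> A * R z = R z * A) --> (ALL m. A * P m = P m * A))"
proof -
 define P where "P m = mk D D (%i j. circ_mean (%z. z powi (- m) * ent (R z) i j))" for m
 have P: "P m : msp D D" for m by (simp add: P_def)
 have Pe: "ent (P m) i j = circ_mean (%z. z powi (- m) * ent (R z) i j)" for m i j
 proof (cases "i : D & j : D")
  case False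
  have "circ_mean (%z. z powi (- m) * ent (R z) i j) = circ_mean (%z. 0)"
   unfolding circ_mean_def using mspD0[OF R] False by (intro integral_cong) auto
  thus ?thesis using False D by (auto simp: P_def ent_mk circ_mean_def)
 qed (use D in \<open>simp add: P_def ent_mk\<close>)
 have c: "ccont (%z. z powi m * ent (R z) i j)" for m i j by (intro continuous_on_mult ccont_powi cont)
 have left: "ent (A * P m) i j = circ_mean (%z. z powi (- m) * ent (A * R z) i j)" if "A : msp D D" for A m i j
 proof -
  have "ent (A * P m) i j = (SUM k:D. circ_mean (%z. ent A i k * (z powi (- m) * ent (R z) k j)))"
   using D that P by (subst ent_mult_msp[of D _ D _ D]) (auto simp: Pe circ_mean_cmul)
  also have "... = circ_mean (%z. SUM k:D. ent A i k * (z powi (- m) * ent (R z) k j))"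
   using D by (intro circ_mean_sum[symmetric] continuous_on_mult continuous_on_const c)
  also have "... = circ_mean (%z. z powi (- m) * ent (A * R z) i j)"
   unfolding circ_mean_def using D that
   by (intro integral_cong) (subst ent_mult_msp[of D _ D _ D], auto simp: sum_distrib_left mult_ac)
  finally show ?thesis .
 qed
 have right: "ent (P m * A) i j = circ_mean (%z. z powi (- m) * ent (R z * A) i j)" if "A : msp D D" for A m i j
 proof -
  have "ent (P m * A) i j = (SUM k:D. circ_mean (%z. ent A k j * (z powi (- m) * ent (R z) i k)))"
   using D that P by (subst ent_mult_msp[of D _ D _ D]) (auto simp: Pe circ_mean_cmul mult.commute)
  also have "... = circ_mean (%z. SUM k:D. ent A k j * (z powi (- m) * ent (R z) i k))"
   using D by (intro circ_mean_sum[symmetric] continuous_on_mult continuous_on_const c)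
  also have "... = circ_mean (%z. z powi (- m) * ent (R z * A) i j)"
   unfolding circ_mean_def using D that
   by (intro integral_cong) (subst ent_mult_msp[of D _ D _ D], auto simp: sum_distrib_left mult_ac)
  finally show ?thesis .
 qed
 have comm: "A * P m = P m * A" if "A : msp D D" "!!z. cmod z = 1 ==> A * R z = R z * A" for A m
  unfolding circ_mean_def
  by (rule fmat_eqI) (simp add: left right that(1), simp add: circ_mean_def that(2))
 have RP: "R w * P m = csc (w powi m) (P m)" if w: "cmod w = 1" for w m
 proof (rule fmat_eqI)
  fix i j
  have w0: "w ~= 0" using w by auto
  have "ent (R w * P m) i j = circ_mean (%z. z powi (- m) * ent (R w * R z) i j)"
   by (rule left[OF R[OF w]])
  also have "... = circ_mean (%z. w powi m * ((w * z) powi (- m) * ent (R (w * z)) i j))"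
   unfolding circ_mean_def using w w0
   by (intro integral_cong) (simp add: mult power_int_mult_distrib mult.assoc[symmetric] power_int_minus_mult power_int_minus)
  also have "... = w powi m * circ_mean (%z. z powi (- m) * ent (R z) i j)"
   by (simp only: circ_mean_cmul circ_mean_shift[OF c w])
  finally show "ent (R w * P m) i j = ent (csc (w powi m) (P m)) i j" by (simp add: Pe)
 qed
 have PP: "P m * P l = (if m = l then P m else 0)" for m l
 proof (rule fmat_eqI)
  fix i j
  have "ent (P m * P l) i j = circ_mean (%z. z powi (- m) * ent (R z * P l) i j)" by (rule right[OF P])
  also have "... = circ_mean (%z. ent (P l) i j * z powi (l - m))" unfolding circ_mean_def
   by (intro integral_cong) (simp add: RP power_int_diff power_int_minus divide_simps)
  also have "... = ent (if m = l then P m else 0) i j" by (simp add: circ_mean_cmul circ_mean_powi)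
  finally show "ent (P m * P l) i j = ent (if m = l then P m else 0) i j" .
 qed
 define F where "F = {m. P m ~= 0}"
 have F: "finite F" unfolding F_def by (rule orthogonal_idempotents_finite[OF D P PP])
 define Q where "Q = e D - sum P F"
 have Q: "Q : msp D D" using P by (auto simp: Q_def)
 have PQ: "P m * Q = 0" for m
 proof -
  have "P m * sum P F = (SUM l:F. if m = l then P m else 0)" by (simp add: sum_distrib_left PP)
  also have "... = P m" using F by (auto simp: F_def)
  finally show ?thesis using P D by (simp add: Q_def right_diff_distrib mult_e[of D _ D])
 qed
 have "ent (R 1 * Q) i j = 0" for i j
 proof (rule fourier_unique[of "%z. ent (R z * Q) i j"])
  have "continuous_on (sphere 0 1) (%z. SUM k:D. ent (R z) i k * ent Q k j)"
   by (intro continuous_intros cont)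
  thus "ccont (%z. ent (R z * Q) i j)"
   by (rule continuous_on_eq) (use D Q in \<open>auto simp: ent_mult_msp[of D _ D _ D]\<close>)
  show "circ_mean (%z. z powi m * ent (R z * Q) i j) = 0" for m
   using right[OF Q, of "- m" i j] by (simp add: PQ)
 qed simp
 hence "R 1 * Q = 0" by (intro fmat_eqI) simp
 hence "Q = 0" using Q D by (simp add: R1 e_mult)
 hence "sum P F = e D" by (simp add: Q_def)
 thus ?thesis using F P PP RP comm by (intro exI[of _ F] exI[of _ P]) auto
qed

section \<open>The group $SU(N) \times SU(N)$ as block matrices\<close>

definition bd :: "nat => nat => nat => bool" where
 "bd N i j \<longleftrightarrow> (i < N & j < N) \<or> (N <= i & i < 2 * N & N <= j & j < 2 * N)"

definition BD :: "nat => fmat set" where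
 "BD N = {A. ALL i j. ent A i j ~= 0 --> bd N i j}"

definition blk :: "nat => fmat => fmat => fmat" where
 "blk N A B = mk {..<2*N} {..<2*N} (%i j. if i < N & j < N then ent A i j
   else if N <= i & N <= j then ent B (i - N) (j - N) else 0)"

definition P1 :: "nat => fmat => fmat" where "P1 N A = mk {..<N} {..<N} (ent A)"
definition P2 :: "nat => fmat => fmat" where "P2 N A = mk {..<N} {..<N} (%i j. ent A (N + i) (N + j))"

definition dt :: "nat => fmat => complex" where
 "dt N A = Det (mat N N (%(i,j). ent A i j))"

lemma ent_P: "ent (P1 N A) i j = (if i < N & j < N then ent A i j else 0)"
 "ent (P2 N A) i j = (if i < N & j < N then ent A (N + i) (N + j) else 0)"
 by (auto simp: P1_def P2_def ent_mk)

lemma P_msp [simp, intro]: "P1 N A : msp {..<N} {..<N}" "P2 N A : msp {..<N} {..<N}"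
 by (auto simp: P1_def P2_def)

lemma ent_blk: "ent (blk N A B) i j = (if i < N & j < N then ent A i j
   else if N <= i & N <= j & i < 2 * N & j < 2 * N then ent B (i - N) (j - N) else 0)"
 by (auto simp: blk_def ent_mk)

lemma blk_BD [simp, intro]: "blk N A B : BD N"
 by (auto simp: BD_def ent_blk bd_def split: if_splits)

lemma BD_msp [intro]: "A : BD N ==> A : msp {..<2*N} {..<2*N}"
 by (fastforce simp: BD_def msp_def bd_def)

lemma BD_blk: "A : BD N ==> A = blk N (P1 N A) (P2 N A)"
 by (rule fmat_eqI) (auto simp: ent_blk ent_P BD_def bd_def)

lemma P_blk: "A : msp {..<N} {..<N} ==> P1 N (blk N A B) = A" "B : msp {..<N} {..<N} ==> P2 N (blk N A B) = B"
 by (rule fmat_eqI, auto simp: ent_blk ent_P msp_def)+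

lemma BD_closed [intro]:
 "0 : BD N" "A : BD N ==> B : BD N ==> A + B : BD N" "A : BD N ==> B : BD N ==> A - B : BD N"
 "A : BD N ==> - A : BD N" "A : BD N ==> csc c A : BD N" "A : BD N ==> star A : BD N"
 "dg {..<2*N} f : BD N"
proof -
 assume A: "A : BD N"
 show "- A : BD N" "csc c A : BD N" "star A : BD N" using A by (auto simp: BD_def bd_def)
 assume B: "B : BD N"
 have *: "ent A i j ~= 0 \<or> ent B i j ~= 0 ==> bd N i j" for i j using A B by (auto simp: BD_def)
 show "A + B : BD N" unfolding BD_def mem_Collect_eq by (intro allI impI, rule *) auto
 show "A - B : BD N" unfolding BD_def mem_Collect_eq by (intro allI impI, rule *) auto
qed (auto simp: BD_def bd_def ent_dg split: if_splits)

lemma sum_split_N: "(\<Sum>k<2*N. f k) = (\<Sum>k<N. f k) + (\<Sum>k<N. f (N + k))" for f :: "nat => 'a::comm_monoid_add"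
 using sum.atLeastLessThan_concat[of 0 N "2 * N" f] sum.shift_bounds_nat_ivl[of f 0 N N]
 by (simp add: lessThan_atLeast0 mult_2 add.commute)

lemma blk_mult:
 assumes "A : msp {..<N} {..<N}" "B : msp {..<N} {..<N}" "A' : msp {..<N} {..<N}" "B' : msp {..<N} {..<N}"
 shows "blk N A B * blk N A' B' = blk N (A * A') (B * B')"
proof (rule fmat_eqI)
 fix i j
 have "ent (blk N A B * blk N A' B') i j = (\<Sum>k<2*N. ent (blk N A B) i k * ent (blk N A' B') k j)"
  by (rule ent_mult_msp) auto
 also have "... = (\<Sum>k<N. ent (blk N A B) i k * ent (blk N A' B') k j) +
   (\<Sum>k<N. ent (blk N A B) i (N + k) * ent (blk N A' B') (N + k) j)" by (rule sum_split_N)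
 also have "... = ent (blk N (A * A') (B * B')) i j"
  using assms by (auto simp: ent_blk ent_mult_msp[of "{..<N}" _ "{..<N}"])
 finally show "ent (blk N A B * blk N A' B') i j = ent (blk N (A * A') (B * B')) i j" .
qed

lemma blk_star: "star (blk N A B) = blk N (star A) (star B)" by (rule fmat_eqI) (auto simp: ent_blk)

lemma blk_dg: "blk N (dg {..<N} f) (dg {..<N} g) = dg {..<2*N} (%i. if i < N then f i else g (i - N))"
 by (rule fmat_eqI) (auto simp: ent_blk ent_dg)

lemma BD_mult [intro]: "A : BD N ==> B : BD N ==> A * B : BD N"
 by (metis BD_blk blk_mult blk_BD P_msp)

lemma P_mult: assumes "A : BD N" "B : BD N" shows "P1 N (A * B) = P1 N A * P1 N B" "P2 N (A * B) = P2 N A * P2 N B"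
proof -
 have "A * B = blk N (P1 N A * P1 N B) (P2 N A * P2 N B)"
  using assms by (metis BD_blk blk_mult P_msp)
 thus "P1 N (A * B) = P1 N A * P1 N B" "P2 N (A * B) = P2 N A * P2 N B"
  by (simp_all add: P_blk msp_mult[OF P_msp(1) P_msp(1)] msp_mult[OF P_msp(2) P_msp(2)])
qed

lemma P_star: "P1 N (star A) = star (P1 N A)" "P2 N (star A) = star (P2 N A)"
 by (auto intro!: fmat_eqI simp: ent_P)

lemma P_dg: "P1 N (dg {..<2*N} f) = dg {..<N} f" "P2 N (dg {..<2*N} f) = dg {..<N} (%i. f (N + i))"
 by (auto intro!: fmat_eqI simp: ent_P ent_dg)

lemma dt_mult: assumes "A : msp {..<N} {..<N}" "B : msp {..<N} {..<N}" shows "dt N (A * B) = dt N A * dt N B"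
proof -
 have "mat N N (%(i,j). ent (A * B) i j) = mat N N (%(i,j). ent A i j) * mat N N (%(i,j). ent B i j)"
  using assms by (intro eq_matI) (auto simp: ent_mult_msp[of "{..<N}" _ "{..<N}"] scalar_prod_def lessThan_atLeast0)
 thus ?thesis unfolding dt_def by (simp add: Determinant.det_mult[of _ N])
qed

lemma dt_dg: "dt N (dg {..<N} f) = (\<Prod>i<N. f i)"
proof -
 let ?M = "mat N N (%(i,j). ent (dg {..<N} f) i j)"
 have "Det ?M = prod_list (diag_mat ?M)" by (rule det_upper_triangular[of _ N]) (auto simp: ent_dg)
 also have "diag_mat ?M = map f [0..<N]" by (auto simp: diag_mat_def ent_dg)
 finally show ?thesis using prod.distinct_set_conv_list[of "[0..<N]" f] by (simp add: dt_def lessThan_atLeast0)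
qed

lemma dt_csc: "dt N (csc c A) = c ^ N * dt N A"
proof -
 have eq: "mat N N (%(i,j). ent (csc c A) i j) = c \<cdot>\<^sub>m mat N N (%(i,j). ent A i j)" by (intro eq_matI) auto
 show ?thesis unfolding dt_def eq by simp
qed

text \<open>\<open>?Q\<close> is an idempotent of trace 0, since U times its adjoint has the same
  trace as the adjoint times U.\<close>

lemma unitary_right:
 assumes S: "finite S" and U: "U : msp S S" "star U * U = e S"
 shows "U * star U = e S"
proof -
 let ?Q = "e S - U * star U"
 have "U * star U * (U * star U) = U * (star U * U) * star U" by (simp add: mult.assoc)
 also have "... = U * star U" using U S by (simp add: mult_e)
 finally have UU: "U * star U * (U * star U) = U * star U" .
 have Us: "U * star U : msp S S" using U by auto
 have "?Q * ?Q = ?Q"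
  unfolding left_diff_distrib right_diff_distrib e_mult[OF S Us] mult_e[OF S Us] e_mult[OF S msp_dg] UU by simp
 moreover have "tr ?Q = 0"
 proof -
  have "tr (e S) = tr (U * star U) + tr ?Q" by (simp flip: tr_add)
  moreover have "tr (U * star U) = tr (e S)" by (simp add: tr_comm[of U] U)
  ultimately show ?thesis by simp
 qed
 ultimately have "?Q = 0" using idem_trace[OF S, of ?Q] U by auto
 thus ?thesis by simp
qed

definition GG :: "nat => fmat set" where
 "GG N = {U : BD N. star U * U = e {..<2*N} & dt N (P1 N U) = 1 & dt N (P2 N U) = 1}"

definition TT :: "nat => (nat => complex) set" where
 "TT N = {u. (ALL i<2*N. cmod (u i) = 1) & (\<Prod>i<N. u i) = 1 & (\<Prod>i<N. u (N + i)) = 1}"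

abbreviation tor :: "nat => (nat => complex) => fmat" where "tor N u == dg {..<2*N} u"

lemma GG_simps:
 assumes "U : GG N"
 shows "U : BD N" "U : msp {..<2*N} {..<2*N}" "star U * U = e {..<2*N}" "U * star U = e {..<2*N}"
  "dt N (P1 N U) = 1" "dt N (P2 N U) = 1"
 using assms unitary_right[of "{..<2*N}" U] BD_msp[of U N] by (auto simp: GG_def)

lemma GG_mult [intro]: assumes "U : GG N" "V : GG N" shows "U * V : GG N"
proof -
 note U = GG_simps[OF assms(1)] and V = GG_simps[OF assms(2)]
 have "star (U * V) * (U * V) = star V * (star U * U) * V" by (simp add: mult.assoc)
 also have "... = e {..<2*N}" using V by (simp add: U(3) mult_e[of "{..<2*N}" _ "{..<2*N}"])
 finally show ?thesis using U V by (auto simp: GG_def P_mult dt_mult)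
qed

lemma dg_cong: "finite S ==> (!!i. i : S ==> f i = g i) ==> dg S f = dg S g"
 by (rule fmat_eqI) (auto simp: ent_dg)

lemma e_GG [intro, simp]: "e {..<2*N} : GG N" by (auto simp: GG_def P_dg dt_dg dg_mult)

lemma GG_star [intro]: assumes "U : GG N" shows "star U : GG N"
proof -
 note U = GG_simps[OF assms]
 have "dt N (P1 N (star U * U)) = dt N (P1 N (star U)) * dt N (P1 N U)"
  "dt N (P2 N (star U * U)) = dt N (P2 N (star U)) * dt N (P2 N U)"
  using U(1) by (simp_all add: P_mult[OF BD_closed(6)] dt_mult)
 hence "dt N (P1 N (star U)) = 1" "dt N (P2 N (star U)) = 1"
  unfolding U(3) U(5,6) by (simp_all add: P_dg dt_dg)
 thus ?thesis using U by (auto simp: GG_def)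
qed

lemma tor_GG [intro]: "u : TT N ==> tor N u : GG N"
proof -
 assume u: "u : TT N"
 have "star (tor N u) * tor N u = e {..<2*N}"
  using u by (auto simp: dg_mult TT_def mult.commute complex_norm_square[symmetric] intro!: dg_cong)
 thus ?thesis using u by (auto simp: GG_def P_dg dt_dg TT_def)
qed

lemma TT_mult [intro]: "u : TT N ==> v : TT N ==> (%i. u i * v i) : TT N"
 by (auto simp: TT_def norm_mult prod.distrib)

lemma unitary_dt:
 assumes k: "k : msp {..<N} {..<N}" "star k * k = e {..<N}"
 shows "cmod (dt N k) = 1"
proof -
  have "dt N (star k) * dt N k = 1" using k by (simp add: dt_mult[symmetric] dt_dg)
  moreover have "dt N (star k) = cnj (dt N k)"
  proof -
   have eq: "mat N N (%(i,j). ent (star k) i j) = map_mat cnj (mat N N (%(i,j). ent k i j))\<^sup>T"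
    by (intro eq_matI) auto
   have tm: "(map_mat cnj A)\<^sup>T = map_mat cnj (A\<^sup>T)" for A by (intro eq_matI) auto
   have "dt N (star k) = Det (map_mat cnj (mat N N (%(i,j). ent k i j)))"
    unfolding dt_def eq tm[symmetric] by (subst det_transpose[of _ N]) auto
   also have "... = cnj (dt N k)"
    unfolding dt_def Determinant.det_def by (auto simp: sign_def intro!: sum.cong prod.cong)
   finally show ?thesis .
  qed
  ultimately show ?thesis
   by (metis complex_mod_cnj mult_cancel_left2 norm_ge_zero norm_mult norm_one power2_eq_1_iff power2_eq_square real_sqrt_abs abs_of_nonneg)
qed

lemma normal_diag:
 assumes A: "A : BD N" "star A * A = A * star A" and N: "N > 0"
 shows "EX k:GG N. EX f. A = k * dg {..<2*N} f * star k"
proof -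
 have ex: "EX k f. k : msp {..<N} {..<N} & star k * k = e {..<N} & dt N k = 1 & B = k * dg {..<N} f * star k"
  if B: "B : msp {..<N} {..<N}" "star B * B = B * star B" for B
 proof -
  obtain k f where k: "k : msp {..<N} {..<N}" "star k * k = e {..<N}" "k * star k = e {..<N}"
   "B = k * dg {..<N} f * star k" by (rule spectral_normal[OF B]) blast
  have dk: "cmod (dt N k) = 1" by (rule unitary_dt[OF k(1,2)])
  \<comment> \<open>Rescaling k by an N-th root of the inverse determinant makes it special without
    changing the conjugation.\<close>
  obtain c where c: "c ^ N = 1 / dt N k" using N by (metis exists_complex_root neq0_conv zero_neq_one)
  have "cmod c ^ N = 1" using c dk by (metis norm_divide norm_one norm_power div_by_1)
  hence "cmod c = 1" using N power_eq_imp_eq_base[of "cmod c" N 1] by simp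
  hence cc: "cnj c * c = 1" by (simp add: mult.commute complex_norm_square[symmetric])
  have "dt N (csc c k) = 1" using c dk by (auto simp: dt_csc)
  thus ?thesis using k cc by (intro exI[of _ "csc c k"] exI[of _ f]) (auto simp: mult.commute)
 qed
 have n: "star (P1 N A) * P1 N A = P1 N A * star (P1 N A)" "star (P2 N A) * P2 N A = P2 N A * star (P2 N A)"
  using A by (metis P_mult P_star BD_closed(6))+
 obtain k1 f1 where 1: "k1 : msp {..<N} {..<N}" "star k1 * k1 = e {..<N}" "dt N k1 = 1" "P1 N A = k1 * dg {..<N} f1 * star k1"
  using ex[OF P_msp(1) n(1)] by blast
 obtain k2 f2 where 2: "k2 : msp {..<N} {..<N}" "star k2 * k2 = e {..<N}" "dt N k2 = 1" "P2 N A = k2 * dg {..<N} f2 * star k2"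
  using ex[OF P_msp(2) n(2)] by blast
 let ?k = "blk N k1 k2"
 have "?k : GG N" using 1 2 by (auto simp: GG_def blk_star blk_mult blk_dg P_blk)
 moreover have "A = ?k * dg {..<2*N} (%i. if i < N then f1 i else f2 (i - N)) * star ?k"
 proof -
  have "?k * dg {..<2*N} (%i. if i < N then f1 i else f2 (i - N)) = blk N (k1 * dg {..<N} f1) (k2 * dg {..<N} f2)"
   unfolding blk_dg[symmetric] by (rule blk_mult) (use 1 2 in auto)
  also have "... * star ?k = blk N (P1 N A) (P2 N A)"
   unfolding blk_star 1(4) 2(4) by (rule blk_mult) (use 1 2 in auto)
  finally show ?thesis using BD_blk[OF A(1)] by simp
 qed
 ultimately show ?thesis by blast
qed

text \<open>The diagonal factor is a conjugate of U by an element of the group, so it lies in the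
  group itself, which makes its entries torus parameters.\<close>

lemma GG_diag:
 assumes U: "U : GG N" and N: "N > 0"
 shows "EX k:GG N. EX u:TT N. U = k * tor N u * star k"
proof -
 note u = GG_simps[OF U]
 obtain k f where k: "k : GG N" "U = k * dg {..<2*N} f * star k"
  using normal_diag[of U N] u N by auto
 note k' = GG_simps[OF k(1)]
 have "star k * U * k = (star k * k) * dg {..<2*N} f * (star k * k)" by (simp add: k(2) mult.assoc)
 also have "... = dg {..<2*N} f" by (simp add: k'(3) mult_e[of "{..<2*N}" _ "{..<2*N}"] e_mult[of "{..<2*N}" _ "{..<2*N}"])
 finally have f: "dg {..<2*N} f : GG N" using U k(1) by (metis GG_mult GG_star)
 have "f : TT N"
 proof -
  have "cmod (f i) = 1" if "i < 2*N" for i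
  proof -
   have "ent (star (dg {..<2*N} f) * dg {..<2*N} f) i i = 1"
    using GG_simps(3)[OF f] that by (simp add: ent_dg)
   hence "cnj (f i) * f i = 1" using that by (simp add: dg_mult ent_dg)
   moreover have "complex_of_real ((cmod (f i))\<^sup>2) = f i * cnj (f i)" by (rule complex_norm_square)
   ultimately have "complex_of_real ((cmod (f i))\<^sup>2) = 1" by (simp only: mult.commute)
   hence "(cmod (f i))\<^sup>2 = 1" using of_real_eq_1_iff by blast
   thus ?thesis by (simp add: power2_eq_1_iff) (metis norm_ge_zero not_one_le_zero neg_0_le_iff_le)
  qed
  thus ?thesis using GG_simps(5,6)[OF f] by (auto simp: TT_def P_dg dt_dg)
 qed
 thus ?thesis using k by blast
qed

text \<open>Block-diagonal matrices whose blocks are traceless, and the skew-Hermitian ones among them: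
 the Lie algebras of $SL(N) \times SL(N)$ and of $SU(N) \times SU(N)$.\<close>

definition LA :: "nat => fmat set" where
 "LA N = {X : BD N. (\<Sum>i<N. ent X i i) = 0 & (\<Sum>i<N. ent X (N + i) (N + i)) = 0}"

definition KA :: "nat => fmat set" where "KA N = {X : LA N. star X = - X}"

text \<open>Parameters of the Lie algebra of the torus: h stands for the diagonal matrix with
  entries \<open>\<i> * h i\<close>.\<close>

definition HH :: "nat => (nat => real) set" where
 "HH N = {h. (\<Sum>i<N. h i) = 0 & (\<Sum>i<N. h (N + i)) = 0}"

lemma LA_closed [intro]: "A : LA N ==> B : LA N ==> A + B : LA N" "A : LA N ==> B : LA N ==> A - B : LA N"
 "A : LA N ==> csc c A : LA N" "A : LA N ==> star A : LA N" "A : LA N ==> - A : LA N" "0 : LA N"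
 unfolding LA_def by (auto simp: sum.distrib sum_subtractf sum_distrib_left[symmetric] sum_negf cnj_sum[symmetric] simp del: cnj_sum)

lemma tr_P: "tr (P1 N A) = (\<Sum>i<N. ent A i i)" "tr (P2 N A) = (\<Sum>i<N. ent A (N + i) (N + i))"
 by (auto simp: tr_msp[of "{..<N}" _ "{..<N}"] ent_P)

lemma LA_iff: "X : LA N \<longleftrightarrow> X : BD N & tr (P1 N X) = 0 & tr (P2 N X) = 0"
 by (simp add: LA_def tr_P)

lemma LA_comm: assumes "A : BD N" "B : BD N" shows "A * B - B * A : LA N"
proof -
 have "tr (P1 N (A * B - B * A)) = tr (P1 N (A * B)) - tr (P1 N (B * A))"
  "tr (P2 N (A * B - B * A)) = tr (P2 N (A * B)) - tr (P2 N (B * A))" by (simp_all add: tr_P sum_subtractf)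
 thus ?thesis using assms unfolding LA_iff by (auto simp: P_mult tr_comm)
qed

lemma LA_conj: assumes g: "g : GG N" and X: "X : LA N" shows "g * X * star g : LA N"
proof -
 note g' = GG_simps[OF g]
 have X': "X : BD N" using X by (simp add: LA_def)
 have b: "star g * (g * X) = X" using g' BD_msp[OF X'] by (simp add: mult.assoc[symmetric] e_mult[of "{..<2*N}" _ "{..<2*N}"])
 have "tr (P1 N ((g * X) * star g)) = tr (P1 N (star g * (g * X)))" "tr (P2 N ((g * X) * star g)) = tr (P2 N (star g * (g * X)))"
  using g' X' by (auto simp: P_mult BD_mult BD_closed(6) tr_comm)
 thus ?thesis using X g' X' unfolding LA_iff b by auto
qed

lemma KA_diag:
 assumes X: "X : KA N" and N: "N > 0"
 shows "EX k:GG N. EX h:HH N. X = k * dg {..<2*N} (%i. \<i> * of_real (h i)) * star k"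
proof -
 have X': "X : BD N" "star X = - X" "X : LA N" using X by (auto simp: KA_def LA_def)
 obtain k f where k: "k : GG N" "X = k * dg {..<2*N} f * star k"
  using normal_diag[of X N] X' N by auto
 note k' = GG_simps[OF k(1)]
 have "star k * X * k = (star k * k) * dg {..<2*N} f * (star k * k)" by (simp add: k(2) mult.assoc)
 also have "... = dg {..<2*N} f" by (simp add: k'(3) mult_e[of "{..<2*N}" _ "{..<2*N}"] e_mult[of "{..<2*N}" _ "{..<2*N}"])
 finally have eq: "star k * X * k = dg {..<2*N} f" .
 have L: "dg {..<2*N} f : LA N" using LA_conj[OF GG_star[OF k(1)] X'(3)] by (simp add: eq)
 have "star (dg {..<2*N} f) = - dg {..<2*N} f" unfolding eq[symmetric] by (simp add: X'(2) mult.assoc)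
 hence "cnj (f i) = - f i" if "i < 2*N" for i
  using that by (metis (no_types, lifting) ent_dg ent_simps(3) ent_star finite_lessThan lessThan_iff)
 hence fi: "f i = \<i> * of_real (Im (f i))" if "i < 2*N" for i
  using that by (force simp: complex_eq_iff)
 define h where "h i = Im (f i)" for i
 have "(\<Sum>i<N. f i) = 0" "(\<Sum>i<N. f (N + i)) = 0" using L by (simp_all add: LA_def ent_dg)
 hence "h : HH N" unfolding HH_def h_def by (auto simp flip: Im_sum)
 moreover have "dg {..<2*N} f = dg {..<2*N} (%i. \<i> * of_real (h i))"
  using fi by (intro dg_cong) (auto simp: h_def)
 ultimately show ?thesis using k by metis
qed

section \<open>Weights of the torus\<close>

text \<open>The indices of the simple roots of both factors. The index N would join the two blocks
  and is left out, so 1, ..., N - 1 belong to the first factor and N + 1, ..., 2N - 1 to the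
  second.\<close>

definition KK :: "nat => nat set" where "KK N = {1..<2*N} - {N}"

text \<open>The inverse of the passage from fugacities to diagonal entries: the partial products of
  the \<xi> are the x.\<close>

definition Xc :: "(nat => complex) => nat => complex" where "Xc u k = (\<Prod>i<k. u i)"

definition chi :: "nat => (nat => int) => (nat => complex) => complex" where
 "chi N p u = (PROD k:KK N. Xc u k powi p k)"

text \<open>The differential of the character p: \<open>chi_exp\<close> shows that on the
  one-parameter group of h the character is the exponential of
  \<open>\<i> * t * pr N p h\<close>.\<close>

definition pr :: "nat => (nat => int) => (nat => real) => real" where
 "pr N p h = (SUM k:KK N. of_int (p k) * (\<Sum>i<k. h i))"

text \<open>The k-th simple coroot as a map from the circle to the torus; on the unit circle
  \<open>cnj z\<close> is the inverse of z.\<close>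

definition cr :: "nat => complex => nat => complex" where
 "cr k z i = (if i = k - 1 then z else if i = k then cnj z else 1)"

lemma finite_KK [simp]: "finite (KK N)" by (simp add: KK_def)

lemma Xc_unit: "u : TT N ==> k <= 2 * N ==> cmod (Xc u k) = 1"
 unfolding Xc_def prod_norm[symmetric] by (rule prod.neutral) (auto simp: TT_def)

lemma chi_unit: "u : TT N ==> cmod (chi N p u) = 1"
 unfolding chi_def prod_norm[symmetric] by (rule prod.neutral) (auto simp: norm_power_int Xc_unit KK_def)

lemma chi_add: "u : TT N ==> chi N (%k. p k + q k) u = chi N p u * chi N q u"
proof -
 assume u: "u : TT N"
 have "Xc u k ~= 0" if "k : KK N" for k using Xc_unit[OF u, of k] that by (auto simp: KK_def)
 thus ?thesis unfolding chi_def prod.distrib[symmetric] by (intro prod.cong refl) (simp add: power_int_add)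
qed

lemma chi_cong: "(!!k. k : KK N ==> p k = q k) ==> chi N p u = chi N q u"
 unfolding chi_def by (rule prod.cong) auto

lemma prod_split_N: "(\<Prod>k<2*N. f k) = (\<Prod>k<N. f k) * (\<Prod>k<N. f (N + k))" for f :: "nat => 'a::comm_monoid_mult"
 using prod.atLeastLessThan_concat[of 0 N "2 * N" f] prod.shift_bounds_nat_ivl[of f 0 N N]
 by (simp add: lessThan_atLeast0 mult_2 add.commute)

lemma prod_two: "finite I ==> a : I ==> b : I ==> a ~= b ==>
  (PROD i:I. if i = a then x else if i = b then y else (1::complex)) = x * y"
 by (subst prod.remove[of _ a], simp, simp, subst prod.remove[of _ b], simp, simp)
   (auto intro!: prod.neutral)

lemma cr_TT: assumes k: "k : KK N" and z: "cmod z = 1" shows "cr k z : TT N"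
proof -
 have zz: "z * cnj z = 1" using z by (simp add: complex_norm_square[symmetric])
 have "(\<Prod>i<N. cr k z i) = 1"
 proof (cases "k < N")
  case True
  hence "(\<Prod>i<N. cr k z i) = z * cnj z" unfolding cr_def
   using k by (intro prod_two) (auto simp: KK_def)
  thus ?thesis by (simp add: zz)
 next
  case False
  thus ?thesis using k by (intro prod.neutral) (auto simp: cr_def KK_def)
 qed
 moreover have "(\<Prod>i<N. cr k z (N + i)) = 1"
 proof (cases "k < N")
  case True
  thus ?thesis by (intro prod.neutral) (auto simp: cr_def)
 next
  case False
  have "(\<Prod>i<N. cr k z (N + i)) = (\<Prod>i<N. if i = k - 1 - N then z else if i = k - N then cnj z else 1)"
   using False k by (intro prod.cong) (auto simp: cr_def KK_def)
  also have "... = z * cnj z" using k False by (intro prod_two) (auto simp: KK_def)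
  finally show ?thesis by (simp add: zz)
 qed
 ultimately show ?thesis using z by (auto simp: TT_def cr_def)
qed

text \<open>At position i only the factors with k = i + 1 and k = i differ from 1, and their product
  is the quotient of consecutive partial products.\<close>

lemma cr_decomp: assumes u: "u : TT N" and i: "i < 2 * N" shows "(PROD k:KK N. cr k (Xc u k) i) = u i"
proof -
 have X1: "Xc u N = 1" "Xc u (2 * N) = 1" "Xc u 0 = 1"
  using u by (auto simp: Xc_def TT_def prod_split_N)
 have X: "Xc u (Suc i) = Xc u i * u i" by (simp add: Xc_def)
 \<comment> \<open>At the indices 0, N and 2N the partial product is 1, so they can be added to the
   index set and i needs no case distinction.\<close>
 have "(PROD k:KK N. cr k (Xc u k) i) = (PROD k:{1..<2*N}. cr k (Xc u k) i)"
  unfolding KK_def by (rule prod.mono_neutral_left) (auto simp: cr_def X1)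
 also have "... = (PROD k:{..2*N}. if k = Suc i then Xc u k else if k = i then cnj (Xc u k) else 1)"
 proof (rule prod.mono_neutral_cong_left)
  show "ALL k:{..2*N} - {1..<2*N}. (if k = Suc i then Xc u k else if k = i then cnj (Xc u k) else 1) = 1"
  proof
   fix k assume "k : {..2*N} - {1..<2*N}"
   hence "k = 0 \<or> k = 2 * N" by auto
   hence "Xc u k = 1" using X1 by auto
   thus "(if k = Suc i then Xc u k else if k = i then cnj (Xc u k) else 1) = 1" by auto
  qed
 qed (auto simp: cr_def)
 also have "... = (PROD k:{..2*N}. if k = Suc i then Xc u (Suc i) else if k = i then cnj (Xc u i) else 1)"
  by (intro prod.cong) auto
 also have "... = Xc u (Suc i) * cnj (Xc u i)" using i by (intro prod_two) auto
 also have "... = u i * (Xc u i * cnj (Xc u i))" by (simp add: X)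
 also have "... = u i" using Xc_unit[OF u, of i] i by (simp add: complex_norm_square[symmetric])
 finally show ?thesis .
qed

lemma cr_mult: "cr k (z * w) = (%i. cr k z i * cr k w i)" by (rule ext) (auto simp: cr_def)

lemma TT_prod: "(!!k. k : J ==> f k : TT N) ==> (%i. PROD k:J. f k i) : TT N"
 by (induction J rule: infinite_finite_induct) (auto intro: TT_mult simp: TT_def norm_mult prod.distrib)

text \<open>Continuous representations of SU(N) x SU(N) on block matrices. Outside the group
  \<open>rh\<close> is arbitrary. The section on matrix representations translates to and from
  \<open>is_rep\<close>.\<close>

locale su_rep =
 fixes N d :: nat and rh :: "fmat => fmat"
 assumes N2: "N >= 2"
  and rho_in: "U : GG N ==> rh U : msp {..<d} {..<d}"
  and rho_mult: "U : GG N ==> V : GG N ==> rh (U * V) = rh U * rh V"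
  and rho_one: "rh (e {..<2*N}) = e {..<d}"
  and rho_cont: "(!!m. A m : GG N) ==> g : GG N ==> (!!i j. (%m. ent (A m) i j) \<longlonglongrightarrow> ent g i j) ==>
    (%m. ent (rh (A m)) a b) \<longlonglongrightarrow> ent (rh g) a b"
begin

lemma N0: "N > 0" using N2 by simp

abbreviation "II == {..<2*N}"
abbreviation "DD == {..<d}"

definition cdec :: "nat => int set => (int => fmat) => bool" where
 "cdec k F P \<longleftrightarrow> finite F & (ALL m. P m : msp DD DD) & (ALL m l. P m * P l = (if m = l then P m else 0)) &
   sum P F = e DD & (ALL z m. cmod z = 1 --> rh (tor N (cr k z)) * P m = csc (z powi m) (P m)) &
   (ALL A:msp DD DD. (ALL z. cmod z = 1 --> A * rh (tor N (cr k z)) = rh (tor N (cr k z)) * A) --> (ALL m. A * P m = P m * A))"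

lemma circle_decomp:
 assumes k: "k : KK N"
 shows "EX F P. cdec k F P" unfolding cdec_def
proof (rule circle_rep)
 show "cmod z = 1 ==> rh (tor N (cr k z)) : msp DD DD" for z using k by (intro rho_in tor_GG cr_TT)
 have "cr k 1 = (%_. 1)" by (auto simp: cr_def)
 thus "rh (tor N (cr k 1)) = e DD" by (simp add: rho_one)
 show "rh (tor N (cr k (z * w))) = rh (tor N (cr k z)) * rh (tor N (cr k w))" if "cmod z = 1" "cmod w = 1" for z w
  using that k by (simp add: cr_mult dg_mult[symmetric] rho_mult tor_GG cr_TT)
 show "ccont (%z. ent (rh (tor N (cr k z))) i j)" for i j unfolding continuous_on_sequentially
 proof (intro allI ballI impI, elim conjE)
  fix z :: "nat => complex" and a assume a: "a : sphere 0 1" and z: "ALL n. z n : sphere 0 1" "z \<longlonglongrightarrow> a"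
  have z1: "cmod (z n) = 1" for n using z(1) by simp
  show "((%z. ent (rh (tor N (cr k z))) i j) \<circ> z) \<longlonglongrightarrow> ent (rh (tor N (cr k a))) i j"
   unfolding o_def
  proof (rule rho_cont)
   show "tor N (cr k (z m)) : GG N" for m using k z1 by (intro tor_GG cr_TT)
   show "tor N (cr k a) : GG N" using k a by (intro tor_GG cr_TT) auto
   show "(%m. ent (tor N (cr k (z m))) i j) \<longlonglongrightarrow> ent (tor N (cr k a)) i j" for i j
    using z(2) by (auto simp: ent_dg cr_def intro!: tendsto_intros)
  qed
 qed
qed simp

text \<open>A joint weight decomposition for the circles in J. Weights vanish outside J, so that
  different elements of F are different weights of these circles; the commutation clause carries the
  induction over J.\<close>

definition wdec :: "nat set => (nat => int) set => ((nat => int) => fmat) => bool" where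
 "wdec J F Q \<longleftrightarrow> finite F & (ALL p:F. ALL k. k \<notin> J --> p k = 0) & (ALL p. Q p : msp DD DD) &
   (ALL p:F. ALL q:F. Q p * Q q = (if p = q then Q p else 0)) & sum Q F = e DD &
   (ALL k:J. ALL z. ALL p:F. cmod z = 1 --> rh (tor N (cr k z)) * Q p = csc (z powi p k) (Q p)) &
   (ALL A:msp DD DD. (ALL k:J. ALL z. cmod z = 1 --> A * rh (tor N (cr k z)) = rh (tor N (cr k z)) * A) --> (ALL p:F. A * Q p = Q p * A))"

lemma wdecD:
 assumes "wdec J F Q"
 shows "finite F" "p : F ==> k \<notin> J ==> p k = 0" "Q p : msp DD DD"
  "p : F ==> q : F ==> Q p * Q q = (if p = q then Q p else 0)" "sum Q F = e DD"
  "k : J ==> p : F ==> cmod z = 1 ==> rh (tor N (cr k z)) * Q p = csc (z powi p k) (Q p)"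
  "A : msp DD DD ==> (!!k z. k : J ==> cmod z = 1 ==> A * rh (tor N (cr k z)) = rh (tor N (cr k z)) * A)
    ==> p : F ==> A * Q p = Q p * A"
proof -
 note c = assms[unfolded wdec_def]
 note d = c[THEN conjunct2]
 note d1 = d[THEN conjunct2]
 note d2 = d1[THEN conjunct2]
 note d3 = d2[THEN conjunct2]
 note d4 = d3[THEN conjunct2]
 show "finite F" by (rule c[THEN conjunct1])
 show "p : F ==> k \<notin> J ==> p k = 0" by (rule d[THEN conjunct1, rule_format])
 show "Q p : msp DD DD" by (rule d1[THEN conjunct1, rule_format])
 show "p : F ==> q : F ==> Q p * Q q = (if p = q then Q p else 0)" by (rule d2[THEN conjunct1, rule_format])
 show "sum Q F = e DD" by (rule d3[THEN conjunct1])
 show "k : J ==> p : F ==> cmod z = 1 ==> rh (tor N (cr k z)) * Q p = csc (z powi p k) (Q p)"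
  by (rule d4[THEN conjunct1, rule_format])
 show "A : msp DD DD ==> (!!k z. k : J ==> cmod z = 1 ==> A * rh (tor N (cr k z)) = rh (tor N (cr k z)) * A)
    ==> p : F ==> A * Q p = Q p * A" by (rule d4[THEN conjunct2, rule_format])
qed

lemma tor_comm: "tor N u * tor N v = tor N v * tor N u"
 by (simp add: dg_mult) (rule dg_cong, simp_all add: mult.commute)

lemma rho_tor_comm: assumes "u : TT N" "v : TT N"
 shows "rh (tor N u) * rh (tor N v) = rh (tor N v) * rh (tor N u)"
proof -
 have "rh (tor N u) * rh (tor N v) = rh (tor N u * tor N v)" using assms by (simp only: rho_mult tor_GG)
 also have "... = rh (tor N v * tor N u)" by (subst tor_comm) (rule refl)
 also have "... = rh (tor N v) * rh (tor N u)" using assms by (simp only: rho_mult tor_GG)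
 finally show ?thesis .
qed

text \<open>The projections P of the new circle commute with its group elements' centralizer, in
  particular with the old circles, and hence with the old projections. The products
  \<open>Q p * P m\<close> are therefore again a complete system of orthogonal idempotents.\<close>

lemma torus_joint_decomp:
 assumes "finite J" "J \<subseteq> KK N"
 shows "EX F Q. wdec J F Q" using assms
proof (induction J rule: finite_induct)
 case empty
 show ?case unfolding wdec_def
  by (intro exI[of _ "{%_. 0}"] exI[of _ "%_. e DD"]) (auto simp: dg_mult mult_e[of DD _ DD] e_mult[of DD _ DD])
next
 case (insert k J)
 let ?R = "%k z. rh (tor N (cr k z))"
 obtain F Q where FQ: "wdec J F Q" using insert.IH insert.prems by auto
 note F = wdecD(1,2)[OF FQ] and Q = wdecD(3)[OF FQ] and QQ = wdecD(4)[OF FQ] and Qs = wdecD(5)[OF FQ]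
  and RQ = wdecD(6)[OF FQ] and Qc = wdecD(7)[OF FQ]
 have k: "k : KK N" and JK: "J \<subseteq> KK N" using insert.prems by auto
 obtain E P where EP: "cdec k E P" using circle_decomp[OF k] by blast
 note c = EP[unfolded cdec_def]
 note E = c[THEN conjunct1] and c1 = c[THEN conjunct2]
 note P = c1[THEN conjunct1, rule_format] and c2 = c1[THEN conjunct2]
 note PP = c2[THEN conjunct1, rule_format] and c3 = c2[THEN conjunct2]
 note Ps = c3[THEN conjunct1] and c4 = c3[THEN conjunct2]
 note RP = c4[THEN conjunct1, rule_format] and Pc = c4[THEN conjunct2, rule_format]
 have RR: "?R l z * ?R l' w = ?R l' w * ?R l z" if "l : KK N" "l' : KK N" "cmod z = 1" "cmod w = 1" for l l' z w
  using that by (intro rho_tor_comm cr_TT)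
 have Rin: "?R l z : msp DD DD" if "l : KK N" "cmod z = 1" for l z using that by (intro rho_in tor_GG cr_TT)
 have RPc: "?R l z * P m = P m * ?R l z" if "l : KK N" "cmod z = 1" for l z m
  using that k by (intro Pc Rin RR) auto
 have PQ: "P m * Q p = Q p * P m" if "p : F" for m p
  using that JK by (intro Qc P RPc[symmetric]) auto
 define F' where "F' = (%(p, m). p(k := m)) ` (F \<times> E)"
 define Q' where "Q' p = Q (p(k := 0)) * P (p k)" for p
 \<comment> \<open>Old weights vanish at the new index k, so the value m at k can be recorded
   without loss.\<close>
 have pk: "p(k := 0) = p" if "p : F" for p using F(2)[OF that insert.hyps(2)] by auto
 have Q': "Q' (p(k := m)) = Q p * P m" if "p : F" for p m using pk[OF that] by (simp add: Q'_def)
 have inj: "inj_on (%(p, m). p(k := m)) (F \<times> E)"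
 proof (rule inj_onI)
  fix x y assume x: "x : F \<times> E" and y: "y : F \<times> E"
   and xy: "(case x of (p, m) => p(k := m)) = (case y of (p, m) => p(k := m))"
  obtain p m q l where [simp]: "x = (p, m)" "y = (q, l)" by (cases x, cases y)
  have eq: "p(k := m) = q(k := l)" using xy by (simp only: \<open>x = (p, m)\<close> \<open>y = (q, l)\<close> case_prod_conv)
  have "p = (p(k := m))(k := 0)" using pk[of p] x by simp
  also have "... = q" using pk[of q] y unfolding eq by simp
  finally have "p = q" .
  moreover have "m = l" using fun_cong[OF eq, of k] by (simp only: fun_upd_same)
  ultimately show "x = y" by simp
 qed
 have "finite F'" using F E by (auto simp: F'_def)
 moreover have "ALL p:F'. ALL l. l \<notin> insert k J --> p l = 0" using F(2) by (auto simp: F'_def)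
 moreover have "ALL p. Q' p : msp DD DD" using Q P by (auto simp: Q'_def)
 moreover have "ALL p:F'. ALL q:F'. Q' p * Q' q = (if p = q then Q' p else 0)"
 proof (intro ballI)
  fix p' q' assume "p' : F'" "q' : F'"
  then obtain p m q l where *: "p : F" "m : E" "q : F" "l : E" "p' = p(k := m)" "q' = q(k := l)"
   by (auto simp: F'_def)
  have Qp: "Q' p' = Q p * P m" "Q' q' = Q q * P l" using * Q' by auto
  have iff: "(p = q & m = l) = (p' = q')" using inj_onD[OF inj, of "(p, m)" "(q, l)"] * by auto
  have "Q' p' * Q' q' = Q p * (P m * Q q) * P l" by (simp only: Qp mult.assoc)
  also have "... = (Q p * Q q) * (P m * P l)" using * by (simp only: PQ mult.assoc)
  also have "... = (if p = q & m = l then Q p * P m else 0)" using * by (auto simp: QQ PP)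
  finally show "Q' p' * Q' q' = (if p' = q' then Q' p' else 0)" by (simp only: iff Qp)
 qed
 moreover have "sum Q' F' = e DD"
 proof -
  have "sum Q' F' = (\<Sum>(p, m)\<in>F \<times> E. Q p * P m)"
   unfolding F'_def by (subst sum.reindex[OF inj]) (auto intro!: sum.cong simp: Q')
  also have "... = sum Q F * sum P E" by (simp add: sum_product sum.cartesian_product)
  finally show ?thesis by (simp add: Qs Ps dg_mult)
 qed
 moreover have "ALL l:insert k J. ALL z. ALL p:F'. cmod z = 1 --> ?R l z * Q' p = csc (z powi p l) (Q' p)"
 proof (intro ballI allI impI)
  fix l z p' assume *: "l : insert k J" "p' : F'" "cmod z = 1"
  then obtain p m where p: "p : F" "m : E" "p' = p(k := m)" by (auto simp: F'_def)
  show "?R l z * Q' p' = csc (z powi p' l) (Q' p')"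
  proof (cases "l = k")
   case True
   have "?R k z * Q' p' = (?R k z * P m) * Q p" using p by (simp add: Q' PQ mult.assoc)
   also have "... = csc (z powi m) (Q p * P m)" using p *(3) by (simp add: RP PQ)
   finally show ?thesis using True p by (simp add: Q')
  next
   case False
   hence "?R l z * Q' p' = csc (z powi p l) (Q p) * P m"
    using p * by (simp add: Q' mult.assoc[symmetric] RQ)
   thus ?thesis using False p by (simp add: Q')
  qed
 qed
 moreover have "ALL A:msp DD DD. (ALL l:insert k J. ALL z. cmod z = 1 --> A * ?R l z = ?R l z * A) --> (ALL p:F'. A * Q' p = Q' p * A)"
 proof (intro ballI impI)
  fix A p' assume A: "A : msp DD DD" "ALL l:insert k J. ALL z. cmod z = 1 --> A * ?R l z = ?R l z * A" and "p' : F'"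
  then obtain p m where p: "p : F" "m : E" "p' = p(k := m)" by (auto simp: F'_def)
  have "A * Q p = Q p * A" "A * P m = P m * A" using A p by (auto intro: Qc Pc)
  thus "A * Q' p' = Q' p' * A" using p by (simp add: Q' mult.assoc[symmetric]) (simp add: mult.assoc)
 qed
 ultimately have "wdec (insert k J) F' Q'" unfolding wdec_def by blast
 thus ?case by blast
qed

text \<open>A fixed weight decomposition for the whole torus: \<open>WS\<close> is the set of
  weights, \<open>Q\<close> the projections. A projection \<open>Q p\<close> with p in
  \<open>WS\<close> may still be 0.\<close>

definition "WT = (SOME FQ. wdec (KK N) (fst FQ) (snd FQ))"
definition "WS = fst WT"
definition "Q = snd WT"

lemma torus_decomp:
 shows "finite WS" "p : WS ==> k \<notin> KK N ==> p k = 0" "Q p : msp DD DD"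
 "p : WS ==> q : WS ==> Q p * Q q = (if p = q then Q p else 0)" "sum Q WS = e DD"
 "u : TT N ==> p : WS ==> rh (tor N u) * Q p = csc (chi N p u) (Q p)"
 "u : TT N ==> p : WS ==> Q p * rh (tor N u) = csc (chi N p u) (Q p)"
proof -
 let ?R = "%k z. rh (tor N (cr k z))"
 obtain F R where "wdec (KK N) F R" using torus_joint_decomp[OF finite_KK subset_refl] by blast
 hence FQ: "wdec (KK N) WS Q" using someI[of "%FQ. wdec (KK N) (fst FQ) (snd FQ)" "(F, R)"]
  by (simp add: WS_def Q_def WT_def)
 note F = wdecD(1,2)[OF FQ] and Q = wdecD(3)[OF FQ] and QQ = wdecD(4)[OF FQ] and Qs = wdecD(5)[OF FQ]
  and RQ = wdecD(6)[OF FQ] and Qc = wdecD(7)[OF FQ]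
 show "finite WS" by (rule F(1))
 show "p : WS ==> k \<notin> KK N ==> p k = 0" by (rule F(2))
 show "Q p : msp DD DD" by (rule Q)
 show "p : WS ==> q : WS ==> Q p * Q q = (if p = q then Q p else 0)" by (rule QQ)
 show "sum Q WS = e DD" by (rule Qs)
 have main: "rh (tor N u) * Q p = csc (chi N p u) (Q p)" if u: "u : TT N" and p: "p : WS" for u p
 proof -
  have "rh (tor N (%i. PROD k:J. cr k (Xc u k) i)) * Q p = csc (PROD k:J. Xc u k powi p k) (Q p)"
   if "finite J" "J \<subseteq> KK N" for J using that
  proof (induction J rule: finite_induct)
   case empty
   show ?case by (simp add: rho_one e_mult[OF finite_lessThan Q])
  next
   case (insert k J)
   have k: "k : KK N" and J: "J \<subseteq> KK N" using insert.prems by auto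
   have x: "cmod (Xc u l) = 1" if "l : KK N" for l using Xc_unit[OF u, of l] that by (auto simp: KK_def)
   have g: "tor N (cr k (Xc u k)) : GG N" "tor N (%i. PROD k:J. cr k (Xc u k) i) : GG N"
    using k J x by (auto intro!: tor_GG cr_TT TT_prod)
   have "tor N (%i. PROD k:insert k J. cr k (Xc u k) i) = tor N (cr k (Xc u k)) * tor N (%i. PROD k:J. cr k (Xc u k) i)"
    using insert.hyps by (simp add: dg_mult)
   hence "rh (tor N (%i. PROD k:insert k J. cr k (Xc u k) i)) = ?R k (Xc u k) * rh (tor N (%i. PROD k:J. cr k (Xc u k) i))"
    by (simp only: rho_mult[OF g])
   hence "rh (tor N (%i. PROD k:insert k J. cr k (Xc u k) i)) * Q p = csc (PROD k:J. Xc u k powi p k) (?R k (Xc u k) * Q p)"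
    by (simp only: mult.assoc insert.IH[OF J] csc_mult)
   also have "... = csc (PROD k:J. Xc u k powi p k) (csc (Xc u k powi p k) (Q p))"
    by (simp only: RQ[OF k p x[OF k]])
   also have "... = csc (PROD k:insert k J. Xc u k powi p k) (Q p)"
    by (simp only: prod.insert[OF insert.hyps] csc_simps mult.commute)
   finally show ?case .
  qed
  from this[OF finite_KK subset_refl]
  have "rh (tor N (%i. PROD k:KK N. cr k (Xc u k) i)) * Q p = csc (chi N p u) (Q p)" by (simp add: chi_def)
  moreover have "tor N (%i. PROD k:KK N. cr k (Xc u k) i) = tor N u" using cr_decomp[OF u] by (intro dg_cong) auto
  ultimately show ?thesis by simp
 qed
 have main2: "Q p * rh (tor N u) = csc (chi N p u) (Q p)" if u: "u : TT N" and p: "p : WS" for u p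
 proof -
  have "rh (tor N u) * Q p = Q p * rh (tor N u)"
  proof (rule Qc[OF rho_in[OF tor_GG[OF u]] _ p])
   fix k and z :: complex assume "k : KK N" "cmod z = 1"
   thus "rh (tor N u) * ?R k z = ?R k z * rh (tor N u)" using u by (intro rho_tor_comm cr_TT)
  qed
  thus ?thesis using main[OF u p] by simp
 qed
 show "u : TT N ==> p : WS ==> rh (tor N u) * Q p = csc (chi N p u) (Q p)"
  "u : TT N ==> p : WS ==> Q p * rh (tor N u) = csc (chi N p u) (Q p)" by (rule main main2; assumption)+
qed

lemma rho_tor: assumes "u : TT N" shows "rh (tor N u) = (SUM p:WS. csc (chi N p u) (Q p))"
proof -
 have "rh (tor N u) = rh (tor N u) * sum Q WS"
  unfolding torus_decomp(5) by (rule mult_e[OF finite_lessThan rho_in[OF tor_GG[OF assms]], symmetric])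
 thus ?thesis using assms by (simp add: sum_distrib_left torus_decomp(6))
qed

end

section \<open>Differentiating a continuous representation\<close>

lemma finite_convergent_subsequence:
 assumes "finite I" "!!i m. i : I ==> cmod (f i m) <= B"
 shows "EX r. strict_mono (r :: nat => nat) & (ALL i:I. convergent (%m. f i (r m)))" using assms
proof (induction I rule: finite_induct)
 case empty
 show ?case by (rule exI[of _ id]) (simp add: strict_mono_def)
next
 case (insert i I)
 then obtain r where r: "strict_mono (r :: nat => nat)" "ALL i:I. convergent (%m. f i (r m))" by auto
 have "bounded (range (%m. f i (r m)))" using insert.prems by (intro boundedI[of _ B]) auto
 then obtain l s where s: "strict_mono (s :: nat => nat)" "((%m. f i (r m)) \<circ> s) \<longlonglongrightarrow> l"
  using bounded_imp_convergent_subsequence by blast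
 have "convergent (%m. f j (r (s m)))" if "j : I" for j
  using r(2) that convergent_subseq_convergent[OF _ s(1), of "%m. f j (r m)"] by (simp add: o_def)
 moreover have "convergent (%m. f i (r (s m)))" using s(2) by (auto simp: convergent_def o_def)
 ultimately show ?case using r(1) s(1)
  by (intro exI[of _ "r \<circ> s"]) (auto simp: strict_mono_def)
qed

lemma GG_entry_le_1: assumes "U : GG N" shows "cmod (ent U i j) <= 1"
proof (cases "i < 2*N & j < 2*N")
 case True
 note U = GG_simps[OF assms]
 have "1 = ent (star U * U) j j" using True by (simp add: U(3) ent_dg)
 also have "... = (\<Sum>k<2*N. cnj (ent U k j) * ent U k j)"
  using U by (subst ent_mult_msp[of "{..<2*N}" _ "{..<2*N}"]) auto
 also have "... = of_real (\<Sum>k<2*N. (cmod (ent U k j))\<^sup>2)"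
  unfolding of_real_sum by (intro sum.cong refl) (simp only: complex_norm_square mult.commute)
 finally have "(\<Sum>k<2*N. (cmod (ent U k j))\<^sup>2) = 1" by (metis of_real_eq_1_iff)
 moreover have "(cmod (ent U i j))\<^sup>2 <= (\<Sum>k<2*N. (cmod (ent U k j))\<^sup>2)"
  using True by (intro member_le_sum) auto
 ultimately show ?thesis by (simp add: power_le_one_iff abs_square_le_1)
next
 case False
 thus ?thesis using mspD0[OF GG_simps(2)[OF assms], of i j] by auto
qed

lemma GG_nrm: "U : GG N ==> nrm U <= real (2*N * (2*N))"
 using nrm_le[of "{..<2*N}" "{..<2*N}" U 1] GG_entry_le_1 GG_simps(2) by simp

lemma dt_tendsto:
 assumes "!!i j. (%m. ent (A m) i j) \<longlonglongrightarrow> ent g i j"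
 shows "(%m. dt N (A m)) \<longlonglongrightarrow> dt N g"
proof -
 have eq: "dt N B = (\<Sum>p | p permutes {0..<N}. signof p * (\<Prod>i = 0..<N. ent B i (p i)))" for B
  unfolding dt_def by (subst det_def'[of _ N]) (auto intro!: sum.cong prod.cong dest: permutes_in_image)
 show ?thesis unfolding eq by (intro tendsto_sum tendsto_mult tendsto_prod tendsto_const assms)
qed

text \<open>With the bound on the entries this is compactness of the group, in the sequential form
  needed for \<open>rho_bounded\<close>.\<close>

lemma GG_closed_limit:
 assumes A: "!!m. A m : GG N" and L: "!!i j. (%m. ent (A m) i j) \<longlonglongrightarrow> L i j"
 shows "mk {..<2*N} {..<2*N} L : GG N & (ALL i j. (%m. ent (A m) i j) \<longlonglongrightarrow> ent (mk {..<2*N} {..<2*N} L) i j)"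
proof -
 let ?g = "mk {..<2*N} {..<2*N} L"
 have z: "L i j = 0" if "~ bd N i j" for i j
 proof -
  have "(%m. ent (A m) i j) = (%m. 0)" using GG_simps(1)[OF A] that by (auto simp: BD_def)
  thus ?thesis using L[of i j] LIMSEQ_unique[OF tendsto_const[of 0]] by metis
 qed
 have g: "ent ?g i j = L i j" for i j using z[of i j] by (auto simp: ent_mk bd_def)
 have lim: "(%m. ent (A m) i j) \<longlonglongrightarrow> ent ?g i j" for i j using L by (simp add: g)
 have gB: "?g : BD N" using z by (auto simp: BD_def g)
 have "star ?g * ?g = e {..<2*N}"
 proof (rule fmat_eqI)
  fix i j
  have ex: "ent (star B * B) i j = (\<Sum>k<2*N. cnj (ent B k i) * ent B k j)" if "B : BD N" for B
   using BD_msp[OF that] by (subst ent_mult_msp[of "{..<2*N}" _ "{..<2*N}"]) auto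
  have "(%m. \<Sum>k<2*N. cnj (ent (A m) k i) * ent (A m) k j) \<longlonglongrightarrow> (\<Sum>k<2*N. cnj (ent ?g k i) * ent ?g k j)"
   by (intro tendsto_intros lim)
  hence "(%m. ent (star (A m) * A m) i j) \<longlonglongrightarrow> ent (star ?g * ?g) i j"
   by (simp only: ex[OF GG_simps(1)[OF A]] ex[OF gB])
  hence "(%m. ent (e {..<2*N}) i j) \<longlonglongrightarrow> ent (star ?g * ?g) i j" by (simp only: GG_simps(3)[OF A])
  thus "ent (star ?g * ?g) i j = ent (e {..<2*N}) i j" by (simp add: LIMSEQ_const_iff)
 qed
 moreover have "dt N (P1 N ?g) = 1"
 proof -
  have "(%m. dt N (P1 N (A m))) \<longlonglongrightarrow> dt N (P1 N ?g)"
   by (rule dt_tendsto) (use lim in \<open>auto simp: ent_P\<close>)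
  thus ?thesis by (simp add: GG_simps(5)[OF A] LIMSEQ_const_iff)
 qed
 moreover have "dt N (P2 N ?g) = 1"
 proof -
  have "(%m. dt N (P2 N (A m))) \<longlonglongrightarrow> dt N (P2 N ?g)"
   by (rule dt_tendsto) (use lim in \<open>auto simp: ent_P\<close>)
  thus ?thesis by (simp add: GG_simps(6)[OF A] LIMSEQ_const_iff)
 qed
 ultimately show ?thesis using gB lim unfolding GG_def by blast
qed

text \<open>f(t) = O(|t|^k) as t tends to 0. Keeping the radius at most 1 allows the exponent to be
  lowered with the same constant.\<close>

definition sm :: "nat => (real => fmat) => bool" where
 "sm k f \<longleftrightarrow> (\<exists>C de. 0 < de & de <= 1 & 0 <= C & (ALL t. \<bar>t\<bar> <= de --> nrm (f t) <= C * \<bar>t\<bar> ^ k))"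

lemma smI: "0 < de ==> 0 <= C ==> (!!t. \<bar>t\<bar> <= de ==> nrm (f t) <= C * \<bar>t\<bar> ^ k) ==> sm k f"
 unfolding sm_def by (intro exI[of _ C] exI[of _ "min de 1"]) auto

lemma smE: assumes "sm k f" obtains C de where "0 < de" "de <= 1" "0 <= C" "!!t. \<bar>t\<bar> <= de ==> nrm (f t) <= C * \<bar>t\<bar> ^ k"
 using assms unfolding sm_def by auto

lemma sm_add: assumes "sm k f" "sm k g" shows "sm k (%t. f t + g t)"
proof -
 obtain C de where f: "0 < de" "de <= 1" "0 <= C" "!!t. \<bar>t\<bar> <= de ==> nrm (f t) <= C * \<bar>t\<bar> ^ k" by (rule smE[OF assms(1)]) blast
 obtain D ep where g: "0 < ep" "ep <= 1" "0 <= D" "!!t. \<bar>t\<bar> <= ep ==> nrm (g t) <= D * \<bar>t\<bar> ^ k" by (rule smE[OF assms(2)]) blast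
 show ?thesis
 proof (rule smI[of "min de ep" "C + D"])
  fix t assume "\<bar>t\<bar> <= min de ep"
  hence "nrm (f t) <= C * \<bar>t\<bar> ^ k" "nrm (g t) <= D * \<bar>t\<bar> ^ k" using f g by auto
  thus "nrm (f t + g t) <= (C + D) * \<bar>t\<bar> ^ k" using nrm_add[of "f t" "g t"] by (simp add: distrib_right)
 qed (use f g in auto)
qed

lemma sm_mult: assumes "sm k f" "sm l g" shows "sm (k + l) (%t. f t * g t)"
proof -
 obtain C de where f: "0 < de" "de <= 1" "0 <= C" "!!t. \<bar>t\<bar> <= de ==> nrm (f t) <= C * \<bar>t\<bar> ^ k" by (rule smE[OF assms(1)]) blast
 obtain D ep where g: "0 < ep" "ep <= 1" "0 <= D" "!!t. \<bar>t\<bar> <= ep ==> nrm (g t) <= D * \<bar>t\<bar> ^ l" by (rule smE[OF assms(2)]) blast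
 show ?thesis
 proof (rule smI[of "min de ep" "C * D"])
  fix t assume "\<bar>t\<bar> <= min de ep"
  hence "nrm (f t) <= C * \<bar>t\<bar> ^ k" "nrm (g t) <= D * \<bar>t\<bar> ^ l" using f g by auto
  hence "nrm (f t) * nrm (g t) <= (C * \<bar>t\<bar> ^ k) * (D * \<bar>t\<bar> ^ l)" using f(3) by (intro mult_mono) auto
  thus "nrm (f t * g t) <= C * D * \<bar>t\<bar> ^ (k + l)" using nrm_mult[of "f t" "g t"] by (simp add: power_add mult_ac)
 qed (use f g in auto)
qed

lemma sm_mono: assumes "sm k f" "l <= k" shows "sm l f"
proof -
 obtain C de where f: "0 < de" "de <= 1" "0 <= C" "!!t. \<bar>t\<bar> <= de ==> nrm (f t) <= C * \<bar>t\<bar> ^ k" by (rule smE[OF assms(1)]) blast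
 show ?thesis
 proof (rule smI[of de C])
  fix t assume t: "\<bar>t\<bar> <= de"
  have "C * \<bar>t\<bar> ^ k <= C * \<bar>t\<bar> ^ l" using t f assms(2) by (intro mult_left_mono power_decreasing) auto
  thus "nrm (f t) <= C * \<bar>t\<bar> ^ l" using f(4)[OF t] by linarith
 qed (use f in auto)
qed

lemma sm_const: "sm 0 (%t. A)" by (rule smI[of 1 "nrm A"]) auto
lemma sm_lin: "sm 1 (%t. csc (of_real t) A)" by (rule smI[of 1 "nrm A"]) (auto simp: mult.commute)
lemma sm_bounded: "0 <= K ==> (!!t. nrm (f t) <= K) ==> sm 0 f" by (rule smI[of 1 K]) auto
lemma sm_minus: "sm k f ==> sm k (%t. - f t)" by (simp add: sm_def)
lemma sm_diff: "sm k f ==> sm k g ==> sm k (%t. f t - g t)" using sm_add[of k f "%t. - g t"] sm_minus[of k g] by simp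
lemma sm_dom: assumes "sm k f" "0 <= K" "!!t. nrm (g t) <= K * nrm (f t)" shows "sm k g"
proof -
 obtain C de where f: "0 < de" "de <= 1" "0 <= C" "!!t. \<bar>t\<bar> <= de ==> nrm (f t) <= C * \<bar>t\<bar> ^ k" by (rule smE[OF assms(1)]) blast
 show ?thesis
 proof (rule smI[of de "K * C"])
  fix t assume t: "\<bar>t\<bar> <= de"
  have "K * nrm (f t) <= K * (C * \<bar>t\<bar> ^ k)" using f(4)[OF t] assms(2) by (rule mult_left_mono)
  thus "nrm (g t) <= K * C * \<bar>t\<bar> ^ k" using assms(3)[of t] by (simp add: mult.assoc)
 qed (use f assms in auto)
qed

lemma sm_scale: assumes "sm k f" shows "sm k (%t. f (c * t))"
proof -
 obtain C de where f: "0 < de" "de <= 1" "0 <= C" "!!t. \<bar>t\<bar> <= de ==> nrm (f t) <= C * \<bar>t\<bar> ^ k" by (rule smE[OF assms(1)]) blast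
 show ?thesis
 proof (rule smI[of "de / (\<bar>c\<bar> + 1)" "C * \<bar>c\<bar> ^ k"])
  fix t assume t: "\<bar>t\<bar> <= de / (\<bar>c\<bar> + 1)"
  hence "\<bar>t\<bar> * (\<bar>c\<bar> + 1) <= de" by (simp add: pos_le_divide_eq)
  hence "\<bar>c * t\<bar> <= de" unfolding abs_mult by (simp add: algebra_simps)
  thus "nrm (f (c * t)) <= C * \<bar>c\<bar> ^ k * \<bar>t\<bar> ^ k" using f(4)[of "c * t"] by (simp add: abs_mult power_mult_distrib mult.assoc)
 qed (use f in auto)
qed

text \<open>Dividing the estimate of the linear term by t bounds \<open>nrm A\<close> by a multiple
  of t for all small t. This is how linear coefficients of two expansions are compared.\<close>

lemma sm_2_lin: assumes "sm 2 (%t. csc (of_real t) A + f t)" "sm 2 f" shows "A = 0"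
proof -
 have "sm 2 (%t. csc (of_real t) A)" using sm_diff[OF assms] by simp
 then obtain C de where f: "0 < de" "de <= 1" "0 <= C" "!!t. \<bar>t\<bar> <= de ==> nrm (csc (of_real t) A) <= C * \<bar>t\<bar> ^ 2" by (rule smE) blast
 have le: "nrm A <= C * t" if "0 < t" "t <= de" for t
 proof -
  have "t * nrm A <= t * (C * t)" using f(4)[of t] that by (simp add: power2_eq_square mult_ac)
  thus ?thesis using that by (simp add: mult_le_cancel_left_pos)
 qed
 have "nrm A <= 0"
 proof (rule ccontr)
  assume n: "~ nrm A <= 0"
  \<comment> \<open>So small that C t is at most half of \<open>nrm A\<close>.\<close>
  define t where "t = min de (nrm A / (2 * (C + 1)))"
  have "0 < t" "t <= de" using n f by (auto simp: t_def)
  hence "nrm A <= C * t" by (rule le)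
  also have "... <= (C + 1) * (nrm A / (2 * (C + 1)))" using f(1,3) n by (intro mult_mono) (auto simp: t_def)
  also have "... = nrm A / 2" using f(3) by (simp add: field_simps)
  finally show False using n by simp
 qed
 thus ?thesis by (rule nrm_eq_0)
qed

text \<open>The tail of the series is dominated by the same tail at the modulus of z, where exp r <=
  1 + r + r^2 on [0, 1] applies.\<close>

lemma exp_2_bound: assumes "cmod z <= 1" shows "cmod (exp z - 1 - z) <= (cmod z)\<^sup>2"
proof -
 have s: "summable (%n. inverse (fact (n + 2)) *\<^sub>R (cmod z) ^ (n + 2))"
  by (subst summable_iff_shift) (rule summable_exp_generic)
 have "cmod (exp z - 1 - z) = cmod (\<Sum>n. inverse (fact (n + 2)) *\<^sub>R z ^ (n + 2))"
  using exp_first_two_terms[of z] by simp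
 also have "... <= (\<Sum>n. cmod (inverse (fact (n + 2)) *\<^sub>R z ^ (n + 2)))"
  by (rule summable_norm) (use s in \<open>simp add: norm_power norm_mult\<close>)
 also have "... = (\<Sum>n. inverse (fact (n + 2)) *\<^sub>R (cmod z) ^ (n + 2))" by (simp add: norm_power norm_mult)
 also have "... = exp (cmod z) - 1 - cmod z" using exp_first_two_terms[of "cmod z"] by simp
 also have "... <= (cmod z)\<^sup>2" using exp_bound[of "cmod z"] assms by simp
 finally show ?thesis .
qed

lemma sm_exp: "sm 2 (%t. csc (exp (\<i> * of_real (t * a)) - 1 - \<i> * of_real (t * a)) A)"
proof (rule smI[of "1 / (\<bar>a\<bar> + 1)" "a\<^sup>2 * nrm A"])
 fix t :: real assume t: "\<bar>t\<bar> <= 1 / (\<bar>a\<bar> + 1)"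
 let ?z = "\<i> * of_real (t * a)"
 have c: "cmod ?z = \<bar>t * a\<bar>" by (simp only: norm_mult norm_ii norm_of_real mult_1_left)
 have "\<bar>t\<bar> * (\<bar>a\<bar> + 1) <= 1" using t by (simp add: pos_le_divide_eq)
 moreover have "\<bar>t\<bar> * \<bar>a\<bar> <= \<bar>t\<bar> * (\<bar>a\<bar> + 1)" by (intro mult_left_mono) auto
 ultimately have "cmod ?z <= 1" unfolding c abs_mult by linarith
 hence "cmod (exp ?z - 1 - ?z) <= a\<^sup>2 * \<bar>t\<bar>\<^sup>2" using exp_2_bound[of ?z] unfolding c by (simp add: power_mult_distrib mult.commute)
 hence "cmod (exp ?z - 1 - ?z) * nrm A <= (a\<^sup>2 * \<bar>t\<bar>\<^sup>2) * nrm A" by (rule mult_right_mono) simp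
 thus "nrm (csc (exp ?z - 1 - ?z) A) <= a\<^sup>2 * nrm A * \<bar>t\<bar>\<^sup>2" by (simp add: mult_ac)
qed auto

lemma sm_sum: "finite F ==> (!!x. x : F ==> sm k (f x)) ==> sm k (%t. SUM x:F. f x t)"
proof (induction F rule: finite_induct)
 case empty
 show ?case by (rule smI[of 1 0]) auto
next
 case (insert x F)
 thus ?case by (simp add: sm_add)
qed

lemma nrm_star [simp]: "nrm (star A) = nrm A"
proof -
 obtain n where n: "A : msp {..<n} {..<n}" using fmat_msp by blast
 have "nrm (star A) = (\<Sum>i<n. \<Sum>j<n. cmod (ent A j i))" using n by (subst nrm_msp[of "{..<n}" "{..<n}"]) auto
 also have "... = (\<Sum>j<n. \<Sum>i<n. cmod (ent A j i))" by (rule sum.swap)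
 also have "... = nrm A" using n by (subst nrm_msp[of "{..<n}" "{..<n}" A]) auto
 finally show ?thesis .
qed

text \<open>The product rule. The error splits into t^2 X Y and terms containing one of the
  remainders E, E'; boundedness of the second factor controls the term with E.\<close>

lemma sm_prod_expand:
 assumes S: "finite S" and m: "X : msp S S" "Y : msp S S" "!!t. ga t : msp S S" "!!t. ga' t : msp S S"
  and b: "sm 0 ga'" and 1: "sm 2 (%t. ga t - e S - csc (of_real t) X)" and 2: "sm 2 (%t. ga' t - e S - csc (of_real t) Y)"
 shows "sm 2 (%t. ga t * ga' t - e S - csc (of_real t) (X + Y))"
proof -
 define E where "E t = ga t - e S - csc (of_real t) X" for t
 define E' where "E' t = ga' t - e S - csc (of_real t) Y" for t
 have g: "ga t = e S + csc (of_real t) X + E t" "ga' t = e S + csc (of_real t) Y + E' t" for t by (simp_all add: E_def E'_def)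
 have E': "e S * E' t = E' t" for t using m by (intro e_mult[OF S, of _ S]) (auto simp: E'_def)
 have "ga t * ga' t - e S - csc (of_real t) (X + Y) =
   csc (of_real t) X * csc (of_real t) Y + (E' t + csc (of_real t) X * E' t) + E t * ga' t" for t
 proof -
  have "ga t * ga' t = (e S + csc (of_real t) X) * (e S + csc (of_real t) Y + E' t) + E t * ga' t"
   unfolding g(2)[symmetric] g(1) by (simp only: distrib_right add.assoc)
  also have "... = e S + csc (of_real t) Y + E' t + csc (of_real t) X + csc (of_real t) X * csc (of_real t) Y + csc (of_real t) X * E' t + E t * ga' t"
   using m by (simp add: distrib_left distrib_right E' e_mult[OF S, of _ S] mult_e[OF S, of _ S] del: csc_mult)
  finally show ?thesis by (simp add: csc_distrib)
 qed
 moreover have "sm 2 (%t. csc (of_real t) X * csc (of_real t) Y + (E' t + csc (of_real t) X * E' t) + E t * ga' t)"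
  using 1 2 b sm_mult[OF sm_lin sm_lin] sm_mult[OF sm_lin, of 2 E'] sm_mult[of 2 E 0 ga']
  unfolding E_def[symmetric] E'_def[symmetric]
  by (intro sm_add) (auto intro: sm_mono simp: numeral_2_eq_2)
 ultimately show ?thesis by simp
qed

text \<open>To first order the second factor is the inverse of the first, and conjugation of X has
  the commutator with Y as its linear term.\<close>

lemma sm_conj_expand:
 assumes S: "finite S" and m: "X : msp S S" "Y : msp S S" "!!t. ga t : msp S S" "!!t. ga' t : msp S S"
  and b: "sm 0 ga'" and 1: "sm 2 (%t. ga t - e S - csc (of_real t) Y)" and 2: "sm 2 (%t. ga' t - e S + csc (of_real t) Y)"
 shows "sm 2 (%t. ga t * X * ga' t - X - csc (of_real t) (Y * X - X * Y))"
proof -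
 define E where "E t = ga t - e S - csc (of_real t) Y" for t
 define E' where "E' t = ga' t - e S + csc (of_real t) Y" for t
 have g: "ga t = e S + csc (of_real t) Y + E t" "ga' t = e S - csc (of_real t) Y + E' t" for t by (simp_all add: E_def E'_def)
 have YX: "Y * X : msp S S" using m by auto
 have "ga t * X * ga' t - X - csc (of_real t) (Y * X - X * Y) =
   (X * E' t + csc (of_real t) (Y * X) * E' t) - csc (of_real t) (Y * X) * csc (of_real t) Y + E t * (X * ga' t)" for t
 proof -
  have "ga t * X * ga' t = (X + csc (of_real t) (Y * X)) * ga' t + E t * (X * ga' t)"
   unfolding g(1) using m by (simp add: distrib_right e_mult[OF S, of _ S] mult.assoc)
  also have "(X + csc (of_real t) (Y * X)) * ga' t = X + csc (of_real t) (Y * X) - csc (of_real t) (X * Y)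
    - csc (of_real t) (Y * X) * csc (of_real t) Y + X * E' t + csc (of_real t) (Y * X) * E' t"
   unfolding g(2) using m by (simp add: distrib_left distrib_right right_diff_distrib mult_e[OF S, of _ S] mult_e[OF S YX] mult_e[OF S YX, unfolded mult.assoc] mult.assoc csc_distrib)
  finally show ?thesis by (simp add: csc_distrib algebra_simps)
 qed
 moreover have "sm 2 (%t. (X * E' t + csc (of_real t) (Y * X) * E' t) - csc (of_real t) (Y * X) * csc (of_real t) Y + E t * (X * ga' t))"
 proof -
  have a: "sm 2 E" "sm 2 E'" using 1 2 unfolding E_def E'_def .
  have "sm 2 (%t. X * E' t)" using sm_mult[OF sm_const[of X] a(2)] by (simp only: add_0)
  moreover have "sm 2 (%t. csc (of_real t) (Y * X) * E' t)" using sm_mono[OF sm_mult[OF sm_lin a(2)]] by fastforce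
  moreover have "sm 2 (%t. csc (of_real t) (Y * X) * csc (of_real t) Y)" using sm_mult[OF sm_lin[of "Y * X"] sm_lin[of Y]] by (simp only: one_add_one)
  moreover have "sm 2 (%t. E t * (X * ga' t))" using sm_mult[OF a(1) sm_mult[OF sm_const b]] by simp
  ultimately show ?thesis by (intro sm_add sm_diff)
 qed
 ultimately show ?thesis by simp
qed

lemma norm_powi_diff: assumes "cmod z = 1" shows "cmod (z powi m - 1) <= real_of_int \<bar>m\<bar> * cmod (z - 1)"
proof -
 have p: "cmod (w ^ n - 1) <= real n * cmod (w - 1)" if "cmod w = 1" for w n
  using norm_power_diff[of w 1 n] that by simp
 show ?thesis
 proof (cases "m >= 0")
  case True
  thus ?thesis using p[OF assms, of "nat m"] by (simp add: power_int_def)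
 next
  case False
  have "cmod (inverse z - 1) = cmod (z - 1)"
  proof -
   have "z ~= 0" using assms by auto
   hence "inverse z - 1 = - (inverse z * (z - 1))" by (simp add: right_diff_distrib)
   hence "cmod (inverse z - 1) = cmod (inverse z) * cmod (z - 1)" by (simp only: norm_minus_cancel norm_mult)
   thus ?thesis using assms by (simp add: norm_inverse)
  qed
  thus ?thesis using p[of "inverse z" "nat (- m)"] False assms by (simp add: power_int_def norm_inverse)
 qed
qed

text \<open>For numbers of modulus 1 the difference of two products is at most the sum of the
  differences. This is used twice, for the partial products and for the character.\<close>

lemma chi_diff_bound:
 "\<exists>C\<ge>0. ALL u:TT N. ALL b. (ALL i<2*N. cmod (u i - 1) <= b) --> cmod (chi N p u - 1) <= C * b"
proof (intro exI[of _ "SUM k:KK N. real_of_int \<bar>p k\<bar> * real k"] conjI ballI allI impI)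
 fix u b assume u: "u : TT N" and b: "ALL i<2*N. cmod (u i - 1) <= b"
 have "cmod (chi N p u - (PROD k:KK N. 1)) <= (SUM k:KK N. cmod (Xc u k powi p k - 1))"
  unfolding chi_def by (rule norm_prod_diff) (auto simp: norm_power_int Xc_unit[OF u] KK_def)
 also have "... <= (SUM k:KK N. real_of_int \<bar>p k\<bar> * (real k * b))"
 proof (intro sum_mono)
  fix k assume k: "k : KK N"
  have x: "cmod (Xc u k) = 1" using Xc_unit[OF u] k by (auto simp: KK_def)
  have "cmod (Xc u k - (\<Prod>i<k. 1)) <= (\<Sum>i<k. cmod (u i - 1))"
   unfolding Xc_def using u k by (intro norm_prod_diff) (auto simp: TT_def KK_def)
  also have "... <= (\<Sum>i<k. b)" using b k by (intro sum_mono) (auto simp: KK_def)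
  finally have "cmod (Xc u k - 1) <= real k * b" by simp
  hence "real_of_int \<bar>p k\<bar> * cmod (Xc u k - 1) <= real_of_int \<bar>p k\<bar> * (real k * b)" by (rule mult_left_mono) simp
  thus "cmod (Xc u k powi p k - 1) <= real_of_int \<bar>p k\<bar> * (real k * b)" using norm_powi_diff[OF x, of "p k"] by linarith
 qed
 finally show "cmod (chi N p u - 1) <= (SUM k:KK N. real_of_int \<bar>p k\<bar> * real k) * b" by (simp add: sum_distrib_right mult.assoc)
qed (auto intro: sum_nonneg)

lemma TT_exp: assumes "h : HH N" shows "(%i. exp (\<i> * of_real (t * h i))) : TT N"
proof -
 have "(\<Prod>i<N. exp (\<i> * of_real (t * h i))) = exp (\<i> * of_real (t * (\<Sum>i<N. h i)))"
  "(\<Prod>i<N. exp (\<i> * of_real (t * h (N + i)))) = exp (\<i> * of_real (t * (\<Sum>i<N. h (N + i))))"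
  by (simp_all add: exp_sum[symmetric] sum_distrib_left)
 moreover have "(\<Sum>x<N. complex_of_real (h x)) = 0" "(\<Sum>x<N. complex_of_real (h (N + x))) = 0"
  using assms by (simp_all add: HH_def flip: of_real_sum)
 ultimately show ?thesis by (simp add: TT_def)
qed

lemma chi_exp: "chi N p (%i. exp (\<i> * of_real (t * h i))) = exp (\<i> * of_real (t * pr N p h))"
proof -
 have "Xc (%i. exp (\<i> * of_real (t * h i))) k powi p k = exp (\<i> * of_real (t * (of_int (p k) * (\<Sum>i<k. h i))))" for k
 proof -
  have "Xc (%i. exp (\<i> * of_real (t * h i))) k = exp (\<i> * of_real (t * (\<Sum>i<k. h i)))"
   unfolding Xc_def by (simp add: exp_sum[symmetric] sum_distrib_left)
  thus ?thesis by (simp add: exp_power_int mult_ac)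
 qed
 thus ?thesis unfolding chi_def pr_def by (simp add: exp_sum[symmetric] sum_distrib_left)
qed

text \<open>Arguments are chosen freely except for the last coordinate, which receives minus their
  sum; the product condition makes this a valid argument.\<close>

lemma TT_log_half:
 assumes N: "N > 0" and u: "!!i. i < N ==> cmod (u i) = 1" "(\<Prod>i<N. u i) = 1"
 shows "\<exists>h :: nat => real. (\<Sum>i<N. h i) = 0 & (ALL i<N. u i = exp (\<i> * of_real (h i)))"
proof -
 obtain n where n: "N = Suc n" using N by (cases N) auto
 have a: "u i = exp (\<i> * of_real (Arg (u i)))" if "i < N" for i
  using Arg_eq[of "u i"] u(1)[OF that] by force
 define h where "h i = (if i < n then Arg (u i) else - (\<Sum>i<n. Arg (u i)))" for i
 have "(\<Prod>i<n. u i) = exp (\<i> * of_real (\<Sum>i<n. Arg (u i)))"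
 proof -
  have "(\<Prod>i<n. u i) = (\<Prod>i<n. exp (\<i> * of_real (Arg (u i))))" using a n by (intro prod.cong) auto
  thus ?thesis by (simp add: exp_sum[symmetric] sum_distrib_left)
 qed
 hence "exp (\<i> * of_real (\<Sum>i<n. Arg (u i))) * u n = 1" using u(2) n by simp
 hence "u n = exp (- (\<i> * of_real (\<Sum>i<n. Arg (u i))))" by (simp add: exp_minus field_simps)
 hence "ALL i<N. u i = exp (\<i> * of_real (h i))" using a n by (auto simp: h_def less_Suc_eq)
 moreover have "(\<Sum>i<N. h i) = 0" by (simp add: n h_def)
 ultimately show ?thesis by blast
qed

lemma TT_log: assumes "N > 0" "u : TT N" shows "EX h:HH N. tor N u = tor N (%i. exp (\<i> * of_real (1 * h i)))"
proof -
 obtain h1 where h1: "(\<Sum>i<N. h1 i) = (0::real)" "ALL i<N. u i = exp (\<i> * of_real (h1 i))"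
  using TT_log_half[of N u] assms by (auto simp: TT_def)
 obtain h2 where h2: "(\<Sum>i<N. h2 i) = (0::real)" "ALL i<N. u (N + i) = exp (\<i> * of_real (h2 i))"
  using TT_log_half[of N "%i. u (N + i)"] assms by (auto simp: TT_def)
 define h where "h i = (if i < N then h1 i else h2 (i - N))" for i
 have "h : HH N" using h1 h2 by (simp add: HH_def h_def)
 moreover have "tor N u = tor N (%i. exp (\<i> * of_real (1 * h i)))"
 proof (rule dg_cong)
  fix i assume "i : {..<2*N}"
  thus "u i = exp (\<i> * of_real (1 * h i))" using h1(2) h2(2)[rule_format, of "i - N"] by (auto simp: h_def)
 qed simp
 ultimately show ?thesis by blast
qed

section \<open>Lipschitz bound and the differential of a representation\<close>

context su_rep
begin

text \<open>Otherwise some sequence in the group has images of unbounded norm. A subsequence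
  converges inside the group, and by continuity the images along it converge.\<close>

lemma rho_bounded: "\<exists>K>0. ALL U:GG N. nrm (rh U) <= K"
proof (rule ccontr)
 assume *: "~ ?thesis"
 have "EX U:GG N. nrm (rh U) > real m + 1" for m :: nat
 proof (rule ccontr)
  assume "~ (EX U:GG N. nrm (rh U) > real m + 1)"
  hence "real m + 1 > 0 & (ALL U:GG N. nrm (rh U) <= real m + 1)" by (auto simp: not_less)
  thus False using * by blast
 qed
 then obtain U where U: "!!m. U m : GG N" "!!m::nat. nrm (rh (U m)) > real m + 1" by metis
 obtain r where r: "strict_mono (r :: nat => nat)" "ALL x:II \<times> II. convergent (%m. ent (U (r m)) (fst x) (snd x))"
  using finite_convergent_subsequence[of "II \<times> II" "%x m. ent (U m) (fst x) (snd x)" 1] GG_entry_le_1[OF U(1)] by auto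
 have conv: "convergent (%m. ent (U (r m)) i j)" for i j
 proof (cases "i : II & j : II")
  case True
  thus ?thesis using r(2)[rule_format, of "(i, j)"] by auto
 next
  case False
  have "(%m. ent (U (r m)) i j) = (%m. 0)" using mspD0[OF GG_simps(2)[OF U(1)]] False by blast
  thus ?thesis by (simp add: convergent_const)
 qed
 hence "ALL i j. EX l. (%m. ent (U (r m)) i j) \<longlonglongrightarrow> l" by (simp add: convergent_def)
 then obtain L where L: "!!i j. (%m. ent (U (r m)) i j) \<longlonglongrightarrow> L i j" by metis
 note g = GG_closed_limit[of "%m. U (r m)", OF U(1) L]
 let ?g = "mk II II L"
 have lim: "(%m. ent (rh (U (r m))) a b) \<longlonglongrightarrow> ent (rh ?g) a b" for a b
  by (rule rho_cont) (use U(1) g in auto)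
 have "(%m. \<Sum>a<d. \<Sum>b<d. cmod (ent (rh (U (r m))) a b)) \<longlonglongrightarrow> (\<Sum>a<d. \<Sum>b<d. cmod (ent (rh ?g) a b))"
  by (intro tendsto_intros lim)
 hence "(%m. nrm (rh (U (r m)))) \<longlonglongrightarrow> nrm (rh ?g)"
  using g by (simp add: nrm_msp[OF finite_lessThan finite_lessThan rho_in] U(1))
 hence "Bseq (%m. nrm (rh (U (r m))))" by (intro convergent_imp_Bseq convergentI)
 then obtain B where B: "!!m. norm (nrm (rh (U (r m)))) <= B" by (auto simp: Bseq_def)
 obtain m :: nat where m: "B < real m" using reals_Archimedean2 by blast
 have "real m <= real (r m)" using seq_suble[OF r(1), of m] by simp
 thus False using B[of m] U(2)[of "r m"] m by simp
qed

lemma rho_star: "U : GG N ==> rh U * rh (star U) = e DD" "U : GG N ==> rh (star U) * rh U = e DD"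
 by (simp_all add: rho_mult[symmetric] GG_star GG_simps rho_one)

text \<open>Conjugate U into the torus. There \<open>rh\<close> is a finite sum of characters times
  projections, and characters are Lipschitz by \<open>chi_diff_bound\<close>; the conjugation costs
  only factors bounded on the whole group.\<close>

lemma rho_lipschitz: "\<exists>C\<ge>0. ALL U:GG N. nrm (rh U - e DD) <= C * nrm (U - e II)"
proof -
 obtain K where K: "K > 0" "!!U. U : GG N ==> nrm (rh U) <= K" using rho_bounded by blast
 have "ALL p. \<exists>C\<ge>0. ALL u:TT N. ALL b. (ALL i<2*N. cmod (u i - 1) <= b) --> cmod (chi N p u - 1) <= C * b"
  using chi_diff_bound by blast
 then obtain c where c: "!!p. c p >= 0" "!!p u b. u : TT N ==> (!!i. i < 2*N ==> cmod (u i - 1) <= b) ==> cmod (chi N p u - 1) <= c p * b"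
  by metis
 define M where "M = real (2*N * (2*N))"
 define C where "C = (SUM p:WS. c p * nrm (Q p))"
 have C0: "C >= 0" unfolding C_def using c(1) by (intro sum_nonneg) auto
 have M0: "M >= 0" by (simp add: M_def)
 have "nrm (rh U - e DD) <= (K * (C * (M * M)) * K) * nrm (U - e II)" if U: "U : GG N" for U
 proof -
  obtain k u where k: "k : GG N" and u: "u : TT N" and Uk: "U = k * tor N u * star k" using GG_diag[OF U N0] by blast
  note k' = GG_simps[OF k] and sk = GG_star[OF k] and sk' = GG_simps[OF GG_star[OF k]] and tu = tor_GG[OF u]
  have Um: "U - e II : msp II II" using GG_simps(2)[OF U] by auto
  have "star k * (U - e II) * k = (star k * k) * tor N u * (star k * k) - star k * (e II * k)"
   unfolding Uk by (simp only: left_diff_distrib right_diff_distrib mult.assoc)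
  also have "... = tor N u - e II"
   by (simp add: k'(3) e_mult[OF _ k'(2)] mult_e[of II _ II] e_mult[of II _ II])
  finally have eq: "star k * (U - e II) * k = tor N u - e II" .
  have "nrm (star k * (U - e II) * k) <= nrm (star k) * nrm (U - e II) * nrm k"
   by (meson nrm_mult order_trans mult_right_mono nrm_ge0)
  also have "... <= M * nrm (U - e II) * M"
   using GG_nrm[OF k] GG_nrm[OF sk] M0 by (intro mult_mono) (auto simp: M_def simp del: nrm_star)
  finally have b: "nrm (tor N u - e II) <= M * M * nrm (U - e II)" unfolding eq by (simp only: mult_ac)
  have ui: "cmod (u i - 1) <= M * M * nrm (U - e II)" if "i < 2*N" for i
   using nrm_ent[of "tor N u - e II" i i] b that by (simp add: ent_dg)
  have "rh (tor N u) - e DD = (SUM p:WS. csc (chi N p u - 1) (Q p))"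
   unfolding rho_tor[OF u] torus_decomp(5)[symmetric] by (simp add: sum_subtractf[symmetric] csc_distrib)
  hence "nrm (rh (tor N u) - e DD) <= (SUM p:WS. cmod (chi N p u - 1) * nrm (Q p))"
   using nrm_sum[of "%p. csc (chi N p u - 1) (Q p)" WS] by simp
  also have "... <= (SUM p:WS. (c p * (M * M * nrm (U - e II))) * nrm (Q p))"
   using c(2)[OF u ui] by (intro sum_mono mult_right_mono) auto
  also have "... = C * (M * M) * nrm (U - e II)" by (simp add: C_def sum_distrib_right sum_distrib_left mult_ac)
  finally have t: "nrm (rh (tor N u) - e DD) <= C * (M * M) * nrm (U - e II)" .
  have "rh U - e DD = rh k * rh (tor N u) * rh (star k) - rh k * rh (star k)"
   unfolding Uk using k sk tu by (simp add: rho_mult GG_mult rho_star)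
  also have "... = rh k * (rh (tor N u) - e DD) * rh (star k)"
   by (simp add: left_diff_distrib right_diff_distrib mult_e[OF _ rho_in[OF k]])
  finally have "nrm (rh U - e DD) <= nrm (rh k) * nrm (rh (tor N u) - e DD) * nrm (rh (star k))"
   by (simp only:) (meson nrm_mult order_trans mult_right_mono nrm_ge0)
  also have "... <= K * (C * (M * M) * nrm (U - e II)) * K"
   using K(2)[OF k] K(2)[OF sk] t K(1) C0 M0 by (intro mult_mono) auto
  finally show ?thesis by (simp add: mult_ac)
 qed
 moreover have "K * (C * (M * M)) * K >= 0" using K C0 M0 by simp
 ultimately show ?thesis by blast
qed

text \<open>A is the derivative of \<open>rh\<close> in the direction X, witnessed by one curve in
  the group with tangent X. No smoothness of \<open>rh\<close> enters; \<open>DR_any\<close> passes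
  to all other curves with this tangent.\<close>

definition DR :: "fmat => fmat => bool" where
 "DR X A \<longleftrightarrow> A : msp DD DD & (\<exists>ga. (ALL t. ga t : GG N) & sm 2 (%t. ga t - e II - csc (of_real t) X) &
   sm 2 (%t. rh (ga t) - e DD - csc (of_real t) A))"

lemma sm_GG: "(!!t. ga t : GG N) ==> sm 0 ga"
 using GG_nrm by (intro sm_bounded[of "real (2*N * (2*N))"]) auto

lemma sm_rho: assumes "!!t. ga t : GG N" shows "sm 0 (%t. rh (ga t))"
proof -
 obtain K where K: "K > 0" "!!U. U : GG N ==> nrm (rh U) <= K" using rho_bounded by blast
 thus ?thesis using assms by (intro sm_bounded[of K]) auto
qed

text \<open>Two curves with the same tangent differ by a group element e + O(t^2), which the
  Lipschitz bound sends to e + O(t^2).\<close>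

lemma DR_any:
 assumes "DR X A" and ga: "!!t. ga t : GG N" "sm 2 (%t. ga t - e II - csc (of_real t) X)"
 shows "sm 2 (%t. rh (ga t) - e DD - csc (of_real t) A)"
proof -
 obtain be where b: "!!t. be t : GG N" "sm 2 (%t. be t - e II - csc (of_real t) X)"
   "sm 2 (%t. rh (be t) - e DD - csc (of_real t) A)" using assms(1) unfolding DR_def by blast
 have "sm 2 (%t. ga t - be t)" using sm_diff[OF ga(2) b(2)] by simp
 hence "sm (0 + 2) (%t. star (be t) * (ga t - be t))" using b(1) by (intro sm_mult sm_GG GG_star)
 moreover have "star (be t) * (ga t - be t) = star (be t) * ga t - e II" for t
  by (simp add: right_diff_distrib GG_simps(3)[OF b(1)])
 ultimately have s: "sm 2 (%t. star (be t) * ga t - e II)" by (simp only: add_0)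
 obtain C where C: "C >= 0" "!!U. U : GG N ==> nrm (rh U - e DD) <= C * nrm (U - e II)" using rho_lipschitz by blast
 have "sm 2 (%t. rh (star (be t) * ga t) - e DD)"
  by (rule sm_dom[OF s C(1)]) (intro C(2) GG_mult GG_star b(1) ga(1))
 hence "sm (0 + 2) (%t. rh (be t) * (rh (star (be t) * ga t) - e DD))" by (intro sm_mult sm_rho b(1))
 moreover have "rh (be t) * (rh (star (be t) * ga t) - e DD) = rh (ga t) - rh (be t)" for t
 proof -
  have "rh (be t) * rh (star (be t) * ga t) = rh (be t * (star (be t) * ga t))"
   by (intro rho_mult[symmetric] GG_mult GG_star b(1) ga(1))
  also have "be t * (star (be t) * ga t) = ga t"
   by (simp add: mult.assoc[symmetric] GG_simps(4)[OF b(1)] e_mult[OF _ GG_simps(2)[OF ga(1)]])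
  finally show ?thesis by (simp add: right_diff_distrib mult_e[OF _ rho_in[OF b(1)]])
 qed
 ultimately have d: "sm 2 (%t. rh (ga t) - rh (be t))" by (simp only: add_0)
 have "rh (ga t) - rh (be t) + (rh (be t) - e DD - csc (of_real t) A) = rh (ga t) - e DD - csc (of_real t) A" for t
  by (simp add: algebra_simps)
 thus ?thesis using sm_add[OF d b(3)] by (simp only:)
qed

lemma DR_unique: assumes "DR X A" "DR X B" shows "A = B"
proof -
 obtain be where b: "!!t. be t : GG N" "sm 2 (%t. be t - e II - csc (of_real t) X)"
   "sm 2 (%t. rh (be t) - e DD - csc (of_real t) A)" using assms(1) unfolding DR_def by blast
 have "sm 2 (%t. rh (be t) - e DD - csc (of_real t) B)" by (rule DR_any[OF assms(2) b(1,2)])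
 from sm_diff[OF this b(3)] have "sm 2 (%t. csc (of_real t) (A - B) + 0)" by (simp add: csc_distrib)
 hence "A - B = 0" by (rule sm_2_lin) (rule smI[of 1 0], auto)
 thus ?thesis by simp
qed

lemma DR_scale: assumes "DR X A" shows "DR (csc (of_real c) X) (csc (of_real c) A)"
proof -
 obtain be where b: "!!t. be t : GG N" "sm 2 (%t. be t - e II - csc (of_real t) X)"
   "sm 2 (%t. rh (be t) - e DD - csc (of_real t) A)" using assms unfolding DR_def by blast
 show ?thesis unfolding DR_def using b(1) sm_scale[OF b(2), of c] sm_scale[OF b(3), of c] assms
  by (intro conjI exI[of _ "%t. be (c * t)"]) (auto simp: DR_def mult.commute)
qed

lemma DR_add: assumes "DR X A" "DR Y B" "X : msp II II" "Y : msp II II" shows "DR (X + Y) (A + B)"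
proof -
 obtain be where b: "!!t. be t : GG N" "sm 2 (%t. be t - e II - csc (of_real t) X)"
   "sm 2 (%t. rh (be t) - e DD - csc (of_real t) A)" using assms(1) unfolding DR_def by blast
 obtain ga where g: "!!t. ga t : GG N" "sm 2 (%t. ga t - e II - csc (of_real t) Y)"
   "sm 2 (%t. rh (ga t) - e DD - csc (of_real t) B)" using assms(2) unfolding DR_def by blast
 have AB: "A : msp DD DD" "B : msp DD DD" using assms by (auto simp: DR_def)
 have "sm 2 (%t. be t * ga t - e II - csc (of_real t) (X + Y))"
  by (rule sm_prod_expand[OF finite_lessThan assms(3,4) GG_simps(2)[OF b(1)] GG_simps(2)[OF g(1)] sm_GG[OF g(1)] b(2) g(2)])
 moreover have "sm 2 (%t. rh (be t) * rh (ga t) - e DD - csc (of_real t) (A + B))"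
  by (rule sm_prod_expand[OF finite_lessThan AB rho_in[OF b(1)] rho_in[OF g(1)] sm_rho[OF g(1)] b(3) g(3)])
 ultimately show ?thesis unfolding DR_def using AB b(1) g(1)
  by (intro conjI exI[of _ "%t. be t * ga t"]) (auto simp: rho_mult)
qed

lemma DR_conj: assumes "DR X A" "k : GG N" shows "DR (k * X * star k) (rh k * A * rh (star k))"
proof -
 obtain be where b: "!!t. be t : GG N" "sm 2 (%t. be t - e II - csc (of_real t) X)"
   "sm 2 (%t. rh (be t) - e DD - csc (of_real t) A)" using assms(1) unfolding DR_def by blast
 note k = GG_simps[OF assms(2)] and sk = GG_star[OF assms(2)]
 have "sm (0 + 2 + 0) (%t. k * (be t - e II - csc (of_real t) X) * star k)"
  by (intro sm_mult sm_const b(2))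
 moreover have "k * (be t - e II - csc (of_real t) X) * star k = k * be t * star k - e II - csc (of_real t) (k * X * star k)" for t
  by (simp add: left_diff_distrib right_diff_distrib mult_e[OF _ k(2)] k(4))
 ultimately have 1: "sm 2 (%t. k * be t * star k - e II - csc (of_real t) (k * X * star k))" by (simp only: add_0 add_0_right)
 have "sm (0 + 2 + 0) (%t. rh k * (rh (be t) - e DD - csc (of_real t) A) * rh (star k))"
  by (intro sm_mult sm_const b(3))
 moreover have "rh k * (rh (be t) - e DD - csc (of_real t) A) * rh (star k) = rh (k * be t * star k) - e DD - csc (of_real t) (rh k * A * rh (star k))" for t
  using b(1) assms(2) sk
  by (simp add: left_diff_distrib right_diff_distrib mult_e[OF _ rho_in[OF assms(2)]] rho_star rho_mult GG_mult)
 ultimately have 2: "sm 2 (%t. rh (k * be t * star k) - e DD - csc (of_real t) (rh k * A * rh (star k)))" by (simp only: add_0 add_0_right)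
 have A: "A : msp DD DD" using assms(1) by (simp add: DR_def)
 have "rh k * A * rh (star k) : msp DD DD" by (rule msp_mult[OF msp_mult[OF rho_in[OF assms(2)] A] rho_in[OF sk]])
 thus ?thesis unfolding DR_def using 1 2 b(1) assms(2)
  by (intro conjI exI[of _ "%t. k * be t * star k"]) auto
qed

definition dS :: "(nat => real) => fmat" where "dS h = (SUM p:WS. csc (\<i> * of_real (pr N p h)) (Q p))"

text \<open>The curve is the one-parameter group of h. Both it and its image are finite sums of
  scalar exponentials times fixed matrices, so the second order bound on exp applies term by
  term.\<close>

lemma DR_diag: assumes h: "h : HH N" shows "DR (dg II (%i. \<i> * of_real (h i))) (dS h)"
proof -
 define ga where "ga t = tor N (%i. exp (\<i> * of_real (t * h i)))" for t
 have g: "ga t : GG N" for t unfolding ga_def by (intro tor_GG TT_exp h)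
 let ?E = "%i. mk {i} {i} (%_ _. 1)"
 have "ga t - e II - csc (of_real t) (dg II (%i. \<i> * of_real (h i))) =
   (SUM i:II. csc (exp (\<i> * of_real (t * h i)) - 1 - \<i> * of_real (t * h i)) (?E i))" for t
 proof (rule fmat_eqI)
  fix a b
  have *: "ent (csc c (?E i)) a b = (if i = a then (if a = b then c else 0) else 0)" for c i by (simp add: ent_mk)
  show "ent (ga t - e II - csc (of_real t) (dg II (%i. \<i> * of_real (h i)))) a b =
   ent (SUM i:II. csc (exp (\<i> * of_real (t * h i)) - 1 - \<i> * of_real (t * h i)) (?E i)) a b"
   unfolding ent_sum * by (simp add: ga_def ent_dg)
 qed
 hence 1: "sm 2 (%t. ga t - e II - csc (of_real t) (dg II (%i. \<i> * of_real (h i))))"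
  by (simp only:) (intro sm_sum sm_exp finite_lessThan)
 have "rh (ga t) - e DD - csc (of_real t) (dS h) =
   (SUM p:WS. csc (exp (\<i> * of_real (t * pr N p h)) - 1 - \<i> * of_real (t * pr N p h)) (Q p))" for t
  unfolding ga_def rho_tor[OF TT_exp[OF h]] chi_exp torus_decomp(5)[symmetric] dS_def csc_sum
  by (simp only: sum_subtractf[symmetric] csc_distrib csc_simps of_real_mult mult.left_commute)
 hence 2: "sm 2 (%t. rh (ga t) - e DD - csc (of_real t) (dS h))"
  by (simp only:) (intro sm_sum sm_exp torus_decomp(1))
 have "dS h : msp DD DD" unfolding dS_def by (intro msp_sum msp_closed torus_decomp(3))
 thus ?thesis unfolding DR_def using g 1 2 by blast
qed

text \<open>Every skew-Hermitian X is conjugate under the group to a diagonal one, where the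
  derivative is known.\<close>

lemma DR_exists: assumes "X : KA N" shows "EX A. DR X A"
proof -
 obtain k h where "k : GG N" "h : HH N" "X = k * dg II (%i. \<i> * of_real (h i)) * star k"
  using KA_diag[OF assms N0] by blast
 thus ?thesis using DR_conj[OF DR_diag] by blast
qed

definition dr :: "fmat => fmat" where "dr X = (THE A. DR X A)"

lemma dr_eq: "DR X A ==> dr X = A" unfolding dr_def using DR_unique by blast
lemma DR_dr: "X : KA N ==> DR X (dr X)" using DR_exists dr_eq by metis

lemma KA_closed [intro]: "X : KA N ==> Y : KA N ==> X + Y : KA N" "X : KA N ==> Y : KA N ==> X - Y : KA N"
 "X : KA N ==> csc (of_real c) X : KA N" "X : KA N ==> - X : KA N" "0 : KA N"
 unfolding KA_def by (auto intro: LA_closed simp: csc_distrib)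

lemma KA_simps: "X : KA N ==> X : BD N" "X : KA N ==> X : msp II II" "X : KA N ==> star X = - X" "X : KA N ==> X : LA N"
 by (auto simp: KA_def LA_def)

lemma KA_conj: "k : GG N ==> X : KA N ==> k * X * star k : KA N"
 unfolding KA_def using LA_conj[of k N X] by (auto simp: mult.assoc)

lemma dr_in: "X : KA N ==> dr X : msp DD DD" using DR_dr by (auto simp: DR_def)
lemma dr_add: "X : KA N ==> Y : KA N ==> dr (X + Y) = dr X + dr Y"
 by (intro dr_eq DR_add DR_dr KA_simps)
lemma dr_scale: "X : KA N ==> dr (csc (of_real c) X) = csc (of_real c) (dr X)"
 by (intro dr_eq DR_scale DR_dr)
lemma dr_conj: "X : KA N ==> k : GG N ==> dr (k * X * star k) = rh k * dr X * rh (star k)"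
 by (intro dr_eq DR_conj DR_dr)
lemma dr_minus: "X : KA N ==> dr (- X) = - dr X" using dr_scale[of X "-1"] by simp
lemma dr_0: "dr 0 = 0" using dr_scale[of 0 0] KA_closed(5) by simp
lemma dr_diff: "X : KA N ==> Y : KA N ==> dr (X - Y) = dr X - dr Y"
 using dr_add[of X "- Y"] dr_minus[of Y] KA_closed(4) by simp

text \<open>The Lipschitz bound along a curve with tangent X, divided by t.\<close>

lemma dr_bound: "\<exists>C\<ge>0. ALL X:KA N. nrm (dr X) <= C * nrm X"
proof -
 obtain C where C: "C >= 0" "!!U. U : GG N ==> nrm (rh U - e DD) <= C * nrm (U - e II)" using rho_lipschitz by blast
 have "nrm (dr X) <= C * nrm X" if X: "X : KA N" for X
 proof -
  obtain be where b: "!!t. be t : GG N" "sm 2 (%t. be t - e II - csc (of_real t) X)"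
    "sm 2 (%t. rh (be t) - e DD - csc (of_real t) (dr X))" using DR_dr[OF X] unfolding DR_def by blast
  obtain A a where f: "0 < a" "a <= 1" "0 <= A" "!!t. \<bar>t\<bar> <= a ==> nrm (be t - e II - csc (of_real t) X) <= A * \<bar>t\<bar>\<^sup>2" by (rule smE[OF b(2)]) blast
  obtain B ep where g: "0 < ep" "ep <= 1" "0 <= B" "!!t. \<bar>t\<bar> <= ep ==> nrm (rh (be t) - e DD - csc (of_real t) (dr X)) <= B * \<bar>t\<bar>\<^sup>2" by (rule smE[OF b(3)]) blast
  have key: "nrm (dr X) <= C * nrm X + (C * A + B) * t" if t: "0 < t" "t <= a" "t <= ep" for t
  proof -
   have "csc (of_real t) (dr X) = (rh (be t) - e DD) - (rh (be t) - e DD - csc (of_real t) (dr X))" by simp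
   hence "t * nrm (dr X) <= nrm (rh (be t) - e DD) + B * t\<^sup>2"
    using nrm_diff[of "rh (be t) - e DD" "rh (be t) - e DD - csc (of_real t) (dr X)"] g(4)[of t] t nrm_csc[of "of_real t" "dr X"] by simp
   moreover have "nrm (rh (be t) - e DD) <= C * nrm (be t - e II)" by (rule C(2)[OF b(1)])
   moreover have "C * nrm (be t - e II) <= C * (t * nrm X + A * t\<^sup>2)"
   proof (rule mult_left_mono[OF _ C(1)])
    have "nrm (csc (of_real t) X + (be t - e II - csc (of_real t) X)) <= nrm (csc (of_real t) X) + nrm (be t - e II - csc (of_real t) X)"
     by (rule nrm_add)
    thus "nrm (be t - e II) <= t * nrm X + A * t\<^sup>2" using f(4)[of t] t by simp
   qed
   ultimately have "t * nrm (dr X) <= t * (C * nrm X + (C * A + B) * t)" by (simp add: algebra_simps power2_eq_square)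
   thus ?thesis using t by (simp add: mult_le_cancel_left_pos)
  qed
  show ?thesis
  proof (rule ccontr)
   assume n: "~ nrm (dr X) <= C * nrm X"
   define c where "c = nrm (dr X) - C * nrm X"
   \<comment> \<open>Chosen so that the remainder \<open>(C * A + B) * t\<close> is at most c /
     2.\<close>
   define t where "t = min (min a ep) (c / (2 * (C * A + B + 1)))"
   have CA: "C * A + B >= 0" using C f g by simp
   have c: "c > 0" using n by (simp add: c_def)
   have t: "0 < t" "t <= a" "t <= ep" using c f g CA by (auto simp: t_def)
   have "(C * A + B) * t <= (C * A + B + 1) * (c / (2 * (C * A + B + 1)))"
    using CA c t by (intro mult_mono) (auto simp: t_def)
   also have "... = c / 2" using CA by (simp add: field_simps)
   finally show False using key[OF t] c by (simp add: c_def)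
  qed
 qed
 thus ?thesis using C(1) by blast
qed

lemma KA_bracket: "X : KA N ==> Y : KA N ==> Y * X - X * Y : KA N"
 unfolding KA_def using LA_comm[of Y N X] by (auto simp: LA_def)

text \<open>The value of \<open>dr\<close> at the conjugate of X by a curve with tangent Y is
  expanded in t twice: with the commutator inside \<open>dr\<close>, and through
  \<open>dr_conj\<close> with the commutator of the images. By \<open>dr_bound\<close> the map
  \<open>dr\<close> keeps the remainder R of order t^2, so the linear terms agree.\<close>

lemma dr_bracket: assumes X: "X : KA N" and Y: "Y : KA N"
 shows "dr (Y * X - X * Y) = dr Y * dr X - dr X * dr Y"
proof -
 obtain ga where g: "!!t. ga t : GG N" "sm 2 (%t. ga t - e II - csc (of_real t) Y)"
   "sm 2 (%t. rh (ga t) - e DD - csc (of_real t) (dr Y))" using DR_dr[OF Y] unfolding DR_def by blast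
 have sg: "star (ga t) : GG N" for t using g(1) by (rule GG_star)
 have "sm 2 (%t. star (ga t - e II - csc (of_real t) Y))" using g(2) by (simp add: sm_def del: csc_simps)
 hence g': "sm 2 (%t. star (ga t) - e II - csc (of_real t) (- Y))" using KA_simps(3)[OF Y] by simp
 have g'': "sm 2 (%t. rh (star (ga t)) - e DD - csc (of_real t) (- dr Y))"
  using DR_any[OF DR_dr[OF KA_closed(4)[OF Y]] sg g'] dr_minus[OF Y] by simp
 define R where "R t = ga t * X * star (ga t) - X - csc (of_real t) (Y * X - X * Y)" for t
 have R: "sm 2 R" unfolding R_def
  using sm_conj_expand[OF finite_lessThan KA_simps(2)[OF X] KA_simps(2)[OF Y] GG_simps(2)[OF g(1)] GG_simps(2)[OF sg] sm_GG[OF sg] g(2)] g'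
  by (simp add: csc_distrib)
 have RK: "R t : KA N" for t unfolding R_def using g(1) X Y by (intro KA_closed KA_conj KA_bracket)
 have dR: "sm 2 (%t. dr (R t))"
 proof -
  obtain C where C: "C >= 0" "!!X. X : KA N ==> nrm (dr X) <= C * nrm X" using dr_bound by blast
  show ?thesis by (rule sm_dom[OF R C(1)]) (rule C(2)[OF RK])
 qed
 have S: "sm 2 (%t. rh (ga t) * dr X * rh (star (ga t)) - dr X - csc (of_real t) (dr Y * dr X - dr X * dr Y))"
  using sm_conj_expand[OF finite_lessThan dr_in[OF X] dr_in[OF Y] rho_in[OF g(1)] rho_in[OF sg] sm_rho[OF sg] g(3)] g''
  by (simp add: csc_distrib)
 have "rh (ga t) * dr X * rh (star (ga t)) = dr X + csc (of_real t) (dr (Y * X - X * Y)) + dr (R t)" for t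
 proof -
  have "rh (ga t) * dr X * rh (star (ga t)) = dr (ga t * X * star (ga t))" by (rule dr_conj[OF X g(1), symmetric])
  also have "ga t * X * star (ga t) = X + csc (of_real t) (Y * X - X * Y) + R t" by (simp add: R_def)
  also have "dr ... = dr X + csc (of_real t) (dr (Y * X - X * Y)) + dr (R t)"
   using X Y RK by (simp only: dr_add dr_scale KA_closed KA_bracket)
  finally show ?thesis .
 qed
 hence "sm 2 (%t. csc (of_real t) (dr (Y * X - X * Y) - (dr Y * dr X - dr X * dr Y)) + dr (R t))"
  using S by (simp add: csc_distrib algebra_simps)
 from sm_2_lin[OF this dR] show ?thesis by simp
qed

section \<open>Complex linear extension of the differential, through the decomposition M = X + i Y
  with X, Y skew-Hermitian\<close>

definition phi :: "fmat => fmat" where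
 "phi M = dr (csc (1/2) (M - star M)) + csc \<i> (dr (csc (- \<i> / 2) (M + star M)))"

lemma KA_parts: assumes "M : LA N" shows "csc (1/2) (M - star M) : KA N" "csc (- \<i> / 2) (M + star M) : KA N"
 using assms unfolding KA_def by (auto intro!: LA_closed simp: csc_distrib algebra_simps)

lemma LA_parts: "M = csc (1/2) (M - star M) + csc \<i> (csc (- \<i> / 2) (M + star M))"
 by (rule fmat_eqI) (simp add: field_simps)

lemma phi_KA: assumes "X : KA N" "Y : KA N" shows "phi (X + csc \<i> Y) = dr X + csc \<i> (dr Y)"
proof -
 have s: "star (X + csc \<i> Y) = - X + csc \<i> Y" using KA_simps(3)[OF assms(1)] KA_simps(3)[OF assms(2)] by (simp add: csc_distrib)
 have "csc (1/2) ((X + csc \<i> Y) - star (X + csc \<i> Y)) = X" unfolding s by (rule fmat_eqI) simp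
 moreover have "csc (- \<i> / 2) ((X + csc \<i> Y) + star (X + csc \<i> Y)) = Y" unfolding s by (rule fmat_eqI) simp
 ultimately show ?thesis by (simp add: phi_def)
qed

lemma LA_decomp: assumes "M : LA N" obtains X Y where "X : KA N" "Y : KA N" "M = X + csc \<i> Y" "phi M = dr X + csc \<i> (dr Y)"
 using that[OF KA_parts[OF assms] LA_parts] by (simp add: phi_def)

lemma phi_in: "M : LA N ==> phi M : msp DD DD"
 unfolding phi_def using KA_parts[of M] by (intro msp_closed dr_in)

lemma phi_add: assumes "M : LA N" "M' : LA N" shows "phi (M + M') = phi M + phi M'"
proof -
 obtain X Y where 1: "X : KA N" "Y : KA N" "M = X + csc \<i> Y" "phi M = dr X + csc \<i> (dr Y)" by (rule LA_decomp[OF assms(1)]) blast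
 obtain X' Y' where 2: "X' : KA N" "Y' : KA N" "M' = X' + csc \<i> Y'" "phi M' = dr X' + csc \<i> (dr Y')" by (rule LA_decomp[OF assms(2)]) blast
 have "M + M' = (X + X') + csc \<i> (Y + Y')" by (simp add: 1(3) 2(3) csc_distrib algebra_simps)
 hence "phi (M + M') = dr (X + X') + csc \<i> (dr (Y + Y'))" using 1 2 by (simp only: phi_KA KA_closed)
 also have "... = phi M + phi M'" using 1 2 by (simp add: dr_add csc_distrib algebra_simps)
 finally show ?thesis .
qed

lemma phi_csc: assumes "M : LA N" shows "phi (csc c M) = csc c (phi M)"
proof -
 obtain X Y where 1: "X : KA N" "Y : KA N" "M = X + csc \<i> Y" "phi M = dr X + csc \<i> (dr Y)" by (rule LA_decomp[OF assms]) blast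
 let ?a = "of_real (Re c) :: complex" and ?b = "of_real (Im c) :: complex"
 have eq: "csc c (A + csc \<i> B) = (csc ?a A - csc ?b B) + csc \<i> (csc ?b A + csc ?a B)" for A B
  by (rule fmat_eqI) (simp add: complex_eq_iff algebra_simps)
 have "phi (csc c M) = dr (csc ?a X - csc ?b Y) + csc \<i> (dr (csc ?b X + csc ?a Y))"
  unfolding 1(3) eq using 1 by (intro phi_KA KA_closed)
 also have "... = csc c (phi M)" unfolding 1(4) eq using 1 by (simp only: dr_add dr_diff dr_scale KA_closed)
 finally show ?thesis .
qed

lemma phi_conj: assumes "M : LA N" "k : GG N" shows "phi (k * M * star k) = rh k * phi M * rh (star k)"
proof -
 obtain X Y where 1: "X : KA N" "Y : KA N" "M = X + csc \<i> Y" "phi M = dr X + csc \<i> (dr Y)" by (rule LA_decomp[OF assms(1)]) blast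
 have "k * M * star k = k * X * star k + csc \<i> (k * Y * star k)" by (simp add: 1(3) algebra_simps)
 hence "phi (k * M * star k) = dr (k * X * star k) + csc \<i> (dr (k * Y * star k))" using 1 assms(2) by (simp only: phi_KA KA_conj)
 also have "... = rh k * phi M * rh (star k)" using 1 assms(2) by (simp only: dr_conj distrib_left distrib_right csc_mult)
 finally show ?thesis .
qed

lemma phi_bracket: assumes "M : LA N" "M' : LA N" shows "phi (M * M' - M' * M) = phi M * phi M' - phi M' * phi M"
proof -
 obtain X Y where 1: "X : KA N" "Y : KA N" "M = X + csc \<i> Y" "phi M = dr X + csc \<i> (dr Y)" by (rule LA_decomp[OF assms(1)]) blast
 obtain X' Y' where 2: "X' : KA N" "Y' : KA N" "M' = X' + csc \<i> Y'" "phi M' = dr X' + csc \<i> (dr Y')" by (rule LA_decomp[OF assms(2)]) blast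
 let ?c = "%A B. A * B - B * A"
 have eq: "?c (A + csc \<i> B) (A' + csc \<i> B') = (?c A A' - ?c B B') + csc \<i> (?c A B' + ?c B A')" for A B A' B'
  by (simp add: algebra_simps csc_distrib)
 have "phi (?c M M') = dr (?c X X' - ?c Y Y') + csc \<i> (dr (?c X Y' + ?c Y X'))"
  unfolding 1(3) 2(3) eq using 1 2 by (intro phi_KA KA_closed KA_bracket)
 also have "... = ?c (phi M) (phi M')" unfolding 1(4) 2(4) eq
  using 1 2 by (simp only: dr_add dr_diff KA_closed KA_bracket dr_bracket)
 finally show ?thesis .
qed

end

text \<open>On a stable subspace any function g of the eigenvalues may be applied to a sum of
  eigenvectors. Induction on the number of eigenvalues: A - c removes the eigenvalue c, and with the
  divided difference g' one has g(x) = g(c) + g'(x) (x - c).\<close>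

lemma eigen_components:
 assumes W: "csub W" and A: "!!w. w : W ==> A * w : W"
  and F: "finite F" "!!p. p : F ==> A * v p = csc (a p) (v p)" "sum v F : W"
 shows "(SUM p:F. csc (g (a p)) (v p)) : W" using F
proof (induction "card (a ` F)" arbitrary: F v g)
 case 0
 thus ?case using csubD(1)[OF W] by simp
next
 case (Suc n)
 then obtain c where c: "c : a ` F" by (metis card.empty ex_in_conv nat.distinct(1))
 define F' where "F' = {p\<in>F. a p ~= c}"
 define g' where "g' x = (g x - g c) / (x - c)" for x
 have F': "finite F'" "F' \<subseteq> F" using Suc.prems by (auto simp: F'_def)
 have "a ` F' = a ` F - {c}" by (auto simp: F'_def)
 hence "card (a ` F') = n" using Suc.hyps(2) c Suc.prems(1) by simp
 moreover have "A * csc (a p - c) (v p) = csc (a p) (csc (a p - c) (v p))" if "p : F'" for p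
  using Suc.prems(2)[of p] that F'(2) by (auto simp: mult.commute)
 moreover have "(SUM p:F'. csc (a p - c) (v p)) : W"
 proof -
  have "A * sum v F - csc c (sum v F) = (SUM p:F. csc (a p - c) (v p))"
   using Suc.prems(2) by (simp add: sum_distrib_left csc_sum csc_distrib sum_subtractf)
  also have "... = (SUM p:F'. csc (a p - c) (v p))"
   using Suc.prems(1) by (intro sum.mono_neutral_right) (auto simp: F'_def)
  finally show ?thesis using W A Suc.prems(3) by (metis csubD(3,4))
 qed
 ultimately have "(SUM p:F'. csc (g' (a p)) (csc (a p - c) (v p))) : W"
  using Suc.hyps(1)[of F' "%p. csc (a p - c) (v p)" g'] F'(1) by simp
 also have "(SUM p:F'. csc (g' (a p)) (csc (a p - c) (v p))) = (SUM p:F'. csc (g (a p) - g c) (v p))"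
  by (intro sum.cong) (auto simp: F'_def g'_def)
 also have "... = (SUM p:F. csc (g (a p) - g c) (v p))"
  using Suc.prems(1) by (intro sum.mono_neutral_left) (auto simp: F'_def)
 finally have 1: "(SUM p:F. csc (g (a p) - g c) (v p)) : W" .
 have "(SUM p:F. csc (g (a p)) (v p)) = (SUM p:F. csc (g (a p) - g c) (v p)) + csc (g c) (sum v F)"
  by (simp add: csc_sum sum.distrib[symmetric] csc_distrib)
 thus ?case using 1 Suc.prems(3) W by (simp add: csubD)
qed

context su_rep
begin

text \<open>An element of the group is a polynomial in its logarithm, because the latter acts
 diagonalizably.\<close>

lemma phi_stable_imp_rho_stable:
 assumes W: "csub W" "W \<subseteq> msp DD {0}" and st: "!!M w. M : LA N ==> w : W ==> phi M * w : W"
  and U: "U : GG N" and w: "w : W"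
 shows "rh U * w : W"
proof -
 obtain k u where k: "k : GG N" and u: "u : TT N" and Uk: "U = k * tor N u * star k" using GG_diag[OF U N0] by blast
 obtain h where h: "h : HH N" "tor N u = tor N (%i. exp (\<i> * of_real (1 * h i)))" using TT_log[OF N0 u] by blast
 define X where "X = k * dg II (%i. \<i> * of_real (h i)) * star k"
 have D: "dg II (%i. \<i> * of_real (h i)) : KA N"
  using h(1) by (auto simp: KA_def LA_def BD_closed ent_dg HH_def sum_distrib_left[symmetric] of_real_sum[symmetric] intro!: fmat_eqI simp del: of_real_sum)
 have X: "X : KA N" unfolding X_def by (rule KA_conj[OF k D])
 have drX: "dr X = rh k * dS h * rh (star k)" unfolding X_def by (intro dr_eq DR_conj DR_diag h k)
 have "phi X = dr X" using phi_KA[OF X KA_closed(5)] by (simp add: dr_0)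
 hence A: "!!w. w : W ==> dr X * w : W" using st KA_simps(4)[OF X] by metis
 define v where "v p = rh k * Q p * rh (star k) * w" for p
 note sk = GG_star[OF k]
 have wv: "w : msp DD {0}" using w W by auto
 have "sum v WS = rh k * sum Q WS * rh (star k) * w" unfolding v_def by (simp add: sum_distrib_left sum_distrib_right)
 also have "... = w" unfolding torus_decomp(5) mult_e[OF finite_lessThan rho_in[OF k]] rho_star(1)[OF k] by (rule e_mult[OF finite_lessThan wv])
 finally have sv: "sum v WS : W" using w by simp
 have kk: "rh (star k) * (rh k * Z) = Z" if "Z : msp DD {0}" for Z
  unfolding mult.assoc[symmetric] rho_star(2)[OF k] by (rule e_mult[OF finite_lessThan that])
 have kin: "Q p * (rh (star k) * w) : msp DD {0}" for p by (rule msp_mult[OF torus_decomp(3) msp_mult[OF rho_in[OF sk] wv]])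
 have SQ: "dS h * Q p = csc (\<i> * of_real (pr N p h)) (Q p)" if p: "p : WS" for p
 proof -
  have "dS h * Q p = (SUM q:WS. if q = p then csc (\<i> * of_real (pr N p h)) (Q p) else 0)"
   unfolding dS_def sum_distrib_right by (intro sum.cong refl) (use p in \<open>auto simp: torus_decomp(4)\<close>)
  thus ?thesis using p torus_decomp(1) by simp
 qed
 have "dr X * v p = csc (\<i> * of_real (pr N p h)) (v p)" if p: "p : WS" for p
 proof -
  have "dr X * v p = rh k * (dS h * (rh (star k) * (rh k * (Q p * (rh (star k) * w)))))" by (simp add: drX v_def mult.assoc)
  also have "... = rh k * ((dS h * Q p) * (rh (star k) * w))" by (simp only: kk[OF kin] mult.assoc)
  also have "... = csc (\<i> * of_real (pr N p h)) (v p)" unfolding SQ[OF p] by (simp add: v_def mult.assoc)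
  finally show ?thesis .
 qed
 from eigen_components[OF W(1) A torus_decomp(1) this sv, of exp]
 have "(SUM p:WS. csc (exp (\<i> * of_real (pr N p h))) (v p)) : W" .
 also have "(SUM p:WS. csc (exp (\<i> * of_real (pr N p h))) (v p)) = rh k * rh (tor N u) * rh (star k) * w"
  unfolding h(2) rho_tor[OF TT_exp[OF h(1), of 1]] chi_exp v_def by (simp add: sum_distrib_left sum_distrib_right mult.assoc)
 also have "... = rh U * w" unfolding Uk using k u sk by (simp add: rho_mult GG_mult tor_GG)
 finally show ?thesis .
qed

end

section \<open>Highest weights\<close>

definition Eu :: "nat => nat => fmat" where "Eu i j = mk {i} {j} (%_ _. 1)"

lemma ent_Eu: "ent (Eu i j) a b = (if a = i & b = j then 1 else 0)" by (auto simp: Eu_def ent_mk)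

lemma Eu_LA: "bd N i j ==> i ~= j ==> Eu i j : LA N" by (auto simp: LA_def BD_def ent_Eu)

text \<open>The action is abstract because it is used for a single representation and, in
  \<open>character_unique\<close>, for a pair of representations acting on pairs of vectors.\<close>

locale lie_act =
 fixes N :: nat and sc :: "complex => 'v::ab_group_add => 'v" and ac :: "fmat => 'v => 'v"
 assumes ac_add: "ac X (v + w) = ac X v + ac X w" and ac_sc: "ac X (sc c v) = sc c (ac X v)"
  and ac_addl: "X : LA N ==> Y : LA N ==> ac (X + Y) v = ac X v + ac Y v"
  and ac_scl: "X : LA N ==> ac (csc c X) v = sc c (ac X v)"
  and ac_br: "X : LA N ==> Y : LA N ==> ac (X * Y - Y * X) v = ac X (ac Y v) - ac Y (ac X v)"
  and sc0: "sc 0 v = 0"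
begin

inductive_set low :: "'v => 'v set" for u where
 base: "u : low u"
| step: "v : low u ==> bd N i j ==> j < i ==> ac (Eu i j) v : low u"

inductive_set SP :: "'v => 'v set" for u where
 gen: "v : low u ==> v : SP u"
| add: "v : SP u ==> w : SP u ==> v + w : SP u"
| scale: "v : SP u ==> sc c v : SP u"

lemma SP_0: "0 : SP u" using scale[OF gen[OF base], of 0] by (simp add: sc0)

lemma ac_0: "ac 0 v = 0" using ac_scl[of 0 0 v] sc0 LA_closed(6) by simp

lemma ac_sum: "finite F ==> (!!x. x : F ==> f x : LA N) ==> sum f F : LA N & ac (sum f F) v = (SUM x:F. ac (f x) v)"
 by (induction F rule: finite_induct) (auto simp: ac_0 ac_addl intro: LA_closed)

lemma SP_sum: "(!!x. x : F ==> f x : SP u) ==> sum f F : SP u"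
 by (induction F rule: infinite_finite_induct) (auto simp: SP_0 add)

lemma SP_low: "v : SP u ==> bd N i j ==> j < i ==> ac (Eu i j) v : SP u"
 by (induction rule: SP.induct) (auto simp: ac_add ac_sc intro: low.step SP.intros)

text \<open>For a lowering operator F, X F v = [X, F] v + F X v. Induction on the length of the word
  in lowering operators reduces everything to X u, where raising operators give 0 and diagonal
  matrices a multiple of u.\<close>

lemma SP_closed:
 assumes up: "!!i j. bd N i j ==> i < j ==> ac (Eu i j) u = 0"
  and dia: "!!f. dg {..<2*N} f : LA N ==> EX c. ac (dg {..<2*N} f) u = sc c u"
  and v: "v : SP u" and X: "X : LA N"
 shows "ac X v : SP u"
proof -
 have base: "ac X u : SP u" if X: "X : LA N" for X
 proof -
  define F where "F = {(i, j). bd N i j & i ~= j}"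
  have F: "finite F" by (rule finite_subset[of _ "{..<2*N} \<times> {..<2*N}"]) (auto simp: F_def bd_def)
  define O' where "O' = (\<Sum>(i, j)\<in>F. csc (ent X i j) (Eu i j))"
  have mem: "(case x of (i, j) => csc (ent X i j) (Eu i j)) : LA N" if "x : F" for x
   using that by (auto simp: F_def intro!: LA_closed Eu_LA)
  have O': "O' : LA N" "ac O' u = (SUM x:F. ac (case x of (i, j) => csc (ent X i j) (Eu i j)) u)"
   unfolding O'_def using ac_sum[OF F mem, of "%x. x"] ac_sum[OF F mem] by (auto simp: case_prod_unfold)
  have eq: "X - O' = dg {..<2*N} (%i. ent X i i)"
  proof (rule fmat_eqI)
   fix a b
   have "ent O' a b = (SUM x:F. if x = (a, b) then ent X a b else 0)"
    unfolding O'_def ent_sum by (intro sum.cong) (auto simp: ent_Eu split: if_splits)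
   also have "... = (if (a, b) : F then ent X a b else 0)" using F by simp
   finally have Oab: "ent O' a b = (if (a, b) : F then ent X a b else 0)" .
   have "ent X a b ~= 0 ==> bd N a b" using X by (auto simp: LA_def BD_def)
   thus "ent (X - O') a b = ent (dg {..<2*N} (%i. ent X i i)) a b"
    using Oab by (cases "ent X a b = 0") (auto simp: F_def ent_dg bd_def)
  qed
  have D: "dg {..<2*N} (%i. ent X i i) : LA N" unfolding eq[symmetric] using X O'(1) by (rule LA_closed)
  have "X = O' + dg {..<2*N} (%i. ent X i i)" unfolding eq[symmetric] by simp
  hence "ac X u = ac O' u + ac (dg {..<2*N} (%i. ent X i i)) u" using ac_addl[OF O'(1) D] by simp
  moreover have "ac O' u : SP u" unfolding O'(2)
  proof (intro SP_sum)
   fix x assume "x : F"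
   then obtain i j where x: "x = (i, j)" "bd N i j" "i ~= j" by (auto simp: F_def)
   show "ac (case x of (i, j) => csc (ent X i j) (Eu i j)) u : SP u"
   proof (cases "i < j")
    case True
    thus ?thesis using x up ac_scl[OF Eu_LA[OF x(2,3)]] scale[OF SP_0] by simp
   next
    case False
    hence "ac (Eu i j) u : SP u" using x by (intro SP_low gen low.base) auto
    thus ?thesis using x ac_scl[OF Eu_LA[OF x(2,3)]] scale by simp
   qed
  qed
  moreover have "ac (dg {..<2*N} (%i. ent X i i)) u : SP u"
   using dia[OF D] scale[OF gen[OF low.base]] by auto
  ultimately show ?thesis by (simp add: add)
 qed
 have low: "ALL X:LA N. ac X v : SP u" if "v : low u" for v using that
 proof (induction rule: low.induct)
  case base
  thus ?case using \<open>!!X. X : LA N ==> ac X u : SP u\<close> by blast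
 next
  case (step v i j)
  show ?case
  proof
   fix X assume X: "X : LA N"
   have E: "Eu i j : LA N" using step by (intro Eu_LA) auto
   have "ac X (ac (Eu i j) v) = ac (X * Eu i j - Eu i j * X) v + ac (Eu i j) (ac X v)"
    using ac_br[OF X E, of v] by simp
   moreover have "X * Eu i j - Eu i j * X : LA N" using X E by (intro LA_comm) (auto simp: LA_def)
   hence "ac (X * Eu i j - Eu i j * X) v : SP u" using step.IH by blast
   moreover have "ac (Eu i j) (ac X v) : SP u" using step X by (intro SP_low) auto
   ultimately show "ac X (ac (Eu i j) v) : SP u" by (simp add: add)
  qed
 qed
 show ?thesis using v
 proof (induction rule: SP.induct)
  case (gen v)
  thus ?case using low X by blast
 next
  case (add v w)
  thus ?case by (simp add: ac_add SP.add)
 next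
  case (scale v c)
  thus ?case by (simp add: ac_sc SP.scale)
 qed
qed

end

text \<open>Dynkin labels of the root with torus character \<open>u i * cnj (u j)\<close>: the
  coordinate i has label 1 at i + 1 and -1 at i.\<close>

definition rt :: "nat => nat => nat => int" where
 "rt i j k = of_bool (k = Suc i) - of_bool (k = i) - (of_bool (k = Suc j) - of_bool (k = j))"

text \<open>The number k (N - k), the coefficient of the k-th simple coroot in the sum of all
  positive coroots, on each of the two blocks. So \<open>ht\<close> pairs a weight with that sum and
  is twice the usual height on roots.\<close>

definition hc :: "nat => nat => int" where "hc N k = int (k mod N) * (int N - int (k mod N))"

definition ht :: "nat => (nat => int) => int" where "ht N p = (SUM k:KK N. p k * hc N k)"

text \<open>The dominance order for both factors at once; \<open>rt (l - 1) l\<close> is the l-th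
  simple root.\<close>

definition wle :: "nat => (nat => int) => (nat => int) => bool" where
 "wle N p q \<longleftrightarrow> (\<exists>c :: nat => nat. ALL k:KK N. q k - p k = (SUM l:KK N. int (c l) * rt (l - 1) l k))"

lemma chi_step: assumes u: "u : TT N" and i: "i < 2*N"
 shows "chi N (%k. of_bool (k = Suc i) - of_bool (k = i)) u = u i"
proof -
 have X1: "Xc u N = 1" "Xc u (2 * N) = 1" "Xc u 0 = 1"
  using u by (auto simp: Xc_def TT_def prod_split_N)
 have "chi N (%k. of_bool (k = Suc i) - of_bool (k = i)) u = (PROD k:KK N. cr k (Xc u k) i)"
  unfolding chi_def
 proof (intro prod.cong refl)
  fix k assume k: "k : KK N"
  hence "cmod (Xc u k) = 1" using Xc_unit[OF u, of k] by (auto simp: KK_def)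
  hence "Xc u k * cnj (Xc u k) = 1" by (simp add: complex_norm_square[symmetric])
  hence "inverse (Xc u k) = cnj (Xc u k)" by (rule inverse_unique)
  thus "Xc u k powi (of_bool (k = Suc i) - of_bool (k = i)) = cr k (Xc u k) i"
   using k by (auto simp: cr_def KK_def power_int_minus)
 qed
 thus ?thesis using cr_decomp[OF u i] by simp
qed

lemma chi_minus: assumes u: "u : TT N" shows "chi N (%k. - p k) u = cnj (chi N p u)"
proof -
 have "chi N (%k. - p k) u * chi N p u = 1" using chi_add[OF u, of "%k. - p k" p] by (simp add: chi_def)
 moreover have "cnj (chi N p u) * chi N p u = 1" using chi_unit[OF u, of p] by (simp add: mult.commute complex_norm_square[symmetric])
 ultimately show ?thesis by (metis mult_right_cancel mult_zero_right zero_neq_one)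
qed

lemma chi_rt: assumes u: "u : TT N" and i: "i < 2*N" "j < 2*N" shows "chi N (rt i j) u = u i * cnj (u j)"
proof -
 have "rt i j = (%k. (of_bool (k = Suc i) - of_bool (k = i)) + - (of_bool (k = Suc j) - of_bool (k = j)))"
  by (auto simp: rt_def)
 thus ?thesis by (simp only: chi_add[OF u] chi_minus[OF u] chi_step[OF u i(1)] chi_step[OF u i(2)])
qed

lemma chi_cr: assumes k: "k : KK N" and z: "cmod z = 1" shows "chi N p (cr k z) = z powi p k"
proof -
 have zz: "z * cnj z = 1" using z by (simp add: complex_norm_square[symmetric])
 have X: "Xc (cr k z) l = (if l = k then z else 1)" for l
 proof (cases "l < k")
  case True
  thus ?thesis unfolding Xc_def cr_def by (auto intro!: prod.neutral)
 next
  case False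
  have k1: "k = Suc (k - 1)" using k by (auto simp: KK_def)
  have 1: "(\<Prod>i<k. cr k z i) = z" by (subst k1, subst prod.lessThan_Suc) (auto simp: cr_def intro!: prod.neutral)
  show ?thesis
  proof (cases "l = k")
   case True
   thus ?thesis by (simp add: Xc_def 1)
  next
   case f: False
   have "(\<Prod>i<l. cr k z i) = (\<Prod>i<l. if i = k - 1 then z else if i = k then cnj z else 1)" by (simp add: cr_def)
   also have "... = z * cnj z" using f False k1 by (intro prod_two) auto
   finally show ?thesis using f by (simp add: Xc_def zz)
  qed
 qed
 have "chi N p (cr k z) = (PROD l:KK N. if l = k then z powi p k else 1)"
  unfolding chi_def X by (intro prod.cong) auto
 thus ?thesis using k by simp
qed

lemma chi_separates:
 assumes k: "k : KK N" and ne: "p k ~= q k"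
 shows "EX u:TT N. chi N p u ~= chi N q u"
proof -
 \<comment> \<open>With this z the two characters differ by the factor -1 on the k-th
   coroot.\<close>
 define z where "z = cis (pi / of_int (p k - q k))"
 have z: "cmod z = 1" by (simp add: z_def)
 have "z powi (p k - q k) = cis (of_int (p k - q k) * (pi / of_int (p k - q k)))" unfolding z_def by (rule cis_power_int)
 hence "z powi (p k - q k) = -1" using ne by simp
 moreover have z0: "z ~= 0" using z by auto
 moreover have "z powi (p k - q k) = z powi p k / z powi q k" using z0 by (intro power_int_diff) auto
 ultimately have "z powi p k ~= z powi q k" by (metis divide_self_if one_neq_neg_one power_int_eq_0_iff)
 thus ?thesis using chi_cr[OF k z] cr_TT[OF k z] by metis
qed

text \<open>The differences of consecutive values of \<open>hc\<close> are N - 1 - 2 (a mod N).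
  Since \<open>hc\<close> vanishes at 0, N and 2N, the labels of a root that fall outside
  \<open>KK N\<close> may be included in the sum.\<close>

lemma ht_rt: assumes N: "N > 0" and b: "bd N i j" shows "ht N (rt i j) = 2 * (int j - int i)"
proof -
 have h0: "hc N k = 0" if "k : {..2*N}" "k \<notin> KK N" for k
 proof -
  have "k = 0 \<or> k = N \<or> k = 2 * N" using that by (auto simp: KK_def)
  thus ?thesis by (auto simp: hc_def)
 qed
 have s: "(SUM k:KK N. of_bool (k = a) * hc N k) = hc N a" if "a <= 2*N" for a
 proof (cases "a : KK N")
  case True
  have "(SUM k:KK N. of_bool (k = a) * hc N k) = (SUM k:KK N. if k = a then hc N a else 0)" by (intro sum.cong) auto
  thus ?thesis using True by simp
 next
  case False
  hence "(SUM k:KK N. of_bool (k = a) * hc N k) = 0" by (intro sum.neutral) auto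
  thus ?thesis using h0[of a] False that by simp
 qed
 have ij: "i < 2*N" "j < 2*N" using b by (auto simp: bd_def)
 have "ht N (rt i j) = (SUM k:KK N. of_bool (k = Suc i) * hc N k) - (SUM k:KK N. of_bool (k = i) * hc N k)
   - ((SUM k:KK N. of_bool (k = Suc j) * hc N k) - (SUM k:KK N. of_bool (k = j) * hc N k))"
  unfolding ht_def rt_def by (simp add: left_diff_distrib sum_subtractf)
 also have "... = hc N (Suc i) - hc N i - (hc N (Suc j) - hc N j)" using ij by (simp only: s Suc_leI less_imp_le)
 finally have e: "ht N (rt i j) = hc N (Suc i) - hc N i - (hc N (Suc j) - hc N j)" .
 have d: "hc N (Suc a) - hc N a = int N - 1 - 2 * int (a mod N)" for a
 proof (cases "Suc (a mod N) = N")
  case True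
  hence "Suc a mod N = 0" by (simp add: mod_Suc)
  moreover define m where "m = a mod N"
  moreover have "int N = int m + 1" using True by (simp add: m_def)
  ultimately show ?thesis unfolding hc_def m_def[symmetric] by (simp add: algebra_simps)
 next
  case False
  hence "Suc a mod N = Suc (a mod N)" by (simp add: mod_Suc)
  thus ?thesis unfolding hc_def by (simp add: algebra_simps)
 qed
 have "int (j mod N) - int (i mod N) = int j - int i" using b by (auto simp: bd_def le_mod_geq)
 thus ?thesis unfolding e d by simp
qed

lemma wle_refl: "(!!k. k : KK N ==> p k = q k) ==> wle N p q"
 unfolding wle_def by (intro exI[of _ "%_. 0"]) simp

lemma wle_trans: assumes "wle N p q" "wle N q r" shows "wle N p r"
proof -
 obtain c c' where c: "ALL k:KK N. q k - p k = (SUM l:KK N. int (c l) * rt (l - 1) l k)"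
  "ALL k:KK N. r k - q k = (SUM l:KK N. int (c' l) * rt (l - 1) l k)" using assms unfolding wle_def by blast
 have "r k - p k = (SUM l:KK N. int (c l + c' l) * rt (l - 1) l k)" if "k : KK N" for k
 proof -
  have "r k - p k = (q k - p k) + (r k - q k)" by simp
  also have "... = (SUM l:KK N. int (c l + c' l) * rt (l - 1) l k)"
   unfolding c(1)[rule_format, OF that] c(2)[rule_format, OF that] by (simp only: distrib_right sum.distrib of_nat_add)
  finally show ?thesis .
 qed
 thus ?thesis unfolding wle_def by (intro exI[of _ "%l. c l + c' l"] ballI)
qed

lemma rt_telescope: "i <= j ==> rt i j k = (SUM l:{i<..j}. rt (l - 1) l k)"
proof (induction j rule: dec_induct)
 case base
 show ?case by (simp add: rt_def)
next
 case (step n)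
 have "{i<..Suc n} = insert (Suc n) {i<..n}" using step by auto
 thus ?case using step by (simp add: rt_def)
qed

lemma wle_lower: assumes b: "bd N i j" and ij: "j < i" shows "wle N (%k. p k + rt i j k) p"
 unfolding wle_def
\<comment> \<open>The negative of the root is the sum of the simple roots with index in
  {j<..i}.\<close>
proof (intro exI[of _ "%l. of_bool (l : {j<..i})"] ballI)
 fix k assume "k : KK N"
 have sub: "{j<..i} \<subseteq> KK N" using b ij by (auto simp: KK_def bd_def)
 have "(SUM l:KK N. int (of_bool (l : {j<..i})) * rt (l - 1) l k) = (SUM l:{j<..i}. rt (l - 1) l k)"
  using sub by (intro sum.mono_neutral_cong_right) auto
 also have "... = rt j i k" using ij by (intro rt_telescope[symmetric]) simp
 finally show "p k - (p k + rt i j k) = (SUM l:KK N. int (of_bool (l : {j<..i})) * rt (l - 1) l k)" by (simp add: rt_def)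
qed

lemma KK_bd: "l : KK N ==> bd N (l - 1) l" by (auto simp: KK_def bd_def)

lemma ht_diff: "ht N (%k. p k - q k) = ht N p - ht N q"
 unfolding ht_def by (simp add: left_diff_distrib sum_subtractf)

lemma wle_ht: assumes N: "N > 0" and c: "ALL k:KK N. q k - p k = (SUM l:KK N. int (c l) * rt (l - 1) l k)"
 shows "ht N q - ht N p = (SUM l:KK N. 2 * int (c l))"
proof -
 have "ht N q - ht N p = (SUM k:KK N. (SUM l:KK N. int (c l) * rt (l - 1) l k) * hc N k)"
 proof -
  have "ht N q - ht N p = ht N (%k. q k - p k)" by (rule ht_diff[symmetric])
  thus ?thesis unfolding ht_def using c by (simp only:) (intro sum.cong refl, simp only:)
 qed
 also have "... = (SUM k:KK N. SUM l:KK N. int (c l) * (rt (l - 1) l k * hc N k))"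
  by (simp add: sum_distrib_right mult.assoc)
 also have "... = (SUM l:KK N. int (c l) * ht N (rt (l - 1) l))"
  by (subst sum.swap) (simp add: ht_def sum_distrib_left)
 also have "... = (SUM l:KK N. 2 * int (c l))"
 proof (intro sum.cong refl)
  fix l assume l: "l : KK N"
  hence "l >= 1" by (auto simp: KK_def)
  thus "int (c l) * ht N (rt (l - 1) l) = 2 * int (c l)" using ht_rt[OF N KK_bd[OF l]] by simp
 qed
 finally show ?thesis .
qed

lemma wle_ht_le: "N > 0 ==> wle N p q ==> ht N p <= ht N q"
proof -
 assume N: "N > 0" and "wle N p q"
 then obtain c where c: "ALL k:KK N. q k - p k = (SUM l:KK N. int (c l) * rt (l - 1) l k)" unfolding wle_def by blast
 have "(SUM l:KK N. 2 * int (c l)) >= 0" by (intro sum_nonneg) auto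
 thus ?thesis using wle_ht[OF N c] by linarith
qed

text \<open>The two heights agree, and their difference is twice the sum of the coefficients of the
  simple roots, so all these natural numbers are 0.\<close>

lemma wle_antisym: assumes N: "N > 0" and "wle N p q" "wle N q p" and k: "k : KK N" shows "p k = q k"
proof -
 obtain c where c: "ALL k:KK N. q k - p k = (SUM l:KK N. int (c l) * rt (l - 1) l k)" using assms(2) unfolding wle_def by blast
 have "(SUM l:KK N. 2 * int (c l)) = 0" using wle_ht[OF N c] wle_ht_le[OF N assms(2)] wle_ht_le[OF N assms(3)] by simp
 hence "ALL l:KK N. 2 * int (c l) = 0" by (subst (asm) sum_nonneg_eq_0_iff) auto
 hence "(SUM l:KK N. int (c l) * rt (l - 1) l k) = 0" by (intro sum.neutral) auto
 thus ?thesis using c[rule_format, OF k] by linarith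
qed

section \<open>Weights and highest weight vectors of a representation\<close>

context su_rep
begin

text \<open>The zero vector counts as a weight vector of every weight here, so that operators map
  weight vectors to weight vectors without exceptions; \<open>hwv\<close> asks for a nonzero
  one.\<close>

definition wv :: "(nat => int) => fmat => bool" where
 "wv p v \<longleftrightarrow> v : msp DD {0} & (ALL u:TT N. rh (tor N u) * v = csc (chi N p u) v)"

definition hwv :: "(nat => int) => fmat => bool" where
 "hwv p v \<longleftrightarrow> wv p v & v ~= 0 & (ALL i j. bd N i j --> i < j --> phi (Eu i j) * v = 0)"

definition irr :: bool where
 "irr \<longleftrightarrow> d > 0 & (ALL W. csub W & W \<subseteq> msp DD {0} & (ALL U:GG N. ALL w:W. rh U * w : W) --> W = {0} \<or> W = msp DD {0})"

lemma wv_Q: assumes "p : WS" "w : msp DD {0}" shows "wv p (Q p * w)"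
 unfolding wv_def using assms torus_decomp(3) by (auto simp: mult.assoc[symmetric] torus_decomp(6))

lemma wv_in: "wv p v ==> v : msp DD {0}" by (simp add: wv_def)

lemma wv_cong: "(!!k. k : KK N ==> p k = q k) ==> wv p v = wv q v"
 unfolding wv_def using chi_cong[of N p q] by simp

text \<open>Applying \<open>Q p\<close> to the action of a torus element that separates p from q
  multiplies \<open>Q p * w\<close> by two different numbers.\<close>

lemma Q_other: assumes w: "wv q w" and p: "p : WS" and k: "k : KK N" "p k ~= q k" shows "Q p * w = 0"
proof -
 obtain u where u: "u : TT N" "chi N p u ~= chi N q u" using chi_separates[of k N p q, OF k] by blast
 have "csc (chi N p u) (Q p * w) = Q p * rh (tor N u) * w" using torus_decomp(7)[OF u(1) p] by simp
 also have "... = csc (chi N q u) (Q p * w)" using w u(1) by (simp add: wv_def mult.assoc)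
 finally have "csc (chi N p u - chi N q u) (Q p * w) = 0" by (simp add: csc_distrib)
 hence "csc (1 / (chi N p u - chi N q u)) (csc (chi N p u - chi N q u) (Q p * w)) = 0" by simp
 thus ?thesis using u(2) by simp
qed

lemma sum_Q: assumes "w : msp DD {0}" shows "(SUM p:WS. Q p * w) = w"
 unfolding sum_distrib_right[symmetric] torus_decomp(5) by (rule e_mult[OF finite_lessThan assms])

lemma wv_WS: assumes w: "wv q w" "w ~= 0" shows "EX p:WS. (ALL k:KK N. p k = q k) & Q p * w ~= 0"
proof (rule ccontr)
 assume "~ ?thesis"
 hence "Q p * w = 0" if "p : WS" for p using Q_other[OF w(1) that] that by blast
 thus False using sum_Q[OF wv_in[OF w(1)]] w(2) by simp
qed

lemma Q_same: assumes w: "wv q w" and p: "p : WS" "!!k. k : KK N ==> p k = q k" shows "Q p * w = w"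
proof -
 have "Q p' * w = (if p' = p then Q p * w else 0)" if p': "p' : WS" for p'
 proof (cases "p' = p")
  case False
  then obtain k where k: "p' k ~= p k" by blast
  hence "k : KK N" using torus_decomp(2)[OF p'] torus_decomp(2)[OF p(1)] by metis
  thus ?thesis using Q_other[OF w p', of k] k p(2) False by auto
 qed simp
 hence "(SUM p':WS. Q p' * w) = (SUM p':WS. if p' = p then Q p * w else 0)" by (rule sum.cong[OF refl])
 thus ?thesis using sum_Q[OF wv_in[OF w]] p(1) torus_decomp(1) by simp
qed

text \<open>Conjugation by a torus element multiplies the matrix unit by the character of its
  root.\<close>

lemma phi_wv: assumes b: "bd N i j" "i ~= j" and v: "wv p v" shows "wv (%k. p k + rt i j k) (phi (Eu i j) * v)"
 unfolding wv_def
proof (intro conjI ballI)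
 have E: "Eu i j : LA N" by (rule Eu_LA[OF b])
 show "phi (Eu i j) * v : msp DD {0}" by (rule msp_mult[OF phi_in[OF E] wv_in[OF v]])
 fix u assume u: "u : TT N"
 have ij: "i < 2*N" "j < 2*N" using b by (auto simp: bd_def)
 note t = tor_GG[OF u]
 have tE: "tor N u * Eu i j * star (tor N u) = csc (u i * cnj (u j)) (Eu i j)"
 proof (rule fmat_eqI)
  fix a b
  have m: "Eu i j : msp II II" using ij by (auto simp: msp_def ent_Eu split: if_splits)
  have l: "tor N u * Eu i j = csc (u i) (Eu i j)"
   by (rule fmat_eqI) (subst ent_mult[of "{i}"], use ij in \<open>auto simp: ent_Eu ent_dg split: if_splits\<close>)
  have r: "Eu i j * star (tor N u) = csc (cnj (u j)) (Eu i j)"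
   by (rule fmat_eqI) (subst ent_mult[of "{j}"], use ij in \<open>auto simp: ent_Eu ent_dg split: if_splits\<close>)
  show "ent (tor N u * Eu i j * star (tor N u)) a b = ent (csc (u i * cnj (u j)) (Eu i j)) a b"
   unfolding l csc_mult r by simp
 qed
 have "rh (tor N u) * (phi (Eu i j) * v) = rh (tor N u) * phi (Eu i j) * (rh (star (tor N u)) * rh (tor N u)) * v"
  unfolding rho_star(2)[OF t] mult.assoc e_mult[OF finite_lessThan wv_in[OF v]] ..
 also have "... = phi (tor N u * Eu i j * star (tor N u)) * (rh (tor N u) * v)"
  unfolding phi_conj[OF E t] by (simp only: mult.assoc)
 also have "... = csc (chi N (%k. p k + rt i j k) u) (phi (Eu i j) * v)"
  unfolding tE phi_csc[OF E] using v u by (simp add: wv_def chi_add[OF u] chi_rt[OF u ij] mult.commute)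
 finally show "rh (tor N u) * (phi (Eu i j) * v) = csc (chi N (%k. p k + rt i j k) u) (phi (Eu i j) * v)" .
qed

lemma dS_wv: assumes v: "wv p v" shows "dS h * v = csc (\<i> * of_real (pr N p h)) v"
proof -
 have "dS h * v = (SUM q:WS. csc (\<i> * of_real (pr N p h)) (Q q * v))"
  unfolding dS_def sum_distrib_right
 proof (intro sum.cong refl)
  fix q assume q: "q : WS"
  show "csc (\<i> * of_real (pr N q h)) (Q q) * v = csc (\<i> * of_real (pr N p h)) (Q q * v)"
  proof (cases "ALL k:KK N. q k = p k")
   case True
   hence "pr N q h = pr N p h" by (simp add: pr_def)
   thus ?thesis by simp
  next
   case False
   hence "Q q * v = 0" using Q_other[OF v q] by blast
   thus ?thesis by simp
  qed
 qed
 thus ?thesis using sum_Q[OF wv_in[OF v]] by (simp add: csc_sum[symmetric])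
qed

text \<open>The scalar depends on the weight only, so it is the same in every representation.\<close>

definition dwt :: "(nat => int) => (nat => complex) => complex" where
 "dwt p f = \<i> * of_real (pr N p (%i. Im (f i))) + \<i> * (\<i> * of_real (pr N p (%i. - Re (f i))))"

lemma phi_diag_scalar: assumes f: "dg II f : LA N" and v: "wv p v" shows "phi (dg II f) * v = csc (dwt p f) v"
proof -
 have r: "dr (dg II (%i. \<i> * of_real (h i))) * v = csc (\<i> * of_real (pr N p h)) v" if "h : HH N" for h
  using dr_eq[OF DR_diag[OF that]] dS_wv[OF v, of h] by simp
 have H: "(%i. Im (f i)) : HH N" "(%i. - Re (f i)) : HH N"
  using f by (auto simp: HH_def LA_def ent_dg sum_negf complex_eq_iff)
 have e1: "csc (1/2) (dg II f - star (dg II f)) = dg II (%i. \<i> * of_real (Im (f i)))"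
  by (rule fmat_eqI) (auto simp: ent_dg complex_eq_iff)
 have e2: "csc (- \<i> / 2) (dg II f + star (dg II f)) = dg II (%i. \<i> * of_real (- Re (f i)))"
  by (rule fmat_eqI) (auto simp: ent_dg complex_eq_iff)
 show ?thesis
  unfolding phi_def e1 e2 dwt_def by (simp only: distrib_right csc_mult r[OF H(1)] r[OF H(2)] csc_distrib csc_simps)
qed

lemma phi_diag_wv: "dg II f : LA N ==> wv p v ==> EX c. phi (dg II f) * v = csc c v"
 using phi_diag_scalar by blast

lemma lie_act: "lie_act N csc (%X v. phi X * v)"
 by unfold_locales (simp_all add: distrib_left phi_add distrib_right phi_csc phi_bracket left_diff_distrib mult.assoc)

abbreviation "spn == lie_act.SP N csc (%X v. phi X * v)"

lemma spn_sub: assumes "u : msp DD {0}" shows "spn u \<subseteq> msp DD {0}" "csub (spn u)"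
proof -
 interpret lie_act N csc "%X v. phi X * v" by (rule lie_act)
 have low: "v : msp DD {0}" if "v : low u" for v using that
 proof (induction rule: low.induct)
  case (step v i j)
  thus ?case using msp_mult[OF phi_in[OF Eu_LA] step.IH] by auto
 qed (rule assms)
 have "v : msp DD {0}" if "v : SP u" for v
  using that by (induction rule: SP.induct) (auto intro: low)
 thus "SP u \<subseteq> msp DD {0}" by blast
 show "csub (SP u)" unfolding csub_def by (auto intro: SP_0 SP.intros)
qed

text \<open>The span of the lowered vectors is stable under the Lie algebra, hence under the group,
  and it contains u.\<close>

lemma spn_all: assumes irr and h: "hwv p u" shows "spn u = msp DD {0}"
proof -
 interpret lie_act N csc "%X v. phi X * v" by (rule lie_act)
 have u: "wv p u" "u ~= 0" "u : msp DD {0}" using h wv_in by (auto simp: hwv_def)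
 have cl: "phi X * v : SP u" if "X : LA N" "v : SP u" for X v
  by (rule SP_closed[OF _ _ that(2,1)]) (use h phi_diag_wv[OF _ u(1)] in \<open>auto simp: hwv_def\<close>)
 have "rh U * w : SP u" if "U : GG N" "w : SP u" for U w
  by (rule phi_stable_imp_rho_stable[OF spn_sub(2,1)[OF u(3)] cl that])
 hence "SP u = {0} \<or> SP u = msp DD {0}" using \<open>irr\<close> spn_sub[OF u(3)] unfolding irr_def by blast
 moreover have "u : SP u" by (intro SP.gen low.base)
 ultimately show ?thesis using u(2) by blast
qed

lemma low_wv: assumes u: "wv p u" and v: "v : lie_act.low N (%X v. phi X * v) u"
 shows "EX q. wv q v & wle N q p & (v ~= u --> ht N q < ht N p)"
proof -
 interpret lie_act N csc "%X v. phi X * v" by (rule lie_act)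
 show ?thesis using v
 proof (induction rule: low.induct)
  case base
  thus ?case using u wle_refl by blast
 next
  case (step v i j)
  then obtain q where q: "wv q v" "wle N q p" by blast
  let ?q = "%k. q k + rt i j k"
  have 1: "wv ?q (phi (Eu i j) * v)" using step q by (intro phi_wv) auto
  have 2: "wle N ?q q" using step by (intro wle_lower) auto
  have "ht N ?q = ht N q + ht N (rt i j)" by (simp add: ht_def distrib_right sum.distrib)
  hence "ht N ?q < ht N q" using ht_rt[OF N0 step.hyps(2)] step.hyps(3) by simp
  thus ?case using 1 wle_trans[OF 2 q(2)] wle_ht_le[OF N0 q(2)] by (intro exI[of _ ?q]) auto
 qed
qed

text \<open>Every vector is a combination of lowered vectors. If its projection to the weight q is
  nonzero, then one of these has weight q, and lowering only subtracts simple roots.\<close>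

lemma irr_weights: assumes irr and h: "hwv p u" and w: "wv q w" "w ~= 0" shows "wle N q p"
proof -
 interpret lie_act N csc "%X v. phi X * v" by (rule lie_act)
 have u: "wv p u" using h by (simp add: hwv_def)
 obtain q' where q': "q' : WS" "ALL k:KK N. q' k = q k" "Q q' * w ~= 0" using wv_WS[OF w] by blast
 have "Q q' * v ~= 0 --> wle N q' p" if "v : SP u" for v using that
 proof (induction rule: SP.induct)
  case (gen v)
  then obtain r where r: "wv r v" "wle N r p" using low_wv[OF u] by blast
  show ?case
  proof
   assume "Q q' * v ~= 0"
   hence "ALL k:KK N. q' k = r k" using Q_other[OF r(1) q'(1)] by blast
   thus "wle N q' p" using r(2) wle_trans[OF wle_refl] by blast
  qed
 qed (auto simp: distrib_left)
 moreover have "w : SP u" using spn_all[OF assms(1) h] wv_in[OF w(1)] by simp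
 ultimately have "wle N q' p" using q'(3) by blast
 thus ?thesis using q'(2) wle_trans[OF wle_refl[of N q q']] by simp
qed

text \<open>Among the nonzero weight spaces take one of greatest \<open>ht\<close>; a raising
  operator would lead to a greater one.\<close>

lemma hwv_exists: assumes d: "d > 0" shows "EX p:WS. EX u. hwv p u"
proof -
 define S where "S = {p\<in>WS. Q p ~= 0}"
 have S: "finite S" using torus_decomp(1) by (simp add: S_def)
 have "ent (e DD) 0 0 ~= 0" using d by (simp add: ent_dg)
 hence "sum Q WS ~= 0" unfolding torus_decomp(5) by auto
 hence "S ~= {}" unfolding S_def using sum.neutral[of WS Q] by blast
 hence "Max (ht N ` S) : ht N ` S" using S by (intro Max_in) auto
 then obtain p where p: "p : S" "ht N p = Max (ht N ` S)" by auto
 have pmax: "ht N q <= ht N p" if "q : S" for q unfolding p(2) using S that by (intro Max_ge) auto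
 have p': "p : WS" "Q p ~= 0" using p(1) by (auto simp: S_def)
 obtain w where w: "w : msp DD {0}" "Q p * w ~= 0" using mat_ext_vec[OF torus_decomp(3)[of p]] p'(2) by blast
 have v: "wv p (Q p * w)" by (rule wv_Q[OF p'(1) w(1)])
 have "phi (Eu i j) * (Q p * w) = 0" if "bd N i j" "i < j" for i j
 proof (rule ccontr)
  assume n: "phi (Eu i j) * (Q p * w) ~= 0"
  have 1: "wv (%k. p k + rt i j k) (phi (Eu i j) * (Q p * w))" using that v by (intro phi_wv) auto
  obtain q where q: "q : WS" "ALL k:KK N. q k = p k + rt i j k" "Q q * (phi (Eu i j) * (Q p * w)) ~= 0" using wv_WS[OF 1 n] by blast
  have "q : S" using q by (auto simp: S_def)
  hence "ht N q <= ht N p" by (rule pmax)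
  moreover have "ht N q = ht N p + ht N (rt i j)" using q(2) by (simp add: ht_def distrib_right sum.distrib)
  ultimately show False using ht_rt[OF N0 that(1)] that(2) by simp
 qed
 thus ?thesis using v w(2) p'(1) unfolding hwv_def by blast
qed

end

section \<open>Equal highest weights give equal characters\<close>

lemma relation_matrix:
 assumes ex: "!!v. v : msp {..<d} {0} ==> EX y:msp {..<d'} {0}. M v y"
  and add: "!!v v' y y'. M v y ==> M v' y' ==> M (v + v') (y + y')" and sc: "!!c v y. M v y ==> M (csc c v) (csc c y)"
 shows "EX T:msp {..<d'} {..<d}. ALL v:msp {..<d} {0}. M v (T * v)"
proof -
 let ?E = "%j. mk {j} {0} (%_ _. 1)"
 have "EX y:msp {..<d'} {0}. M (?E j) y" if "j < d" for j using that by (intro ex msp_mono[OF msp_mk]) auto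
 then obtain f where f: "!!j. j < d ==> f j : msp {..<d'} {0} & M (?E j) (f j)" by metis
 define T where "T = mk {..<d'} {..<d} (%i j. ent (f j) i 0)"
 have T: "T : msp {..<d'} {..<d}" by (simp add: T_def)
 have "M v (T * v)" if v: "v : msp {..<d} {0}" for v
 proof -
  have z: "M 0 0" using ex[of 0] sc[of 0 _ 0] by auto
  have "M (SUM j:F. csc (ent v j 0) (?E j)) (SUM j:F. csc (ent v j 0) (f j))" if "finite F" "F \<subseteq> {..<d}" for F
   using that by (induction F rule: finite_induct) (auto intro!: add sc z simp: f)
  hence "M (\<Sum>j<d. csc (ent v j 0) (?E j)) (\<Sum>j<d. csc (ent v j 0) (f j))" by simp
  moreover have "(\<Sum>j<d. csc (ent v j 0) (?E j)) = v"
  proof (rule fmat_eqI)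
   fix i j
   have "ent (\<Sum>j<d. csc (ent v j 0) (?E j)) i j = (\<Sum>l<d. if l = i then (if j = 0 then ent v i 0 else 0) else 0)"
    unfolding ent_sum by (intro sum.cong) (auto simp: ent_mk)
   thus "ent (\<Sum>j<d. csc (ent v j 0) (?E j)) i j = ent v i j" using v by (auto simp: msp_def)
  qed
  moreover have "T * v = (\<Sum>j<d. csc (ent v j 0) (f j))"
  proof (rule fmat_eqI)
   fix a b
   have "ent (T * v) a b = (\<Sum>j<d. ent T a j * ent v j b)" using T v by (intro ent_mult_msp) auto
   also have "... = (\<Sum>j<d. ent v j 0 * ent (f j) a b)"
   proof (rule sum.cong[OF refl])
    fix j assume "j : {..<d}"
    hence "f j : msp {..<d'} {0}" "j < d" using f by auto
    thus "ent T a j * ent v j b = ent v j 0 * ent (f j) a b"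
     using mspD0[of "f j" "{..<d'}" "{0}" a] mspD0[OF v, of j b] by (cases "a < d'"; cases "b = 0") (auto simp: T_def ent_mk)
   qed
   finally show "ent (T * v) a b = ent (\<Sum>j<d. csc (ent v j 0) (f j)) a b" by (simp add: ent_sum)
  qed
  ultimately show ?thesis by simp
 qed
 thus ?thesis using T by blast
qed

text \<open>Let \<open>?M\<close> be the module generated by (v0, v0'). Its weight component at p
  consists of multiples of (v0, v0') only, so (0, v0') is not in it and \<open>?M\<close> meets the
  second factor in a proper submodule, which is 0. As \<open>?M\<close> projects onto the first
  space, it is the graph of a linear map T commuting with both actions, and irreducibility makes T
  bijective.\<close>

theorem character_unique:
 assumes R: "su_rep N d rh" and R': "su_rep N d' rh'"
  and irr: "su_rep.irr N d rh" and irr': "su_rep.irr N d' rh'"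
  and h: "su_rep.hwv N d rh p v0" and h': "su_rep.hwv N d' rh' p v0'" and u: "u : TT N"
 shows "tr (rh (tor N u)) = tr (rh' (tor N u))"
proof -
 interpret R: su_rep N d rh by (rule R)
 interpret R': su_rep N d' rh' by (rule R')
 define sc where "sc c x = (csc c (fst x), csc c (snd x))" for c and x :: "fmat \<times> fmat"
 define ac where "ac X x = (R.phi X * fst x, R'.phi X * snd x)" for X and x :: "fmat \<times> fmat"
 interpret P: lie_act N sc ac
  by unfold_locales (auto simp: sc_def ac_def distrib_left R.phi_add R'.phi_add distrib_right R.phi_csc R'.phi_csc
    R.phi_bracket R'.phi_bracket left_diff_distrib mult.assoc zero_prod_def)
 have w: "R.wv p v0" "R'.wv p v0'" "v0 ~= 0" "v0' ~= 0" using h h' by (auto simp: R.hwv_def R'.hwv_def)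
 let ?M = "P.SP (v0, v0')"
 have cl: "ac X x : ?M" if "X : LA N" "x : ?M" for X x
 proof (rule P.SP_closed[OF _ _ that(2,1)])
  show "bd N i j ==> i < j ==> ac (Eu i j) (v0, v0') = 0" for i j
   using h h' by (auto simp: ac_def R.hwv_def R'.hwv_def zero_prod_def)
  fix f assume f: "dg {..<2*N} f : LA N"
  show "EX c. ac (dg {..<2*N} f) (v0, v0') = sc c (v0, v0')"
   using R.phi_diag_scalar[OF f w(1)] R'.phi_diag_scalar[OF f w(2)] by (auto simp: ac_def sc_def R.dwt_def R'.dwt_def)
 qed
 \<comment> \<open>Both components of a lowered pair have the same weight, and its \<open>ht\<close>
   drops strictly except for the generator itself.\<close>
 have low: "EX q. R.wv q (fst x) & R'.wv q (snd x) & (x = (v0, v0') \<or> ht N q < ht N p)" if "x : P.low (v0, v0')" for x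
  using that
 proof (induction rule: P.low.induct)
  case base
  thus ?case using w by auto
 next
  case (step x i j)
  then obtain q where q: "R.wv q (fst x)" "R'.wv q (snd x)" "x = (v0, v0') \<or> ht N q < ht N p" by blast
  let ?q = "%k. q k + rt i j k"
  have 1: "R.wv ?q (fst (ac (Eu i j) x))" "R'.wv ?q (snd (ac (Eu i j) x))"
   using step q by (auto simp: ac_def intro!: R.phi_wv R'.phi_wv)
  have "ht N ?q = ht N q + ht N (rt i j)" by (simp add: ht_def distrib_right sum.distrib)
  hence 2: "ht N ?q < ht N q" using ht_rt[OF R.N0 step.hyps(2)] step.hyps(3) by simp
  have "ht N q <= ht N p"
  proof (cases "x = (v0, v0')")
   case True
   obtain b where b: "b : R.WS" "ALL k:KK N. b k = q k" "R.Q b * v0 ~= 0"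
    using R.wv_WS[of q v0] q(1) True w(3) by auto
   have "q k = p k" if "k : KK N" for k using R.Q_other[OF w(1) b(1) that] b that by force
   thus ?thesis by (simp add: ht_def)
  qed (use q(3) in auto)
  thus ?case using 1 2 by (intro exI[of _ ?q]) auto
 qed
 obtain a where a: "a : R.WS" "ALL k:KK N. a k = p k" using R.wv_WS[OF w(1,3)] by blast
 obtain a' where a': "a' : R'.WS" "ALL k:KK N. a' k = p k" using R'.wv_WS[OF w(2,4)] by blast
 \<comment> \<open>On lowered pairs other than the generator both projections vanish; on the
   generator both act as 1, which forces the common scalar c.\<close>
 have pr: "EX c. R.Q a * fst x = csc c v0 & R'.Q a' * snd x = csc c v0'" if "x : ?M" for x
  using that
 proof (induction rule: P.SP.induct)
  case (gen x)
  then obtain q where q: "R.wv q (fst x)" "R'.wv q (snd x)" "x = (v0, v0') \<or> ht N q < ht N p" using low by blast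
  show ?case
  proof (cases "x = (v0, v0')")
   case True
   have "R.Q a * v0 = csc 1 v0" "R'.Q a' * v0' = csc 1 v0'"
    using R.Q_same[OF w(1) a(1)] R'.Q_same[OF w(2) a'(1)] a(2) a'(2) by auto
   thus ?thesis using True by (intro exI[of _ 1]) auto
  next
   case False
   hence lt: "ht N q < ht N p" using q by blast
   have "EX k:KK N. q k ~= p k"
   proof (rule ccontr)
    assume "~ ?thesis"
    hence "ht N q = ht N p" by (auto simp: ht_def intro: sum.cong)
    thus False using lt by simp
   qed
   then obtain k where k: "k : KK N" "q k ~= p k" by blast
   have "R.Q a * fst x = csc 0 v0" using R.Q_other[OF q(1) a(1) k(1)] k a(2) by auto
   moreover have "R'.Q a' * snd x = csc 0 v0'" using R'.Q_other[OF q(2) a'(1) k(1)] k a'(2) by auto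
   ultimately show ?thesis by blast
  qed
 next
  case (add x y)
  then obtain b c where "R.Q a * fst x = csc b v0" "R'.Q a' * snd x = csc b v0'"
   "R.Q a * fst y = csc c v0" "R'.Q a' * snd y = csc c v0'" by blast
  hence "R.Q a * fst (x + y) = csc (b + c) v0" "R'.Q a' * snd (x + y) = csc (b + c) v0'"
   by (simp_all add: distrib_left csc_distrib)
  thus ?case by blast
 next
  case (scale x b)
  then obtain c where "R.Q a * fst x = csc c v0" "R'.Q a' * snd x = csc c v0'" by blast
  hence "R.Q a * fst (sc b x) = csc (b * c) v0" "R'.Q a' * snd (sc b x) = csc (b * c) v0'" by (simp_all add: sc_def)
  thus ?case by blast
 qed
 have Madd: "x + y : ?M" if "x : ?M" "y : ?M" for x y using that by (rule P.SP.add)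
 have Msc: "(csc c (fst x), csc c (snd x)) : ?M" if "x : ?M" for c x using P.SP.scale[OF that, of c] by (simp add: sc_def)
 have M0: "(0, 0) : ?M" using P.SP_0 by (simp add: zero_prod_def)
 have Mu: "(v0, v0') : ?M" by (intro P.SP.gen P.low.base)
 have Min: "fst x : msp {..<d} {0} & snd x : msp {..<d'} {0}" if "x : ?M" for x using that
 proof (induction rule: P.SP.induct)
  case (gen x)
  thus ?case using low R.wv_in R'.wv_in by blast
 qed (auto simp: sc_def)
 have tors: "(rh (tor N u) * fst x, rh' (tor N u) * snd x) : ?M" if "x : ?M" for x using that
 proof (induction rule: P.SP.induct)
  case (gen x)
  then obtain q where "R.wv q (fst x)" "R'.wv q (snd x)" using low by blast
  thus ?case using u Msc[OF P.SP.gen[OF gen], of "chi N q u"] by (simp add: R.wv_def R'.wv_def)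
 next
  case (add x y)
  thus ?case using Madd[OF add.IH] by (simp add: distrib_left)
 next
  case (scale x b)
  have "fst (sc b x) = csc b (fst x)" "snd (sc b x) = csc b (snd x)" by (simp_all add: sc_def)
  thus ?case using Msc[OF scale.IH, of b] by simp
 qed
 have k2: "v = 0" if "(0, v) : ?M" for v
 proof -
  let ?K = "{v. (0, v) : ?M}"
  have K: "csub ?K" unfolding csub_def using M0 Madd[of "(0, _)" "(0, _)"] Msc[of "(0, _)"] by auto
  have K2: "?K \<subseteq> msp {..<d'} {0}" using Min by fastforce
  have "R'.phi X * y : ?K" if "X : LA N" "y : ?K" for X y using cl[of X "(0, y)"] that by (simp add: ac_def)
  hence "rh' U * y : ?K" if "U : GG N" "y : ?K" for U y using R'.phi_stable_imp_rho_stable[OF K K2 _ that] by blast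
  hence "?K = {0} \<or> ?K = msp {..<d'} {0}" using irr' K K2 unfolding R'.irr_def by blast
  moreover have "v0' \<notin> ?K"
  proof
   assume "v0' : ?K"
   then obtain c where "0 = csc c v0" "R'.Q a' * v0' = csc c v0'" using pr[of "(0, v0')"] by auto
   moreover have "R'.Q a' * v0' = v0'" using R'.Q_same[OF w(2) a'(1)] a'(2) by auto
   ultimately have "c = 0" using w(3) csc_eq_0 by metis
   thus False using \<open>R'.Q a' * v0' = csc c v0'\<close> \<open>R'.Q a' * v0' = v0'\<close> w(4) by simp
  qed
  ultimately have "?K = {0}" using R'.wv_in[OF w(2)] by blast
  thus ?thesis using that by blast
 qed
 have ex1: "EX y. (v, y) : ?M" if "v : msp {..<d} {0}" for v
 proof -
  let ?K = "fst ` ?M"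
  have K: "csub ?K" unfolding csub_def
  proof (intro conjI ballI allI)
   show "0 : ?K" using M0 by force
   fix x assume "x : ?K" then obtain x' where x: "(x, x') : ?M" by force
   show "csc c x : ?K" for c using Msc[OF x, of c] by force
   fix y assume "y : ?K" then obtain y' where y: "(y, y') : ?M" by force
   show "x + y : ?K" using Madd[OF x y] by force
  qed
  have K2: "?K \<subseteq> msp {..<d} {0}" using Min by blast
  have st: "R.phi X * y : ?K" if X: "X : LA N" and y: "y : ?K" for X y
  proof -
   obtain y' where y: "(y, y') : ?M" using y by force
   thus ?thesis using cl[OF X] by (force simp: ac_def)
  qed
  have "rh U * y : ?K" if "U : GG N" "y : ?K" for U y using R.phi_stable_imp_rho_stable[OF K K2 st that] .
  hence "?K = {0} \<or> ?K = msp {..<d} {0}" using irr K K2 unfolding R.irr_def by blast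
  moreover have "v0 : ?K" using Mu by force
  ultimately have "?K = msp {..<d} {0}" using w(3) by blast
  thus ?thesis using that by force
 qed
 have diff: "y = y'" if "(v, y) : ?M" "(v, y') : ?M" for v y y'
 proof -
  have "(0, y - y') : ?M" using Madd[OF that(1) Msc[OF that(2), of "-1"]] by simp
  thus ?thesis using k2 by fastforce
 qed
 have "EX T:msp {..<d'} {..<d}. ALL v:msp {..<d} {0}. (v, T * v) : ?M"
 proof (rule relation_matrix)
  show "EX y:msp {..<d'} {0}. (v, y) : ?M" if v: "v : msp {..<d} {0}" for v using ex1[OF v] Min by fastforce
 qed (use Madd Msc in force)+
 then obtain T where T: "T : msp {..<d'} {..<d}" and TM: "!!v. v : msp {..<d} {0} ==> (v, T * v) : ?M" by blast
 have Tv: "T * v : msp {..<d'} {0}" if "v : msp {..<d} {0}" for v using T that by (rule msp_mult)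
 have v0: "v0 : msp {..<d} {0}" "T * v0 = v0'" using R.wv_in[OF w(1)] diff[OF TM Mu] by auto
 have Tphi: "T * (R.phi X * v) = R'.phi X * (T * v)" if X: "X : LA N" and v: "v : msp {..<d} {0}" for X v
  using diff[OF TM[OF msp_mult[OF R.phi_in[OF X] v]]] cl[OF X TM[OF v]] by (simp add: ac_def)
 have inj: "v = 0" if v: "v : msp {..<d} {0}" "T * v = 0" for v
 proof -
  let ?K = "{v : msp {..<d} {0}. T * v = 0}"
  have K: "csub ?K" "?K \<subseteq> msp {..<d} {0}" unfolding csub_def by (auto simp: distrib_left)
  have "R.phi X * y : ?K" if "X : LA N" "y : ?K" for X y using that Tphi[of X y] msp_mult[OF R.phi_in, of X y] by auto
  hence "rh U * y : ?K" if "U : GG N" "y : ?K" for U y using R.phi_stable_imp_rho_stable[OF K _ that] by blast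
  hence "?K = {0} \<or> ?K = msp {..<d} {0}" using irr K unfolding R.irr_def by blast
  thus ?thesis using v v0 w(4) by blast
 qed
 have surj: "EX v:msp {..<d} {0}. T * v = y" if y: "y : msp {..<d'} {0}" for y
 proof -
  let ?K = "{y. EX v:msp {..<d} {0}. T * v = y}"
  have K: "csub ?K" unfolding csub_def
  proof (intro conjI ballI allI)
   show "0 : ?K" by (auto intro: bexI[of _ 0])
   fix a assume "a : ?K" then obtain v where v: "v : msp {..<d} {0}" "a = T * v" by blast
   show "csc c a : ?K" for c using v by (auto intro!: bexI[of _ "csc c v"])
   fix b assume "b : ?K" then obtain v' where "v' : msp {..<d} {0}" "b = T * v'" by blast
   thus "a + b : ?K" using v by (auto intro!: bexI[of _ "v + v'"] simp: distrib_left)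
  qed
  have K2: "?K \<subseteq> msp {..<d'} {0}" using Tv by blast
  have "R'.phi X * a : ?K" if X: "X : LA N" and a: "a : ?K" for X a
  proof -
   obtain v where v: "v : msp {..<d} {0}" "a = T * v" using a by blast
   thus ?thesis using Tphi[OF X v(1)] msp_mult[OF R.phi_in[OF X] v(1)] by blast
  qed
  hence "rh' U * a : ?K" if "U : GG N" "a : ?K" for U a using R'.phi_stable_imp_rho_stable[OF K K2 _ that] by blast
  hence "?K = {0} \<or> ?K = msp {..<d'} {0}" using irr' K K2 unfolding R'.irr_def by blast
  thus ?thesis using y v0 w(4) by blast
 qed
 have "EX S:msp {..<d} {..<d'}. ALL y:msp {..<d'} {0}. S * y : msp {..<d} {0} & T * (S * y) = y"
  by (rule relation_matrix[where M = "%y v. v : msp {..<d} {0} & T * v = y"]) (use surj in \<open>auto simp: distrib_left\<close>)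
 then obtain S where S: "S : msp {..<d} {..<d'}" and TSy: "!!y. y : msp {..<d'} {0} ==> T * (S * y) = y" by blast
 have "T * S - e {..<d'} = 0"
 proof (rule mat_ext_vec[of _ "{..<d'}" "{..<d'}"])
  show "(T * S - e {..<d'}) * y = 0" if y: "y : msp {..<d'} {0}" for y
   using TSy[OF y] by (simp add: left_diff_distrib mult.assoc e_mult[OF finite_lessThan y])
 qed (use T S in auto)
 hence TS': "T * S = e {..<d'}" by simp
 have "S * T - e {..<d} = 0"
 proof (rule mat_ext_vec[of _ "{..<d}" "{..<d}"])
  fix v assume v: "v : msp {..<d} {0}"
  have "(S * T - e {..<d}) * v = S * (T * v) - v" by (simp add: left_diff_distrib mult.assoc e_mult[OF finite_lessThan v])
  moreover have "S * (T * v) - v = 0"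
   by (rule inj) (use v S Tv[OF v] TSy[OF Tv[OF v]] in \<open>auto simp: right_diff_distrib intro!: msp_closed(3) msp_mult[OF S]\<close>)
  ultimately show "(S * T - e {..<d}) * v = 0" by simp
 qed (use T S in auto)
 hence ST: "S * T = e {..<d}" by simp
 note r = R.rho_in[OF tor_GG[OF u]] and r' = R'.rho_in[OF tor_GG[OF u]]
 have "T * rh (tor N u) - rh' (tor N u) * T = 0"
 proof (rule mat_ext_vec[of _ "{..<d'}" "{..<d}"])
  show "T * rh (tor N u) - rh' (tor N u) * T : msp {..<d'} {..<d}"
   by (intro msp_closed(3) msp_mult[OF T r] msp_mult[OF r' T])
  fix v assume v: "v : msp {..<d} {0}"
  have rv: "rh (tor N u) * v : msp {..<d} {0}" using r v by (rule msp_mult)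
  have "(rh (tor N u) * v, rh' (tor N u) * (T * v)) : ?M" using tors[OF TM[OF v]] by simp
  from diff[OF TM[OF rv] this] show "(T * rh (tor N u) - rh' (tor N u) * T) * v = 0"
   by (simp add: left_diff_distrib mult.assoc)
 qed
 hence int: "T * rh (tor N u) = rh' (tor N u) * T" by simp
 have "tr (rh (tor N u)) = tr (S * (T * rh (tor N u)))" using r by (simp add: mult.assoc[symmetric] ST e_mult[OF finite_lessThan r])
 also have "... = tr (rh' (tor N u) * (T * S))" unfolding int by (subst tr_comm) (simp add: mult.assoc)
 also have "... = tr (rh' (tor N u))" by (simp add: TS' mult_e[OF finite_lessThan r'])
 finally show ?thesis .
qed

section \<open>Comparison with matrix representations\<close>

definition toM :: "nat => fmat => complex mat" where "toM n A = mat n n (%(i,j). ent A i j)"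
definition ofM :: "complex mat => fmat" where "ofM A = mk {..<dim_row A} {..<dim_col A} (%i j. A $$ (i,j))"
definition toV :: "nat => fmat => complex vec" where "toV n v = vec n (%i. ent v i 0)"
definition ofV :: "complex vec => fmat" where "ofV v = mk {..<dim_vec v} {0} (%i j. v $ i)"

lemma ent_ofM: "ent (ofM A) i j = (if i < dim_row A & j < dim_col A then A $$ (i,j) else 0)"
 by (auto simp: ofM_def ent_mk)

lemma ent_ofV: "ent (ofV v) i j = (if i < dim_vec v & j = 0 then v $ i else 0)"
 by (auto simp: ofV_def ent_mk)

lemma toM_carrier [simp, intro]: "toM n A : carrier_mat n n" by (simp add: toM_def)
lemma toM_index [simp]: "i < n ==> j < n ==> toM n A $$ (i,j) = ent A i j" by (simp add: toM_def)
lemma toM_dim [simp]: "dim_row (toM n A) = n" "dim_col (toM n A) = n" by (simp_all add: toM_def)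
lemma toV_carrier [simp, intro]: "toV n A : carrier_vec n" by (simp add: toV_def)
lemma ofM_msp [intro]: "A : carrier_mat n n ==> ofM A : msp {..<n} {..<n}" by (auto simp: msp_def ent_ofM)
lemma ofV_msp [intro]: "v : carrier_vec n ==> ofV v : msp {..<n} {0}" by (auto simp: msp_def ent_ofV)
lemma toM_ofM [simp]: "A : carrier_mat n n ==> toM n (ofM A) = A" by (intro eq_matI) (auto simp: ent_ofM)
lemma ofM_toM [simp]: "A : msp {..<n} {..<n} ==> ofM (toM n A) = A" by (intro fmat_eqI) (auto simp: ent_ofM msp_def)
lemma toV_ofV [simp]: "v : carrier_vec n ==> toV n (ofV v) = v" by (intro eq_vecI) (auto simp: ent_ofV toV_def)
lemma ofV_toV [simp]: "v : msp {..<n} {0} ==> ofV (toV n v) = v" by (intro fmat_eqI) (auto simp: ent_ofV msp_def toV_def)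

lemma ofM_mult: assumes "A : carrier_mat n n" "B : carrier_mat n n" shows "ofM (A * B) = ofM A * ofM B"
proof (rule fmat_eqI)
 fix i j
 have "ent (ofM A * ofM B) i j = (\<Sum>k<n. ent (ofM A) i k * ent (ofM B) k j)"
  using assms by (intro ent_mult_msp[of _ _ "{..<n}" _ "{..<n}"]) auto
 thus "ent (ofM (A * B)) i j = ent (ofM A * ofM B) i j"
  using assms by (auto simp: ent_ofM scalar_prod_def lessThan_atLeast0 intro!: sum.cong)
qed

lemma ofM_one: "ofM (1\<^sub>m n) = e {..<n}" by (rule fmat_eqI) (auto simp: ent_ofM ent_dg)

lemma ofM_inj: "A : carrier_mat n n ==> B : carrier_mat n n ==> ofM A = ofM B ==> A = B"
 by (metis toM_ofM)

lemma toM_mult: "A : msp {..<n} {..<n} ==> B : msp {..<n} {..<n} ==> toM n (A * B) = toM n A * toM n B"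
 by (rule ofM_inj[of _ n]) (auto simp: ofM_mult[of _ n])

lemma ofV_mult: assumes "A : carrier_mat n n" "v : carrier_vec n" shows "ofV (A *\<^sub>v v) = ofM A * ofV v"
proof (rule fmat_eqI)
 fix i j
 have "ent (ofM A * ofV v) i j = (\<Sum>k<n. ent (ofM A) i k * ent (ofV v) k j)"
  using assms by (intro ent_mult_msp[of _ _ "{..<n}" _ "{0}"]) auto
 thus "ent (ofV (A *\<^sub>v v)) i j = ent (ofM A * ofV v) i j"
  using assms by (auto simp: ent_ofM ent_ofV scalar_prod_def lessThan_atLeast0 intro!: sum.cong)
qed

lemma ofV_add: "v : carrier_vec n ==> w : carrier_vec n ==> ofV (v + w) = ofV v + ofV w"
 by (intro fmat_eqI) (auto simp: ent_ofV)
lemma ofV_smult: "ofV (c \<cdot>\<^sub>v v) = csc c (ofV v)"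
 by (intro fmat_eqI) (auto simp: ent_ofV)
lemma ofV_zero: "ofV (0\<^sub>v n) = 0" by (intro fmat_eqI) (auto simp: ent_ofV)
lemma ofV_inj: "v : carrier_vec n ==> w : carrier_vec n ==> ofV v = ofV w ==> v = w"
 by (metis toV_ofV)

lemma dt_ofM: "A : carrier_mat n n ==> dt n (ofM A) = Det A"
 unfolding dt_def using toM_ofM[of A n] by (simp add: toM_def)

lemma ofM_adjoint: "A : carrier_mat n n ==> ofM (mat_adjoint A) = star (ofM A)"
 by (rule fmat_eqI) (auto simp: ent_ofM mat_adjoint_def mat_of_rows_index)

lemma adjoint_carrier: "A : carrier_mat n n ==> mat_adjoint A : carrier_mat n n"
 by (auto simp: mat_adjoint_def)

lemma SU_iff: "A : carrier (SU n) \<longleftrightarrow> A : carrier_mat n n & star (ofM A) * ofM A = e {..<n} & dt n (ofM A) = 1"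
proof (cases "A : carrier_mat n n")
 case True
 note A' = adjoint_carrier[OF True]
 have "mat_adjoint A * A = 1\<^sub>m n \<longleftrightarrow> ofM (mat_adjoint A * A) = ofM (1\<^sub>m n)"
  using A' True ofM_inj[of "mat_adjoint A * A" n "1\<^sub>m n"] by auto
 thus ?thesis using True A' by (simp add: SU_def ofM_mult[of _ n] ofM_adjoint ofM_one dt_ofM)
qed (simp add: SU_def)

definition fp :: "nat => complex mat \<times> complex mat => fmat" where
 "fp N gh = blk N (ofM (fst gh)) (ofM (snd gh))"

definition mp :: "nat => fmat => complex mat \<times> complex mat" where
 "mp N U = (toM N (P1 N U), toM N (P2 N U))"

lemma fp_GG: assumes "g : carrier (SU N)" "h : carrier (SU N)" shows "fp N (g, h) : GG N"
proof -
 have "ofM g : msp {..<N} {..<N}" "ofM h : msp {..<N} {..<N}" using assms by (auto simp: SU_iff)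
 thus ?thesis using assms by (auto simp: GG_def fp_def blk_star blk_mult blk_dg P_blk SU_iff)
qed

lemma mp_SU: assumes "U : GG N" shows "fst (mp N U) : carrier (SU N)" "snd (mp N U) : carrier (SU N)"
proof -
 note U = GG_simps[OF assms]
 have "star (P1 N U) * P1 N U = e {..<N}" "star (P2 N U) * P2 N U = e {..<N}"
  using arg_cong[OF U(3), of "P1 N"] arg_cong[OF U(3), of "P2 N"] U(1)
  by (simp_all add: P_mult[OF BD_closed(6)] P_star P_dg)
 thus "fst (mp N U) : carrier (SU N)" "snd (mp N U) : carrier (SU N)"
  using U by (simp_all add: SU_iff mp_def)
qed

lemma mp_fp: "g : carrier_mat N N ==> h : carrier_mat N N ==> mp N (fp N (g, h)) = (g, h)"
 by (simp add: mp_def fp_def P_blk ofM_msp)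

lemma fp_mp: "U : BD N ==> fp N (mp N U) = U" by (simp add: mp_def fp_def BD_blk[symmetric])

lemma SU_carrier: "g : carrier (SU N) ==> g : carrier_mat N N" by (simp add: SU_def)

lemma GL_carrier: "A : carrier (GL d) ==> A : carrier_mat d d & (EX B:carrier_mat d d. B * A = 1\<^sub>m d)"
 by (auto simp: GL_def units_of_def Units_def ring_mat_def)

lemma rep_carrier:
 assumes "is_rep N d rh" "U : GG N"
 shows "rh (mp N U) : carrier_mat d d" "EX B:carrier_mat d d. B * rh (mp N U) = 1\<^sub>m d"
proof -
 have "rh : hom (SU N \<times>\<times> SU N) (GL d)" using assms(1) by (simp add: is_rep_def)
 moreover have "mp N U : carrier (SU N \<times>\<times> SU N)" using mp_SU[OF assms(2)] by (simp add: mem_Times_iff)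
 ultimately have "rh (mp N U) : carrier (GL d)" by (rule hom_in_carrier)
 thus "rh (mp N U) : carrier_mat d d" "EX B:carrier_mat d d. B * rh (mp N U) = 1\<^sub>m d" using GL_carrier by blast+
qed

lemma su_rep_of_is_rep:
 assumes N: "N >= 2" and R: "is_rep N d rh"
 shows "su_rep N d (%U. ofM (rh (mp N U)))"
proof
 have hom: "rh : hom (SU N \<times>\<times> SU N) (GL d)" using R by (simp add: is_rep_def)
 have mem: "mp N U : carrier (SU N \<times>\<times> SU N)" if "U : GG N" for U using mp_SU[OF that] by (simp add: mem_Times_iff)
 have c: "rh (mp N U) : carrier_mat d d" "EX B:carrier_mat d d. B * rh (mp N U) = 1\<^sub>m d" if "U : GG N" for U
  using rep_carrier[OF R that] by auto
 show "U : GG N ==> ofM (rh (mp N U)) : msp {..<d} {..<d}" for U using c(1) by auto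
 show mult: "ofM (rh (mp N (U * V))) = ofM (rh (mp N U)) * ofM (rh (mp N V))" if "U : GG N" "V : GG N" for U V
 proof -
  have "mp N (U * V) = mp N U \<otimes>\<^bsub>SU N \<times>\<times> SU N\<^esub> mp N V"
   using GG_simps(1)[OF that(1)] GG_simps(1)[OF that(2)]
   by (simp add: mp_def SU_def P_mult toM_mult DirProd_def)
  hence "rh (mp N (U * V)) = rh (mp N U) * rh (mp N V)"
   using hom_mult[OF hom mem[OF that(1)] mem[OF that(2)]] by (simp add: GL_def units_of_def ring_mat_def)
  thus ?thesis using c(1) that by (simp add: ofM_mult[of _ d])
 qed
 \<comment> \<open>The image of the unit is idempotent, and an idempotent with a left inverse is the
   identity.\<close>
 show "ofM (rh (mp N (e {..<2*N}))) = e {..<d}"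
 proof -
  let ?A = "ofM (rh (mp N (e {..<2*N})))"
  have A: "?A : msp {..<d} {..<d}" using c(1)[OF e_GG] by auto
  have AA: "?A * ?A = ?A" using mult[OF e_GG e_GG] by (simp add: dg_mult)
  obtain B where B: "B : carrier_mat d d" "B * rh (mp N (e {..<2*N})) = 1\<^sub>m d" using c(2)[OF e_GG] by blast
  have BA: "ofM B * ?A = e {..<d}" using ofM_mult[OF B(1) c(1)[OF e_GG]] B(2) by (simp add: ofM_one)
  have "?A = ofM B * ?A * ?A" unfolding BA by (simp add: e_mult[OF finite_lessThan A])
  also have "... = ofM B * (?A * ?A)" by (simp only: mult.assoc)
  also have "... = e {..<d}" unfolding AA by (rule BA)
  finally show ?thesis .
 qed
 show "(%m. ent (ofM (rh (mp N (A m)))) a b) \<longlonglongrightarrow> ent (ofM (rh (mp N g))) a b"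
  if A: "!!m. A m : GG N" and g: "g : GG N" and lim: "!!i j. (%m. ent (A m) i j) \<longlonglongrightarrow> ent g i j" for A g a b
 proof -
  have "mat_tendsto N (%m. fst (mp N (A m))) (fst (mp N g))" "mat_tendsto N (%m. snd (mp N (A m))) (snd (mp N g))"
   using lim by (simp_all add: mat_tendsto_def mp_def ent_P)
  hence "mat_tendsto d (%m. rh (fst (mp N (A m)), snd (mp N (A m)))) (rh (fst (mp N g), snd (mp N g)))"
   using R[unfolded is_rep_def, THEN conjunct2, rule_format, of "%m. fst (mp N (A m))" "%m. snd (mp N (A m))" "fst (mp N g)" "snd (mp N g)"]
    mp_SU[OF A] mp_SU[OF g] by blast
  hence l: "(%m. rh (mp N (A m)) $$ (i, j)) \<longlonglongrightarrow> rh (mp N g) $$ (i, j)" if "i < d" "j < d" for i j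
   using that by (simp add: mat_tendsto_def)
  have dims: "dim_row (rh (mp N (A m))) = d" "dim_col (rh (mp N (A m))) = d" for m using c(1)[OF A[of m]] by auto
  have dims': "dim_row (rh (mp N g)) = d" "dim_col (rh (mp N g)) = d" using c(1)[OF g] by auto
  show ?thesis using l[of a b] by (cases "a < d & b < d") (auto simp: ent_ofM dims dims')
 qed
qed (use N in auto)

lemma toM_e: "toM d (e {..<d}) = 1\<^sub>m d" by (intro eq_matI) (auto simp: ent_dg)

lemma is_rep_of_su_rep:
 assumes "su_rep N d rh"
 shows "is_rep N d (%x. toM d (rh (fp N x)))"
proof -
 interpret su_rep N d rh by fact
 have inv: "toM d (rh (fp N x)) : Units (ring_mat TYPE(complex) d ())" if "fp N x : GG N" for x
 proof -
  have "toM d (rh (star (fp N x))) * toM d (rh (fp N x)) = 1\<^sub>m d" "toM d (rh (fp N x)) * toM d (rh (star (fp N x))) = 1\<^sub>m d"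
   unfolding toM_mult[symmetric, OF rho_in[OF GG_star[OF that]] rho_in[OF that]]
    toM_mult[symmetric, OF rho_in[OF that] rho_in[OF GG_star[OF that]]] rho_star[OF that] by (rule toM_e)+
  thus ?thesis unfolding Units_def ring_mat_def by (auto intro!: bexI[of _ "toM d (rh (star (fp N x)))"])
 qed
 have "(%x. toM d (rh (fp N x))) : hom (SU N \<times>\<times> SU N) (GL d)"
 proof (rule homI)
  fix x assume "x : carrier (SU N \<times>\<times> SU N)"
  hence "fp N x : GG N" using fp_GG by (metis SigmaE carrier_DirProd)
  thus "toM d (rh (fp N x)) : carrier (GL d)" using inv by (simp add: GL_def units_of_def)
 next
  fix x y assume "x : carrier (SU N \<times>\<times> SU N)" "y : carrier (SU N \<times>\<times> SU N)"
  then obtain g h g' h' where xy: "x = (g, h)" "y = (g', h')" and m: "g : carrier (SU N)" "h : carrier (SU N)" "g' : carrier (SU N)" "h' : carrier (SU N)"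
   by auto
  have "fp N (x \<otimes>\<^bsub>SU N \<times>\<times> SU N\<^esub> y) = fp N x * fp N y"
   using m[THEN SU_carrier] by (simp add: xy fp_def SU_def DirProd_def blk_mult ofM_msp ofM_mult[of _ N])
  thus "toM d (rh (fp N (x \<otimes>\<^bsub>SU N \<times>\<times> SU N\<^esub> y))) = toM d (rh (fp N x)) \<otimes>\<^bsub>GL d\<^esub> toM d (rh (fp N y))"
   using fp_GG m by (simp add: xy rho_mult toM_mult rho_in GL_def units_of_def ring_mat_def)
 qed
 moreover have "mat_tendsto d (%m. toM d (rh (fp N (A m, B m)))) (toM d (rh (fp N (g, h))))"
  if m: "ALL m. A m : carrier (SU N) & B m : carrier (SU N)" and gh: "g : carrier (SU N)" "h : carrier (SU N)"
   and l: "mat_tendsto N A g" "mat_tendsto N B h" for A B g h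
 proof -
  have "(%m. ent (rh (fp N (A m, B m))) a b) \<longlonglongrightarrow> ent (rh (fp N (g, h))) a b" for a b
  proof (rule rho_cont)
   show "fp N (A m, B m) : GG N" for m using m fp_GG by blast
   show "fp N (g, h) : GG N" using gh by (rule fp_GG)
   have dims: "dim_row (A m) = N" "dim_col (A m) = N" "dim_row (B m) = N" "dim_col (B m) = N" for m
    using m SU_carrier by blast+
   have dims': "dim_row g = N" "dim_col g = N" "dim_row h = N" "dim_col h = N" using gh SU_carrier by blast+
   show "(%m. ent (fp N (A m, B m)) i j) \<longlonglongrightarrow> ent (fp N (g, h)) i j" for i j
    using l by (auto simp: fp_def ent_blk ent_ofM dims dims' mat_tendsto_def)
  qed
  thus ?thesis by (simp add: mat_tendsto_def)
 qed
 ultimately show ?thesis unfolding is_rep_def by blast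
qed

lemma subspace_iff:
 "VectorSpace.subspace class_ring W (module_vec TYPE(complex) d) \<longleftrightarrow> W \<subseteq> carrier_vec d & csub (ofV ` W)"
proof
 assume "VectorSpace.subspace class_ring W (module_vec TYPE(complex) d)"
 hence sm: "submodule class_ring W (module_vec TYPE(complex) d)" by (simp add: VectorSpace.subspace_def)
 have W: "W \<subseteq> carrier_vec d" using submodule.subset[OF sm] by (simp add: module_vec_def)
 have a: "v + w : W" if "v : W" "w : W" for v w using submodule.m_closed[OF sm that] by (simp add: module_vec_def)
 have z: "0\<^sub>v d : W" using submodule.zero_closed[OF sm] by (simp add: module_vec_def)
 have s: "c \<cdot>\<^sub>v v : W" if "v : W" for c v using submodule.smult_closed[OF sm _ that, of c] by (simp add: module_vec_def class_ring_simps)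
 have "csub (ofV ` W)" unfolding csub_def
 proof (intro conjI ballI allI)
  show "0 : ofV ` W" using z ofV_zero[of d] by (metis imageI)
  show "x + y : ofV ` W" if xy: "x : ofV ` W" "y : ofV ` W" for x y
  proof -
   obtain v w where "v : W" "w : W" "x = ofV v" "y = ofV w" using xy by blast
   thus ?thesis using a[of v w] W ofV_add[of v d w] by (metis imageI subsetD)
  qed
  show "csc c x : ofV ` W" if "x : ofV ` W" for c x using that s ofV_smult by (metis imageE imageI)
 qed
 thus "W \<subseteq> carrier_vec d & csub (ofV ` W)" using W by blast
next
 assume *: "W \<subseteq> carrier_vec d & csub (ofV ` W)"
 hence W: "!!v. v : W ==> v : carrier_vec d" and c: "csub (ofV ` W)" by auto
 have bk: "v : W" if v: "v : carrier_vec d" "ofV v : ofV ` W" for v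
 proof -
  obtain w where w: "w : W" "ofV v = ofV w" using v(2) by blast
  thus ?thesis using ofV_inj[OF v(1) W[OF w(1)] w(2)] by simp
 qed
 have "submodule class_ring W (module_vec TYPE(complex) d)"
 proof (rule submodule.intro)
  show "module class_ring (module_vec TYPE(complex) d)" by (rule vec_module)
  show "W \<subseteq> carrier (module_vec TYPE(complex) d)" using * by (simp add: module_vec_def)
  show "v \<oplus>\<^bsub>module_vec TYPE(complex) d\<^esub> w : W" if vw: "v : W" "w : W" for v w
  proof -
   have "ofV (v + w) = ofV v + ofV w" by (rule ofV_add[OF W[OF vw(1)] W[OF vw(2)]])
   hence "ofV (v + w) : ofV ` W" using csubD(2)[OF c imageI[OF vw(1)] imageI[OF vw(2)]] by simp
   moreover have "v + w : carrier_vec d" using W[OF vw(1)] W[OF vw(2)] by simp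
   ultimately have "v + w : W" using bk by simp
   thus ?thesis by (simp add: module_vec_def)
  qed
  have "ofV (0\<^sub>v d) : ofV ` W" using csubD(1)[OF c] by (simp add: ofV_zero)
  thus "\<zero>\<^bsub>module_vec TYPE(complex) d\<^esub> : W" using bk[of "0\<^sub>v d"] by (simp add: module_vec_def)
  show "a \<odot>\<^bsub>module_vec TYPE(complex) d\<^esub> v : W" if v: "v : W" for a v
  proof -
   have "ofV (a \<cdot>\<^sub>v v) : ofV ` W" using csubD(3)[OF c imageI[OF v]] by (simp add: ofV_smult)
   thus ?thesis using bk[of "a \<cdot>\<^sub>v v"] W v by (simp add: module_vec_def)
  qed
 qed
 thus "VectorSpace.subspace class_ring W (module_vec TYPE(complex) d)"
  by (simp add: VectorSpace.subspace_def vec_vs)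
qed

lemma ofV_image: "ofV ` carrier_vec d = msp {..<d} {0}"
proof
 show "msp {..<d} {0} \<subseteq> ofV ` carrier_vec d"
 proof
  fix w assume "w : msp {..<d} {0}"
  thus "w : ofV ` carrier_vec d" by (intro image_eqI[of _ _ "toV d w"]) auto
 qed
qed auto

lemma irr_of_irreducible:
 assumes N: "N >= 2" and I: "irreducible_rep N d rh"
 shows "su_rep.irr N d (%U. ofM (rh (mp N U)))"
proof -
 have R: "is_rep N d rh" and d: "d > 0" using I by (auto simp: irreducible_rep_def)
 interpret su_rep N d "%U. ofM (rh (mp N U))" by (rule su_rep_of_is_rep[OF N R])
 have c: "rh (mp N U) : carrier_mat d d" if "U : GG N" for U using rep_carrier(1)[OF R that] .
 show ?thesis unfolding irr_def
 proof (intro conjI allI impI d)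
  fix W assume W: "csub W & W \<subseteq> msp {..<d} {0} & (ALL U:GG N. ALL w:W. ofM (rh (mp N U)) * w : W)"
  let ?W = "toV d ` W"
  have oW: "ofV ` ?W = W"
  proof -
   have "ofV (toV d w) = w" if "w : W" for w using W that by auto
   thus ?thesis by (force simp: image_image)
  qed
  have Wc: "?W \<subseteq> carrier_vec d" by auto
  have "VectorSpace.subspace class_ring ?W (module_vec TYPE(complex) d)"
   unfolding subspace_iff oW using W Wc by blast
  moreover have "rh x *\<^sub>v v : ?W" if x: "x : carrier (SU N \<times>\<times> SU N)" and v: "v : ?W" for x v
  proof -
   obtain g h where gh: "x = (g, h)" "g : carrier (SU N)" "h : carrier (SU N)" using x by auto
   let ?U = "fp N x"
   have U: "?U : GG N" and mx: "mp N ?U = x" using gh fp_GG mp_fp SU_carrier by auto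
   obtain w where w: "w : W" "v = toV d w" using v by blast
   have "ofV (rh x *\<^sub>v v) = ofM (rh x) * w"
    using c[OF U] w W by (subst ofV_mult[of _ d]) (auto simp: mx)
   hence "ofV (rh x *\<^sub>v v) : W" using W U w mx by metis
   moreover have "rh x *\<^sub>v v : carrier_vec d" using c[OF U] mx w by auto
   ultimately show ?thesis using toV_ofV by (metis imageI)
  qed
  ultimately have "?W = {0\<^sub>v d} \<or> ?W = carrier_vec d" using I unfolding irreducible_rep_def by blast
  thus "W = {0} \<or> W = msp {..<d} {0}"
  proof
   assume "?W = {0\<^sub>v d}"
   hence "ofV ` ?W = {0}" by (simp add: ofV_zero)
   thus ?thesis by (simp only: oW) simp
  next
   assume "?W = carrier_vec d"
   hence "W = ofV ` carrier_vec d" using oW by simp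
   also have "... = msp {..<d} {0}" by (rule ofV_image)
   finally show ?thesis by simp
  qed
 qed
qed

lemma irreducible_of_irr:
 assumes S: "su_rep N d rh" and I: "su_rep.irr N d rh"
 shows "irreducible_rep N d (%x. toM d (rh (fp N x)))"
proof -
 interpret su_rep N d rh by fact
 show ?thesis unfolding irreducible_rep_def
 proof (intro conjI allI impI is_rep_of_su_rep[OF S])
  show "d > 0" using I by (simp add: irr_def)
  fix W assume *: "VectorSpace.subspace class_ring W (module_vec TYPE(complex) d) &
    (ALL g:carrier (SU N \<times>\<times> SU N). ALL v:W. toM d (rh (fp N g)) *\<^sub>v v : W)"
  hence W: "W \<subseteq> carrier_vec d" "csub (ofV ` W)" unfolding subspace_iff by auto
  have "rh U * w : ofV ` W" if U: "U : GG N" and w: "w : ofV ` W" for U w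
  proof -
   obtain v where v: "v : W" "w = ofV v" using w by blast
   have "mp N U : carrier (SU N \<times>\<times> SU N)" using mp_SU[OF U] by (simp add: mem_Times_iff)
   hence "toM d (rh (fp N (mp N U))) *\<^sub>v v : W" using * v by blast
   moreover have "ofV (toM d (rh U) *\<^sub>v v) = rh U * w" using rho_in[OF U] v W by (subst ofV_mult[of _ d]) auto
   ultimately show ?thesis using fp_mp[OF GG_simps(1)[OF U]] by (metis imageI)
  qed
  hence "ofV ` W = {0} \<or> ofV ` W = msp {..<d} {0}"
  proof -
  assume "!!U w. U : GG N ==> w : ofV ` W ==> rh U * w : ofV ` W"
  moreover have "ofV ` W \<subseteq> msp {..<d} {0}" using W(1) ofV_image[of d] by blast
  ultimately show ?thesis using I W(2) unfolding irr_def by blast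
 qed
  thus "W = {0\<^sub>v d} \<or> W = carrier_vec d"
  proof
   assume a: "ofV ` W = {0}"
   have "v = 0\<^sub>v d" if v: "v : W" for v
  proof -
   have "ofV v : {0}" unfolding a[symmetric] by (rule imageI[OF v])
   hence "ofV v = ofV (0\<^sub>v d)" by (simp add: ofV_zero)
   thus ?thesis using v W(1) ofV_inj[of v d "0\<^sub>v d"] by auto
  qed
   thus ?thesis using a by blast
  next
   assume a: "ofV ` W = msp {..<d} {0}"
   have "v : W" if v: "v : carrier_vec d" for v
   proof -
    have "ofV v : ofV ` W" using a v by auto
    then obtain w where "w : W" "ofV v = ofV w" by blast
    thus ?thesis using ofV_inj[of v d w] v W by blast
   qed
   thus ?thesis using W by blast
  qed
 qed
qed

subsection \<open>Fugacities and weights\<close>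

definition ufug :: "nat => (nat => complex) => (nat => complex) => nat => complex" where
 "ufug N x y i = (if i < N then fug N x (i + 1) else fug N y (i - N + 1))"

text \<open>The labels of both factors in one weight, the second shifted by N.\<close>

definition lab :: "nat => (nat => int) => (nat => int) => nat => int" where
 "lab N p q k = (if k < N then p k else q (k - N))"

text \<open>The product telescopes. Its value 1 at k = N is the determinant condition.\<close>

lemma fug_prod: assumes "fugacities N x" "N >= 2" "k <= N"
 shows "(\<Prod>i<k. fug N x (i + 1)) = (if k = 0 \<or> k = N then 1 else x k)" using assms(3)
proof (induction k)
 case (Suc k)
 have nz: "x j ~= 0" if "1 <= j" "j < N" for j using assms(1) that by (force simp: fugacities_def)
 show ?case using Suc assms(2) nz[of k] by (cases "k = 0") (auto simp: fug_def)
qed simp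

lemma fug_unit: assumes "fugacities N x" "N >= 2" "i < N" shows "cmod (fug N x (i + 1)) = 1"
proof -
 have nz: "cmod (x j) = 1" if "1 <= j" "j < N" for j using assms(1) that by (force simp: fugacities_def)
 show ?thesis using nz[of "Suc i"] nz[of i] nz[of 1] nz[of "N - 1"] assms(2,3) by (auto simp: fug_def norm_divide)
qed

lemma ufug_TT: assumes "fugacities N x" "fugacities N y" "N >= 2" shows "ufug N x y : TT N"
proof -
 have "cmod (ufug N x y i) = 1" if "i < 2*N" for i
  using fug_unit[OF assms(1,3), of i] fug_unit[OF assms(2,3), of "i - N"] that by (auto simp: ufug_def)
 moreover have "(\<Prod>i<N. ufug N x y i) = 1"
 proof -
  have "(\<Prod>i<N. ufug N x y i) = (\<Prod>i<N. fug N x (i + 1))" by (intro prod.cong refl) (auto simp: ufug_def)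
  thus ?thesis using fug_prod[OF assms(1,3), of N] assms(3) by simp
 qed
 moreover have "(\<Prod>i<N. ufug N x y (N + i)) = 1" using fug_prod[OF assms(2,3), of N] assms(3) by (simp add: ufug_def)
 ultimately show ?thesis by (simp add: TT_def)
qed

lemma Xc_ufug: assumes "fugacities N x" "fugacities N y" "N >= 2" "k : {1..N - 1}"
 shows "Xc (ufug N x y) k = x k" "Xc (ufug N x y) (N + k) = y k"
proof -
 have "(\<Prod>i<k. ufug N x y i) = (\<Prod>i<k. fug N x (i + 1))" using assms(4) by (intro prod.cong refl) (auto simp: ufug_def)
 thus "Xc (ufug N x y) k = x k" using fug_prod[OF assms(1,3), of k] assms(4) by (auto simp: Xc_def)
 have "Xc (ufug N x y) (N + k) = (\<Prod>i<N. ufug N x y i) * (\<Prod>i<k. ufug N x y (N + i))"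
  unfolding Xc_def using prod.atLeastLessThan_concat[of 0 N "N + k" "ufug N x y"] prod.shift_bounds_nat_ivl[of "ufug N x y" 0 N k]
  by (simp add: lessThan_atLeast0 add.commute)
 moreover have "(\<Prod>i<N. ufug N x y i) = (\<Prod>i<N. fug N x (i + 1))" by (intro prod.cong refl) (auto simp: ufug_def)
 moreover have "(\<Prod>i<k. ufug N x y (N + i)) = (\<Prod>i<k. fug N y (i + 1))" by (intro prod.cong refl) (auto simp: ufug_def)
 ultimately show "Xc (ufug N x y) (N + k) = y k"
  using fug_prod[OF assms(1,3), of N] fug_prod[OF assms(2,3), of k] assms(4) by (auto simp: ufug_def)
qed

lemma KK_split: "KK N = {1..N - 1} \<union> (+) N ` {1..N - 1}"
proof -
 have "k : (+) N ` {1..N - 1}" if "N < k" "k < 2 * N" for k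
  using that by (intro image_eqI[of _ _ "k - N"]) auto
 thus ?thesis by (auto simp: KK_def)
qed

lemma sum_KK: "(SUM k:KK N. f k) = (\<Sum>k=1..N - 1. f k) + (\<Sum>k=1..N - 1. f (N + k))" for f :: "nat => 'a::comm_monoid_add"
 unfolding KK_split by (subst sum.union_disjoint) (auto simp: sum.reindex simp del: image_add_atLeastAtMost)

lemma prod_KK: "(PROD k:KK N. f k) = (\<Prod>k=1..N - 1. f k) * (\<Prod>k=1..N - 1. f (N + k))" for f :: "nat => 'a::comm_monoid_mult"
 unfolding KK_split by (subst prod.union_disjoint) (auto simp: prod.reindex simp del: image_add_atLeastAtMost)

lemma chi_lab: assumes "fugacities N x" "fugacities N y" "N >= 2"
 shows "chi N (lab N p q) (ufug N x y) = (\<Prod>k=1..N - 1. x k powi p k) * (\<Prod>k=1..N - 1. y k powi q k)"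
proof -
 have "(\<Prod>k=1..N - 1. Xc (ufug N x y) k powi lab N p q k) = (\<Prod>k=1..N - 1. x k powi p k)"
  using assms by (intro prod.cong refl) (auto simp: Xc_ufug lab_def)
 moreover have "(\<Prod>k=1..N - 1. Xc (ufug N x y) (N + k) powi lab N p q (N + k)) = (\<Prod>k=1..N - 1. y k powi q k)"
  using assms by (intro prod.cong refl) (auto simp: Xc_ufug lab_def)
 ultimately show ?thesis unfolding chi_def prod_KK by simp
qed

text \<open>The fugacities are the partial products of u, in the second block counted from
  N.\<close>

lemma TT_ufug: assumes u: "u : TT N" and N: "N >= 2"
 shows "EX x y. fugacities N x & fugacities N y & tor N u = tor N (ufug N x y)"
proof -
 define x y where "x = Xc u" "y = (%k. Xc u (N + k))"
 have X1: "Xc u N = 1" "Xc u (2 * N) = 1" "Xc u 0 = 1"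
  using u by (auto simp: Xc_def TT_def prod_split_N)
 have S: "Xc u (Suc i) = Xc u i * u i" for i by (simp add: Xc_def)
 have un: "cmod (Xc u k) = 1" if "k <= 2*N" for k using Xc_unit[OF u that] .
 have nz: "Xc u k ~= 0" if "k <= 2*N" for k using un[OF that] by auto
 have f: "fugacities N x" "fugacities N y" using un by (auto simp: fugacities_def x_y_def)
 have step: "Xc u (Suc i) / Xc u i = u i" if "i < 2*N" for i using S[of i] nz[of i] that by simp
 have a: "fug N x (i + 1) = u i" if "i < N" for i
 proof -
  consider "i = 0" | "i ~= 0" "i + 1 = N" | "i ~= 0" "i + 1 < N" using \<open>i < N\<close> by (metis Suc_eq_plus1 Suc_lessI)
  thus ?thesis
  proof cases
   case 1
   thus ?thesis using step[of 0] N by (simp add: fug_def x_y_def X1)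
  next
   case 2
   thus ?thesis using step[of i] N X1(1) by (simp add: fug_def x_y_def flip: 2(2))
  next
   case 3
   thus ?thesis using step[of i] that by (simp add: fug_def x_y_def)
  qed
 qed
 have b: "fug N y (i + 1) = u (N + i)" if "i < N" for i
 proof -
  consider "i = 0" | "i ~= 0" "i + 1 = N" | "i ~= 0" "i + 1 < N" using \<open>i < N\<close> by (metis Suc_eq_plus1 Suc_lessI)
  thus ?thesis
  proof cases
   case 1
   thus ?thesis using step[of N] N by (simp add: fug_def x_y_def X1)
  next
   case 2
   have i: "Suc (N + i) = 2 * N" "N - 1 = i" using 2 by auto
   have "u (N + i) = 1 / Xc u (N + i)" using step[of "N + i"] i X1(2) by simp
   thus ?thesis using 2 i by (simp add: fug_def x_y_def)
  next
   case 3
   thus ?thesis using step[of "N + i"] that by (simp add: fug_def x_y_def)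
  qed
 qed
 have "tor N u = tor N (ufug N x y)" using a b[of "_ - N"] by (intro dg_cong) (auto simp: ufug_def)
 thus ?thesis using f by blast
qed

lemma torus_fp: assumes "N >= 2" shows "fp N (torus_elt N x, torus_elt N y) = tor N (ufug N x y)"
 unfolding fp_def by (rule fmat_eqI) (auto simp: ent_blk ent_ofM torus_elt_def mat_diag_def ent_dg ufug_def)

lemma is_weight_iff:
 assumes S: "su_rep N d rh'" and c: "!!U. U : GG N ==> rh (mp N U) : carrier_mat d d & rh' U = ofM (rh (mp N U))"
 shows "is_weight N d rh p q \<longleftrightarrow> (EX v. su_rep.wv N d rh' (lab N p q) v & v ~= 0)"
proof -
 interpret su_rep N d rh' by fact
 have key: "(rh (torus_elt N x, torus_elt N y) *\<^sub>v v =
       ((\<Prod>k=1..N - 1. x k powi p k) * (\<Prod>k=1..N - 1. y k powi q k)) \<cdot>\<^sub>v v) \<longleftrightarrow>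
   rh' (tor N (ufug N x y)) * ofV v = csc (chi N (lab N p q) (ufug N x y)) (ofV v)"
  if f: "fugacities N x" "fugacities N y" and v: "v : carrier_vec d" for x y v
 proof -
  let ?U = "tor N (ufug N x y)"
  have U: "?U : GG N" by (intro tor_GG ufug_TT f N2)
  have "mp N ?U = (torus_elt N x, torus_elt N y)"
   unfolding torus_fp[OF N2, symmetric] by (intro mp_fp) (simp_all add: torus_elt_def)
  hence r: "rh (torus_elt N x, torus_elt N y) : carrier_mat d d" "rh' ?U = ofM (rh (torus_elt N x, torus_elt N y))" using c[OF U] by auto
  let ?c = "(\<Prod>k=1..N - 1. x k powi p k) * (\<Prod>k=1..N - 1. y k powi q k)"
  have "(rh (torus_elt N x, torus_elt N y) *\<^sub>v v = ?c \<cdot>\<^sub>v v) \<longleftrightarrow> ofV (rh (torus_elt N x, torus_elt N y) *\<^sub>v v) = ofV (?c \<cdot>\<^sub>v v)"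
   using r v ofV_inj[of "rh (torus_elt N x, torus_elt N y) *\<^sub>v v" d "?c \<cdot>\<^sub>v v"] by auto
  thus ?thesis using r v by (simp add: ofV_mult[of _ d] ofV_smult chi_lab[OF f N2])
 qed
 show ?thesis
 proof
  assume "is_weight N d rh p q"
  then obtain v where v: "v : carrier_vec d" "v ~= 0\<^sub>v d" "!!x y. fugacities N x ==> fugacities N y ==>
    rh (torus_elt N x, torus_elt N y) *\<^sub>v v = ((\<Prod>k=1..N - 1. x k powi p k) * (\<Prod>k=1..N - 1. y k powi q k)) \<cdot>\<^sub>v v"
   unfolding is_weight_def by blast
  have "wv (lab N p q) (ofV v)" unfolding wv_def
  proof (intro conjI ballI)
   show "ofV v : msp {..<d} {0}" using v by auto
   fix u assume u: "u : TT N"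
   then obtain x y where f: "fugacities N x" "fugacities N y" "tor N u = tor N (ufug N x y)" using TT_ufug N2 by blast
   \<comment> \<open>The parameters u and those of the fugacities agree as torus elements, that is
     below 2N, and the character reads no further.\<close>
   have "chi N (lab N p q) u = chi N (lab N p q) (ufug N x y)" unfolding chi_def Xc_def
   proof (intro prod.cong refl arg_cong[where f = "%z. z powi _"])
    fix k i assume "k : KK N" "i : {..<k}"
    hence "i < 2*N" by (auto simp: KK_def)
    thus "u i = ufug N x y i" using arg_cong[OF f(3), of "%A. ent A i i"] by (simp add: ent_dg)
   qed
   thus "rh' (tor N u) * ofV v = csc (chi N (lab N p q) u) (ofV v)"
    using key[OF f(1,2) v(1)] v(3)[OF f(1,2)] f(3) by simp
  qed
  moreover have "ofV v ~= 0" using v(1,2) ofV_inj[of v d "0\<^sub>v d"] ofV_zero[of d] by auto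
  ultimately show "EX v. wv (lab N p q) v & v ~= 0" by blast
 next
  assume "EX v. wv (lab N p q) v & v ~= 0"
  then obtain v where v: "wv (lab N p q) v" "v ~= 0" by blast
  have vm: "v : msp {..<d} {0}" using v wv_in by blast
  have "toV d v ~= 0\<^sub>v d" using vm v(2) ofV_toV[OF vm] ofV_zero[of d] by metis
  moreover have "rh (torus_elt N x, torus_elt N y) *\<^sub>v toV d v =
       ((\<Prod>k=1..N - 1. x k powi p k) * (\<Prod>k=1..N - 1. y k powi q k)) \<cdot>\<^sub>v toV d v"
   if f: "fugacities N x" "fugacities N y" for x y
   using key[OF f, of "toV d v"] v(1) ufug_TT[OF f N2] by (simp add: ofV_toV[OF vm] wv_def)
  ultimately show "is_weight N d rh p q" unfolding is_weight_def by (intro bexI[of _ "toV d v"]) auto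
 qed
qed

text \<open>A simple root of one block has no labels in the other, so the order splits; within a
  block the labels form the Cartan matrix.\<close>

lemma wle_lab: "N >= 2 ==> wle N (lab N p q) (lab N a b) \<longleftrightarrow> weight_le N p a & weight_le N q b"
proof -
 assume N: "N >= 2"
 have c1: "rt (l - 1) l k = cartan_A l k" if "l : {1..N - 1}" "k : {1..N - 1}" for l k
  using that by (auto simp: rt_def cartan_A_def)
 have c2: "rt (N + l - 1) (N + l) (N + k) = cartan_A l k" if "l : {1..N - 1}" "k : {1..N - 1}" for l k
  using that by (auto simp: rt_def cartan_A_def)
 have c3: "rt (l - 1) l (N + k) = 0" "rt (N + l - 1) (N + l) k = 0" if "l : {1..N - 1}" "k : {1..N - 1}" for l k
  using that by (auto simp: rt_def)
 have s1: "(SUM l:KK N. int (c l) * rt (l - 1) l k) = (\<Sum>l=1..N - 1. int (c l) * cartan_A l k)" if "k : {1..N - 1}" for k c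
 proof -
  have "(\<Sum>l=1..N - 1. int (c l) * rt (l - 1) l k) = (\<Sum>l=1..N - 1. int (c l) * cartan_A l k)"
   by (intro sum.cong refl) (simp only: c1[OF _ that])
  moreover have "(\<Sum>l=1..N - 1. int (c (N + l)) * rt (N + l - 1) (N + l) k) = 0"
   by (intro sum.neutral ballI) (simp only: c3(2)[OF _ that] mult_zero_right)
  ultimately show ?thesis unfolding sum_KK by simp
 qed
 have s2: "(SUM l:KK N. int (c l) * rt (l - 1) l (N + k)) = (\<Sum>l=1..N - 1. int (c (N + l)) * cartan_A l k)" if "k : {1..N - 1}" for k c
 proof -
  have "(\<Sum>l=1..N - 1. int (c (N + l)) * rt (N + l - 1) (N + l) (N + k)) = (\<Sum>l=1..N - 1. int (c (N + l)) * cartan_A l k)"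
   by (intro sum.cong refl) (simp only: c2[OF _ that])
  moreover have "(\<Sum>l=1..N - 1. int (c l) * rt (l - 1) l (N + k)) = 0"
   by (intro sum.neutral ballI) (simp only: c3(1)[OF _ that] mult_zero_right)
  ultimately show ?thesis unfolding sum_KK by simp
 qed
 show ?thesis
 proof
  assume "wle N (lab N p q) (lab N a b)"
  then obtain c where c: "ALL k:KK N. lab N a b k - lab N p q k = (SUM l:KK N. int (c l) * rt (l - 1) l k)" unfolding wle_def by blast
  have "a k - p k = (\<Sum>l=1..N - 1. int (c l) * cartan_A l k)" "b k - q k = (\<Sum>l=1..N - 1. int (c (N + l)) * cartan_A l k)"
   if k: "k : {1..N - 1}" for k
  proof -
   have "k : KK N" "N + k : KK N" "k < N" using k by (auto simp: KK_def)
   thus "a k - p k = (\<Sum>l=1..N - 1. int (c l) * cartan_A l k)" "b k - q k = (\<Sum>l=1..N - 1. int (c (N + l)) * cartan_A l k)"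
    using c[rule_format, of k] c[rule_format, of "N + k"] unfolding s1[OF k] s2[OF k] by (simp_all add: lab_def)
  qed
  thus "weight_le N p a & weight_le N q b" unfolding weight_le_def
   by (intro conjI exI[of _ c] exI[of _ "%l. c (N + l)"]) auto
 next
  assume "weight_le N p a & weight_le N q b"
  then obtain c c' where c: "ALL k:{1..N - 1}. a k - p k = (\<Sum>l=1..N - 1. int (c l) * cartan_A l k)"
   "ALL k:{1..N - 1}. b k - q k = (\<Sum>l=1..N - 1. int (c' l) * cartan_A l k)" unfolding weight_le_def by blast
  define C where "C l = (if l < N then c l else c' (l - N))" for l
  have "(\<Sum>l=1..N - 1. int (C l) * cartan_A l k) = (\<Sum>l=1..N - 1. int (c l) * cartan_A l k)"
   "(\<Sum>l=1..N - 1. int (C (N + l)) * cartan_A l k) = (\<Sum>l=1..N - 1. int (c' l) * cartan_A l k)" for k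
   by (rule sum.cong[OF refl], use N in \<open>auto simp: C_def\<close>)+
  note CC = this
  have "lab N a b k - lab N p q k = (SUM l:KK N. int (C l) * rt (l - 1) l k)" if "k : KK N" for k
  proof -
   have "k : {1..N - 1} \<or> k : (+) N ` {1..N - 1}" using that unfolding KK_split by blast
   then consider "k : {1..N - 1}" | k' where "k' : {1..N - 1}" "k = N + k'" by blast
   thus ?thesis
   proof cases
    case 1
    hence "lab N a b k - lab N p q k = a k - p k" by (auto simp: lab_def)
    thus ?thesis unfolding s1[OF 1] CC using c(1) 1 by simp
   next
    case 2
    hence "lab N a b k - lab N p q k = b k' - q k'" by (auto simp: lab_def)
    thus ?thesis unfolding 2(2) s2[OF 2(1)] CC using c(2) 2(1) by simp
   qed
  qed
  thus "wle N (lab N p q) (lab N a b)" unfolding wle_def by blast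
 qed
qed

lemma lab_surj: "EX p' q'. ALL k. lab N p' q' k = p k"
 by (intro exI[of _ p] exI[of _ "%k. p (N + k)"]) (auto simp: lab_def)

text \<open>Any other representation allowed by \<open>is_irrep\<close> has some highest weight r.
  It dominates the prescribed weight, which occurs in that representation, and is dominated by it,
  since \<open>is_irrep\<close> bounds all weights. Antisymmetry gives equality, and
  \<open>character_unique\<close> the value of the description operator.\<close>

theorem irrep_char_eq:
 assumes S: "su_rep N d rh" and I: "su_rep.irr N d rh" and h: "su_rep.hwv N d rh p v0"
  and p: "!!k. k : KK N ==> p k = lab N (%k. int (a k)) (%k. int (b k)) k"
  and f: "fugacities N x" "fugacities N y"
 shows "irrep_char N a b x y = tr (rh (tor N (ufug N x y)))"
proof -
 interpret R: su_rep N d rh by fact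
 let ?ab = "lab N (%k. int (a k)) (%k. int (b k))"
 let ?rh = "%z. toM d (rh (fp N z))"
 have hw: "R.hwv ?ab v0" using h R.wv_cong[of p ?ab v0] p by (auto simp: R.hwv_def)
 have c: "?rh (mp N U) : carrier_mat d d & rh U = ofM (?rh (mp N U))" if "U : GG N" for U
  using R.rho_in[OF that] fp_mp[OF GG_simps(1)[OF that]] by simp
 have w: "is_weight N d ?rh p q \<longleftrightarrow> (EX v. R.wv (lab N p q) v & v ~= 0)" for p q by (rule is_weight_iff[OF S c])
 have ex: "is_irrep N a b d ?rh" unfolding is_irrep_def
 proof (intro conjI allI impI irreducible_of_irr[OF S I])
  show "is_weight N d ?rh (%k. int (a k)) (%k. int (b k))" unfolding w using hw by (auto simp: R.hwv_def)
  fix p q assume "is_weight N d ?rh p q"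
  then obtain v where "R.wv (lab N p q) v" "v ~= 0" unfolding w by blast
  hence "wle N (lab N p q) ?ab" by (rule R.irr_weights[OF I hw])
  thus "weight_le N p (%k. int (a k))" "weight_le N q (%k. int (b k))" unfolding wle_lab[OF R.N2] by auto
 qed
 have trace: "(\<Sum>i<d. rh' (torus_elt N x, torus_elt N y) $$ (i, i)) = tr (ofM (rh' (mp N (tor N (ufug N x y)))))"
  if "rh' (torus_elt N x, torus_elt N y) : carrier_mat d d" for rh' d
 proof -
  have "mp N (tor N (ufug N x y)) = (torus_elt N x, torus_elt N y)"
   unfolding torus_fp[OF R.N2, symmetric] by (intro mp_fp) (simp_all add: torus_elt_def)
  thus ?thesis using that by (subst tr_msp[of "{..<d}" _ "{..<d}"]) (auto simp: ent_ofM)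
 qed
 have U: "tor N (ufug N x y) : GG N" by (intro tor_GG ufug_TT f R.N2)
 have uniq: "(\<Sum>i<d'. rh' (torus_elt N x, torus_elt N y) $$ (i, i)) = tr (rh (tor N (ufug N x y)))" if irr: "is_irrep N a b d' rh'" for d' rh'
 proof -
  have ir: "irreducible_rep N d' rh'" and rep: "is_rep N d' rh'" using irr by (auto simp: is_irrep_def irreducible_rep_def)
  let ?r = "%U. ofM (rh' (mp N U))"
  have S': "su_rep N d' ?r" by (rule su_rep_of_is_rep[OF R.N2 rep])
  interpret R': su_rep N d' ?r by (rule S')
  have I': R'.irr by (rule irr_of_irreducible[OF R.N2 ir])
  have cm: "rh' (mp N U) : carrier_mat d' d' & ?r U = ofM (rh' (mp N U))" if "U : GG N" for U
   using rep_carrier(1)[OF rep that] by simp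
  have w': "is_weight N d' rh' p q \<longleftrightarrow> (EX v. R'.wv (lab N p q) v & v ~= 0)" for p q by (rule is_weight_iff[OF S' cm])
  have "d' > 0" using I' by (simp add: R'.irr_def)
  then obtain r v where rv: "R'.hwv r v" using R'.hwv_exists by blast
  obtain v1 where v1: "R'.wv ?ab v1" "v1 ~= 0" using irr unfolding is_irrep_def w' by blast
  have 1: "wle N ?ab r" by (rule R'.irr_weights[OF I' rv v1])
  obtain p' q' where pq: "ALL k. lab N p' q' k = r k" using lab_surj by blast
  hence rl: "r = lab N p' q'" by auto
  have "is_weight N d' rh' p' q'" unfolding w' using rv rl by (auto simp: R'.hwv_def)
  hence "wle N r ?ab" unfolding rl wle_lab[OF R.N2] using irr by (auto simp: is_irrep_def)
  hence "r k = ?ab k" if "k : KK N" for k by (rule wle_antisym[OF R.N0 _ 1 that])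
  hence hw': "R'.hwv ?ab v" using rv R'.wv_cong[of r ?ab v] by (auto simp: R'.hwv_def)
  have "tr (?r (tor N (ufug N x y))) = tr (rh (tor N (ufug N x y)))"
   by (rule character_unique[OF S' S I' I hw' hw ufug_TT[OF f R.N2]])
  moreover have "rh' (torus_elt N x, torus_elt N y) : carrier_mat d' d'"
  proof -
   have "mp N (tor N (ufug N x y)) = (torus_elt N x, torus_elt N y)"
    unfolding torus_fp[OF R.N2, symmetric] by (intro mp_fp) (simp_all add: torus_elt_def)
   thus ?thesis using cm[OF U] by simp
  qed
  ultimately show ?thesis using trace by simp
 qed
 show ?thesis unfolding irrep_char_def
 proof (rule the_equality)
  show "\<exists>d' rh'. is_irrep N a b d' rh' & tr (rh (tor N (ufug N x y))) = (\<Sum>i<d'. rh' (torus_elt N x, torus_elt N y) $$ (i, i))"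
   using ex uniq[OF ex] by (intro exI[of _ d] exI[of _ ?rh] conjI) simp_all
 qed (use uniq in blast)
qed

section \<open>Symmetric tensors\<close>

lemma sm_deriv: assumes "sm 2 f" shows "((%t. ent (f t) i j) has_vector_derivative 0) (at 0)" "f 0 = 0"
proof -
 obtain C de where C: "0 < de" "0 <= C" "!!t. \<bar>t\<bar> <= de ==> nrm (f t) <= C * \<bar>t\<bar> ^ 2" by (rule smE[OF assms]) blast
 have "nrm (f 0) <= 0" using C(3)[of 0] C(1) by simp
 thus f0: "f 0 = 0" by (rule nrm_eq_0)
 have "(%h. norm (ent (f (0 + h)) i j - ent (f 0) i j - h *\<^sub>R 0) / norm h) \<midarrow>0\<rightarrow> 0"
 proof (rule Lim_null_comparison)
  show "((%h. C * \<bar>h\<bar>) \<longlongrightarrow> 0) (at (0::real))" by (rule tendsto_eq_intros | simp)+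
  show "\<forall>\<^sub>F h in at 0. norm (norm (ent (f (0 + h)) i j - ent (f 0) i j - h *\<^sub>R 0) / norm h) <= C * \<bar>h\<bar>"
   unfolding eventually_at
  proof (intro exI[of _ de] conjI C(1) ballI impI)
   fix h :: real assume h: "h ~= 0 & dist h 0 < de"
   hence "cmod (ent (f h) i j) <= C * \<bar>h\<bar> ^ 2" using nrm_ent[of "f h" i j] C(3)[of h] by auto
   hence "cmod (ent (f h) i j) <= (C * \<bar>h\<bar>) * \<bar>h\<bar>" by (simp add: power2_eq_square mult.assoc)
   thus "norm (norm (ent (f (0 + h)) i j - ent (f 0) i j - h *\<^sub>R 0) / norm h) <= C * \<bar>h\<bar>"
    using h by (simp add: f0 divide_le_eq)
  qed
 qed
 thus "((%t. ent (f t) i j) has_vector_derivative 0) (at 0)"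
  unfolding has_vector_derivative_def has_derivative_at by (auto intro: bounded_linear_scaleR_left)
qed

lemma csc_zero_left: "csc (of_real 0) A = 0" by (simp add: csc_eq_0)

lemma curve_deriv: assumes "sm 2 (%t. ga t - A - csc (of_real t) X)"
 shows "((%t. ent (ga t) i j) has_vector_derivative ent X i j) (at 0)" "ga 0 = A"
proof -
 note d = sm_deriv[OF assms]
 have "((%t. ent (ga t - A - csc (of_real t) X) i j + (ent A i j + of_real t * ent X i j)) has_vector_derivative 0 + (0 + (of_real 0 * 0 + of_real 1 * ent X i j))) (at 0)"
  by (intro derivative_intros d(1))
 thus "((%t. ent (ga t) i j) has_vector_derivative ent X i j) (at 0)" by simp
 show "ga 0 = A" using d(2) by (simp add: csc_zero_left)
qed

lemma has_vector_derivative_prod: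
 fixes f :: "'i => real => complex"
 assumes "!!i. i : I ==> (f i has_vector_derivative f' i) (at x)"
 shows "((%x. PROD i:I. f i x) has_vector_derivative (SUM i:I. f' i * (PROD j:I - {i}. f j x))) (at x)"
proof -
 have "((%x. PROD i:I. f i x) has_derivative (%y. SUM i:I. (y *\<^sub>R f' i) * (PROD j:I - {i}. f j x))) (at x)"
  using assms by (intro has_derivative_prod) (simp add: has_vector_derivative_def)
 thus ?thesis by (simp add: has_vector_derivative_def scaleR_right.sum)
qed

lemma sum_mset_eq_sum_set_mset_count:
 "(SUM c:#m. f c) = (SUM c:set_mset m. count m c * f c)" for f :: "'a => nat"
proof (induction m)
 case (add x m)
 have "(SUM c:set_mset (add_mset x m). count (add_mset x m) c * f c) = (SUM c:insert x (set_mset m). count m c * f c + (if c = x then f c else 0))"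
  by (intro sum.cong) auto
 also have "... = (SUM c:insert x (set_mset m). count m c * f c) + f x" by (simp add: sum.distrib)
 also have "(SUM c:insert x (set_mset m). count m c * f c) = (SUM c:set_mset m. count m c * f c)"
  by (intro sum.mono_neutral_right) (auto simp: not_in_iff)
 finally show ?case using add by simp
qed simp

text \<open>Uniqueness of the expansion in base K. In \<open>PS_kernel\<close> it tells monomials
  apart after all variables are replaced by powers of one.\<close>

lemma digits_unique:
 fixes f g :: "nat => nat"
 assumes "!!i. i < M ==> f i < K" "!!i. i < M ==> g i < K" "(\<Sum>i<M. f i * K ^ i) = (\<Sum>i<M. g i * K ^ i)" "i < M"
 shows "f i = g i" using assms
proof (induction M arbitrary: f g i)
 case (Suc M)
 have e: "f 0 + K * (\<Sum>i<M. f (Suc i) * K ^ i) = g 0 + K * (\<Sum>i<M. g (Suc i) * K ^ i)"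
  using Suc.prems(3) unfolding sum.lessThan_Suc_shift by (simp add: sum_distrib_left mult_ac)
 have lt: "f 0 < K" "g 0 < K" using Suc.prems(1,2)[of 0] by auto
 have 0: "f 0 = g 0" using arg_cong[OF e, of "%x. x mod K"] lt by simp
 have K: "K > 0" using lt by simp
 have "f (Suc j) = g (Suc j)" if "j < M" for j
  using Suc.IH[of "%i. f (Suc i)" "%i. g (Suc i)" j] Suc.prems(1,2) e 0 K that by simp
 thus ?case using 0 Suc.prems(4) by (cases i) auto
qed simp

text \<open>The words of length k over L index the tensors of degree k. Because \<open>fmat\<close>
  is indexed by natural numbers, they are numbered by \<open>wd\<close>.\<close>

locale tensor =
 fixes L :: "'l set" and k :: nat
 assumes finL: "finite L"
begin

definition "WW = PiE {..<k} (%_. L)"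
definition "D = card WW"
definition "wd = (SOME h. bij_betw h {..<D} WW)"

lemma finW: "finite WW" unfolding WW_def by (intro finite_PiE finL) auto

lemma wd: "bij_betw wd {..<D} WW"
proof -
 have "EX h. bij_betw h {..<D} WW" using ex_bij_betw_nat_finite[OF finW] by (simp add: D_def lessThan_atLeast0)
 thus ?thesis unfolding wd_def by (rule someI_ex)
qed

lemma wd_L: "a < D ==> l < k ==> wd a l : L" using bij_betwE[OF wd] by (force simp: WW_def)

lemma wd_eq: assumes "a < D" "b < D" "!!l. l < k ==> wd a l = wd b l" shows "a = b"
proof -
 have "wd a : WW" "wd b : WW" using assms wd by (auto simp: bij_betw_def)
 hence "wd a = wd b" using assms(3) by (auto simp: WW_def intro: PiE_ext)
 thus ?thesis using wd assms(1,2) by (auto simp: bij_betw_def inj_on_def)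
qed

lemma sum_wd: "(\<Sum>a<D. F (wd a)) = (SUM w:WW. F w)" for F :: "_ => complex" by (rule sum.reindex_bij_betw[OF wd])

lemma sum_prod: "(\<Sum>a<D. \<Prod>l<k. G l (wd a l)) = (\<Prod>l<k. SUM c:L. G l c)" for G :: "nat => 'l => complex"
 unfolding sum_wd[of "%w. \<Prod>l<k. G l (w l)"] WW_def by (rule prod_sum_PiE[symmetric]) (auto simp: finL)

abbreviation "SD == {..<D}"

text \<open>The k-th tensor power of a matrix. \<open>td\<close> is its derivative at the identity,
  a sum over the k slots. \<open>pf v\<close> is the homogeneous polynomial function with
  coefficient tensor v, and \<open>pd\<close> its derivative at X in the direction Y.\<close>

definition tp :: "('l => 'l => complex) => fmat" where "tp A = mk SD SD (%a b. \<Prod>l<k. A (wd a l) (wd b l))"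
definition td :: "('l => 'l => complex) => fmat" where
 "td A = mk SD SD (%a b. \<Sum>l<k. A (wd a l) (wd b l) * (PROD l':{..<k} - {l}. of_bool (wd a l' = wd b l')))"
definition pf :: "fmat => ('l => complex) => complex" where "pf v X = (\<Sum>a<D. ent v a 0 * (\<Prod>l<k. X (wd a l)))"
definition pd :: "fmat => ('l => complex) => ('l => complex) => complex" where
 "pd v X Y = (\<Sum>a<D. ent v a 0 * (\<Sum>l<k. Y (wd a l) * (PROD l':{..<k} - {l}. X (wd a l'))))"

lemma tp_in [simp, intro]: "tp A : msp SD SD" by (simp add: tp_def)
lemma td_in [simp, intro]: "td A : msp SD SD" by (simp add: td_def)

lemma ent_tp: "a < D ==> b < D ==> ent (tp A) a b = (\<Prod>l<k. A (wd a l) (wd b l))" by (simp add: tp_def ent_mk)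
lemma ent_td: "a < D ==> b < D ==> ent (td A) a b = (\<Sum>l<k. A (wd a l) (wd b l) * (PROD l':{..<k} - {l}. of_bool (wd a l' = wd b l')))" by (simp add: td_def ent_mk)

lemma msp_eqI: "A : msp S T ==> B : msp S T ==> (!!i j. i : S ==> j : T ==> ent A i j = ent B i j) ==> A = B"
 by (rule fmat_eqI) (metis mspD0)

lemma tp_cong: "(!!c d. c : L ==> d : L ==> A c d = B c d) ==> tp A = tp B"
 by (intro msp_eqI[OF tp_in tp_in]) (auto simp: ent_tp wd_L intro!: prod.cong)

lemma tp_mult: "tp A * tp B = tp (%c d. SUM e:L. A c e * B e d)"
proof (rule msp_eqI)
 fix a b assume ab: "a : SD" "b : SD"
 have "ent (tp A * tp B) a b = (\<Sum>m<D. ent (tp A) a m * ent (tp B) m b)" by (rule ent_mult_msp[of _ _ SD _ SD]) auto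
 also have "... = (\<Sum>m<D. \<Prod>l<k. A (wd a l) (wd m l) * B (wd m l) (wd b l))"
  using ab by (intro sum.cong refl) (simp add: ent_tp prod.distrib)
 also have "... = (\<Prod>l<k. SUM c:L. A (wd a l) c * B c (wd b l))"
  by (rule sum_prod[of "%l c. A (wd a l) c * B c (wd b l)"])
 finally show "ent (tp A * tp B) a b = ent (tp (%c d. SUM e:L. A c e * B e d)) a b" using ab by (simp add: ent_tp)
qed (auto intro: msp_mult[OF tp_in tp_in])

lemma tp_star: "star (tp A) = tp (%c d. cnj (A d c))"
 by (rule msp_eqI[of _ SD SD]) (auto simp: ent_tp intro!: msp_closed)

lemma td_star: "star (td A) = td (%c d. cnj (A d c))"
proof (rule msp_eqI)
 fix a b assume ab: "a : SD" "b : SD"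
 have "cnj (PROD l':{..<k} - {l}. of_bool (wd b l' = wd a l')) = (PROD l':{..<k} - {l}. of_bool (wd a l' = wd b l'))" for l
  unfolding cnj_prod by (intro prod.cong refl) auto
 thus "ent (star (td A)) a b = ent (td (%c d. cnj (A d c))) a b"
  using ab by (simp only: ent_star ent_td lessThan_iff cnj_sum complex_cnj_mult)
qed (auto intro!: msp_closed)

lemma prod_of_bool: "finite I ==> (PROD i:I. of_bool (P i)) = (of_bool (ALL i:I. P i) :: complex)"
 by (induction I rule: finite_induct) auto

lemma tp_one: "tp (%c d. of_bool (c = d)) = e SD"
proof (rule msp_eqI)
 fix a b assume ab: "a : SD" "b : SD"
 have "(ALL l:{..<k}. wd a l = wd b l) \<longleftrightarrow> a = b" using wd_eq[of a b] ab by auto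
 thus "ent (tp (%c d. of_bool (c = d))) a b = ent (e SD) a b"
  using ab by (simp only: ent_tp lessThan_iff prod_of_bool[OF finite_lessThan]) (simp add: ent_dg)
qed auto

lemma pf_diff: "pf (v - w) X = pf v X - pf w X" by (simp add: pf_def left_diff_distrib sum_subtractf)
lemma pf_csc: "pf (csc c v) X = c * pf v X" by (simp add: pf_def sum_distrib_left mult.assoc)
lemma pf_0: "pf 0 X = 0" by (simp add: pf_def)

lemma pf_cong: "(!!c. c : L ==> X c = Y c) ==> pf v X = pf v Y"
 unfolding pf_def by (intro sum.cong refl arg_cong2[where f = "(*)"] prod.cong) (auto simp: wd_L)

text \<open>On polynomials the tensor power acts by substitution: the row vector X is replaced by X
  A.\<close>

lemma pf_tp: assumes v: "v : msp SD {0}" shows "pf (tp A * v) X = pf v (%d. SUM c:L. X c * A c d)"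
proof -
 have "pf (tp A * v) X = (\<Sum>a<D. (\<Sum>b<D. ent (tp A) a b * ent v b 0) * (\<Prod>l<k. X (wd a l)))"
  unfolding pf_def by (intro sum.cong refl arg_cong2[where f = "(*)"] ent_mult_msp[of _ _ SD _ SD]) auto
 also have "... = (\<Sum>a<D. \<Sum>b<D. ent v b 0 * (\<Prod>l<k. X (wd a l) * A (wd a l) (wd b l)))"
  by (intro sum.cong refl) (simp add: sum_distrib_right, intro sum.cong refl, simp add: ent_tp prod.distrib mult_ac)
 also have "... = (\<Sum>b<D. ent v b 0 * (\<Sum>a<D. \<Prod>l<k. X (wd a l) * A (wd a l) (wd b l)))"
  by (subst sum.swap) (simp add: sum_distrib_left)
 also have "... = pf v (%d. SUM c:L. X c * A c d)" unfolding pf_def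
  by (intro sum.cong refl arg_cong2[where f = "(*)"] sum_prod[of "%l c. X c * A c (wd _ l)"])
 finally show ?thesis .
qed

lemma pf_td: assumes v: "v : msp SD {0}" shows "pf (td A * v) X = pd v X (%d. SUM c:L. X c * A c d)"
proof -
 have key: "(\<Sum>a<D. (A (wd a l) (wd b l) * (PROD l':{..<k} - {l}. of_bool (wd a l' = wd b l'))) * (\<Prod>l<k. X (wd a l)))
   = (SUM c:L. X c * A c (wd b l)) * (PROD l':{..<k} - {l}. X (wd b l'))" if l: "l < k" and b: "b < D" for b l
 proof -
  \<comment> \<open>Slot l carries a term of X A and each other slot X times a Kronecker delta, so
    the sum over words factors slot by slot.\<close>
  define G where "G l' c = (if l' = l then X c * A c (wd b l) else X c * of_bool (c = wd b l'))" for l' c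
  have r: "(\<Prod>l'<k. f l') = f l * (PROD l':{..<k} - {l}. f l')" for f :: "nat => complex" using l by (intro prod.remove) auto
  have Gl: "G l c = X c * A c (wd b l)" for c by (simp add: G_def)
  have G': "(PROD l':{..<k} - {l}. f (G l')) = (PROD l':{..<k} - {l}. f (%c. X c * of_bool (c = wd b l')))" for f :: "('l => complex) => complex"
   by (intro prod.cong refl arg_cong[where f = f]) (auto simp: G_def)
  have G'': "(PROD l':{..<k} - {l}. G l' (wd a l')) = (PROD l':{..<k} - {l}. X (wd a l')) * (PROD l':{..<k} - {l}. of_bool (wd a l' = wd b l'))" for a
   unfolding prod.distrib[symmetric] by (intro prod.cong refl) (auto simp: G_def)
  have "(\<Sum>a<D. (A (wd a l) (wd b l) * (PROD l':{..<k} - {l}. of_bool (wd a l' = wd b l'))) * (\<Prod>l<k. X (wd a l))) = (\<Sum>a<D. \<Prod>l'<k. G l' (wd a l'))"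
  proof (rule sum.cong[OF refl])
   fix a
   show "(A (wd a l) (wd b l) * (PROD l':{..<k} - {l}. of_bool (wd a l' = wd b l'))) * (\<Prod>l<k. X (wd a l)) = (\<Prod>l'<k. G l' (wd a l'))"
    unfolding r[of "%l'. X (wd a l')"] r[of "%l'. G l' (wd a l')"] G'' Gl by (simp only: mult_ac)
  qed
  also have "... = (\<Prod>l'<k. SUM c:L. G l' c)" by (rule sum_prod)
  also have "... = (SUM c:L. X c * A c (wd b l)) * (PROD l':{..<k} - {l}. SUM c:L. X c * of_bool (c = wd b l'))"
   unfolding r[of "%l'. SUM c:L. G l' c"] Gl by (simp only: G'[of "%g. sum g L"])
  also have "(PROD l':{..<k} - {l}. SUM c:L. X c * of_bool (c = wd b l')) = (PROD l':{..<k} - {l}. X (wd b l'))"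
  proof (rule prod.cong[OF refl])
   fix l' assume "l' : {..<k} - {l}"
   hence "wd b l' : L" using b by (auto intro: wd_L)
   thus "(SUM c:L. X c * of_bool (c = wd b l')) = X (wd b l')"
    using finL sum.delta[of L "wd b l'" X] by (simp add: of_bool_def if_distrib cong: if_cong)
  qed
  finally show ?thesis .
 qed
 have "pf (td A * v) X = (\<Sum>a<D. (\<Sum>b<D. ent (td A) a b * ent v b 0) * (\<Prod>l<k. X (wd a l)))"
  unfolding pf_def by (intro sum.cong refl arg_cong2[where f = "(*)"] ent_mult_msp[of _ _ SD _ SD]) auto
 also have "... = (\<Sum>a<D. \<Sum>b<D. \<Sum>l<k. ent v b 0 * ((A (wd a l) (wd b l) * (PROD l':{..<k} - {l}. of_bool (wd a l' = wd b l'))) * (\<Prod>l<k. X (wd a l))))"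
  by (intro sum.cong refl, simp only: sum_distrib_right, intro sum.cong refl)
    (simp add: ent_td sum_distrib_left sum_distrib_right mult_ac)
 also have "... = (\<Sum>b<D. ent v b 0 * (\<Sum>l<k. \<Sum>a<D. (A (wd a l) (wd b l) * (PROD l':{..<k} - {l}. of_bool (wd a l' = wd b l'))) * (\<Prod>l<k. X (wd a l))))"
  by (subst sum.swap) (intro sum.cong refl, subst sum.swap, simp only: sum_distrib_left)
 also have "... = pd v X (%d. SUM c:L. X c * A c d)" unfolding pd_def
  by (intro sum.cong refl arg_cong2[where f = "(*)"]) (auto simp: key)
 finally show ?thesis .
qed

lemma pf_deriv: "((%s. pf v (%c. X c + s * Y c)) has_field_derivative pd v (%c. X c + s * Y c) Y) (at s)"
proof -
 have "((%s. X c + s * Y c) has_field_derivative Y c) (at s)" for c by (auto intro!: derivative_eq_intros)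
 hence "((%s. \<Prod>l<k. X (wd a l) + s * Y (wd a l)) has_field_derivative
   (\<Sum>l<k. Y (wd a l) * (PROD l':{..<k} - {l}. X (wd a l') + s * Y (wd a l')))) (at s)" for a
  by (intro has_field_derivative_prod)
 thus ?thesis unfolding pf_def pd_def by (intro derivative_intros DERIV_sum) (auto intro!: DERIV_cmult)
qed

lemma pd_zero: assumes "!!X. pf v X = 0" shows "pd v X Y = 0"
proof -
 have "((%s. pf v (%c. X c + s * Y c)) has_field_derivative pd v (%c. X c + 0 * Y c) Y) (at 0)" by (rule pf_deriv)
 moreover have "((%s. pf v (%c. X c + s * Y c)) has_field_derivative 0) (at 0)" by (simp add: assms)
 ultimately show ?thesis using DERIV_unique by fastforce
qed

section \<open>Symmetric tensors and their polynomials\<close>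

definition mt :: "nat => 'l multiset" where "mt a = image_mset (wd a) (mset_set {..<k})"
definition "MM = {m. set_mset m \<subseteq> L & size m = k}"
definition cls :: "'l multiset => nat set" where "cls m = {a\<in>SD. mt a = m}"
text \<open>The orthogonal projection onto symmetric tensors. It averages over all words with the
  same letters, which replaces a sum over permutations of the slots.\<close>

definition PS :: fmat where "PS = mk SD SD (%a b. if mt a = mt b then 1 / of_nat (card (cls (mt a))) else 0)"

lemma PS_in [simp, intro]: "PS : msp SD SD" by (simp add: PS_def)
lemma fin_cls [simp]: "finite (cls m)" by (simp add: cls_def)

lemma mt_prod: "(\<Prod>l<k. X (wd a l)) = prod_mset (image_mset X (mt a))" for X :: "'l => complex"
 by (simp add: mt_def prod_unfold_prod_mset image_mset.compositionality comp_def)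

lemma mt_image: "mt ` SD = MM"
proof
 show "mt ` SD \<subseteq> MM" by (auto simp: mt_def MM_def wd_L)
 show "MM \<subseteq> mt ` SD"
 proof
  fix m assume m: "m : MM"
  obtain xs where xs: "mset xs = m" using ex_mset by blast
  define w where "w = restrict (%l. xs ! l) {..<k}"
  have len: "length xs = k" using m xs by (auto simp: MM_def)
  have "xs ! l : L" if "l < k" for l using nth_mem[of l xs] that len m xs by (auto simp: MM_def)
  hence "w : WW" by (simp add: WW_def w_def)
  hence "w : wd ` SD" using wd by (simp add: bij_betw_def)
  then obtain a where a: "a < D" "wd a = w" by blast
  have "mt a = image_mset ((!) xs) (mset_set {..<length xs})" unfolding mt_def a len
   by (rule image_mset_cong) (auto simp: w_def)
  also have "... = mset (map ((!) xs) [0..<length xs])" by (simp add: lessThan_atLeast0)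
  also have "... = m" by (simp add: map_nth xs)
  finally show "m : mt ` SD" using a by blast
 qed
qed

lemma finMM [simp]: "finite MM" unfolding mt_image[symmetric] by simp

lemma sum_mt: "(\<Sum>a<D. F a) = (SUM m:MM. SUM a:cls m. F a)" for F :: "nat => complex"
 unfolding cls_def by (rule sum.group[symmetric]) (auto simp: mt_image)

lemma cls_pos: "m : MM ==> card (cls m) > 0" using mt_image by (force simp: card_gt_0_iff cls_def)

lemma pf_mt: "pf v X = (SUM m:MM. (SUM a:cls m. ent v a 0) * prod_mset (image_mset X m))"
 unfolding pf_def sum_mt by (intro sum.cong refl) (simp add: mt_prod sum_distrib_right cls_def)

lemma PS_vec: assumes "v : msp SD {0}" "a < D" shows "ent (PS * v) a 0 = (SUM b:cls (mt a). ent v b 0) / of_nat (card (cls (mt a)))"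
proof -
 have "ent (PS * v) a 0 = (\<Sum>b<D. ent PS a b * ent v b 0)" by (rule ent_mult_msp[of _ _ SD _ SD]) auto
 also have "... = (SUM b:cls (mt a). ent v b 0 / of_nat (card (cls (mt a))))"
  using assms by (intro sum.mono_neutral_cong_right) (auto simp: PS_def ent_mk cls_def)
 finally show ?thesis by (simp add: sum_divide_distrib)
qed

lemma PS_star: "star PS = PS"
 by (rule msp_eqI[of _ SD SD]) (auto simp: PS_def ent_mk intro!: msp_closed)

lemma PS_idem: "PS * PS = PS"
proof (rule msp_eqI)
 fix a b assume ab: "a : SD" "b : SD"
 have "ent (PS * PS) a b = (\<Sum>c<D. ent PS a c * ent PS c b)" by (rule ent_mult_msp[of _ _ SD _ SD]) auto
 also have "... = (SUM c:cls (mt a). ent PS a b / of_nat (card (cls (mt a))))"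
  using ab by (intro sum.mono_neutral_cong_right) (auto simp: PS_def ent_mk cls_def)
 also have "... = ent PS a b" using ab cls_pos[of "mt a"] mt_image by force
 finally show "ent (PS * PS) a b = ent PS a b" .
qed (auto intro: msp_mult[OF PS_in PS_in])

text \<open>The entries of \<open>PS * v\<close> are the coefficients of the polynomial up to class
  sizes. To recover the coefficients from the values, put z^((k+1)^i) for the i-th variable:
  exponents are at most k, so different monomials become different powers of z.\<close>

lemma PS_kernel: assumes v: "v : msp SD {0}" shows "PS * v = 0 \<longleftrightarrow> (ALL X. pf v X = 0)"
proof
 assume 0: "PS * v = 0"
 have "(SUM a:cls m. ent v a 0) = 0" if m: "m : MM" for m
 proof -
  have "m : mt ` SD" using m by (simp only: mt_image)
  then obtain a where "a < D" "mt a = m" by blast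
  thus ?thesis using PS_vec[OF v, of a] 0 cls_pos[OF m] by (simp del: fin_cls card_gt_0_iff)
 qed
 thus "ALL X. pf v X = 0" by (simp add: pf_mt)
next
 assume 0: "ALL X. pf v X = 0"
 obtain ix where ix: "bij_betw ix L {..<card L}" using ex_bij_betw_finite_nat[OF finL] by (auto simp: lessThan_atLeast0)
 define code where "code m = (SUM c:#m. Suc k ^ ix c)" for m
 have code: "code m = (\<Sum>i<card L. count m (inv_into L ix i) * Suc k ^ i)" if m: "m : MM" for m
 proof -
  have "code m = (SUM c:L. count m c * Suc k ^ ix c)"
  proof -
   have "(SUM c:#m. Suc k ^ ix c) = (SUM c:set_mset m. count m c * Suc k ^ ix c)"
    by (rule sum_mset_eq_sum_set_mset_count)
   also have "... = (SUM c:L. count m c * Suc k ^ ix c)"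
    using m finL by (intro sum.mono_neutral_left) (auto simp: MM_def not_in_iff)
   finally show ?thesis by (simp only: code_def)
  qed
  also have "... = (SUM c:L. count m (inv_into L ix (ix c)) * Suc k ^ ix c)"
   using ix by (intro sum.cong refl) (simp add: bij_betw_def inv_into_f_f)
  also have "... = (\<Sum>i<card L. count m (inv_into L ix i) * Suc k ^ i)" by (rule sum.reindex_bij_betw[OF ix])
  finally show ?thesis .
 qed
 have inj: "inj_on code MM"
 proof (rule inj_onI)
  fix m m' assume mm: "m : MM" "m' : MM" "code m = code m'"
  have le: "count m c < Suc k" if "m : MM" for m c using that count_le_size[of m c] by (auto simp: MM_def)
  have "count m (inv_into L ix i) = count m' (inv_into L ix i)" if "i < card L" for i
   using mm(3) unfolding code[OF mm(1)] code[OF mm(2)] by (rule digits_unique[OF le[OF mm(1)] le[OF mm(2)] _ that])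
  hence "count m c = count m' c" if "c : L" for c
   using that ix by (metis bij_betw_def imageI inv_into_f_f lessThan_iff)
  moreover have "count m c = count m' c" if "c \<notin> L" for c
   using that mm(1,2) by (auto simp: MM_def) (metis count_inI subsetD)
  ultimately show "m = m'" by (intro multiset_eqI) blast
 qed
 define S where "S m = (SUM a:cls m. ent v a 0)" for m
 define p where "p = (SUM m:MM. monom (S m) (code m))"
 have "poly p z = 0" for z
 proof -
  have "prod_mset (image_mset (%c. z ^ (Suc k ^ ix c)) m) = z ^ code m" for m
   by (induction m) (auto simp: code_def power_add)
  hence "poly p z = pf v (%c. z ^ (Suc k ^ ix c))" by (simp add: p_def poly_sum poly_monom pf_mt S_def)
  thus ?thesis using 0 by simp
 qed
 hence "p = 0" by (simp add: poly_eq_poly_eq_iff[symmetric] fun_eq_iff)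
 have S0: "S m = 0" if m: "m : MM" for m
 proof -
  have "poly.coeff p (code m) = (SUM m':MM. if m' = m then S m' else 0)" unfolding p_def coeff_sum
   using inj m by (intro sum.cong refl) (auto simp: inj_on_eq_iff)
  thus ?thesis using \<open>p = 0\<close> m by simp
 qed
 show "PS * v = 0"
 proof (rule msp_eqI)
  show "PS * v : msp SD {0}" by (rule msp_mult[OF PS_in v])
  fix i j assume ij: "i : SD" "j : {0::nat}"
  hence "mt i : MM" using mt_image by blast
  thus "ent (PS * v) i j = ent 0 i j" using PS_vec[OF v, of i] S0[of "mt i"] ij by (simp add: S_def)
 qed auto
qed

lemma pf_PS: assumes v: "v : msp SD {0}" shows "pf (PS * v) X = pf v X"
proof -
 have w: "v - PS * v : msp SD {0}" using v by (intro msp_closed msp_mult[OF PS_in v])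
 have "PS * (v - PS * v) = 0" by (simp add: right_diff_distrib mult.assoc[symmetric] PS_idem)
 thus ?thesis using PS_kernel[OF w] by (simp add: pf_diff)
qed

lemma pf_inj: assumes "v : msp SD {0}" "PS * v = v" "!!X. pf v X = 0" shows "v = 0"
 using PS_kernel[OF assms(1)] assms by simp

text \<open>If A and its adjoint preserve the kernel of a self-adjoint projection, then A also
  preserves its range.\<close>

lemma PS_commute:
 assumes A: "A : msp SD SD" and k1: "!!v X. v : msp SD {0} ==> (ALL X. pf v X = 0) ==> pf (A * v) X = 0"
  and k2: "!!v X. v : msp SD {0} ==> (ALL X. pf v X = 0) ==> pf (star A * v) X = 0"
 shows "A * PS = PS * A"
proof -
 have half: "PS * B = PS * B * PS" if B: "B : msp SD SD" and k: "!!v X. v : msp SD {0} ==> (ALL X. pf v X = 0) ==> pf (B * v) X = 0" for B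
 proof -
  have "PS * B * (e SD - PS) = 0"
  proof (rule mat_ext_vec[of _ SD SD])
   show "PS * B * (e SD - PS) : msp SD SD" by (intro msp_mult[OF msp_mult[OF PS_in B]] msp_closed) auto
   fix w assume w: "w : msp SD {0}"
   define u where "u = (e SD - PS) * w"
   have u: "u : msp SD {0}" unfolding u_def by (intro msp_mult[OF _ w] msp_closed) auto
   have "PS * u = 0" unfolding u_def mult.assoc[symmetric] right_diff_distrib by (simp add: PS_idem mult_e[OF finite_lessThan PS_in])
   hence "ALL X. pf u X = 0" using PS_kernel[OF u] by simp
   hence "ALL X. pf (B * u) X = 0" using k[OF u] by blast
   hence "PS * (B * u) = 0" using PS_kernel[OF msp_mult[OF B u]] by simp
   thus "PS * B * (e SD - PS) * w = 0" by (simp add: u_def mult.assoc)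
  qed
  thus ?thesis by (simp add: right_diff_distrib mult_e[OF finite_lessThan msp_mult[OF PS_in B]])
 qed
 have 1: "PS * A = PS * A * PS" by (rule half[OF A k1])
 have "star A : msp SD SD" using A by auto
 hence "PS * star A = PS * star A * PS" by (rule half[OF _ k2])
 hence "star (PS * star A) = star (PS * star A * PS)" by simp
 hence "A * PS = PS * A * PS" by (simp add: PS_star mult.assoc)
 thus ?thesis using 1 by simp
qed

lemma tp_PS: "tp A * PS = PS * tp A" by (rule PS_commute) (auto simp: tp_star pf_tp)

lemma td_PS: "td A * PS = PS * td A" by (rule PS_commute) (auto simp: td_star pf_td intro!: pd_zero)

text \<open>The diagonal entry at a word is its monomial divided by the number of its
  rearrangements, so each multiset of letters contributes its monomial once.\<close>

lemma tr_tp_PS: "tr (tp (%c d. if c = d then x c else 0) * PS) = (SUM m:MM. prod_mset (image_mset x m))"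
proof -
 let ?T = "tp (%c d. if c = d then x c else 0)"
 have T: "ent ?T a b = (if a = b then \<Prod>l<k. x (wd a l) else 0)" if "a < D" "b < D" for a b
  using that wd_eq[of a b] by (auto simp: ent_tp intro!: prod_zero)
 have "tr (?T * PS) = (\<Sum>a<D. ent (?T * PS) a a)" by (rule tr_msp[of _ _ SD]) (auto intro: msp_mult[OF tp_in PS_in])
 also have "... = (\<Sum>a<D. (\<Prod>l<k. x (wd a l)) / of_nat (card (cls (mt a))))"
 proof (intro sum.cong refl)
  fix a assume a: "a : SD"
  have "ent (?T * PS) a a = (\<Sum>b<D. ent ?T a b * ent PS b a)" by (rule ent_mult_msp[of _ _ SD _ SD]) auto
  also have "... = (\<Sum>b<D. if b = a then (\<Prod>l<k. x (wd a l)) / of_nat (card (cls (mt a))) else 0)"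
   using a by (intro sum.cong refl) (auto simp: T PS_def ent_mk)
  finally show "ent (?T * PS) a a = (\<Prod>l<k. x (wd a l)) / of_nat (card (cls (mt a)))" using a by simp
 qed
 also have "... = (SUM m:MM. SUM a:cls m. prod_mset (image_mset x m) / of_nat (card (cls m)))"
  unfolding sum_mt by (intro sum.cong refl) (auto simp: cls_def mt_prod)
 also have "... = (SUM m:MM. prod_mset (image_mset x m))" using cls_pos by (intro sum.cong refl) force
 finally show ?thesis .
qed

end

section \<open>The representation on symmetric tensors of the bifundamental\<close>

lemma wv_csc_diff: "su_rep N d rh ==> su_rep.wv N d rh p v ==> su_rep.wv N d rh p w ==> su_rep.wv N d rh p (csc a v - csc b w)"
 unfolding su_rep.wv_def by (auto simp: right_diff_distrib csc_distrib mult.commute intro!: msp_closed)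

lemma BD_row1: assumes "U : BD N" "i < N" shows "ent (U * V) i j = (\<Sum>a<N. ent U i a * ent V a j)"
proof (rule ent_mult)
 fix a assume "ent U i a ~= 0"
 hence "bd N i a" using assms(1) by (simp add: BD_def)
 thus "a : {..<N}" using assms(2) by (auto simp: bd_def)
qed simp

lemma BD_row2: assumes "U : BD N" "i < N"
 shows "ent (U * V) (2*N - 1 - i) j = (\<Sum>a<N. ent U (2*N - 1 - i) (2*N - 1 - a) * ent V (2*N - 1 - a) j)"
proof -
 have b: "bij_betw (%a. 2*N - 1 - a) {..<N} {N..<2*N}"
  by (rule bij_betw_byWitness[of _ "%a. 2*N - 1 - a"]) auto
 have "ent (U * V) (2*N - 1 - i) j = (SUM a:{N..<2*N}. ent U (2*N - 1 - i) a * ent V a j)"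
 proof (rule ent_mult)
  fix a assume "ent U (2*N - 1 - i) a ~= 0"
  hence "bd N (2*N - 1 - i) a" using assms(1) by (simp add: BD_def)
  thus "a : {N..<2*N}" using assms(2) by (auto simp: bd_def)
 qed simp
 also have "... = (\<Sum>a<N. ent U (2*N - 1 - i) (2*N - 1 - a) * ent V (2*N - 1 - a) j)"
  by (rule sum.reindex_bij_betw[OF b, symmetric])
 finally show ?thesis .
qed

lemma det_addcol_invariant:
 fixes A :: "complex mat"
 assumes "A : carrier_mat n n" "l < n" "k ~= l"
 shows "Det (addcol s k l A) = Det A"
proof -
 have "addcol s k l A = transpose_mat (addrow s k l (transpose_mat A))"
  using assms by (intro eq_matI) (auto simp: mat_addcol_def mat_addrow_def)
 hence "Det (addcol s k l A) = Det (addrow s k l (transpose_mat A))"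
  using assms by (simp add: det_transpose)
 also have "... = Det (transpose_mat A)" using assms by (intro det_addrow) auto
 finally show ?thesis using assms by (simp add: det_transpose)
qed

section \<open>Homogeneous polynomial functions and leading principal minors\<close>

inductive hpoly :: "(nat \<times> nat) set => nat => ((nat \<times> nat => complex) => complex) => bool" for L where
 one: "hpoly L 0 (%X. 1)"
| zero: "hpoly L k (%X. 0)"
| add: "hpoly L k F ==> hpoly L k G ==> hpoly L k (%X. F X + G X)"
| cmul: "hpoly L k F ==> hpoly L k (%X. c * F X)"
| var: "x : L ==> hpoly L k F ==> hpoly L (Suc k) (%X. X x * F X)"

lemma hpoly_mult: "hpoly L k F ==> hpoly L l G ==> hpoly L (k + l) (%X. F X * G X)"
proof (induction rule: hpoly.induct)
 case (add k F F')
 thus ?case using hpoly.add[of L "k + l" "%X. F X * G X" "%X. F' X * G X"] by (simp add: distrib_right)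
next
 case (cmul k F c)
 thus ?case using hpoly.cmul[of L "k + l" "%X. F X * G X" c] by (simp add: mult.assoc)
next
 case (var x k F)
 thus ?case using hpoly.var[of x L "k + l" "%X. F X * G X"] by (simp add: mult.assoc)
qed (auto intro: hpoly.zero)

lemma hpoly_pow: "hpoly L k F ==> hpoly L (n * k) (%X. F X ^ n)"
 by (induction n) (auto intro: hpoly.one hpoly_mult)

lemma hpoly_prod: "finite I ==> (!!i. i : I ==> hpoly L (k i) (F i)) ==> hpoly L (SUM i:I. k i) (%X. PROD i:I. F i X)"
 by (induction I rule: finite_induct) (auto intro: hpoly.one hpoly_mult)

lemma hpoly_sum: "finite I ==> (!!i. i : I ==> hpoly L k (F i)) ==> hpoly L k (%X. SUM i:I. F i X)"
 by (induction I rule: finite_induct) (auto intro: hpoly.zero hpoly.add)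

text \<open>The coefficient tensor need not be symmetric; \<open>HV_exists\<close> symmetrizes it
  afterwards. In the step for a product with a variable, that variable is put in the last
  slot.\<close>

lemma hpoly_tensor: assumes "hpoly L k F" "finite L"
 shows "EX g. ALL X. F X = (SUM w:PiE {..<k} (%_. L). g w * (\<Prod>l<k. X (w l)))" using assms
proof (induction rule: hpoly.induct)
 case one
 show ?case by (intro exI[of _ "%_. 1"]) simp
next
 case (zero k)
 show ?case by (intro exI[of _ "%_. 0"]) simp
next
 case (add k F G)
 then obtain f g where "ALL X. F X = (SUM w:PiE {..<k} (%_. L). f w * (\<Prod>l<k. X (w l)))"
  "ALL X. G X = (SUM w:PiE {..<k} (%_. L). g w * (\<Prod>l<k. X (w l)))" by blast
 thus ?case by (intro exI[of _ "%w. f w + g w"]) (simp add: distrib_right sum.distrib)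
next
 case (cmul k F c)
 then obtain f where "ALL X. F X = (SUM w:PiE {..<k} (%_. L). f w * (\<Prod>l<k. X (w l)))" by blast
 thus ?case by (intro exI[of _ "%w. c * f w"]) (simp add: sum_distrib_left mult.assoc)
next
 case (var x k F)
 then obtain f where f: "ALL X. F X = (SUM w:PiE {..<k} (%_. L). f w * (\<Prod>l<k. X (w l)))" by blast
 define g where "g w = (if w k = x then f (restrict w {..<k}) else 0)" for w
 let ?P = "PiE {..<k} (%_. L)" and ?P' = "PiE {..<Suc k} (%_. L)"
 have inj: "inj_on (%w. w(k := x)) ?P"
 proof (rule inj_onI)
  fix w w' assume w: "w : ?P" "w' : ?P" and eq: "w(k := x) = w'(k := x)"
  have "w l = w' l" if "l : {..<k}" for l using fun_cong[OF eq, of l] that by auto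
  thus "w = w'" using w by (intro PiE_ext)
 qed
 have im: "(%w. w(k := x)) ` ?P = {w : ?P'. w k = x}"
 proof
  show "(%w. w(k := x)) ` ?P \<subseteq> {w : ?P'. w k = x}"
  proof
   fix w' assume "w' : (%w. w(k := x)) ` ?P"
   then obtain w where w: "w : ?P" "w' = w(k := x)" by blast
   have "w' : ?P'"
   proof (rule PiE_I)
    show "w' l : L" if "l : {..<Suc k}" for l using that w var(1) PiE_mem[OF w(1), of l] by (cases "l = k") auto
    show "w' l = undefined" if "l \<notin> {..<Suc k}" for l using that w PiE_arb[OF w(1), of l] by auto
   qed
   thus "w' : {w : ?P'. w k = x}" using w by simp
  qed
  show "{w : ?P'. w k = x} \<subseteq> (%w. w(k := x)) ` ?P"
  proof
   fix w assume w: "w : {w : ?P'. w k = x}"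
   have "w l = ((restrict w {..<k})(k := x)) l" for l
    using w by (cases "l < k"; cases "l = k") (auto simp: PiE_iff extensional_def)
   hence "w = (restrict w {..<k})(k := x)" by blast
   moreover have "restrict w {..<k} : ?P" using w by (auto simp: PiE_iff)
   ultimately show "w : (%w. w(k := x)) ` ?P" by (rule image_eqI)
  qed
 qed
 have r: "restrict (w(k := x)) {..<k} = w" if "w : ?P" for w
  using that by (auto simp: PiE_iff extensional_def fun_eq_iff restrict_def)
 show ?case
 proof (intro exI[of _ g] allI)
  fix X :: "nat \<times> nat => complex"
  have "(SUM w:?P'. g w * (\<Prod>l<Suc k. X (w l))) = (SUM w:{w : ?P'. w k = x}. g w * (\<Prod>l<Suc k. X (w l)))"
   by (intro sum.mono_neutral_right finite_PiE) (auto simp: g_def var)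
  also have "... = (SUM w:?P. g (w(k := x)) * (\<Prod>l<Suc k. X ((w(k := x)) l)))"
   unfolding im[symmetric] by (simp only: sum.reindex[OF inj] comp_def)
  also have "... = (SUM w:?P. X x * (f w * (\<Prod>l<k. X (w l))))"
   by (intro sum.cong refl) (simp add: g_def r mult_ac)
  finally show "X x * F X = (SUM w:?P'. g w * (\<Prod>l<Suc k. X (w l)))" using f by (simp add: sum_distrib_left)
 qed
qed

definition minor :: "nat => (nat \<times> nat => complex) => complex" where "minor m X = Det (mat m m X)"

lemma minor_Leibniz: "minor m X = (\<Sum>p | p permutes {0..<m}. signof p * (\<Prod>i = 0..<m. X (i, p i)))"
proof -
 have "(\<Prod>i = 0..<m. mat m m X $$ (i, p i)) = (\<Prod>i = 0..<m. X (i, p i))" if "p permutes {0..<m}" for p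
 proof (rule prod.cong[OF refl])
  fix i assume "i : {0..<m}"
  moreover from this have "p i < m" using permutes_in_image[OF that, of i] by simp
  ultimately show "mat m m X $$ (i, p i) = X (i, p i)" by simp
 qed
 thus ?thesis unfolding minor_def Determinant.det_def by (auto intro!: sum.cong)
qed

lemma minor_hpoly: assumes "m <= N" shows "hpoly ({..<N} \<times> {..<N}) m (minor m)"
proof -
 have "hpoly ({..<N} \<times> {..<N}) m (%X. \<Prod>i = 0..<m. X (i, p i))" if "p permutes {0..<m}" for p
 proof -
  have "hpoly ({..<N} \<times> {..<N}) (SUM i:{0..<m}. 1) (%X. PROD i:{0..<m}. X (i, p i))"
  proof (rule hpoly_prod)
   fix i assume i: "i : {0..<m}"
   hence "p i < m" using permutes_in_image[OF that, of i] by simp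
   thus "hpoly ({..<N} \<times> {..<N}) 1 (%X. X (i, p i))"
    using hpoly.var[of "(i, p i)" "{..<N} \<times> {..<N}" 0 "%X. 1", OF _ hpoly.one] i assms by simp
  qed simp
  thus ?thesis by simp
 qed
 moreover have "minor m = (%X. \<Sum>p | p permutes {0..<m}. signof p * (\<Prod>i = 0..<m. X (i, p i)))"
  by (rule ext) (rule minor_Leibniz)
 ultimately show ?thesis by (auto intro!: hpoly_sum hpoly.cmul finite_permutations)
qed

lemma minor_scale: "minor m (%(i,j). x i * y j * X (i,j)) = (\<Prod>i<m. x i) * (\<Prod>j<m. y j) * minor m X"
proof -
 have "(\<Prod>i = 0..<m. x i * y (p i) * X (i, p i)) = (\<Prod>i<m. x i) * (\<Prod>j<m. y j) * (\<Prod>i = 0..<m. X (i, p i))"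
  if "p permutes {0..<m}" for p
  using prod.permute[OF that, of y] by (simp add: prod.distrib comp_def lessThan_atLeast0)
 thus ?thesis unfolding minor_Leibniz sum_distrib_left by (intro sum.cong refl) (simp add: mult_ac)
qed

text \<open>Either both rows lie inside the minor and the determinant is unchanged, or the later one
  lies outside and is not seen.\<close>

lemma minor_row: assumes "a < b" shows "minor m (%(i,j). X (i,j) + s * (of_bool (i = b) * X (a,j))) = minor m X"
proof (cases "b < m")
 case True
 have "mat m m (%(i,j). X (i,j) + s * (of_bool (i = b) * X (a,j))) = addrow s b a (mat m m X)"
  using True assms by (intro eq_matI) (auto simp: mat_addrow_def)
 thus ?thesis unfolding minor_def using True assms by (simp add: det_addrow[of _ m])
next
 case False
 hence "mat m m (%(i,j). X (i,j) + s * (of_bool (i = b) * X (a,j))) = mat m m X" by (intro eq_matI) auto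
 thus ?thesis by (simp add: minor_def)
qed

lemma minor_col: assumes "a < b" shows "minor m (%(i,j). X (i,j) + s * (of_bool (j = b) * X (i,a))) = minor m X"
proof (cases "b < m")
 case True
 have "mat m m (%(i,j). X (i,j) + s * (of_bool (j = b) * X (i,a))) = addcol s b a (mat m m X)"
  using True assms by (intro eq_matI) (auto simp: mat_addcol_def)
 thus ?thesis unfolding minor_def using True assms by (simp add: det_addcol_invariant[of _ m])
next
 case False
 hence "mat m m (%(i,j). X (i,j) + s * (of_bool (j = b) * X (i,a))) = mat m m X" by (intro eq_matI) auto
 thus ?thesis by (simp add: minor_def)
qed

lemma minor_diag: "minor m (%(i,j). if i = j then 1 else 0) = 1"
proof -
 have "mat m m (%(i,j). if i = j then 1 else 0) = (1\<^sub>m m :: complex mat)" by (intro eq_matI) auto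
 thus ?thesis by (simp add: minor_def)
qed

text \<open>The last m entries times the partial product before them give the total product 1, and
  conjugation inverts unit numbers.\<close>

lemma Xc_rev: assumes u: "u : TT N" and m: "m <= N" shows "(\<Prod>i<m. cnj (u (2*N - 1 - i))) = Xc u (2*N - m)"
proof -
 have "Xc u (2*N - m) * (\<Prod>i<m. u (2*N - 1 - i)) = Xc u (2*N)" using m
 proof (induction m)
  case (Suc m)
  have "Xc u (2*N - m) = Xc u (2*N - Suc m) * u (2*N - 1 - m)"
  proof -
   have "2*N - m = Suc (2*N - Suc m)" "2*N - 1 - m = 2*N - Suc m" using Suc.prems by auto
   thus ?thesis by (simp add: Xc_def)
  qed
  thus ?case using Suc by (simp add: mult_ac)
 qed simp
 also have "Xc u (2*N) = 1" using u by (simp add: Xc_def TT_def prod_split_N)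
 finally have 1: "Xc u (2*N - m) * (\<Prod>i<m. u (2*N - 1 - i)) = 1" .
 have "cmod (\<Prod>i<m. u (2*N - 1 - i)) = 1"
  unfolding prod_norm[symmetric] using u m by (intro prod.neutral) (auto simp: TT_def)
 hence 2: "(\<Prod>i<m. u (2*N - 1 - i)) * cnj (\<Prod>i<m. u (2*N - 1 - i)) = 1"
  using complex_norm_square[of "\<Prod>i<m. u (2*N - 1 - i)"] by (simp only: mult.commute) simp
 have inv_unique: "a = b" if "a * q = 1" "q * b = 1" for a b q :: complex
  using that by (metis mult.assoc mult.commute mult.right_neutral)
 have "Xc u (2*N - m) = cnj (\<Prod>i<m. u (2*N - 1 - i))" by (rule inv_unique[OF 1 2])
 thus ?thesis by simp
qed

section \<open>The symmetric power of degree k of the bifundamental\<close>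

locale bifund =
 fixes N k :: nat
 assumes N2: "N >= 2"
begin

sublocale tensor "{..<N} \<times> {..<N}" k by unfold_locales auto

abbreviation "LL == {..<N} \<times> {..<N}"

definition la :: "fmat => nat \<times> nat => nat \<times> nat => complex" where
 "la U = (%(i,j) (i',j'). ent U i i' * cnj (ent U (2*N - 1 - j) (2*N - 1 - j')))"

text \<open>The complex linear extension of the derivative of \<open>la\<close>. For skew-Hermitian
  Z the conjugate of an entry is minus the transposed entry; this turns the antilinear second factor
  into a linear expression.\<close>

definition lad :: "fmat => nat \<times> nat => nat \<times> nat => complex" where
 "lad Z = (%(i,j) (i',j'). ent Z i i' * of_bool (j = j') - of_bool (i = i') * ent Z (2*N - 1 - j') (2*N - 1 - j))"

definition rho :: "fmat => fmat" where "rho U = tp (la U)"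

lemma rho_mult': assumes U: "U : BD N" shows "rho (U * V) = rho U * rho V" unfolding rho_def tp_mult
proof (rule tp_cong)
 fix c d assume cd: "c : LL" "d : LL"
 obtain i j i' j' where ij: "c = (i,j)" "d = (i',j')" "i < N" "j < N" using cd by auto
 have "la (U * V) c d = (\<Sum>a<N. ent U i a * ent V a i') * (\<Sum>b<N. cnj (ent U (2*N - 1 - j) (2*N - 1 - b)) * cnj (ent V (2*N - 1 - b) (2*N - 1 - j')))"
  unfolding la_def ij prod.case BD_row1[OF U ij(3)] BD_row2[OF U ij(4)] by simp
 also have "... = (\<Sum>a<N. \<Sum>b<N. la U c (a,b) * la V (a,b) d)"
  unfolding sum_product by (intro sum.cong refl) (simp add: la_def ij)
 also have "... = (SUM x:LL. la U c x * la V x d)" by (simp add: sum.cartesian_product)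
 finally show "la (U * V) c d = (SUM x:LL. la U c x * la V x d)" .
qed

lemma rho_star': "rho (star U) = star (rho U)"
 unfolding rho_def tp_star by (rule tp_cong) (auto simp: la_def)

lemma la_one: "c : LL ==> d : LL ==> la (e {..<2*N}) c d = of_bool (c = d)"
proof -
 assume "c : LL" "d : LL"
 then obtain i j i' j' where ij: "c = (i,j)" "d = (i',j')" "i < N" "j < N" "i' < N" "j' < N" by auto
 have "2*N - 1 - j = 2*N - 1 - j' \<longleftrightarrow> j = j'" using ij by auto
 thus ?thesis using ij by (auto simp: la_def ent_dg)
qed

lemma rho_one': "rho (e {..<2*N}) = e SD"
 unfolding rho_def tp_one[symmetric] by (rule tp_cong) (rule la_one)

sublocale R: su_rep N D rho
proof
 fix A g a b assume l: "!!i j. (%m. ent (A m) i j) \<longlonglongrightarrow> ent g i j"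
 show "(%m. ent (rho (A m)) a b) \<longlonglongrightarrow> ent (rho g) a b"
 proof (cases "a < D & b < D")
  case True
  have "(%m. la (A m) c d) \<longlonglongrightarrow> la g c d" for c d
   unfolding la_def by (cases c; cases d) (auto intro!: tendsto_intros l)
  hence "(%m. \<Prod>l<k. la (A m) (wd a l) (wd b l)) \<longlonglongrightarrow> (\<Prod>l<k. la g (wd a l) (wd b l))" by (rule tendsto_prod)
  thus ?thesis using True by (simp add: rho_def ent_tp)
 next
  case False
  hence "ent (rho U) a b = 0" for U using mspD0[OF tp_in, of a b] by (auto simp: rho_def)
  thus ?thesis by simp
 qed
next
 show "rho (e {..<2*N}) = e SD" by (rule rho_one')
 show "rho (U * V) = rho U * rho V" if "U : GG N" for U V by (rule rho_mult'[OF GG_simps(1)[OF that]])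
 show "rho U : msp SD SD" for U by (simp add: rho_def)
qed (rule N2)

lemma td_add: "td (%c d. A c d + B c d) = td A + td B"
 by (rule msp_eqI[of _ SD SD]) (auto simp: ent_td distrib_right sum.distrib intro!: msp_closed)
lemma td_csc: "td (%c d. z * A c d) = csc z (td A)"
 by (rule msp_eqI[of _ SD SD]) (auto simp: ent_td sum_distrib_left mult_ac intro!: msp_closed)
lemma lad_add: "lad (X + Y) = (%c d. lad X c d + lad Y c d)"
 by (auto simp: lad_def fun_eq_iff algebra_simps)
lemma lad_csc: "lad (csc z X) = (%c d. z * lad X c d)"
 by (auto simp: lad_def fun_eq_iff algebra_simps)

lemma dr_td: assumes X: "X : KA N" shows "R.dr X = td (lad X)"
proof -
 obtain ga where g: "!!t. ga t : GG N" "sm 2 (%t. ga t - e {..<2*N} - csc (of_real t) X)"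
  "sm 2 (%t. rho (ga t) - e SD - csc (of_real t) (R.dr X))"
  using R.DR_dr[OF X] unfolding R.DR_def by blast
 note d = curve_deriv[OF g(2)]
 have skew: "cnj (ent X i j) = - ent X j i" for i j
  using arg_cong[OF R.KA_simps(3)[OF X], of "%A. ent A j i"] by simp
 have l: "((%t. la (ga t) c c') has_vector_derivative lad X c c') (at 0)" if cc: "c : LL" "c' : LL" for c c'
 proof -
  obtain i j i' j' where ij: "c = (i,j)" "c' = (i',j')" "i < N" "j < N" "i' < N" "j' < N" using cc by auto
  have E: "2*N - 1 - j = 2*N - 1 - j' \<longleftrightarrow> j = j'" using ij by auto
  have "((%t. ent (ga t) i i' * cnj (ent (ga t) (2*N - 1 - j) (2*N - 1 - j'))) has_vector_derivative
    ent (ga 0) i i' * cnj (ent X (2*N - 1 - j) (2*N - 1 - j')) + ent X i i' * cnj (ent (ga 0) (2*N - 1 - j) (2*N - 1 - j'))) (at 0)"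
   by (intro has_vector_derivative_mult bounded_linear.has_vector_derivative[OF bounded_linear_cnj] d(1))
  moreover have "ent (ga 0) i i' * cnj (ent X (2*N - 1 - j) (2*N - 1 - j')) + ent X i i' * cnj (ent (ga 0) (2*N - 1 - j) (2*N - 1 - j')) = lad X c c'"
   using ij E by (auto simp: lad_def d(2) ent_dg skew)
  moreover have "(%t. ent (ga t) i i' * cnj (ent (ga t) (2*N - 1 - j) (2*N - 1 - j'))) = (%t. la (ga t) c c')" using ij by (simp add: la_def)
  ultimately show ?thesis by simp
 qed
 show ?thesis
 proof (rule msp_eqI)
  show "R.dr X : msp SD SD" by (rule R.dr_in[OF X])
  fix a b assume ab: "a : SD" "b : SD"
  have 1: "((%t. ent (rho (ga t)) a b) has_vector_derivative ent (R.dr X) a b) (at 0)" by (rule curve_deriv(1)[OF g(3)])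
  have "((%t. \<Prod>l<k. la (ga t) (wd a l) (wd b l)) has_vector_derivative
    (\<Sum>l<k. lad X (wd a l) (wd b l) * (PROD l':{..<k} - {l}. la (ga 0) (wd a l') (wd b l')))) (at 0)"
   using ab by (intro has_vector_derivative_prod l wd_L) auto
  also have "(\<Sum>l<k. lad X (wd a l) (wd b l) * (PROD l':{..<k} - {l}. la (ga 0) (wd a l') (wd b l'))) = ent (td (lad X)) a b"
   using ab by (auto simp: ent_td d(2) la_one wd_L intro!: sum.cong prod.cong)
  finally have 2: "((%t. ent (rho (ga t)) a b) has_vector_derivative ent (td (lad X)) a b) (at 0)" using ab by (simp add: rho_def ent_tp)
  show "ent (R.dr X) a b = ent (td (lad X)) a b" using vector_derivative_unique_at[OF 1 2] .
 qed auto
qed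

lemma phi_td: assumes "Z : LA N" shows "R.phi Z = td (lad Z)"
proof -
 obtain X Y where "X : KA N" "Y : KA N" "Z = X + csc \<i> Y" "R.phi Z = R.dr X + csc \<i> (R.dr Y)" by (rule R.LA_decomp[OF assms]) blast
 thus ?thesis by (simp add: dr_td lad_add lad_csc td_add td_csc)
qed

text \<open>The direction in which row b changes when a multiple of row a is added to it;
  \<open>cold\<close> is the same for columns.\<close>

definition rowd :: "nat => nat => (nat \<times> nat => complex) => nat \<times> nat => complex" where
 "rowd a b X = (%(i,j). of_bool (i = b) * X (a,j))"
definition cold :: "nat => nat => (nat \<times> nat => complex) => nat \<times> nat => complex" where
 "cold a b X = (%(i,j). of_bool (j = b) * X (i,a))"

lemma pd_cong: "(!!c. c : LL ==> Y c = Y' c) ==> pd v X Y = pd v X Y'"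
 unfolding pd_def by (intro sum.cong refl arg_cong2[where f = "(*)"]) (auto simp: wd_L)

lemma pd_minus: "pd v X (%c. - Y c) = - pd v X Y" by (simp add: pd_def sum_negf)

lemma pf_phi_row: assumes v: "v : msp SD {0}" and ab: "a < b" "b < N"
 shows "pf (R.phi (Eu a b) * v) X = pd v X (rowd a b X)"
proof -
 have E: "Eu a b : LA N" using ab by (intro Eu_LA) (auto simp: bd_def)
 have "(SUM c:LL. X c * lad (Eu a b) c d) = rowd a b X d" if d: "d : LL" for d
 proof -
  obtain i' j' where d: "d = (i',j')" "i' < N" "j' < N" using d by auto
  have "X c * lad (Eu a b) c d = (if c = (a,j') then of_bool (i' = b) * X (a,j') else 0)" if c: "c : LL" for c
  proof -
   obtain i j where "c = (i,j)" "i < N" "j < N" using c by auto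
   moreover from this have "2*N - 1 - j' ~= a" using ab d by auto
   ultimately show ?thesis using d ab by (auto simp: lad_def ent_Eu)
  qed
  hence "(SUM c:LL. X c * lad (Eu a b) c d) = (SUM c:LL. if c = (a,j') then of_bool (i' = b) * X (a,j') else 0)" by (rule sum.cong[OF refl])
  also have "... = of_bool (i' = b) * X (a,j')" using ab d by (subst sum.delta) auto
  finally show ?thesis by (simp add: rowd_def d)
 qed
 thus ?thesis unfolding phi_td[OF E] pf_td[OF v] by (intro pd_cong)
qed

lemma pf_phi_col: assumes v: "v : msp SD {0}" and ab: "a < b" "b < N"
 shows "pf (R.phi (Eu (2*N - 1 - b) (2*N - 1 - a)) * v) X = - pd v X (cold a b X)"
proof -
 let ?E = "Eu (2*N - 1 - b) (2*N - 1 - a)"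
 have E: "?E : LA N" using ab by (intro Eu_LA) (auto simp: bd_def)
 have "(SUM c:LL. X c * lad ?E c d) = - cold a b X d" if d: "d : LL" for d
 proof -
  obtain i' j' where d: "d = (i',j')" "i' < N" "j' < N" using d by auto
  have "X c * lad ?E c d = (if c = (i',a) then - (of_bool (j' = b) * X (i',a)) else 0)" if c: "c : LL" for c
  proof -
   obtain i j where c: "c = (i,j)" "i < N" "j < N" using c by auto
   have "i ~= 2*N - 1 - b" "2*N - 1 - j' = 2*N - 1 - b \<longleftrightarrow> j' = b" "2*N - 1 - j = 2*N - 1 - a \<longleftrightarrow> j = a" using c d ab by auto
   thus ?thesis using c d ab by (auto simp: lad_def ent_Eu)
  qed
  hence "(SUM c:LL. X c * lad ?E c d) = (SUM c:LL. if c = (i',a) then - (of_bool (j' = b) * X (i',a)) else 0)" by (rule sum.cong[OF refl])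
  also have "... = - (of_bool (j' = b) * X (i',a))" using ab d by (subst sum.delta) auto
  finally show ?thesis by (simp add: cold_def d)
 qed
 thus ?thesis unfolding phi_td[OF E] pf_td[OF v] pd_minus[symmetric] by (intro pd_cong)
qed

section \<open>Polynomials killed by the raising operators\<close>

definition raised :: "fmat => bool" where
 "raised v \<longleftrightarrow> (ALL i j. bd N i j --> i < j --> R.phi (Eu i j) * v = 0)"

lemma raised_cases: assumes "bd N i j" "i < j"
 shows "j < N \<or> (EX a b. a < b & b < N & i = 2*N - 1 - b & j = 2*N - 1 - a)"
proof (cases "j < N")
 case False
 hence "i = 2*N - 1 - (2*N - 1 - i)" "j = 2*N - 1 - (2*N - 1 - j)" "2*N - 1 - j < 2*N - 1 - i" "2*N - 1 - i < N"
  using assms by (auto simp: bd_def)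
 thus ?thesis by blast
qed simp

lemma const_of_deriv0: assumes "!!s::complex. (f has_field_derivative 0) (at s)" shows "f s = f 0"
proof -
 have "EX c. ALL x:UNIV. f x = c" by (rule has_field_derivative_zero_constant) (auto simp: assms)
 thus ?thesis by auto
qed

text \<open>Moving along the direction leaves row (or column) a, and hence the direction, unchanged.
  The derivative therefore vanishes at every s, not only at 0.\<close>

lemma raised_inv: assumes v: "v : msp SD {0}" and r: "raised v" and ab: "a < b" "b < N"
 shows "pf v (%c. X c + s * rowd a b X c) = pf v X" "pf v (%c. X c + s * cold a b X c) = pf v X"
proof -
 have "pf v (%c. X c + s * rowd a b X c) = pf v (%c. X c + 0 * rowd a b X c)"
 proof (rule const_of_deriv0)
  fix s
  let ?Y = "%c. X c + s * rowd a b X c"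
  have e: "rowd a b ?Y = rowd a b X" using ab by (auto simp: rowd_def fun_eq_iff)
  have "R.phi (Eu a b) * v = 0" using r ab by (simp add: raised_def bd_def)
  hence "pd v ?Y (rowd a b X) = 0" using pf_phi_row[OF v ab, of ?Y] by (simp add: e pf_0)
  thus "((%s. pf v (%c. X c + s * rowd a b X c)) has_field_derivative 0) (at s)" using pf_deriv[of v X "rowd a b X" s] by simp
 qed
 thus "pf v (%c. X c + s * rowd a b X c) = pf v X" by simp
 have "pf v (%c. X c + s * cold a b X c) = pf v (%c. X c + 0 * cold a b X c)"
 proof (rule const_of_deriv0)
  fix s
  let ?Y = "%c. X c + s * cold a b X c"
  have e: "cold a b ?Y = cold a b X" using ab by (auto simp: cold_def fun_eq_iff)
  have "bd N (2*N - 1 - b) (2*N - 1 - a)" "2*N - 1 - b < 2*N - 1 - a" using ab by (auto simp: bd_def)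
  hence "R.phi (Eu (2*N - 1 - b) (2*N - 1 - a)) * v = 0" using r unfolding raised_def by blast
  hence "pd v ?Y (cold a b X) = 0" using pf_phi_col[OF v ab, of ?Y] by (simp add: e pf_0)
  thus "((%s. pf v (%c. X c + s * cold a b X c)) has_field_derivative 0) (at s)" using pf_deriv[of v X "cold a b X" s] by simp
 qed
 thus "pf v (%c. X c + s * cold a b X c) = pf v X" by simp
qed

lemma PS_phi: "Z : LA N ==> PS * v = v ==> PS * (R.phi Z * v) = R.phi Z * v"
 by (simp add: phi_td mult.assoc[symmetric] td_PS[symmetric]) (simp add: mult.assoc)

lemma raisedI: assumes v: "v : msp SD {0}" "PS * v = v"
 and r: "!!a b X s. a < b ==> b < N ==> pf v (%c. X c + s * rowd a b X c) = pf v X"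
 and c: "!!a b X s. a < b ==> b < N ==> pf v (%c. X c + s * cold a b X c) = pf v X"
 shows "raised v"
proof -
 have pd0: "pd v X Y = 0" if "!!s. pf v (%c. X c + s * Y c) = pf v X" for X Y
 proof -
  have 1: "((%s. pf v (%c. X c + s * Y c)) has_field_derivative pd v (%c. X c + 0 * Y c) Y) (at 0)" by (rule pf_deriv)
  have 2: "((%s. pf v (%c. X c + s * Y c)) has_field_derivative 0) (at 0)" by (simp add: that)
  show ?thesis using DERIV_unique[OF 1 2] by simp
 qed
 have "R.phi (Eu i j) * v = 0" if b: "bd N i j" and ij: "i < j" for i j
 proof -
  have E: "Eu i j : LA N" using b ij by (intro Eu_LA) auto
  have "pf (R.phi (Eu i j) * v) X = 0" for X using raised_cases[OF b ij]
  proof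
   assume "j < N"
   thus ?thesis using pf_phi_row[OF v(1) ij] pd0 r[OF ij] by simp
  next
   assume "EX a b. a < b & b < N & i = 2*N - 1 - b & j = 2*N - 1 - a"
   then obtain a b where ab: "a < b" "b < N" "i = 2*N - 1 - b" "j = 2*N - 1 - a" by blast
   thus ?thesis using pf_phi_col[OF v(1) ab(1,2)] pd0 c[OF ab(1,2)] by simp
  qed
  thus ?thesis by (intro pf_inj msp_mult[OF R.phi_in[OF E] v(1)] PS_phi[OF E v(2)])
 qed
 thus ?thesis by (simp add: raised_def)
qed

lemma pf_tor: assumes v: "v : msp SD {0}"
 shows "pf (rho (tor N u) * v) X = pf v (%(i,j). u i * cnj (u (2*N - 1 - j)) * X (i,j))"
 unfolding rho_def pf_tp[OF v]
proof (rule pf_cong)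
 fix d assume "d : LL"
 then obtain i' j' where d: "d = (i',j')" "i' < N" "j' < N" by auto
 have "X c * la (tor N u) c d = (if c = d then X d * (u i' * cnj (u (2*N - 1 - j'))) else 0)" if c: "c : LL" for c
 proof -
  obtain i j where c: "c = (i,j)" "i < N" "j < N" using c by auto
  have "2*N - 1 - j = 2*N - 1 - j' \<longleftrightarrow> j = j'" using c d by auto
  thus ?thesis using c d by (auto simp: la_def ent_dg)
 qed
 hence "(SUM c:LL. X c * la (tor N u) c d) = (SUM c:LL. if c = d then X d * (u i' * cnj (u (2*N - 1 - j'))) else 0)" by (rule sum.cong[OF refl])
 also have "... = X d * (u i' * cnj (u (2*N - 1 - j')))" using d by (subst sum.delta) auto
 finally show "(SUM c:LL. X c * la (tor N u) c d) = (case d of (i,j) => u i * cnj (u (2*N - 1 - j)) * X (i,j))" by (simp add: d mult_ac)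
qed

end

lemma prod_powi_sum: "finite I ==> z ~= 0 ==> (PROD i:I. z powi f i) = z powi sum f I" for z :: complex
 by (induction I rule: finite_induct) (auto simp: power_int_add)

context bifund
begin

lemma pf_poly: "EX P. ALL s. pf v (%c. X c + s * Y c) = poly P s"
proof -
 have "poly (\<Sum>a<D. Polynomial.smult (ent v a 0) (\<Prod>l<k. [:X (wd a l), Y (wd a l):])) s = pf v (%c. X c + s * Y c)" for s
  by (simp add: poly_sum poly_prod pf_def)
 thus ?thesis by (intro exI allI) (rule sym)
qed

text \<open>On a line the function is a polynomial in s, so infinitely many zeros suffice; singular
  positions are reached from generic ones in this way.\<close>

lemma pf_zero_extend: assumes "infinite S" "!!s. s : S ==> pf v (%c. X c + s * Y c) = 0"
 shows "pf v (%c. X c + s * Y c) = 0"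
proof -
 obtain P where P: "!!s. pf v (%c. X c + s * Y c) = poly P s" using pf_poly by blast
 have "S \<subseteq> {s. poly P s = 0}" using assms(2) P by auto
 hence "P = 0" using assms(1) poly_roots_finite[of P] finite_subset by blast
 thus ?thesis by (simp add: P)
qed

lemma raised_elim_row: assumes v: "v : msp SD {0}" and r: "raised v" and I: "I \<subseteq> {m<..<N}"
 shows "pf v (%(i,j). X (i,j) + of_bool (i : I) * s i * X (m,j)) = pf v X"
proof -
 have "finite I" using I finite_subset by blast
 thus ?thesis using I
 proof (induction I rule: finite_induct)
  case (insert b I)
  let ?Y = "%(i,j). X (i,j) + of_bool (i : I) * s i * X (m,j)"
  have b: "m < b" "b < N" "m \<notin> I" using insert.prems by auto
  have "pf v (%(i,j). X (i,j) + of_bool (i : insert b I) * s i * X (m,j)) = pf v (%c. ?Y c + s b * rowd m b ?Y c)"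
   using insert.hyps b by (intro pf_cong) (auto simp: rowd_def)
  also have "... = pf v ?Y" by (rule raised_inv(1)[OF v r b(1,2)])
  finally show ?case using insert by simp
 qed (simp add: case_prod_eta)
qed

lemma raised_elim_col: assumes v: "v : msp SD {0}" and r: "raised v" and I: "I \<subseteq> {m<..<N}"
 shows "pf v (%(i,j). X (i,j) + of_bool (j : I) * s j * X (i,m)) = pf v X"
proof -
 have "finite I" using I finite_subset by blast
 thus ?thesis using I
 proof (induction I rule: finite_induct)
  case (insert b I)
  let ?Y = "%(i,j). X (i,j) + of_bool (j : I) * s j * X (i,m)"
  have b: "m < b" "b < N" "m \<notin> I" using insert.prems by auto
  have "pf v (%(i,j). X (i,j) + of_bool (j : insert b I) * s j * X (i,m)) = pf v (%c. ?Y c + s b * cold m b ?Y c)"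
   using insert.hyps b by (intro pf_cong) (auto simp: cold_def)
  also have "... = pf v ?Y" by (rule raised_inv(2)[OF v r b(1,2)])
  finally show ?case using insert by simp
 qed (simp add: case_prod_eta)
qed

definition FD :: "fmat => (nat => complex) => complex" where "FD v d = pf v (%(i,j). if i = j then d i else 0)"

text \<open>Gaussian elimination reduces X to a diagonal matrix.\<close>

lemma raised_diag: assumes v: "v : msp SD {0}" and r: "raised v" and F0: "!!d. FD v d = 0"
 shows "pf v X = 0"
proof -
 have "pf v X = 0" if "m <= N" "!!i j. i < N ==> j < N ==> i ~= j ==> min i j < m ==> X (i,j) = 0" for m X
  using that
 proof (induction m arbitrary: X rule: inc_induct)
  case base
  have "pf v X = FD v (%i. X (i,i))" unfolding FD_def using base by (intro pf_cong) auto
  thus ?case using F0 by simp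
 next
  case (step m)
  \<comment> \<open>The case of a nonzero pivot: its column and then its row are cleared, which
    leads to the induction hypothesis for m + 1.\<close>
  have piv: "pf v Z = 0" if Z: "!!i j. i < N ==> j < N ==> i ~= j ==> min i j < m ==> Z (i,j) = 0" "Z (m,m) ~= 0" for Z
  proof -
   define Z1 where "Z1 = (%(i,j). Z (i,j) + of_bool (i : {m<..<N}) * (- Z (i,m) / Z (m,m)) * Z (m,j))"
   define Z2 where "Z2 = (%(i,j). Z1 (i,j) + of_bool (j : {m<..<N}) * (- Z1 (m,j) / Z1 (m,m)) * Z1 (i,m))"
   have "pf v Z2 = pf v Z1" unfolding Z2_def by (rule raised_elim_col[OF v r]) simp
   moreover have "pf v Z1 = pf v Z" unfolding Z1_def by (rule raised_elim_row[OF v r]) simp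
   moreover have "pf v Z2 = 0"
   proof (rule step.IH)
    fix i j assume ij: "i < N" "j < N" "i ~= j" "min i j < Suc m"
    have Z1m: "Z1 (i,m) = 0" if "i < N" "i ~= m" for i
    proof (cases "i < m")
     case True
     thus ?thesis using Z(1)[of i m] that step.hyps by (simp add: Z1_def)
    next
     case False
     thus ?thesis using Z(2) that by (simp add: Z1_def)
    qed
    have Z1z: "Z1 (i,j) = 0" if "i < N" "j < N" "i ~= j" "min i j < m" for i j
     using that Z by (cases "i < m"; cases "j < m") (auto simp: Z1_def)
    have Zm: "Z1 (m,m) ~= 0" using Z(2) by (simp add: Z1_def)
    consider "min i j < m" | "i = m" "m < j" | "j = m" "m < i" using ij by (cases "i <= j") (auto simp: min_def less_Suc_eq)
    thus "Z2 (i,j) = 0"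
    proof cases
     case 1
     hence "Z1 (i,j) = 0" using Z1z ij by blast
     moreover have "of_bool (j : {m<..<N}) * Z1 (m,j) * Z1 (i,m) = 0"
     proof (cases "m < j")
      case True
      hence "i < m" using 1 by (auto simp: min_def split: if_splits)
      thus ?thesis using Z1z[of i m] ij step.hyps by simp
     qed simp
     ultimately show ?thesis by (auto simp: Z2_def)
    next
     case 2
     thus ?thesis using Zm ij by (simp add: Z2_def)
    next
     case 3
     thus ?thesis using Z1m ij by (simp add: Z2_def)
    qed
   qed
   ultimately show ?thesis by simp
  qed
  \<comment> \<open>A zero pivot is avoided by varying the entry (m, m): for all but one s it is
    nonzero.\<close>
  define Y :: "nat \<times> nat => complex" where "Y c = of_bool (c = (m,m))" for c
  have "pf v (%c. X c + 0 * Y c) = 0"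
  proof (rule pf_zero_extend)
   have "UNIV = insert (- X (m,m)) {s. s ~= - X (m,m)}" by auto
   thus "infinite {s. s ~= - X (m,m)}" using infinite_UNIV_char_0[where 'a = complex] by (metis finite_insert)
   fix s assume "s : {s. s ~= - X (m,m)}"
   thus "pf v (%c. X c + s * Y c) = 0" using step.prems by (intro piv) (auto simp: Y_def add_eq_0_iff)
  qed
  thus ?case by simp
 qed
 from this[of 0 X] show ?thesis by simp
qed

lemma pf_homog: "pf v (%c. z * X c) = z ^ k * pf v X"
 by (simp add: pf_def prod.distrib sum_distrib_left mult_ac)

lemma FD_homog: "FD v (%i. z * d i) = z ^ k * FD v d"
 unfolding FD_def pf_homog[symmetric] by (rule pf_cong) auto

lemma FD_cong: "(!!i. i < N ==> d i = d' i) ==> FD v d = FD v d'"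
 unfolding FD_def by (rule pf_cong) auto

lemma FD_wv: assumes w: "R.wv p v" and u: "u : TT N"
 shows "FD v (%i. u i * cnj (u (2*N - 1 - i)) * d i) = chi N p u * FD v d"
proof -
 have v: "v : msp SD {0}" using w by (rule R.wv_in)
 have "FD v (%i. u i * cnj (u (2*N - 1 - i)) * d i) = pf (rho (tor N u) * v) (%(i,j). if i = j then d i else 0)"
  unfolding FD_def pf_tor[OF v] by (rule pf_cong) auto
 also have "rho (tor N u) * v = csc (chi N p u) v" using w u by (simp add: R.wv_def)
 finally show ?thesis by (simp add: pf_csc FD_def)
qed

lemma unit_root: assumes "cmod w = 1" "n > 0" shows "EX z. cmod z = 1 & z ^ n = w"
proof -
 obtain p where "w = cis (2 * pi * p)" using unit_cis[OF assms(1)] by blast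
 moreover have "cis (2 * pi * p / n) ^ n = cis (real n * (2 * pi * p / n))" by (rule Complex.DeMoivre)
 moreover have "real n * (2 * pi * p / n) = 2 * pi * p" using assms(2) by simp
 ultimately have "cis (2 * pi * p / n) ^ n = w" by simp
 thus ?thesis by (intro exI[of _ "cis (2 * pi * p / n)"]) simp
qed

text \<open>Dividing d by an N-th root z of its product gives an element of the torus with trivial
  second block; homogeneity of degree k accounts for z.\<close>

lemma FD_unit: assumes w: "R.wv p v" and d: "!!i. i < N ==> cmod (d i) = 1"
 shows "EX c. c ~= 0 & FD v d = c * FD v (%_. 1)"
proof -
 have "cmod (\<Prod>i<N. d i) = 1" unfolding prod_norm[symmetric] using d by (intro prod.neutral) auto
 then obtain z where z: "cmod z = 1" "z ^ N = (\<Prod>i<N. d i)" using unit_root N2 by (metis gr0I not_numeral_le_zero)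
 define u where "u i = (if i < N then d i / z else 1)" for i
 have z0: "z ~= 0" using z by auto
 have "(\<Prod>i<N. u i) = (\<Prod>i<N. d i / z)" by (intro prod.cong refl) (simp add: u_def)
 also have "... = (\<Prod>i<N. d i) / z ^ N" by (subst prod_dividef) simp
 also have "... = 1" unfolding z(2)[symmetric] using z0 by simp
 finally have u: "u : TT N" using z d by (auto simp: TT_def u_def norm_divide)
 have "FD v d = FD v (%i. z * (u i * cnj (u (2*N - 1 - i)) * 1))" using z0 by (intro FD_cong) (auto simp: u_def)
 also have "... = (z ^ k * chi N p u) * FD v (%_. 1)" unfolding FD_homog FD_wv[OF w u] by (simp only: mult.assoc)
 finally show ?thesis using z0 chi_unit[OF u, of p] by (intro exI[of _ "z ^ k * chi N p u"]) auto
qed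

text \<open>Diagonals with unit entries are covered by \<open>FD_unit\<close>. The coordinates are
  then freed one at a time, since a polynomial that vanishes on the unit circle is 0.\<close>

lemma FD_zero: assumes w: "R.wv p v" and F1: "FD v (%_. 1) = 0" shows "FD v d = 0"
proof -
 have "FD v d = 0" if "m <= N" "!!i. m <= i ==> i < N ==> cmod (d i) = 1" for m d using that
 proof (induction m arbitrary: d)
  case 0
  thus ?case using FD_unit[OF w, of d] F1 by auto
 next
  case (Suc m)
  let ?X = "%(i,j). if i = j & i ~= m then d i else 0" and ?Y = "%c. of_bool (c = (m,m))"
  have e: "pf v (%c. ?X c + s * ?Y c) = FD v (d(m := s))" for s unfolding FD_def
  proof (rule pf_cong)
   fix c
   show "?X c + s * ?Y c = (case c of (i,j) => if i = j then (d(m := s)) i else 0)" by (cases c; cases "fst c = snd c"; cases "fst c = m") auto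
  qed
  have "pf v (%c. ?X c + d m * ?Y c) = 0"
  proof (rule pf_zero_extend)
   have "connected (sphere (0::complex) 1)" by (rule connected_sphere) simp
   moreover have "(1::complex) : sphere 0 1" "(-1::complex) : sphere 0 1" "(1::complex) ~= -1" by auto
   ultimately show "infinite (sphere (0::complex) 1)" by (metis connected_finite_iff_sing empty_iff singletonD)
   fix s :: complex assume "s : sphere 0 1"
   thus "pf v (%c. ?X c + s * ?Y c) = 0" unfolding e using Suc.prems by (intro Suc.IH) auto
  qed
  thus ?case unfolding e by simp
 qed
 from this[of N d] show ?thesis by simp
qed

section \<open>Highest weight vectors of the symmetric power\<close>

definition HV :: "(nat => int) => fmat => bool" where "HV p v \<longleftrightarrow> R.hwv p v & PS * v = v"

text \<open>For the last claim: vanishing at the identity matrix would spread to all diagonal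
  matrices, by elimination to all matrices, and make v zero.\<close>

lemma HV_D: assumes "HV p v" shows "R.wv p v" "v : msp SD {0}" "v ~= 0" "raised v" "PS * v = v" "FD v (%_. 1) ~= 0"
proof -
 show *: "R.wv p v" "v ~= 0" "raised v" "PS * v = v" using assms by (auto simp: HV_def R.hwv_def raised_def)
 show v: "v : msp SD {0}" using * R.wv_in by blast
 show "FD v (%_. 1) ~= 0"
 proof
  assume "FD v (%_. 1) = 0"
  hence "FD v d = 0" for d by (rule FD_zero[OF *(1)])
  hence "pf v X = 0" for X by (rule raised_diag[OF v *(3)])
  thus False using pf_inj[OF v *(4)] *(2) by blast
 qed
qed

lemma powi_inj: assumes "!!z. cmod z = 1 ==> z powi a = z powi b" shows "a = b"
proof -
 have "circ_mean (%z. z powi (a - b)) = circ_mean (%z. z powi 0)"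
  unfolding circ_mean_def by (intro integral_cong) (simp add: power_int_diff assms)
 thus ?thesis unfolding circ_mean_powi by (simp split: if_splits)
qed

text \<open>On the matrix with block [[a, 1], [1, 0]] in rows and columns m - 1 and m, which elimination reduces to diag (a, - 1/a),
 the polynomial is a constant multiple of the p m-th power of a.\<close>

lemma HV_pos: assumes h: "HV p v" and m: "1 <= m" "m < N" shows "p m >= 0"
proof (rule ccontr)
 assume neg: "~ p m >= 0"
 note h' = HV_D[OF h]
 let ?l = "m - 1"
 have lm: "?l < m" "m ~= ?l" using m by auto
 define X :: "nat \<times> nat => complex" where "X = (%(i,j). if i = ?l & j = m \<or> i = m & j = ?l \<or> i = j & i ~= ?l & i ~= m then 1 else 0)"
 define Y :: "nat \<times> nat => complex" where "Y = (%(i,j). if i = ?l & j = ?l then 1 else 0)"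
 define d' :: "nat => complex" where "d' i = (if i = m then -1 else 1)" for i
 obtain P where P: "!!s. pf v (%c. X c + s * Y c) = poly P s" using pf_poly by blast
 have "cmod (d' i) = 1" for i by (simp add: d'_def)
 then obtain C where C: "FD v d' = C" "C ~= 0" using FD_unit[OF h'(1), of d'] h'(6) by force
 have key: "poly P a = a powi p m * C" if a: "cmod a = 1" for a
 proof -
  have a0: "a ~= 0" using a by auto
  have "a * cnj a = 1" using complex_norm_square[of a] a by simp
  hence ca: "cnj a = 1 / a" using a0 by (simp add: field_simps)
  define Z where "Z c = X c + a * Y c" for c
  define Z1 where "Z1 c = Z c + (- 1 / a) * rowd ?l m Z c" for c
  define Z2 where "Z2 c = Z1 c + (- 1 / a) * cold ?l m Z1 c" for c
  have "pf v Z2 = pf v Z" unfolding Z2_def Z1_def by (simp only: raised_inv[OF h'(2,4) lm(1) m(2)])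
  moreover have "pf v Z2 = FD v (%i. cr m a i * cnj (cr m a (2*N - 1 - i)) * d' i)" unfolding FD_def
  proof (rule pf_cong)
   fix c assume "c : LL"
   then obtain i j where c: "c = (i,j)" "i < N" "j < N" by auto
   have "cr m a (2*N - 1 - i) = 1" using c m by (auto simp: cr_def)
   moreover have "Z2 (i,j) = (if i = j then cr m a i * d' i else 0)"
    using a0 lm by (auto simp: Z2_def Z1_def Z_def X_def Y_def rowd_def cold_def cr_def d'_def ca)
   ultimately show "Z2 c = (case c of (i,j) => if i = j then cr m a i * cnj (cr m a (2*N - 1 - i)) * d' i else 0)"
    by (simp only: c prod.case complex_cnj_one mult_1_right)
  qed
  moreover have "m : KK N" using m by (auto simp: KK_def)
  hence "FD v (%i. cr m a i * cnj (cr m a (2*N - 1 - i)) * d' i) = a powi p m * C"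
   by (simp only: FD_wv[OF h'(1) cr_TT[OF _ a]] chi_cr[OF _ a] C(1))
  ultimately have "pf v Z = a powi p m * C" by simp
  thus ?thesis using P[of a] unfolding Z_def by simp
 qed
 \<comment> \<open>On the circle C = z^(- p m) P(z). If p m is negative, all exponents on the right
   are positive and their means are 0, while the left side has mean C.\<close>
 have "circ_mean (%z. C * z powi 0) = circ_mean (%z. \<Sum>i\<le>degree P. poly.coeff P i * z powi (int i - p m))"
  unfolding circ_mean_def
 proof (rule integral_cong)
  fix th :: real
  let ?z = "cis (2 * pi * th)"
  have z: "cmod ?z = 1" "?z ~= 0" by auto
  have "C = ?z powi (- p m) * poly P ?z" using z(2) by (simp add: key power_int_minus)
  also have "... = (\<Sum>i\<le>degree P. poly.coeff P i * ?z powi (int i - p m))"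
   using z(2) by (simp add: poly_altdef sum_distrib_left power_int_diff power_int_minus field_simps)
  finally show "C * ?z powi 0 = (\<Sum>i\<le>degree P. poly.coeff P i * ?z powi (int i - p m))" by simp
 qed
 also have "... = (\<Sum>i\<le>degree P. circ_mean (%z. poly.coeff P i * z powi (int i - p m)))"
  by (intro circ_mean_sum finite_atMost continuous_intros ccont_powi)
 also have "... = 0" using neg by (simp only: circ_mean_cmul circ_mean_powi) (auto intro!: sum.neutral)
 finally show False using C(2) by (simp only: circ_mean_cmul circ_mean_powi) simp
qed

text \<open>On diagonal matrices the coroots m and 2N - m act by the same factors, and the value at
  the identity is nonzero.\<close>

lemma HV_sym: assumes h: "HV p v" and m: "1 <= m" "m < N" shows "p (2*N - m) = p m"
proof (rule powi_inj)
 fix z :: complex assume z: "cmod z = 1"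
 note h' = HV_D[OF h]
 have K: "m : KK N" "2*N - m : KK N" using m by (auto simp: KK_def)
 have zz: "z * cnj z = 1" using complex_norm_square[of z] z by simp
 have "FD v (%i. cr (2*N - m) z i * cnj (cr (2*N - m) z (2*N - 1 - i)) * 1) = FD v (%i. cr m z i * cnj (cr m z (2*N - 1 - i)) * 1)"
 proof (rule FD_cong)
  fix i assume i: "i < N"
  have 1: "cr (2*N - m) z i = 1" "cr m z (2*N - 1 - i) = 1" using i m by (auto simp: cr_def)
  have e1: "2*N - 1 - i = 2*N - m - 1 \<longleftrightarrow> i = m" using i m by auto
  have e2: "2*N - 1 - i = 2*N - m \<longleftrightarrow> i = m - 1" using i m by auto
  have "cnj (cr (2*N - m) z (2*N - 1 - i)) = cr m z i" unfolding cr_def e1 e2 using m by auto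
  thus "cr (2*N - m) z i * cnj (cr (2*N - m) z (2*N - 1 - i)) * 1 = cr m z i * cnj (cr m z (2*N - 1 - i)) * 1" using 1 by simp
 qed
 hence "chi N p (cr (2*N - m) z) = chi N p (cr m z)"
  unfolding FD_wv[OF h'(1) cr_TT[OF K(1) z]] FD_wv[OF h'(1) cr_TT[OF K(2) z]] using h'(6) by simp
 thus "z powi p (2*N - m) = z powi p m" by (simp add: chi_cr[OF _ z] K)
qed

text \<open>The diagonal matrix with entries 1, ..., 1, z^N is z times a torus element u.
  Homogeneity and the weight multiply the value at 1 by z^K, while as a polynomial the value
  contains only nonnegative powers of z^N. Hence K is a multiple r N with r >= 0.\<close>

lemma HV_degree: assumes h: "HV p v" shows "EX r. int k = (\<Sum>m=1..N - 1. int m * p m) + int N * int r"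
proof -
 note h' = HV_D[OF h]
 define K where "K = int k - (\<Sum>m=1..N - 1. int m * p m)"
 define c where "c a = ent v a 0 * of_bool (ALL l<k. fst (wd a l) = snd (wd a l))" for a
 \<comment> \<open>The number of slots holding the last diagonal variable, the only one that becomes
   z^N.\<close>
 define n where "n a = card {l. l < k & wd a l = (N - 1, N - 1)}" for a
 have eq: "z powi K * FD v (%_. 1) = (\<Sum>a<D. c a * z powi (int (N * n a)))" if z: "cmod z = 1" for z
 proof -
  have z0: "z ~= 0" using z by auto
  define u where "u i = (if i < N - 1 then inverse z else if i = N - 1 then z ^ (N - 1) else 1)" for i
  have pN: "(\<Prod>i<N. f i) = (\<Prod>i<N - 1. f i) * f (N - 1)" for f :: "nat => complex"
   using N2 prod.lessThan_Suc[of f "N - 1"] by simp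
  have uN: "u (N + i) = 1" for i using N2 by (auto simp: u_def)
  have X: "Xc u m = z powi (- int m)" if "m < N" for m
  proof -
   have "Xc u m = (\<Prod>i<m. inverse z)" unfolding Xc_def using that by (intro prod.cong refl) (auto simp: u_def)
   thus ?thesis by (simp add: power_int_minus power_inverse)
  qed
  have "(\<Prod>i<N. u i) = inverse z ^ (N - 1) * z ^ (N - 1)" unfolding pN by (simp add: u_def)
  hence "(\<Prod>i<N. u i) = 1" using z0 by (simp add: power_mult_distrib[symmetric])
  hence u: "u : TT N" using z unfolding TT_def by (auto simp: uN) (auto simp: u_def norm_power norm_inverse)
  have XN: "Xc u (N + m) = 1" for m
  proof -
   have "(\<Prod>i<N. u i) = 1" using u by (simp add: TT_def)
   moreover have "(PROD i:{N..<N + m}. u i) = 1" using N2 by (intro prod.neutral) (auto simp: u_def)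
   ultimately show ?thesis unfolding Xc_def using prod.atLeastLessThan_concat[of 0 N "N + m" u] by (simp add: lessThan_atLeast0)
  qed
  have "chi N p u = (\<Prod>m=1..N - 1. z powi (- (int m * p m)))"
   unfolding chi_def prod_KK XN by (auto intro!: prod.cong simp: X power_int_mult[symmetric])
  also have "... = z powi (- (\<Sum>m=1..N - 1. int m * p m))"
   using prod_powi_sum[OF _ z0, of "{1..N - 1}" "%m. - (int m * p m)"] by (simp only: sum_negf finite_atLeastAtMost)
  finally have chi: "chi N p u = z powi (- (\<Sum>m=1..N - 1. int m * p m))" .
  have "z powi K * FD v (%_. 1) = z ^ k * (chi N p u * FD v (%_. 1))"
   using z0 by (simp add: K_def chi power_int_diff power_int_minus field_simps)
  also have "... = FD v (%i. z * (u i * cnj (u (2*N - 1 - i)) * 1))" by (simp only: FD_homog FD_wv[OF h'(1) u])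
  also have "... = FD v (%i. if i = N - 1 then z ^ N else 1)"
   using z0 N2 by (intro FD_cong) (auto simp: u_def power_eq_if)
  also have "... = (\<Sum>a<D. c a * z powi (int (N * n a)))" unfolding FD_def pf_def
  proof (intro sum.cong refl)
   fix a assume a: "a : SD"
   show "ent v a 0 * (\<Prod>l<k. case wd a l of (i,j) => if i = j then (if i = N - 1 then z ^ N else 1) else 0) = c a * z powi (int (N * n a))"
   proof (cases "ALL l<k. fst (wd a l) = snd (wd a l)")
    case True
    have "(\<Prod>l<k. case wd a l of (i,j) => if i = j then (if i = N - 1 then z ^ N else 1) else 0) = (\<Prod>l<k. if wd a l = (N - 1, N - 1) then z ^ N else 1)"
     using True by (intro prod.cong refl) (auto simp: case_prod_beta prod_eq_iff)
    also have "... = (PROD l:{l\<in>{..<k}. wd a l = (N - 1, N - 1)}. z ^ N)" by (rule prod.inter_filter[symmetric]) simp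
    also have "... = z ^ (N * n a)" by (simp add: n_def power_mult)
    finally show ?thesis using True by (simp add: c_def del: of_nat_mult)
   next
    case False
    then obtain l where l: "l < k" "fst (wd a l) ~= snd (wd a l)" by blast
    have "(\<Prod>l<k. case wd a l of (i,j) => if i = j then (if i = N - 1 then z ^ N else 1) else 0) = 0"
     by (rule prod_zero[OF finite_lessThan], rule bexI[of _ l]) (use l in \<open>auto simp: case_prod_beta\<close>)
    moreover have "c a = 0" using False by (simp add: c_def)
    ultimately show ?thesis by (simp only: mult_zero_left mult_zero_right)
   qed
  qed
  finally show ?thesis .
 qed
 have "circ_mean (%z. FD v (%_. 1) * z powi 0) = circ_mean (%z. \<Sum>a<D. c a * z powi (int (N * n a) - K))"
  unfolding circ_mean_def
 proof (rule integral_cong)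
  fix th :: real
  let ?z = "cis (2 * pi * th)"
  have z: "cmod ?z = 1" "?z ~= 0" by auto
  have "FD v (%_. 1) = ?z powi (- K) * (\<Sum>a<D. c a * ?z powi (int (N * n a)))"
   unfolding eq[OF z(1), symmetric] using z(2) by (simp add: power_int_minus)
  also have "... = (\<Sum>a<D. c a * ?z powi (int (N * n a) - K))"
   using z(2) by (simp add: sum_distrib_left power_int_diff power_int_minus field_simps)
  finally show "FD v (%_. 1) * ?z powi 0 = (\<Sum>a<D. c a * ?z powi (int (N * n a) - K))" by simp
 qed
 also have "... = (\<Sum>a<D. circ_mean (%z. c a * z powi (int (N * n a) - K)))"
  by (intro circ_mean_sum finite_lessThan continuous_intros ccont_powi)
 also have "... = (\<Sum>a<D. c a * (if int (N * n a) - K = 0 then 1 else 0))" by (simp only: circ_mean_cmul circ_mean_powi)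
 finally have "(\<Sum>a<D. c a * (if int (N * n a) - K = 0 then 1 else 0)) ~= 0" using h'(6) by (simp only: circ_mean_cmul circ_mean_powi) simp
 then obtain a where "c a * (if int (N * n a) - K = 0 then 1 else 0) ~= 0" by (rule sum.not_neutral_contains_not_neutral)
 hence "int (N * n a) = K" by (auto split: if_splits)
 thus ?thesis by (intro exI[of _ "n a"]) (simp add: K_def)
qed

text \<open>The combination w of the two vectors that vanishes at the identity matrix would again be
  a highest weight vector if it were nonzero, contrary to \<open>HV_D\<close>.\<close>

lemma HV_unique: assumes h: "HV p v" and h': "HV p' v'" and eq: "!!m. 1 <= m ==> m < N ==> p m = p' m"
 shows "EX c. c ~= 0 & v' = csc c v"
proof -
 note v = HV_D[OF h] and v' = HV_D[OF h']
 have pp: "p' m = p m" if m: "m : KK N" for m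
 proof (cases "m < N")
  case False
  hence "m = 2*N - (2*N - m)" "1 <= 2*N - m" "2*N - m < N" using m by (auto simp: KK_def)
  thus ?thesis using HV_sym[OF h, of "2*N - m"] HV_sym[OF h', of "2*N - m"] eq[of "2*N - m"] by simp
 qed (use eq m in \<open>auto simp: KK_def\<close>)
 have w': "R.wv p v'" using v'(1) R.wv_cong[of p' p v'] pp by simp
 define a b where "a = FD v (%_. 1)" "b = FD v' (%_. 1)"
 define w where "w = csc a v' - csc b v"
 have ab: "a ~= 0" "b ~= 0" using v(6) v'(6) by (auto simp: a_b_def)
 have "w = 0"
 proof (rule ccontr)
  assume "w ~= 0"
  have "HV p w" unfolding HV_def R.hwv_def
  proof (intro conjI allI impI \<open>w ~= 0\<close>)
   show "R.wv p w" unfolding w_def by (rule wv_csc_diff[OF R.su_rep_axioms w' v(1)])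
   show "R.phi (Eu i j) * w = 0" if "bd N i j" "i < j" for i j
    using v(4) v'(4) that by (simp add: raised_def w_def right_diff_distrib)
   show "PS * w = w" by (simp add: w_def right_diff_distrib v(5) v'(5))
  qed
  hence "FD w (%_. 1) ~= 0" by (rule HV_D(6))
  thus False by (simp add: w_def FD_def pf_diff pf_csc) (simp add: a_b_def FD_def)
 qed
 hence "csc a v' = csc b v" by (simp add: w_def)
 hence "csc (inverse a) (csc a v') = csc (inverse a) (csc b v)" by simp
 hence "v' = csc (inverse a * b) v" using ab by simp
 thus ?thesis using ab by (intro exI[of _ "inverse a * b"]) simp
qed

text \<open>Under the torus the minor of size m is multiplied by
  \<open>Xc t m * Xc t (2*N - m)\<close>, which places its exponent at the labels m and 2N - m. The
  full determinant is invariant; its power r only adjusts the degree.\<close>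

lemma HV_exists:
 assumes n: "(\<Sum>m=1..N - 1. m * n m) + N * r = k"
 shows "EX v. HV (lab N (%m. int (n m)) (%m. int (n (N - m)))) v"
proof -
 let ?p = "lab N (%m. int (n m)) (%m. int (n (N - m)))"
 define H where "H X = (\<Prod>m=1..N - 1. minor m X ^ n m) * minor N X ^ r" for X
 have "hpoly LL ((\<Sum>m=1..N - 1. n m * m) + r * N) H" unfolding H_def
  by (intro hpoly_mult hpoly_prod hpoly_pow minor_hpoly) auto
 hence "hpoly LL k H" using n by (simp add: mult.commute)
 then obtain g where g: "!!X. H X = (SUM w:PiE {..<k} (%_. LL). g w * (\<Prod>l<k. X (w l)))"
  using hpoly_tensor finL by blast
 define u where "u = mk SD {0} (%a _. g (wd a))"
 define v where "v = PS * u"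
 have u: "u : msp SD {0}" by (simp add: u_def)
 have v: "v : msp SD {0}" unfolding v_def by (rule msp_mult[OF PS_in u])
 have Pv: "PS * v = v" by (simp add: v_def mult.assoc[symmetric] PS_idem)
 have pfv: "pf v X = H X" for X
 proof -
  have "pf u X = (\<Sum>a<D. g (wd a) * (\<Prod>l<k. X (wd a l)))" by (simp add: pf_def u_def ent_mk)
  also have "... = H X" unfolding g by (simp only: sum_wd[of "%w. g w * (\<Prod>l<k. X (w l))"] WW_def)
  finally show ?thesis by (simp add: v_def pf_PS[OF u])
 qed
 have r: "raised v"
 proof (rule raisedI[OF v Pv])
  fix a b :: nat and X :: "nat \<times> nat => complex" and s assume ab: "a < b" "b < N"
  have "(%c. X c + s * rowd a b X c) = (%(i,j). X (i,j) + s * (of_bool (i = b) * X (a,j)))"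
   "(%c. X c + s * cold a b X c) = (%(i,j). X (i,j) + s * (of_bool (j = b) * X (i,a)))"
   by (auto simp: rowd_def cold_def fun_eq_iff)
  thus "pf v (%c. X c + s * rowd a b X c) = pf v X" "pf v (%c. X c + s * cold a b X c) = pf v X"
   by (simp_all only: pfv H_def minor_row[OF ab(1)] minor_col[OF ab(1)])
 qed
 have H1: "pf v (%(i,j). if i = j then 1 else 0) = 1" by (simp add: pfv H_def minor_diag)
 hence v0: "v ~= 0" using pf_0 by auto
 have w: "R.wv ?p v" unfolding R.wv_def
 proof (intro conjI v ballI)
  fix t assume t: "t : TT N"
  have T: "minor m (%(i,j). t i * cnj (t (2*N - 1 - j)) * X (i,j)) = Xc t m * Xc t (2*N - m) * minor m X" if "m <= N" for m X
   unfolding minor_scale[of m t "%j. cnj (t (2*N - 1 - j))" X] Xc_rev[OF t that] by (simp add: Xc_def)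
  have XN: "Xc t N = 1" using t by (simp add: Xc_def TT_def)
  have rev: "(\<Prod>m=1..N - 1. f (N - m)) = (\<Prod>m=1..N - 1. f m)" for f :: "nat => complex"
   by (rule prod.reindex_bij_witness[of _ "%m. N - m" "%m. N - m"]) auto
  have chi: "chi N ?p t = (\<Prod>m=1..N - 1. Xc t m ^ n m) * (\<Prod>m=1..N - 1. Xc t (2*N - m) ^ n m)"
  proof -
   have "(\<Prod>m=1..N - 1. Xc t m powi ?p m) = (\<Prod>m=1..N - 1. Xc t m ^ n m)" by (intro prod.cong refl) (auto simp: lab_def)
   moreover have "(\<Prod>m=1..N - 1. Xc t (N + m) powi ?p (N + m)) = (\<Prod>m=1..N - 1. Xc t (2*N - (N - m)) ^ n (N - m))"
   proof (intro prod.cong refl)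
    fix m assume "m : {1..N - 1}"
    hence "2*N - (N - m) = N + m" by auto
    thus "Xc t (N + m) powi ?p (N + m) = Xc t (2*N - (N - m)) ^ n (N - m)" by (simp add: lab_def)
   qed
   ultimately show ?thesis unfolding chi_def prod_KK by (simp only: rev[of "%m. Xc t (2*N - m) ^ n m"])
  qed
  have HT: "H (%(i,j). t i * cnj (t (2*N - 1 - j)) * X (i,j)) = chi N ?p t * H X" for X
  proof -
   have "(\<Prod>m=1..N - 1. minor m (%(i,j). t i * cnj (t (2*N - 1 - j)) * X (i,j)) ^ n m) = (\<Prod>m=1..N - 1. (Xc t m * Xc t (2*N - m) * minor m X) ^ n m)"
    by (intro prod.cong refl arg_cong[where f = "%x. x ^ _"] T) auto
   thus ?thesis unfolding H_def chi T[OF order_refl] using XN by (simp add: power_mult_distrib prod.distrib mult_ac)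
  qed
  let ?d = "rho (tor N t) * v - csc (chi N ?p t) v"
  have "?d = 0"
  proof (rule pf_inj)
   show "?d : msp SD {0}" by (intro msp_closed msp_mult[OF _ v]) (auto simp: rho_def v)
   have "PS * (rho (tor N t) * v) = rho (tor N t) * v"
    unfolding mult.assoc[symmetric] rho_def tp_PS[symmetric] by (simp add: mult.assoc Pv)
   thus "PS * ?d = ?d" by (simp add: right_diff_distrib Pv)
   show "pf ?d X = 0" for X unfolding pf_diff pf_csc pf_tor[OF v] pfv HT by simp
  qed
  thus "rho (tor N t) * v = csc (chi N ?p t) v" by simp
 qed
 have "HV ?p v" using w v0 r Pv by (auto simp: HV_def R.hwv_def raised_def)
 thus ?thesis by blast
qed

end

lemma tendsto_sandwich_mult:
 assumes S: "finite S" and A: "!!m. A m : msp S S" "G : msp S S" and l: "!!i j. (%m. ent (A m) i j) \<longlonglongrightarrow> ent G i j"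
 shows "(%m. ent (K * A m * L) a b) \<longlonglongrightarrow> ent (K * G * L) a b"
proof -
 have K: "ent (K * M * L) a b = (SUM j:S. (SUM i:S. ent K a i * ent M i j) * ent L j b)" if M: "M : msp S S" for M
 proof -
  have "ent (K * M) a j ~= 0 ==> j : S" for j
   using M ent_mult[of S K a M j] S by (metis (no_types, lifting) mspD mult_zero_right sum.neutral)
  hence "ent (K * M * L) a b = (SUM j:S. ent (K * M) a j * ent L j b)" by (intro ent_mult S) auto
  also have "... = (SUM j:S. (SUM i:S. ent K a i * ent M i j) * ent L j b)"
   using M S by (intro sum.cong refl arg_cong2[where f = "(*)"] ent_mult) (auto simp: msp_def)
  finally show ?thesis .
 qed
 show ?thesis unfolding K[OF A(1)] K[OF A(2)] by (intro tendsto_intros l)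
qed

lemma tr_e: "tr (e {..<r}) = of_nat r"
proof -
 have "tr (e {..<r}) = (\<Sum>i<r. ent (e {..<r}) i i)" by (rule tr_msp[of _ _ "{..<r}"]) auto
 thus ?thesis by (simp add: ent_dg)
qed

lemma msp_empty: "A : msp S {..<0} ==> A = 0" by (rule fmat_eqI) (auto simp: msp_def)

section \<open>Decomposition of the symmetric power into irreducible pieces\<close>

context bifund
begin

abbreviation "labn n == lab N (%m. int (n m)) (%m. int (n (N - m)))"

text \<open>B is an orthonormal basis of an invariant subspace of the symmetric tensors, and
  \<open>subr B\<close> is the representation on it in these coordinates.\<close>

definition good :: "nat => fmat => bool" where
 "good r B \<longleftrightarrow> isometry SD r B & PS * B = B & (ALL U:GG N. B * star B * rho U * B = rho U * B)"

definition subr :: "fmat => fmat => fmat" where "subr B U = star B * rho U * B"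

lemma goodD: assumes "good r B"
 shows "B : msp SD {..<r}" "star B : msp {..<r} SD" "star B * B = e {..<r}" "PS * B = B" "U : GG N ==> B * subr B U = rho U * B"
 using assms by (auto simp: good_def isometry_def subr_def mult.assoc)

lemma rho_in': "rho U : msp SD SD" by (simp add: rho_def)

lemma sub_rep: assumes g: "good r B" shows "su_rep N r (subr B)"
proof
 note B = goodD[OF g]
 show "subr B U : msp {..<r} {..<r}" for U unfolding subr_def by (rule msp_mult[OF msp_mult[OF B(2) rho_in'] B(1)])
 show "subr B (U * V) = subr B U * subr B V" if "U : GG N" "V : GG N" for U V
 proof -
  have "subr B (U * V) = star B * rho U * (rho V * B)" by (simp add: subr_def rho_mult'[OF GG_simps(1)[OF that(1)]] mult.assoc)
  also have "... = subr B U * subr B V" unfolding B(5)[OF that(2), symmetric] by (simp add: subr_def mult.assoc)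
  finally show ?thesis .
 qed
 have "star B * (e SD * B) = e {..<r}" by (simp only: e_mult[OF finite_lessThan B(1)] B(3))
 thus "subr B (e {..<2 * N}) = e {..<r}" by (simp only: subr_def rho_one' mult.assoc)
 show "(%m. ent (subr B (A m)) a b) \<longlonglongrightarrow> ent (subr B G) a b"
  if "!!m. A m : GG N" "G : GG N" "!!i j. (%m. ent (A m) i j) \<longlonglongrightarrow> ent G i j" for A G a b
  unfolding subr_def by (rule tendsto_sandwich_mult[of SD]) (use that in \<open>auto intro: rho_in' R.rho_cont\<close>)
qed (rule N2)

text \<open>Along one curve B intertwines the two representations exactly, so the linear terms are
  intertwined as well.\<close>

lemma sub_dr: assumes g: "good r B" and X: "X : KA N" shows "B * su_rep.dr N r (subr B) X = R.dr X * B"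
proof -
 interpret S: su_rep N r "subr B" by (rule sub_rep[OF g])
 note B = goodD[OF g]
 obtain ga where c: "!!t. ga t : GG N" "sm 2 (%t. ga t - e {..<2*N} - csc (of_real t) X)"
  "sm 2 (%t. subr B (ga t) - e {..<r} - csc (of_real t) (S.dr X))"
  using S.DR_dr[OF X] unfolding S.DR_def by blast
 have d: "sm 2 (%t. rho (ga t) - e SD - csc (of_real t) (R.dr X))" by (rule R.DR_any[OF R.DR_dr[OF X] c(1,2)])
 define f where "f t = B * (subr B (ga t) - e {..<r} - csc (of_real t) (S.dr X)) - (rho (ga t) - e SD - csc (of_real t) (R.dr X)) * B" for t
 define A where "A = B * S.dr X - R.dr X * B"
 have f: "sm 2 f" unfolding f_def
 proof (rule sm_diff)
  show "sm 2 (%t. B * (subr B (ga t) - e {..<r} - csc (of_real t) (S.dr X)))" using sm_mult[OF sm_const c(3), of B] by (simp only: add_0)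
  show "sm 2 (%t. (rho (ga t) - e SD - csc (of_real t) (R.dr X)) * B)" using sm_mult[OF d sm_const, of B] by simp
 qed
 have "csc (of_real t) A + f t = 0" for t
  by (simp add: f_def A_def right_diff_distrib left_diff_distrib B(5)[OF c(1)] mult_e[OF finite_lessThan B(1)] e_mult[OF finite_lessThan B(1)] csc_distrib)
 hence "sm 2 (%t. csc (of_real t) A + f t)" by (simp add: smI[of 1 0])
 hence "A = 0" using f by (rule sm_2_lin)
 thus ?thesis by (simp add: A_def)
qed

lemma sub_phi: assumes g: "good r B" and Z: "Z : LA N" shows "B * su_rep.phi N r (subr B) Z = R.phi Z * B"
proof -
 interpret S: su_rep N r "subr B" by (rule sub_rep[OF g])
 show ?thesis unfolding S.phi_def R.phi_def
  using sub_dr[OF g R.KA_parts(1)[OF Z]] sub_dr[OF g R.KA_parts(2)[OF Z]] by (simp add: distrib_left distrib_right)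
qed

lemma good_inj: assumes g: "good r B" and w: "w : msp {..<r} {0}" shows "star B * (B * w) = w" "B * w = 0 \<longleftrightarrow> w = 0"
proof -
 show "star B * (B * w) = w" unfolding mult.assoc[symmetric] goodD(3)[OF g] by (rule e_mult[OF finite_lessThan w])
 thus "B * w = 0 \<longleftrightarrow> w = 0" by (metis mult_zero_right)
qed

lemma sub_wv: assumes g: "good r B" and w: "w : msp {..<r} {0}"
 shows "su_rep.wv N r (subr B) p w \<longleftrightarrow> R.wv p (B * w)"
proof -
 interpret S: su_rep N r "subr B" by (rule sub_rep[OF g])
 note B = goodD[OF g]
 have "subr B (tor N u) * w = csc (chi N p u) w \<longleftrightarrow> rho (tor N u) * (B * w) = csc (chi N p u) (B * w)" if u: "u : TT N" for u
 proof
  assume "subr B (tor N u) * w = csc (chi N p u) w"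
  thus "rho (tor N u) * (B * w) = csc (chi N p u) (B * w)"
   unfolding mult.assoc[symmetric] B(5)[OF tor_GG[OF u], symmetric] by (simp add: mult.assoc)
 next
  assume "rho (tor N u) * (B * w) = csc (chi N p u) (B * w)"
  hence "star B * (rho (tor N u) * (B * w)) = csc (chi N p u) (star B * (B * w))" by simp
  thus "subr B (tor N u) * w = csc (chi N p u) w" by (simp only: good_inj(1)[OF g w]) (simp add: subr_def mult.assoc)
 qed
 thus ?thesis unfolding S.wv_def R.wv_def using w msp_mult[OF B(1) w] by blast
qed

lemma sub_hwv: assumes g: "good r B" and w: "w : msp {..<r} {0}"
 shows "su_rep.hwv N r (subr B) p w \<longleftrightarrow> HV p (B * w)"
proof -
 interpret S: su_rep N r "subr B" by (rule sub_rep[OF g])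
 note B = goodD[OF g]
 have "S.phi (Eu i j) * w = 0 \<longleftrightarrow> R.phi (Eu i j) * (B * w) = 0" if "bd N i j" "i < j" for i j
 proof -
  have E: "Eu i j : LA N" using that by (intro Eu_LA) auto
  have m: "S.phi (Eu i j) * w : msp {..<r} {0}" by (rule msp_mult[OF S.phi_in[OF E] w])
  show ?thesis unfolding mult.assoc[symmetric] sub_phi[OF g E, symmetric] using good_inj(2)[OF g m] by (simp add: mult.assoc)
 qed
 moreover have "PS * (B * w) = B * w" by (simp add: mult.assoc[symmetric] B(4))
 ultimately show ?thesis unfolding S.hwv_def HV_def R.hwv_def sub_wv[OF g w] using good_inj(2)[OF g w] by blast
qed

lemma subr_star: "star (subr B U) = subr B (star U)" by (simp add: subr_def rho_star' mult.assoc)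

text \<open>W is a proper nonzero invariant subspace and \<open>W2\<close> its orthogonal
  complement, which is invariant because the representation respects adjoints.\<close>

lemma good_split:
 assumes g: "good r B" and r: "r > 0" and ni: "~ su_rep.irr N r (subr B)"
 shows "EX r1 B1 r2 B2. good r1 B1 & good r2 B2 & r1 < r & r2 < r & B1 * star B1 + B2 * star B2 = B * star B & star B1 * B2 = 0"
proof -
 interpret S: su_rep N r "subr B" by (rule sub_rep[OF g])
 note B = goodD[OF g]
 let ?V = "msp {..<r} {0}"
 obtain W where W: "csub W" "W \<subseteq> ?V" "!!U w. U : GG N ==> w : W ==> subr B U * w : W" "W ~= {0}" "W ~= ?V"
  using ni r unfolding S.irr_def by blast
 obtain r1 C where C: "isometry {..<r} r1 C" "!!v. v : ?V ==> v : W \<longleftrightarrow> C * star C * v = v" "!!w. w : msp {..<r1} {0} ==> C * w : W"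
  by (rule onb_exists[OF finite_lessThan W(1,2)]) blast
 define W2 where "W2 = {w : ?V. star C * w = 0}"
 have W2: "csub W2" "W2 \<subseteq> ?V" unfolding W2_def csub_def by (auto simp: distrib_left)
 obtain r2 C2 where C2: "isometry {..<r} r2 C2" "!!v. v : ?V ==> v : W2 \<longleftrightarrow> C2 * star C2 * v = v" "!!w. w : msp {..<r2} {0} ==> C2 * w : W2"
  by (rule onb_exists[OF finite_lessThan W2]) blast
 have c: "C : msp {..<r} {..<r1}" "star C * C = e {..<r1}" "C2 : msp {..<r} {..<r2}" "star C2 * C2 = e {..<r2}"
  using C(1) C2(1) by (auto simp: isometry_def)
 have cs: "star C : msp {..<r1} {..<r}" "star C2 : msp {..<r2} {..<r}" using c by auto
 have o: "star C * C2 = 0"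
 proof (rule mat_ext_vec)
  show "star C * C2 : msp {..<r1} {..<r2}" by (rule msp_mult[OF cs(1) c(3)])
  fix w assume "w : msp {..<r2} {0}"
  thus "star C * C2 * w = 0" using C2(3)[of w] by (simp add: W2_def mult.assoc)
 qed
 hence "star (star C * C2) = 0" by simp
 hence o': "star C2 * C = 0" by simp
 have sum: "C * star C + C2 * star C2 = e {..<r}"
 proof -
  have "C * star C + C2 * star C2 - e {..<r} = 0"
  proof (rule mat_ext_vec)
   show "C * star C + C2 * star C2 - e {..<r} : msp {..<r} {..<r}"
    by (intro msp_closed msp_mult[OF c(1) cs(1)] msp_mult[OF c(3) cs(2)] msp_dg)
   fix w assume w: "w : ?V"
   define w1 where "w1 = C * (star C * w)"
   have w1: "w1 : ?V" unfolding w1_def by (rule msp_mult[OF c(1) msp_mult[OF cs(1) w]])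
   have "star C * (w - w1) = star C * w - (star C * C) * (star C * w)" by (simp add: w1_def right_diff_distrib mult.assoc)
   also have "... = 0" by (simp add: c(2) e_mult[OF finite_lessThan msp_mult[OF cs(1) w]])
   finally have "w - w1 : W2" using w w1 by (auto simp: W2_def)
   hence "C2 * star C2 * (w - w1) = w - w1" using C2(2)[of "w - w1"] w w1 by auto
   moreover have "C2 * star C2 * w1 = 0"
   proof -
    have "C2 * star C2 * w1 = C2 * (star C2 * C) * (star C * w)" by (simp add: w1_def mult.assoc)
    thus ?thesis by (simp add: o')
   qed
   ultimately have "C2 * star C2 * w = w - w1" by (simp add: right_diff_distrib)
   thus "(C * star C + C2 * star C2 - e {..<r}) * w = 0"
    by (simp add: distrib_right left_diff_distrib e_mult[OF finite_lessThan w] w1_def mult.assoc)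
  qed
  thus ?thesis by simp
 qed
 have "tr (C * star C) + tr (C2 * star C2) = of_nat r" using arg_cong[OF sum, of tr] by (simp add: tr_e)
 hence "of_nat (r1 + r2) = (of_nat r :: complex)" by (simp add: tr_comm[of C] tr_comm[of C2] c(2,4) tr_e)
 hence rr: "r1 + r2 = r" by (simp only: of_nat_eq_iff)
 have r1p: "r1 > 0"
 proof (rule ccontr)
  assume "~ r1 > 0"
  hence C0: "C = 0" using c(1) msp_empty by simp
  have "v = 0" if "v : W" for v using C(2)[of v] that W(2) C0 by auto
  thus False using W(4) csubD(1)[OF W(1)] by blast
 qed
 have r2p: "r2 > 0"
 proof (rule ccontr)
  assume "~ r2 > 0"
  hence "C2 = 0" using c(3) msp_empty by simp
  hence "C * star C = e {..<r}" using sum by simp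
  hence "v : W" if "v : ?V" for v using C(2)[OF that] e_mult[OF finite_lessThan that] by simp
  thus False using W(2,5) by blast
 qed
 have inv1: "C * star C * subr B U * C = subr B U * C" if U: "U : GG N" for U
 proof -
  have sC: "subr B U * C : msp {..<r} {..<r1}" by (rule msp_mult[OF S.rho_in[OF U] c(1)])
  have "C * star C * subr B U * C - subr B U * C = 0"
  proof (rule mat_ext_vec)
   show "C * star C * subr B U * C - subr B U * C : msp {..<r} {..<r1}"
    by (intro msp_closed sC msp_mult[OF msp_mult[OF msp_mult[OF c(1) cs(1)] S.rho_in[OF U]] c(1)])
   fix w assume w: "w : msp {..<r1} {0}"
   have m: "subr B U * (C * w) : W" by (rule W(3)[OF U C(3)[OF w]])
   hence "C * star C * (subr B U * (C * w)) = subr B U * (C * w)" using C(2) W(2) by blast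
   thus "(C * star C * subr B U * C - subr B U * C) * w = 0" by (simp add: left_diff_distrib mult.assoc)
  qed
  thus ?thesis by simp
 qed
 have inv2: "C2 * star C2 * subr B U * C2 = subr B U * C2" if U: "U : GG N" for U
 proof -
  have "star C2 * subr B (star U) * C = star C2 * (C * star C * subr B (star U) * C)"
   using inv1[OF GG_star[OF U]] by (simp add: mult.assoc)
  also have "... = (star C2 * C) * (star C * subr B (star U) * C)" by (simp add: mult.assoc)
  finally have "star C2 * subr B (star U) * C = 0" by (simp add: o')
  hence "star (star C2 * subr B (star U) * C) = 0" by simp
  hence z: "star C * (subr B U * C2) = 0" by (simp add: subr_star mult.assoc)
  have "subr B U * C2 = (C * star C + C2 * star C2) * (subr B U * C2)"
   unfolding sum by (rule e_mult[OF finite_lessThan msp_mult[OF S.rho_in[OF U] c(3)], symmetric])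
  also have "... = C2 * star C2 * subr B U * C2" by (simp add: distrib_right mult.assoc z)
  finally show ?thesis by simp
 qed
 have gd: "good r' (B * C')" if C': "isometry {..<r} r' C'" and i: "!!U. U : GG N ==> C' * star C' * subr B U * C' = subr B U * C'" for r' C'
 proof -
  have c': "C' : msp {..<r} {..<r'}" "star C' * C' = e {..<r'}" using C' by (auto simp: isometry_def)
  have "star (B * C') * (B * C') = star C' * (star B * B) * C'" by (simp add: mult.assoc)
  also have "... = e {..<r'}" unfolding B(3) using c' by (simp add: mult.assoc e_mult[OF finite_lessThan c'(1)])
  finally have 1: "isometry SD r' (B * C')" using msp_mult[OF B(1) c'(1)] by (simp add: isometry_def)
  have "B * C' * star (B * C') * rho U * (B * C') = rho U * (B * C')" if U: "U : GG N" for U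
  proof -
   have "B * C' * star (B * C') * rho U * (B * C') = B * (C' * star C' * subr B U * C')" by (simp add: subr_def mult.assoc)
   also have "... = (B * subr B U) * C'" unfolding i[OF U] by (simp add: mult.assoc)
   also have "... = rho U * (B * C')" unfolding B(5)[OF U] by (simp add: mult.assoc)
   finally show ?thesis .
  qed
  moreover have "PS * (B * C') = B * C'" by (simp add: mult.assoc[symmetric] B(4))
  ultimately show ?thesis using 1 by (simp add: good_def)
 qed
 have "B * C * star (B * C) + B * C2 * star (B * C2) = B * (C * star C + C2 * star C2) * star B" by (simp add: distrib_left distrib_right mult.assoc)
 also have "... = B * star B" unfolding sum by (simp add: mult_e[OF finite_lessThan B(1)])
 finally have s: "B * C * star (B * C) + B * C2 * star (B * C2) = B * star B" .
 have "star (B * C) * (B * C2) = star C * (star B * B) * C2" by (simp add: mult.assoc)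
 also have "... = 0" unfolding B(3) mult_e[OF finite_lessThan cs(1)] by (rule o)
 finally have "star (B * C) * (B * C2) = 0" .
 thus ?thesis using gd[OF C(1) inv1] gd[OF C2(1) inv2] s rr r1p r2p
  by (intro exI[of _ r1] exI[of _ "B * C"] exI[of _ r2] exI[of _ "B * C2"]) auto
qed

definition hasHV :: "fmat => (nat => nat) => bool" where
 "hasHV B n \<longleftrightarrow> (EX v. HV (labn n) v & B * star B * v = v)"

text \<open>The labels occurring in degree k; r is the exponent of the full determinant. Label
  functions are undefined outside 1, ..., N - 1, so that each irreducible representation is listed
  once.\<close>

definition Lam :: "(nat => nat) set" where
 "Lam = {n : {1..N - 1} \<rightarrow>\<^sub>E UNIV. EX r. (\<Sum>m=1..N - 1. m * n m) + N * r = k}"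

lemma finite_Lam: "finite Lam"
proof (rule finite_subset)
 show "Lam \<subseteq> {1..N - 1} \<rightarrow>\<^sub>E {..k}"
 proof
  fix n assume n: "n : Lam"
  have "n m <= k" if m: "m : {1..N - 1}" for m
  proof -
   have "n m <= m * n m" using m by simp
   also have "... <= (\<Sum>m=1..N - 1. m * n m)" using m by (intro member_le_sum) auto
   also have "... <= k" using n by (auto simp: Lam_def)
   finally show ?thesis .
  qed
  thus "n : {1..N - 1} \<rightarrow>\<^sub>E {..k}" using n by (auto simp: Lam_def PiE_iff)
 qed
qed (intro finite_PiE; simp)

lemma phi_star: "Z : LA N ==> star (R.phi Z) = R.phi (star Z)"
proof -
 assume Z: "Z : LA N"
 have "(%c d. cnj (lad Z d c)) = lad (star Z)" by (auto simp: lad_def fun_eq_iff)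
 thus ?thesis using Z LA_closed(4)[OF Z] by (simp add: phi_td td_star)
qed

text \<open>The range of the projection is invariant under each operator and under its
  adjoint.\<close>

lemma good_commute: assumes g: "good r B"
 shows "U : GG N ==> B * star B * rho U = rho U * (B * star B)"
  "Z : LA N ==> B * star B * R.phi Z = R.phi Z * (B * star B)"
proof -
 note B = goodD[OF g]
 let ?P = "B * star B"
 have P: "?P * B = B" unfolding mult.assoc B(3) by (rule mult_e[OF finite_lessThan B(1)])
 have half: "?P * M * ?P = M * ?P" if "M * B = B * M'" for M M'
 proof -
  have "?P * M * ?P = ?P * (M * B) * star B" by (simp add: mult.assoc)
  also have "... = (?P * B) * M' * star B" by (simp add: that mult.assoc)
  also have "... = M * ?P" unfolding P that[symmetric] by (simp add: mult.assoc)
  finally show ?thesis .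
 qed
 have full: "?P * M = M * ?P" if "?P * M * ?P = M * ?P" "?P * star M * ?P = star M * ?P" for M
 proof -
  have "star (?P * star M * ?P) = star (star M * ?P)" using that(2) by simp
  hence "?P * M * ?P = ?P * M" by (simp add: mult.assoc)
  thus ?thesis using that(1) by simp
 qed
 show "?P * rho U = rho U * ?P" if U: "U : GG N"
 proof (rule full)
  show "?P * rho U * ?P = rho U * ?P" by (rule half[OF B(5)[OF U, symmetric]])
  show "?P * star (rho U) * ?P = star (rho U) * ?P" unfolding rho_star'[symmetric] by (rule half[OF B(5)[OF GG_star[OF U], symmetric]])
 qed
 show "?P * R.phi Z = R.phi Z * ?P" if Z: "Z : LA N"
 proof (rule full)
  show "?P * R.phi Z * ?P = R.phi Z * ?P" by (rule half[OF sub_phi[OF g Z, symmetric]])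
  show "?P * star (R.phi Z) * ?P = star (R.phi Z) * ?P" unfolding phi_star[OF Z] by (rule half[OF sub_phi[OF g LA_closed(4)[OF Z], symmetric]])
 qed
qed

lemma HV_project: assumes g: "good r B" and h: "HV p v" and ne: "B * star B * v ~= 0" shows "HV p (B * star B * v)"
proof -
 note v = HV_D[OF h] and B = goodD[OF g]
 let ?P = "B * star B"
 have Pv: "?P * v : msp SD {0}" by (rule msp_mult[OF msp_mult[OF B(1,2)] v(2)])
 have "rho (tor N u) * (?P * v) = csc (chi N p u) (?P * v)" if u: "u : TT N" for u
 proof -
  have "rho (tor N u) * (?P * v) = ?P * (rho (tor N u) * v)"
   using good_commute(1)[OF g tor_GG[OF u]] by (simp only: mult.assoc[symmetric])
  thus ?thesis using v(1) u by (simp add: R.wv_def)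
 qed
 moreover have "R.phi (Eu i j) * (?P * v) = 0" if "bd N i j" "i < j" for i j
 proof -
  have E: "Eu i j : LA N" using that by (intro Eu_LA) auto
  have "R.phi (Eu i j) * (?P * v) = ?P * (R.phi (Eu i j) * v)"
   using good_commute(2)[OF g E] by (simp only: mult.assoc[symmetric])
  thus ?thesis using v(4) that by (simp add: raised_def)
 qed
 moreover have "PS * (?P * v) = ?P * v" by (simp add: mult.assoc[symmetric] B(4))
 ultimately show ?thesis using Pv ne by (simp add: HV_def R.hwv_def R.wv_def)
qed

lemma HV_cong: "(!!m. m : KK N ==> p m = q m) ==> HV p v = HV q v"
 unfolding HV_def R.hwv_def using R.wv_cong[of p q v] by simp

lemma labn_of_HV: assumes h: "HV p v"
 defines "n == restrict (%m. nat (p m)) {1..N - 1}"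
 shows "n : Lam" "m : KK N ==> p m = labn n m"
proof -
 have nn: "int (n m) = p m" if "1 <= m" "m < N" for m using that HV_pos[OF h, of m] by (auto simp: n_def KK_def)
 obtain r where r: "int k = (\<Sum>m=1..N - 1. int m * p m) + int N * int r" using HV_degree[OF h] by blast
 have "(\<Sum>m=1..N - 1. int m * p m) = (\<Sum>m=1..N - 1. int m * int (n m))" by (intro sum.cong refl) (auto simp: nn)
 hence "int ((\<Sum>m=1..N - 1. m * n m) + N * r) = int k" using r by simp
 hence "(\<Sum>m=1..N - 1. m * n m) + N * r = k" by (simp only: of_nat_eq_iff)
 thus "n : Lam" by (auto simp: Lam_def n_def)
 show "p m = labn n m" if m: "m : KK N"
 proof (cases "m < N")
  case True
  thus ?thesis using m nn[of m] by (simp add: lab_def KK_def)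
 next
  case False
  hence *: "1 <= 2*N - m" "2*N - m < N" "2*N - (2*N - m) = m" "N - (m - N) = 2*N - m" using m by (auto simp: KK_def)
  show ?thesis using False HV_sym[OF h *(1,2)] nn[OF *(1,2)] * by (simp add: lab_def)
 qed
qed

lemma labn_inj: assumes "!!m. m : KK N ==> labn n m = labn n' m" "n : Lam" "n' : Lam" shows "n = n'"
proof (rule PiE_ext)
 show "n : {1..N - 1} \<rightarrow>\<^sub>E UNIV" "n' : {1..N - 1} \<rightarrow>\<^sub>E UNIV" using assms by (auto simp: Lam_def)
 fix m assume "m : {1..N - 1}"
 hence "m : KK N" "m < N" by (auto simp: KK_def)
 thus "n m = n' m" using assms(1)[of m] by (simp add: lab_def)
qed

text \<open>The two projections of v add up to v, so at least one is nonzero; by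
  \<open>HV_project\<close> it is a highest weight vector again.\<close>

lemma hasHV_split: assumes g: "good r1 B1" "good r2 B2" and s: "B1 * star B1 + B2 * star B2 = B * star B" and h: "hasHV B n"
 shows "hasHV B1 n \<or> hasHV B2 n"
proof -
 obtain v where v: "HV (labn n) v" "B * star B * v = v" using h unfolding hasHV_def by blast
 have proj: "hasHV A n" if A: "good r A" and ne: "A * star A * v ~= 0" for A r
 proof -
  have "A * star A * (A * star A * v) = A * (star A * A) * star A * v" by (simp add: mult.assoc)
  also have "... = A * star A * v" unfolding goodD(3)[OF A] mult_e[OF finite_lessThan goodD(1)[OF A]] ..
  finally show ?thesis using HV_project[OF A v(1) ne] unfolding hasHV_def by blast
 qed
 have "B1 * star B1 * v + B2 * star B2 * v = v" using v(2) unfolding s[symmetric] by (simp add: distrib_right)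
 hence "B1 * star B1 * v ~= 0 \<or> B2 * star B2 * v ~= 0" using HV_D(3)[OF v(1)] by auto
 thus ?thesis using proj[OF g(1)] proj[OF g(2)] by blast
qed

text \<open>Induction on the dimension by splitting. The labels of the two pieces are disjoint:
  highest weight vectors with equal labels are proportional by \<open>HV_unique\<close>, but the two
  pieces are orthogonal.\<close>

lemma good_trace:
 assumes g: "good r B" and f: "fugacities N x" "fugacities N y"
 shows "tr (subr B (tor N (ufug N x y))) = (SUM n:Lam. of_bool (hasHV B n) * irrep_char N n (%m. n (N - m)) x y)"
 using g
proof (induction r arbitrary: B rule: less_induct)
 case (less r)
 note g = less.prems
 note B = goodD[OF g]
 interpret S: su_rep N r "subr B" by (rule sub_rep[OF g])
 let ?t = "tor N (ufug N x y)" and ?c = "%n. irrep_char N n (%m. n (N - m)) x y"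
 have t: "?t : GG N" by (intro tor_GG ufug_TT f N2)
 consider "r = 0" | "r > 0" "S.irr" | "r > 0" "~ S.irr" by blast
 thus ?case
 proof cases
  case 1
  hence B0: "B = 0" using B(1) msp_empty by simp
  have "~ hasHV B n" for n using HV_D(3) by (auto simp: hasHV_def B0)
  thus ?thesis by (simp add: subr_def B0)
 next
  case 2
  obtain p w where h: "S.hwv p w" using S.hwv_exists[OF 2(1)] by blast
  have w: "w : msp {..<r} {0}" using h S.wv_in by (auto simp: S.hwv_def)
  have H: "HV p (B * w)" using h sub_hwv[OF g w] by simp
  define n where "n = restrict (%m. nat (p m)) {1..N - 1}"
  note n = labn_of_HV[OF H, folded n_def]
  have "irrep_char N n (%m. n (N - m)) x y = tr (subr B ?t)"
   by (rule irrep_char_eq[OF sub_rep[OF g] 2(2) h n(2) f])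
  \<comment> \<open>In an irreducible piece any two highest weights dominate each other.\<close>
  moreover have "hasHV B n' \<longleftrightarrow> n' = n" if n': "n' : Lam" for n'
  proof
   assume "hasHV B n'"
   then obtain v where v: "HV (labn n') v" "B * star B * v = v" by (auto simp: hasHV_def)
   define w' where "w' = star B * v"
   have w': "w' : msp {..<r} {0}" unfolding w'_def by (rule msp_mult[OF B(2) HV_D(2)[OF v(1)]])
   have "HV (labn n') (B * w')" using v by (simp add: w'_def mult.assoc)
   hence h': "S.hwv (labn n') w'" using sub_hwv[OF g w'] by simp
   have "wle N (labn n') p" using S.irr_weights[OF 2(2) h, of "labn n'" w'] h' by (simp add: S.hwv_def)
   moreover have "wle N p (labn n')" using S.irr_weights[OF 2(2) h', of p w] h by (simp add: S.hwv_def)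
   ultimately have "labn n' m = p m" if "m : KK N" for m by (rule wle_antisym[OF S.N0 _ _ that])
   thus "n' = n" using n by (intro labn_inj n' n(1)) simp
  next
   assume "n' = n"
   hence "HV (labn n') (B * w)" using H HV_cong[of p "labn n" "B * w"] n(2) by simp
   moreover have "B * star B * (B * w) = B * w" using good_inj(1)[OF g w] by (simp add: mult.assoc)
   ultimately show "hasHV B n'" unfolding hasHV_def by blast
  qed
  hence "(SUM n':Lam. of_bool (hasHV B n') * ?c n') = (SUM n':Lam. if n' = n then ?c n' else 0)" by (intro sum.cong refl) auto
  hence "(SUM n':Lam. of_bool (hasHV B n') * ?c n') = ?c n" using n(1) finite_Lam by simp
  ultimately show ?thesis by simp
 next
  case 3
  obtain r1 B1 r2 B2 where s: "good r1 B1" "good r2 B2" "r1 < r" "r2 < r" "B1 * star B1 + B2 * star B2 = B * star B" "star B1 * B2 = 0"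
   using good_split[OF g 3] by blast
  have "star (star B1 * B2) = 0" using s(6) by simp
  hence o: "star B2 * B1 = 0" by simp
  let ?P1 = "B1 * star B1" and ?P2 = "B2 * star B2"
  have o12: "?P1 * (?P2 * v) = 0" "?P2 * (?P1 * v) = 0" for v
  proof -
   have "?P1 * (?P2 * v) = B1 * (star B1 * B2) * (star B2 * v)" "?P2 * (?P1 * v) = B2 * (star B2 * B1) * (star B1 * v)" by (simp_all add: mult.assoc)
   thus "?P1 * (?P2 * v) = 0" "?P2 * (?P1 * v) = 0" using s(6) o by simp_all
  qed
  have trs: "tr (subr A ?t) = tr (rho ?t * (A * star A))" for A
   unfolding subr_def using tr_comm[of "star A" "rho ?t * A"] by (simp add: mult.assoc)
  have "tr (subr B ?t) = tr (subr B1 ?t) + tr (subr B2 ?t)"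
   unfolding trs s(5)[symmetric] by (simp add: distrib_left)
  also have "... = (SUM n:Lam. of_bool (hasHV B1 n) * ?c n + of_bool (hasHV B2 n) * ?c n)"
   by (simp add: less.IH[OF s(3,1)] less.IH[OF s(4,2)] sum.distrib)
  also have "... = (SUM n:Lam. of_bool (hasHV B n) * ?c n)"
  proof (rule sum.cong[OF refl])
   fix n
   have a: "hasHV B n" if "hasHV B1 n \<or> hasHV B2 n"
   proof -
    have "B * star B * v = v" if "?P1 * v = v \<or> ?P2 * v = v" for v
     using that o12[of v] unfolding s(5)[symmetric] by (auto simp: distrib_right)
    thus ?thesis using that unfolding hasHV_def by blast
   qed
   have b: "~ (hasHV B1 n & hasHV B2 n)"
   proof
    assume "hasHV B1 n & hasHV B2 n"
    then obtain v1 v2 where v: "HV (labn n) v1" "?P1 * v1 = v1" "HV (labn n) v2" "?P2 * v2 = v2" unfolding hasHV_def by blast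
    obtain z where z: "z ~= 0" "v2 = csc z v1" using HV_unique[OF v(1,3)] by blast
    have "v2 = ?P2 * (?P1 * v2)" using v z by simp
    thus False using o12 HV_D(3)[OF v(3)] by simp
   qed
   have c: "hasHV B n ==> hasHV B1 n \<or> hasHV B2 n" by (rule hasHV_split[OF s(1,2,5)])
   show "of_bool (hasHV B1 n) * ?c n + of_bool (hasHV B2 n) * ?c n = of_bool (hasHV B n) * ?c n"
    using a b c by (cases "hasHV B1 n"; cases "hasHV B2 n") auto
  qed
  finally show ?thesis .
 qed
qed

lemma good_total: "EX r B. good r B & B * star B = PS"
proof -
 define W where "W = {v : msp SD {0}. PS * v = v}"
 have W: "csub W" "W \<subseteq> msp SD {0}" unfolding W_def csub_def by (auto simp: distrib_left)
 obtain r B where B: "isometry SD r B" "!!v. v : msp SD {0} ==> v : W \<longleftrightarrow> B * star B * v = v" "!!w. w : msp {..<r} {0} ==> B * w : W"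
  by (rule onb_exists[OF finite_lessThan W]) blast
 have b: "B : msp SD {..<r}" "star B : msp {..<r} SD" "star B * B = e {..<r}" using B(1) by (auto simp: isometry_def)
 have "PS * B - B = 0"
 proof (rule mat_ext_vec)
  show "PS * B - B : msp SD {..<r}" by (intro msp_closed msp_mult[OF PS_in b(1)] b(1))
  show "(PS * B - B) * w = 0" if "w : msp {..<r} {0}" for w
   using B(3)[OF that] by (simp add: W_def left_diff_distrib mult.assoc)
 qed
 hence PB: "PS * B = B" by simp
 have "B * star B * PS - PS = 0"
 proof (rule mat_ext_vec)
  show "B * star B * PS - PS : msp SD SD" by (intro msp_closed msp_mult[OF msp_mult[OF b(1,2)] PS_in] PS_in)
  show "(B * star B * PS - PS) * w = 0" if w: "w : msp SD {0}" for w
  proof -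
   have m: "PS * w : msp SD {0}" by (rule msp_mult[OF PS_in w])
   hence "PS * w : W" by (simp add: W_def mult.assoc[symmetric] PS_idem)
   hence "B * star B * (PS * w) = PS * w" using B(2)[OF m] by simp
   thus ?thesis by (simp add: left_diff_distrib mult.assoc)
  qed
 qed
 hence "B * star B * PS = PS" by simp
 moreover have "star B * PS = star B" using arg_cong[OF PB, of star] by (simp add: PS_star)
 ultimately have BB: "B * star B = PS" by (simp add: mult.assoc)
 have "B * star B * rho U * B = rho U * B" for U
 proof -
  have "B * star B * rho U * B = (PS * rho U) * B" by (simp add: BB)
  also have "... = rho U * (PS * B)" unfolding rho_def tp_PS[symmetric] by (simp add: mult.assoc)
  finally show ?thesis by (simp add: PB)
 qed
 hence g: "good r B" using B(1) PB by (simp add: good_def)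
 thus ?thesis using BB by blast
qed

text \<open>The trace of a torus element on all symmetric tensors, computed from monomials and from
  the decomposition. The argument N - j of the second fugacities comes from counting the second
  block from its end.\<close>

theorem char_decomposition:
 assumes f: "fugacities N x" "fugacities N y"
 shows "(\<Sum>m | set_mset m \<subseteq> LL & size m = k. prod_mset (image_mset (%(i,j). fug N x (i + 1) * cnj (fug N y (N - j))) m))
    = (SUM n:Lam. irrep_char N n (%m. n (N - m)) x y)"
proof -
 let ?t = "tor N (ufug N x y)"
 obtain r B where g: "good r B" and BB: "B * star B = PS" using good_total by blast
 have "tr (subr B ?t) = tr (rho ?t * PS)"
  unfolding subr_def BB[symmetric] using tr_comm[of "star B" "rho ?t * B"] by (simp add: mult.assoc)
 also have "rho ?t = tp (%c d. if c = d then (case c of (i,j) => fug N x (i + 1) * cnj (fug N y (N - j))) else 0)"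
  unfolding rho_def
 proof (rule tp_cong)
  fix c d assume "c : LL" "d : LL"
  then obtain i j i' j' where cd: "c = (i,j)" "d = (i',j')" "i < N" "j < N" "i' < N" "j' < N" by auto
  have "2*N - 1 - j = 2*N - 1 - j' \<longleftrightarrow> j = j'" "~ 2*N - 1 - j < N" "2*N - 1 - j - N + 1 = N - j" using cd by auto
  thus "la ?t c d = (if c = d then (case c of (i,j) => fug N x (i + 1) * cnj (fug N y (N - j))) else 0)"
   using cd by (auto simp: la_def ent_dg ufug_def)
 qed
 finally have 1: "tr (subr B ?t) = (SUM m:MM. prod_mset (image_mset (%(i,j). fug N x (i + 1) * cnj (fug N y (N - j))) m))"
  by (simp only: tr_tp_PS)
 have "hasHV B n" if n: "n : Lam" for n
 proof -
  obtain r where "(\<Sum>m=1..N - 1. m * n m) + N * r = k" using n by (auto simp: Lam_def)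
  then obtain v where v: "HV (labn n) v" using HV_exists by blast
  hence "B * star B * v = v" using HV_D(5)[OF v] BB by simp
  thus ?thesis using v unfolding hasHV_def by blast
 qed
 thus ?thesis using good_trace[OF g f] unfolding 1 MM_def by (simp cong: sum.cong)
qed

end

section \<open>Summation over the highest weights\<close>

context su_rep
begin

text \<open>The weight projections have natural numbers as traces, with sum d, and characters have
  modulus 1 on the torus.\<close>

lemma tr_rho_tor_le: assumes u: "u : TT N" shows "cmod (tr (rh (tor N u))) <= real d"
proof -
 have "EX f. ALL p:WS. tr (Q p) = of_nat (f p)"
 proof (rule bchoice, rule ballI)
  fix p assume p: "p : WS"
  have "Q p * Q p = Q p" using torus_decomp(4)[OF p p] by simp
  thus "EX y. tr (Q p) = of_nat y" using idem_trace[OF finite_lessThan torus_decomp(3)] by blast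
 qed
 then obtain f where f: "!!p. p : WS ==> tr (Q p) = of_nat (f p)" by blast
 have "tr (rh (tor N u)) = (SUM p:WS. chi N p u * of_nat (f p))" unfolding rho_tor[OF u] tr_sum by (simp add: f)
 also have "cmod ... <= (SUM p:WS. real (f p))" by (rule sum_norm_le) (simp add: norm_mult chi_unit[OF u])
 also have "... = real d"
 proof -
  have "of_nat (SUM p:WS. f p) = tr (sum Q WS)" by (simp add: tr_sum f)
  also have "... = of_nat d" unfolding torus_decomp(5) by (rule tr_e)
  finally show ?thesis by (simp only: of_nat_eq_iff of_nat_sum[symmetric])
 qed
 finally show ?thesis .
qed

end

lemma tor_ufug_1: assumes "N >= 2" shows "tor N (ufug N (%_. 1) (%_. 1)) = e {..<2*N}"
 by (rule dg_cong) (auto simp: ufug_def fug_def)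

context bifund
begin

text \<open>Follow the label through the successive splittings until the piece containing it is
  irreducible.\<close>

lemma irr_component:
 assumes "good r B" "hasHV B n"
 shows "\<exists>d rh v. su_rep N d rh & su_rep.irr N d rh & su_rep.hwv N d rh (labn n) v"
 using assms
proof (induction r arbitrary: B rule: less_induct)
 case (less r)
 note g = less.prems(1)
 note B = goodD[OF g]
 interpret S: su_rep N r "subr B" by (rule sub_rep[OF g])
 obtain v where v: "HV (labn n) v" "B * star B * v = v" using less.prems(2) unfolding hasHV_def by blast
 consider "r = 0" | "S.irr" | "r > 0" "~ S.irr" by blast
 thus ?case
 proof cases
  case 1
  hence "B = 0" using B(1) msp_empty by simp
  thus ?thesis using v HV_D(3)[OF v(1)] by simp
 next
  case 2
  have w: "star B * v : msp {..<r} {0}" by (rule msp_mult[OF B(2) HV_D(2)[OF v(1)]])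
  have "S.hwv (labn n) (star B * v)" unfolding sub_hwv[OF g w] using v by (simp add: mult.assoc)
  thus ?thesis using 2 sub_rep[OF g] by blast
 next
  case 3
  obtain r1 B1 r2 B2 where s: "good r1 B1" "good r2 B2" "r1 < r" "r2 < r" "B1 * star B1 + B2 * star B2 = B * star B"
   using good_split[OF g 3] by blast
  have "hasHV B1 n \<or> hasHV B2 n" by (rule hasHV_split[OF s(1,2,5) less.prems(2)])
  thus ?thesis using less.IH[OF s(3,1)] less.IH[OF s(4,2)] by blast
 qed
qed

lemma irr_of_Lam: assumes n: "n : Lam"
 shows "\<exists>d rh v. su_rep N d rh & su_rep.irr N d rh & su_rep.hwv N d rh (labn n) v"
proof -
 obtain r B where g: "good r B" and BB: "B * star B = PS" using good_total by blast
 obtain r where "(\<Sum>m=1..N - 1. m * n m) + N * r = k" using n by (auto simp: Lam_def)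
 then obtain v where v: "HV (labn n) v" using HV_exists by blast
 hence "hasHV B n" unfolding hasHV_def using HV_D(5)[OF v] BB by auto
 thus ?thesis by (rule irr_component[OF g])
qed

text \<open>The dimension, as the value at trivial fugacities, dominates the character;
  \<open>character_sum\<close> uses this for absolute convergence.\<close>

lemma irrep_char_bound:
 assumes n: "n : Lam" and f: "fugacities N x" "fugacities N y"
 shows "EX d. irrep_char N n (%m. n (N - m)) (%_. 1) (%_. 1) = of_nat d & cmod (irrep_char N n (%m. n (N - m)) x y) <= real d"
proof -
 obtain d rh v where r: "su_rep N d rh" "su_rep.irr N d rh" "su_rep.hwv N d rh (labn n) v" using irr_of_Lam[OF n] by blast
 interpret S: su_rep N d rh by (rule r(1))
 have c: "irrep_char N n (%m. n (N - m)) x y = tr (rh (tor N (ufug N x y)))" if "fugacities N x" "fugacities N y" for x y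
  by (rule irrep_char_eq[OF r refl that])
 have f1: "fugacities N (%_. 1)" by (simp add: fugacities_def)
 have "irrep_char N n (%m. n (N - m)) (%_. 1) (%_. 1) = of_nat d"
  unfolding c[OF f1 f1] tor_ufug_1[OF N2] S.rho_one by (rule tr_e)
 moreover have "cmod (irrep_char N n (%m. n (N - m)) x y) <= real d"
  unfolding c[OF f] by (rule S.tr_rho_tor_le[OF ufug_TT[OF f N2]])
 ultimately show ?thesis by blast
qed

end

text \<open>The complete homogeneous symmetric polynomial of degree k in the numbers c a.\<close>

definition hsym :: "'l set => ('l => complex) => nat => complex" where
 "hsym A c k = (\<Sum>m | set_mset m \<subseteq> A & size m = k. prod_mset (image_mset c m))"

lemma finite_multisets: assumes "finite A" shows "finite {m. set_mset m \<subseteq> A & size m = k}"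
proof -
 interpret tensor A k by unfold_locales (rule assms)
 show ?thesis using finMM by (simp add: MM_def)
qed

text \<open>Multisets are sorted by the multiplicity i of the new element.\<close>

lemma hsym_insert:
 assumes A: "finite A" "a \<notin> A"
 shows "hsym (insert a A) c k = (\<Sum>i\<le>k. c a ^ i * hsym A c (k - i))"
proof -
 let ?M = "%A k. {m. set_mset m \<subseteq> A & size m = k}"
 have "(\<Sum>i\<le>k. c a ^ i * hsym A c (k - i)) = (\<Sum>(i, m)\<in>(SIGMA i:{..k}. ?M A (k - i)). c a ^ i * prod_mset (image_mset c m))"
  unfolding hsym_def sum_distrib_left by (rule sum.Sigma) (auto intro: finite_multisets A)
 also have "... = (SUM m:?M (insert a A) k. prod_mset (image_mset c m))"
 proof (rule sum.reindex_bij_witness[of _ "%m. (count m a, filter_mset (%x. x ~= a) m)" "%(i, m). replicate_mset i a + m"])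
  fix im assume im: "im : (SIGMA i:{..k}. ?M A (k - i))"
  then obtain i m where im': "im = (i, m)" "i <= k" "set_mset m \<subseteq> A" "size m = k - i" by auto
  have "a \<notin># m" using im'(3) A(2) by blast
  hence "count m a = 0" by (simp add: not_in_iff)
  moreover have "filter_mset (%x. x ~= a) m = m" using \<open>a \<notin># m\<close> by (auto simp: filter_mset_eq_conv)
  ultimately have "count m a = 0" "filter_mset (%x. x ~= a) m = m" by auto
  thus "(count (case im of (i, m) => replicate_mset i a + m) a, filter_mset (%x. x ~= a) (case im of (i, m) => replicate_mset i a + m)) = im"
   by (simp add: im')
  show "(case im of (i, m) => replicate_mset i a + m) : ?M (insert a A) k" using im' by (auto split: if_splits)
  show "prod_mset (image_mset c (case im of (i, m) => replicate_mset i a + m)) = (case im of (i, m) => c a ^ i * prod_mset (image_mset c m))"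
   by (simp add: im')
 next
  fix m assume m: "m : ?M (insert a A) k"
  have e: "m = replicate_mset (count m a) a + filter_mset (%x. x ~= a) m" by (rule multiset_eqI) auto
  have "size m = count m a + size (filter_mset (%x. x ~= a) m)" using arg_cong[OF e, of size] by simp
  thus "(count m a, filter_mset (%x. x ~= a) m) : (SIGMA i:{..k}. ?M A (k - i))" using m by auto
  show "(case (count m a, filter_mset (%x. x ~= a) m) of (i, m) => replicate_mset i a + m) = m" using e by simp
 qed
 finally show ?thesis by (simp add: hsym_def)
qed

text \<open>By \<open>hsym_insert\<close> each new element multiplies the generating series by a
  geometric series, as a Cauchy product.\<close>

lemma hsym_sums:
 assumes A: "finite A" and c: "!!a. a : A ==> cmod (c a) <= 1" and q: "cmod q < 1"
 shows "summable (%k. norm (hsym A c k * q ^ k))" "(%k. hsym A c k * q ^ k) sums (PROD a:A. 1 / (1 - c a * q))"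
proof -
 have "summable (%k. norm (hsym A c k * q ^ k)) & (%k. hsym A c k * q ^ k) sums (PROD a:A. 1 / (1 - c a * q))"
  using A c
 proof (induction A rule: finite_induct)
  case empty
  have h: "hsym {} c k * q ^ k = (if k = 0 then 1 else 0)" for k
  proof (cases "k = 0")
   case True
   have "{m :: 'a multiset. set_mset m \<subseteq> {} & size m = 0} = {{#}}" by auto
   thus ?thesis using True by (simp add: hsym_def)
  next
   case False
   hence "{m :: 'a multiset. set_mset m \<subseteq> {} & size m = k} = {}" by auto
   thus ?thesis using False by (simp only: hsym_def) simp
  qed
  have "(%k. norm (hsym {} c k * q ^ k)) = (%k. if k = 0 then 1 else 0)" unfolding h by auto
  thus ?case unfolding h using sums_single[of 0 "%_. 1 :: complex"] summable_single[of 0 "%_. 1 :: real"] by simp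
 next
  case (insert a A)
  let ?f = "%i. (c a * q) ^ i" and ?g = "%k. hsym A c k * q ^ k"
  have ca: "cmod (c a * q) < 1"
  proof -
   have "cmod (c a * q) <= 1 * cmod q" unfolding norm_mult using insert.prems[of a] by (intro mult_right_mono) auto
   thus ?thesis using q by simp
  qed
  have IH: "summable (%k. norm (?g k))" "?g sums (PROD a:A. 1 / (1 - c a * q))" using insert by auto
  have sf: "summable (%k. norm (?f k))" using ca by (simp add: norm_power summable_geometric)
  have eq: "hsym (insert a A) c k * q ^ k = (\<Sum>i\<le>k. ?f i * ?g (k - i))" for k
   unfolding hsym_insert[OF insert.hyps] sum_distrib_right
  proof (rule sum.cong[OF refl])
   fix i assume "i : {..k}"
   hence "q ^ k = q ^ i * q ^ (k - i)" by (simp add: power_add[symmetric])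
   thus "c a ^ i * hsym A c (k - i) * q ^ k = (c a * q) ^ i * (hsym A c (k - i) * q ^ (k - i))" by (simp add: power_mult_distrib mult_ac)
  qed
  have "(%k. \<Sum>i\<le>k. ?f i * ?g (k - i)) sums ((\<Sum>k. ?f k) * (\<Sum>k. ?g k))" by (rule Cauchy_product_sums[OF sf IH(1)])
  also have "(\<Sum>k. ?f k) = 1 / (1 - c a * q)" using ca by (rule suminf_geometric)
  also have "(\<Sum>k. ?g k) = (PROD a:A. 1 / (1 - c a * q))" using IH(2) by (simp add: sums_iff)
  finally have 1: "(%k. hsym (insert a A) c k * q ^ k) sums (PROD a:insert a A. 1 / (1 - c a * q))" unfolding eq using insert.hyps by simp
  have "summable (%k. \<Sum>i\<le>k. norm (?f i) * norm (?g (k - i)))"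
   using summable_Cauchy_product[of "%k. norm (?f k)" "%k. norm (?g k)"] sf IH(1) by simp
  hence "summable (%k. norm (\<Sum>i\<le>k. ?f i * ?g (k - i)))"
   by (rule summable_comparison_test'[where N = 0]) (auto simp flip: norm_mult intro!: norm_sum sum_norm_le)
  thus ?case using 1 unfolding eq by simp
 qed
 thus "summable (%k. norm (hsym A c k * q ^ k))" "(%k. hsym A c k * q ^ k) sums (PROD a:A. 1 / (1 - c a * q))" by auto
qed

definition wdeg :: "nat => (nat => nat) => nat" where "wdeg N n = (\<Sum>m=1..N - 1. m * n m)"
definition Edeg :: "nat => nat => (nat => nat) set" where "Edeg N k = {n : {1..N - 1} \<rightarrow>\<^sub>E UNIV. wdeg N n = k}"

text \<open>Either the determinant does not occur (r = 0), or one factor of it can be removed.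
  Summed over all degrees this produces the factor 1 - q^N.\<close>

lemma Lam_Edeg: assumes N: "N >= 2"
 shows "bifund.Lam N k = Edeg N k \<union> (if N <= k then bifund.Lam N (k - N) else {})" "Edeg N k \<inter> (if N <= k then bifund.Lam N (k - N) else {}) = {}"
proof -
 have b: "bifund N" by (simp add: bifund_def N)
 note L = bifund.Lam_def[OF b, folded wdeg_def]
 show "bifund.Lam N k = Edeg N k \<union> (if N <= k then bifund.Lam N (k - N) else {})"
 proof (rule Set.set_eqI)
  fix n :: "nat => nat"
  have "(EX r. wdeg N n + N * r = k) \<longleftrightarrow> wdeg N n = k \<or> (N <= k & (EX r. wdeg N n + N * r = k - N))"
  proof
   assume "EX r. wdeg N n + N * r = k"
   then obtain r where r: "wdeg N n + N * r = k" by blast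
   show "wdeg N n = k \<or> (N <= k & (EX r. wdeg N n + N * r = k - N))"
   proof (cases r)
    case (Suc r')
    hence "N <= k" "wdeg N n + N * r' = k - N" using r by auto
    thus ?thesis by blast
   qed (use r in simp)
  next
   assume "wdeg N n = k \<or> (N <= k & (EX r. wdeg N n + N * r = k - N))"
   thus "EX r. wdeg N n + N * r = k"
   proof
    assume "N <= k & (EX r. wdeg N n + N * r = k - N)"
    then obtain r where "N <= k" "wdeg N n + N * r = k - N" by blast
    thus ?thesis by (intro exI[of _ "Suc r"]) simp
   qed (auto intro: exI[of _ 0])
  qed
  thus "n : bifund.Lam N k \<longleftrightarrow> n : Edeg N k \<union> (if N <= k then bifund.Lam N (k - N) else {})"
   by (auto simp: L Edeg_def)
 qed
 have "wdeg N n ~= k" if nk: "N <= k" "n : bifund.Lam N (k - N)" for n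
 proof -
  obtain r where "wdeg N n + N * r = k - N" using nk(2) by (auto simp: L)
  thus ?thesis using nk(1) N by auto
 qed
 thus "Edeg N k \<inter> (if N <= k then bifund.Lam N (k - N) else {}) = {}" by (auto simp: Edeg_def)
qed

locale fug_chars =
 fixes N :: nat and x y :: "nat => complex"
 assumes N2: "N >= 2" and f: "fugacities N x" "fugacities N y"
begin

definition "cc = (%(i,j). fug N x (i + 1) * cnj (fug N y (N - j)))"
definition "hh = hsym ({..<N} \<times> {..<N}) cc"
abbreviation "GC n == irrep_char N n (%m. n (N - m)) x y"

lemma fug_unit': assumes "i : {1..N}" shows "cmod (fug N x i) = 1" "cmod (fug N y i) = 1"
proof -
 have "i - 1 < N" "i - 1 + 1 = i" using assms by auto
 thus "cmod (fug N x i) = 1" "cmod (fug N y i) = 1"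
  using fug_unit[OF f(1) N2, of "i - 1"] fug_unit[OF f(2) N2, of "i - 1"] by simp_all
qed

lemma cc_unit: "a : {..<N} \<times> {..<N} ==> cmod (cc a) = 1"
proof -
 assume a: "a : {..<N} \<times> {..<N}"
 obtain i j where "a = (i, j)" "i < N" "j < N" using a by auto
 thus ?thesis using fug_unit'(1)[of "i + 1"] fug_unit'(2)[of "N - j"] by (simp add: cc_def norm_mult)
qed

lemma bif: "bifund N" by (simp add: bifund_def N2)

lemma hh_Lam: "hh k = (SUM n:bifund.Lam N k. GC n)"
 unfolding hh_def hsym_def cc_def by (rule bifund.char_decomposition[OF bif f])

lemma hh_Edeg: "(SUM n:Edeg N k. GC n) = hh k - (if N <= k then hh (k - N) else 0)"
proof -
 have fin: "finite (bifund.Lam N k)" "finite (bifund.Lam N (k - N))" using bifund.finite_Lam[OF bif] by auto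
 hence "finite (Edeg N k)" using Lam_Edeg(1)[OF N2, of k] by (metis finite_Un)
 hence "hh k = (SUM n:Edeg N k. GC n) + (SUM n:(if N <= k then bifund.Lam N (k - N) else {}). GC n)"
  unfolding hh_Lam Lam_Edeg(1)[OF N2, of k] using fin Lam_Edeg(2)[OF N2, of k] by (intro sum.union_disjoint) auto
 thus ?thesis by (auto simp: hh_Lam)
qed

lemma finite_Edeg: "finite (Edeg N k)"
 using Lam_Edeg(1)[OF N2, of k] bifund.finite_Lam[OF bif, of k] by (metis finite_Un)

lemma sums_chars: assumes q: "cmod q < 1"
 shows "(%k. (SUM n:Edeg N k. GC n) * q ^ k) sums ((1 - q ^ N) * (PROD a:{..<N} \<times> {..<N}. 1 / (1 - cc a * q)))"
proof -
 let ?P = "PROD a:{..<N} \<times> {..<N}. 1 / (1 - cc a * q)"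
 have h: "(%k. hh k * q ^ k) sums ?P" unfolding hh_def by (rule hsym_sums(2)) (auto simp: cc_unit q)
 have h2: "(%k. (if N <= k then hh (k - N) else 0) * q ^ k) sums (q ^ N * ?P)"
 proof -
  have "(%k. (if N <= k + N then hh (k + N - N) else 0) * q ^ (k + N)) sums (q ^ N * ?P)"
   using sums_mult[OF h, of "q ^ N"] by (simp add: power_add mult_ac)
  thus ?thesis by (subst (asm) sums_iff_shift) simp
 qed
 show ?thesis using sums_diff[OF h h2] unfolding hh_Edeg by (simp add: left_diff_distrib)
qed

end

text \<open>Grouping by degree gives the value by \<open>sums_chars\<close>. For unordered summation
  absolute convergence is needed: at trivial fugacities the characters are dimensions, and those in
  degree k add up to at most the dimension of the k-th symmetric power, whose series
  converges.\<close>

theorem character_sum: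
 assumes N: "N >= 2" and f: "fugacities N x" "fugacities N y" and q: "cmod q < 1"
 shows "((%n. irrep_char N n (%m. n (N - m)) x y * q ^ (\<Sum>j=1..N - 1. j * n j)) has_sum
   (1 - q ^ N) * (PROD a:{..<N} \<times> {..<N}. 1 / (1 - fug_chars.cc N x y a * q))) ({1..N - 1} \<rightarrow>\<^sub>E UNIV)"
proof -
 interpret C: fug_chars N x y by unfold_locales (use assms in auto)
 interpret C1: fug_chars N "%_. 1" "%_. 1" by unfold_locales (use assms in \<open>auto simp: fugacities_def\<close>)
 have bd: "EX d. C1.GC n = of_nat d & cmod (C.GC n) <= real d" if n: "n : Edeg N k" for n k
 proof -
  have "n : bifund.Lam N k" using Lam_Edeg(1)[OF N, of k] n by blast
  thus ?thesis by (rule bifund.irrep_char_bound[OF C.bif _ f])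
 qed
 define F where "F k = (SUM n:Edeg N k. cmod (C.GC n)) * cmod q ^ k" for k
 have F0: "F k >= 0" for k unfolding F_def by (intro mult_nonneg_nonneg sum_nonneg) auto
 have "summable F"
 proof (rule summable_comparison_test'[where N = 0])
  show "summable (%k. norm (C1.hh k * q ^ k))" unfolding C1.hh_def by (rule hsym_sums(1)) (auto simp: C1.cc_unit q)
  fix k :: nat
  obtain d where d: "!!n. n : Edeg N k ==> C1.GC n = of_nat (d n) & cmod (C.GC n) <= real (d n)"
   using bchoice[of "Edeg N k" "%n d. C1.GC n = of_nat d & cmod (C.GC n) <= real d"] bd by blast
  have nn: "EX d. C1.hh j = of_nat d" for j
  proof -
   have c1: "C1.cc = (%_. 1)" by (auto simp: C1.cc_def fug_def fun_eq_iff)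
   have p1: "prod_mset (image_mset (%_. 1 :: complex) m) = 1" for m :: "(nat \<times> nat) multiset" by (induction m) auto
   hence "C1.hh j = (\<Sum>m | set_mset m \<subseteq> {..<N} \<times> {..<N} & size m = j. 1)"
    unfolding C1.hh_def hsym_def by (intro sum.cong refl) (simp only: c1 p1)
   thus ?thesis by (intro exI[of _ "card {m. set_mset m \<subseteq> {..<N} \<times> {..<N} & size m = j}"]) simp
  qed
  obtain a b where ab: "C1.hh k = of_nat a" "C1.hh (k - N) = of_nat b" using nn by blast
  have "(of_nat (SUM n:Edeg N k. d n) :: complex) = (SUM n:Edeg N k. C1.GC n)" unfolding of_nat_sum by (intro sum.cong refl) (simp add: d)
  also have "... = of_nat a - (if N <= k then of_nat b else 0)" unfolding C1.hh_Edeg by (simp add: ab)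
  finally have e: "of_nat ((SUM n:Edeg N k. d n) + (if N <= k then b else 0)) = (of_nat a :: complex)" by (auto split: if_splits)
  have "(SUM n:Edeg N k. d n) <= a" using e unfolding of_nat_eq_iff by simp
  moreover have "(SUM n:Edeg N k. cmod (C.GC n)) <= real (SUM n:Edeg N k. d n)" unfolding of_nat_sum by (intro sum_mono) (simp add: d)
  ultimately have "(SUM n:Edeg N k. cmod (C.GC n)) <= real a" by linarith
  thus "norm (F k) <= norm (C1.hh k * q ^ k)"
   using F0[of k] unfolding ab norm_mult norm_power by (simp add: F_def mult_right_mono)
 qed
 let ?f = "%n. C.GC n * q ^ wdeg N n"
 define S where "S = (1 - q ^ N) * (PROD a:{..<N} \<times> {..<N}. 1 / (1 - C.cc a * q))"
 have sums: "(%k. SUM n:Edeg N k. ?f n) sums S"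
 proof -
  have "(SUM n:Edeg N k. ?f n) = (SUM n:Edeg N k. C.GC n) * q ^ k" for k
   unfolding sum_distrib_right by (intro sum.cong refl) (simp add: Edeg_def)
  thus ?thesis using C.sums_chars[OF q] by (simp add: S_def)
 qed
 have Fsum: "(SUM n:Edeg N k. cmod (?f n)) = F k" for k
  unfolding F_def sum_distrib_right by (intro sum.cong refl) (simp add: Edeg_def norm_mult norm_power)
 have "((%(k, n). ?f n) has_sum S) (Sigma UNIV (Edeg N))"
 proof (rule has_sum_SigmaI)
  show "((%n. case (k, n) of (k, n) => ?f n) has_sum (SUM n:Edeg N k. ?f n)) (Edeg N k)" for k
   using has_sum_finite[OF C.finite_Edeg, of ?f k] by simp
  show "((%k. SUM n:Edeg N k. ?f n) has_sum S) UNIV"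
  proof (rule norm_summable_imp_has_sum[OF _ sums])
   show "summable (%k. norm (SUM n:Edeg N k. ?f n))"
    by (rule summable_comparison_test'[OF \<open>summable F\<close>, where N = 0]) (simp add: Fsum[symmetric] norm_sum)
  qed
  have "(%kn. norm (case kn of (k, n) => ?f n)) summable_on Sigma UNIV (Edeg N)"
   unfolding Infinite_Sum.abs_summable_on_Sigma_iff
  proof (intro conjI ballI)
   show "(%n. norm (case (k, n) of (k, n) => ?f n)) summable_on Edeg N k" for k
    by (rule summable_on_finite) (rule C.finite_Edeg)
   have "(\<Sum>\<^sub>\<infinity>n\<in>Edeg N k. norm (case (k, n) of (k, n) => ?f n)) = F k" for k
    using C.finite_Edeg Fsum by (simp add: infsum_finite)
   thus "(%k. norm (\<Sum>\<^sub>\<infinity>n\<in>Edeg N k. norm (case (k, n) of (k, n) => ?f n))) summable_on UNIV"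
    using \<open>summable F\<close> F0 by (simp add: summable_on_UNIV_nonneg_real_iff)
  qed
  thus "(%(k, n). ?f n) summable_on Sigma UNIV (Edeg N)" by (rule abs_summable_summable)
 qed
 moreover have "bij_betw (%n. (wdeg N n, n)) ({1..N - 1} \<rightarrow>\<^sub>E UNIV) (Sigma UNIV (Edeg N))"
 proof -
  have "(%n. (wdeg N n, n)) ` A = Sigma UNIV (%k. {n : A. wdeg N n = k})" for A by auto
  thus ?thesis unfolding bij_betw_def Edeg_def inj_on_def by simp
 qed
 ultimately have "((%n. case (wdeg N n, n) of (k, n) => ?f n) has_sum S) ({1..N - 1} \<rightarrow>\<^sub>E UNIV)"
  using has_sum_reindex_bij_betw by blast
 thus ?thesis by (simp add: S_def wdeg_def)
qed

section \<open>The integral as a Toeplitz determinant\<close>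

abbreviation "ccirc == circlepath (0::complex) 1"
definition oint :: "(complex => complex) => complex" where "oint h = contour_integral ccirc (%z. h z / z)"

lemma oint_int: "ccont h ==> (%z. h z / z) contour_integrable_on ccirc"
 by (rule contour_integrable_continuous_circlepath) (auto intro!: continuous_intros)

lemma oint_cong: "(!!z. cmod z = 1 ==> h z = g z) ==> oint h = oint g"
 unfolding oint_def by (rule contour_integral_eq) auto

lemma oint_sum: assumes "finite I" "!!i. i : I ==> ccont (h i)" shows "oint (%z. SUM i:I. c i * h i z) = (SUM i:I. c i * oint (h i))"
proof -
 have "oint (%z. SUM i:I. c i * h i z) = contour_integral ccirc (%z. SUM i:I. c i * (h i z / z))"
  unfolding oint_def by (simp add: sum_divide_distrib)
 also have "... = (SUM i:I. contour_integral ccirc (%z. c i * (h i z / z)))"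
  by (rule contour_integral_sum[OF assms(1)]) (intro contour_integrable_lmul oint_int assms(2))
 also have "... = (SUM i:I. c i * oint (h i))"
  unfolding oint_def by (intro sum.cong refl contour_integral_lmul oint_int assms(2))
 finally show ?thesis .
qed

lemma iter_oint_cong:
 "(!!zs. length zs = n ==> (!!z. z : set zs ==> cmod z = 1) ==> h zs = g zs) ==> iter_oint n h = iter_oint n g"
proof (induction n arbitrary: h g)
 case (Suc n)
 have "iter_oint n (%zs. h (w # zs)) = iter_oint n (%zs. g (w # zs))" if "cmod w = 1" for w
  using that by (intro Suc.IH Suc.prems) auto
 thus ?case by (auto intro!: contour_integral_eq)
qed simp

text \<open>A finite sum of products of one-variable functions is integrated factor by factor;
  \<open>unit_diff_norm\<close> brings the integrand to this form.\<close>

lemma iter_oint_sum_prod: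
 assumes "finite I" "!!i a. i : I ==> a < n ==> ccont (h i a)"
 shows "iter_oint n (%zs. SUM i:I. c i * (\<Prod>a<n. h i a (zs ! a))) = (SUM i:I. c i * (\<Prod>a<n. oint (h i a)))"
 using assms(2)
proof (induction n arbitrary: h c)
 case (Suc n)
 have "iter_oint n (%zs. SUM i:I. c i * (\<Prod>a<Suc n. h i a ((w # zs) ! a))) = (SUM i:I. (c i * (\<Prod>a<n. oint (h i (Suc a)))) * h i 0 w)" for w
 proof -
  have "iter_oint n (%zs. SUM i:I. c i * (\<Prod>a<Suc n. h i a ((w # zs) ! a))) = iter_oint n (%zs. SUM i:I. (c i * h i 0 w) * (\<Prod>a<n. h i (Suc a) (zs ! a)))"
   unfolding prod.lessThan_Suc_shift by (simp add: mult.assoc)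
  also have "... = (SUM i:I. (c i * h i 0 w) * (\<Prod>a<n. oint (h i (Suc a))))"
   by (rule Suc.IH) (auto intro: Suc.prems)
  finally show ?thesis by (simp add: mult_ac)
 qed
 hence "iter_oint (Suc n) (%zs. SUM i:I. c i * (\<Prod>a<Suc n. h i a (zs ! a))) = oint (%w. SUM i:I. (c i * (\<Prod>a<n. oint (h i (Suc a)))) * h i 0 w)"
  by (simp add: oint_def)
 also have "... = (SUM i:I. (c i * (\<Prod>a<n. oint (h i (Suc a)))) * oint (h i 0))"
  by (rule oint_sum[OF assms(1)]) (auto intro: Suc.prems)
 also have "... = (SUM i:I. c i * (\<Prod>a<Suc n. oint (h i a)))"
  unfolding prod.lessThan_Suc_shift by (simp add: mult_ac)
 finally show ?case .
qed simp

lemma diag_prod_list: "prod_list (diag_mat (mat n n f)) = (\<Prod>i<n. f (i,i))"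
 unfolding prod_list_diag_prod lessThan_atLeast0 by (rule prod.cong) auto

lemma det_unitriangular:
 fixes f :: "nat \<times> nat => complex"
 assumes "!!i j. j < i ==> i < n ==> f (i,j) = 0" "!!i. i < n ==> f (i,i) = 1"
 shows "Det (mat n n f) = 1"
proof -
 have "upper_triangular (mat n n f)" using assms(1) by (auto simp: upper_triangular_def)
 hence "Det (mat n n f) = (\<Prod>i<n. f (i,i))" using diag_prod_list[of n f] by (simp add: det_upper_triangular[of _ n])
 thus ?thesis using assms(2) by simp
qed

text \<open>Newton's basis turns the Vandermonde matrix into a triangular one.\<close>

lemma vandermonde_det:
 "Det (mat n n (%(i,j). z i ^ j)) = (\<Prod>b<n. \<Prod>a<b. z b - z a)" for z :: "nat => complex"
proof -
 define P where "P j = (\<Prod>a<j. [:- z a, 1:])" for j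
 have dP: "degree (P j) = j" "poly.coeff (P j) j = 1" for j
 proof -
  have "degree (P j) = (\<Sum>a<j. degree [:- z a, 1:])" unfolding P_def by (rule degree_prod_eq_sum_degree) auto
  thus d: "degree (P j) = j" by simp
  have "lead_coeff (P j) = 1" unfolding P_def lead_coeff_prod by simp
  thus "poly.coeff (P j) j = 1" by (simp add: d)
 qed
 let ?V = "mat n n (%(i,j). z i ^ j)" and ?U = "mat n n (%(m,j). poly.coeff (P j) m)" and ?L = "mat n n (%(i,j). poly (P j) (z i))"
 have "?L = ?V * ?U"
 proof (rule eq_matI)
  fix i j assume ij: "i < dim_row (?V * ?U)" "j < dim_col (?V * ?U)"
  have "poly (P j) (z i) = (\<Sum>m\<le>j. poly.coeff (P j) m * z i ^ m)" by (simp add: poly_altdef dP(1))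
  also have "... = (\<Sum>m<n. poly.coeff (P j) m * z i ^ m)"
   using ij by (intro sum.mono_neutral_left) (auto simp: coeff_eq_0 dP(1))
  also have "... = (\<Sum>m<n. z i ^ m * poly.coeff (P j) m)" by (simp only: mult.commute)
  also have "... = (?V * ?U) $$ (i,j)" using ij by (simp add: scalar_prod_def lessThan_atLeast0)
  finally show "?L $$ (i,j) = (?V * ?U) $$ (i,j)" using ij by simp
 qed auto
 hence "Det ?L = Det ?V * Det ?U" by (simp add: det_mult[of _ n])
 moreover have "Det ?U = 1" by (rule det_unitriangular) (auto simp: coeff_eq_0 dP)
 moreover have "Det ?L = (\<Prod>b<n. \<Prod>a<b. z b - z a)"
 proof -
  have "Det ?L = prod_list (diag_mat ?L)"
  proof (rule det_lower_triangular)
   fix i j assume "i < j" "j < n"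
   thus "?L $$ (i,j) = 0" by (auto simp: P_def poly_prod)
  qed simp
  also have "... = (\<Prod>b<n. \<Prod>a<b. z b - z a)" by (simp add: diag_prod_list P_def poly_prod)
  finally show ?thesis .
 qed
 ultimately show ?thesis by simp
qed

text \<open>The left side is the Vandermonde determinant times its conjugate. Both are expanded by
  the Leibniz formula, and on the unit circle conjugation is inversion.\<close>

lemma unit_diff_norm:
 fixes z :: "nat => complex"
 assumes "!!a. a < n ==> cmod (z a) = 1"
 shows "(\<Prod>b<n. \<Prod>a<b. of_real ((cmod (z a - z b))\<^sup>2)) = (\<Sum>(p,q)\<in>{p. p permutes {0..<n}} \<times> {q. q permutes {0..<n}}.
   (signof p * signof q) * (\<Prod>a<n. z a powi (int (q a) - int (p a))))"
proof -
 let ?V = "mat n n (%(i,j). z i ^ j)"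
 have V: "Det ?V = (\<Sum>p | p permutes {0..<n}. signof p * (\<Prod>a<n. z a ^ p a))"
 proof -
  have "(\<Prod>i = 0..<n. ?V $$ (i, p i)) = (\<Prod>i<n. z i ^ p i)" if "p permutes {0..<n}" for p
   using permutes_in_image[OF that] by (auto simp: lessThan_atLeast0 intro!: prod.cong)
  thus ?thesis unfolding Determinant.det_def by (auto intro!: sum.cong)
 qed
 have sg: "cnj (signof p) = signof p" for p :: "nat => nat" by (simp add: sign_def)
 have pw: "cnj (z a) ^ k * z a ^ l = z a powi (int l - int k)" if "a < n" for a k l
 proof -
  have z0: "z a ~= 0" using assms[OF that] by auto
  have "z a * cnj (z a) = 1" using complex_norm_square[of "z a"] assms[OF that] by simp
  hence "cnj (z a) = inverse (z a)" by (rule inverse_unique[symmetric])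
  hence "cnj (z a) ^ k = inverse (z a ^ k)" by (simp only: power_inverse)
  thus ?thesis using z0 by (simp add: power_int_diff divide_inverse mult.commute)
 qed
 have "(\<Prod>b<n. \<Prod>a<b. of_real ((cmod (z a - z b))\<^sup>2)) = (\<Prod>b<n. \<Prod>a<b. cnj (z b - z a) * (z b - z a))"
 proof (intro prod.cong refl)
  fix a b
  have "complex_of_real ((cmod (z a - z b))\<^sup>2) = of_real ((cmod (z b - z a))\<^sup>2)" by (simp only: norm_minus_commute)
  also have "... = cnj (z b - z a) * (z b - z a)" by (simp only: complex_norm_square mult.commute)
  finally show "complex_of_real ((cmod (z a - z b))\<^sup>2) = cnj (z b - z a) * (z b - z a)" .
 qed
 also have "... = cnj (Det ?V) * Det ?V" by (simp add: vandermonde_det prod.distrib)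
 also have "... = (\<Sum>p | p permutes {0..<n}. signof p * (\<Prod>a<n. cnj (z a) ^ p a)) * (\<Sum>q | q permutes {0..<n}. signof q * (\<Prod>a<n. z a ^ q a))"
  unfolding V by (simp add: sg)
 also have "... = (\<Sum>(p,q)\<in>{p. p permutes {0..<n}} \<times> {q. q permutes {0..<n}}. (signof p * (\<Prod>a<n. cnj (z a) ^ p a)) * (signof q * (\<Prod>a<n. z a ^ q a)))"
  by (simp add: sum_product sum.cartesian_product)
 also have "... = (\<Sum>(p,q)\<in>{p. p permutes {0..<n}} \<times> {q. q permutes {0..<n}}. (signof p * signof q) * (\<Prod>a<n. z a powi (int (q a) - int (p a))))"
 proof (intro sum.cong refl, clarify)
  fix p q
  have "(\<Prod>a<n. z a powi (int (q a) - int (p a))) = (\<Prod>a<n. cnj (z a) ^ p a) * (\<Prod>a<n. z a ^ q a)"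
   unfolding prod.distrib[symmetric] by (intro prod.cong refl) (simp add: pw)
  thus "(signof p * (\<Prod>a<n. cnj (z a) ^ p a)) * (signof q * (\<Prod>a<n. z a ^ q a)) = (signof p * signof q) * (\<Prod>a<n. z a powi (int (q a) - int (p a)))"
   by (simp only: mult_ac)
 qed
 finally show ?thesis .
qed

definition toep :: "(complex => complex) => nat => complex mat" where
 "toep h n = mat n n (%(i,j). oint (%z. z powi (int j - int i) * h z) / (2 * of_real pi * \<i>))"

text \<open>For a fixed permutation p the sum over q is the Toeplitz determinant with rows permuted
  by p. The two signs of p cancel, so each of the n! permutations contributes the same
  amount.\<close>

lemma integral_toeplitz:
 assumes h: "ccont h"
 shows "iter_oint n (%zs. (\<Prod>b<n. \<Prod>a<b. of_real ((cmod (zs ! a - zs ! b))\<^sup>2)) * (\<Prod>a<n. h (zs ! a)))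
   = fact n * (2 * of_real pi * \<i>) ^ n * Det (toep h n)"
proof -
 let ?S = "{p. p permutes {0..<n}}"
 let ?c = "%k::int. oint (%z. z powi k * h z)"
 have fS: "finite ?S" by (rule finite_permutations) simp
 have "iter_oint n (%zs. (\<Prod>b<n. \<Prod>a<b. of_real ((cmod (zs ! a - zs ! b))\<^sup>2)) * (\<Prod>a<n. h (zs ! a)))
   = iter_oint n (%zs. SUM pq:?S \<times> ?S. (signof (fst pq) * signof (snd pq)) * (\<Prod>a<n. (zs ! a) powi (int (snd pq a) - int (fst pq a)) * h (zs ! a)))"
 proof (rule iter_oint_cong)
  fix zs :: "complex list" assume zs: "length zs = n" "!!z. z : set zs ==> cmod z = 1"
  hence u: "cmod (zs ! a) = 1" if "a < n" for a using that by simp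
  show "(\<Prod>b<n. \<Prod>a<b. of_real ((cmod (zs ! a - zs ! b))\<^sup>2)) * (\<Prod>a<n. h (zs ! a))
   = (SUM pq:?S \<times> ?S. (signof (fst pq) * signof (snd pq)) * (\<Prod>a<n. (zs ! a) powi (int (snd pq a) - int (fst pq a)) * h (zs ! a)))"
  proof -
   have e: "(\<Prod>b<n. \<Prod>a<b. of_real ((cmod (zs ! a - zs ! b))\<^sup>2)) = (SUM pq:?S \<times> ?S. (signof (fst pq) * signof (snd pq)) * (\<Prod>a<n. (zs ! a) powi (int (snd pq a) - int (fst pq a))))"
    using unit_diff_norm[of n "%a. zs ! a", OF u] by (simp add: case_prod_beta)
   show ?thesis unfolding e sum_distrib_right by (intro sum.cong refl) (simp add: prod.distrib mult.assoc)
  qed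
 qed
 also have "... = (SUM pq:?S \<times> ?S. (signof (fst pq) * signof (snd pq)) * (\<Prod>a<n. ?c (int (snd pq a) - int (fst pq a))))"
  by (rule iter_oint_sum_prod) (auto intro!: fS continuous_intros ccont_powi h)
 also have "... = (SUM p:?S. SUM q:?S. (signof p * signof q) * (\<Prod>a<n. ?c (int (q a) - int (p a))))"
  by (simp add: sum.cartesian_product case_prod_beta)
 also have "... = (SUM p:?S. (2 * of_real pi * \<i>) ^ n * Det (toep h n))"
 proof (rule sum.cong[OF refl])
  fix p assume p: "p : ?S"
  let ?A = "toep h n"
  have A: "?A : carrier_mat n n" by (simp add: toep_def)
  have pl: "p i < n" if "i < n" for i using permutes_in_image[of p "{0..<n}" i] p that by simp
  have "Det (mat n n (%(i,j). ?A $$ (p i, j))) = signof p * Det ?A"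
   using p by (intro det_permute_rows A) simp
  moreover have "Det (mat n n (%(i,j). ?A $$ (p i, j))) = (SUM q:?S. signof q * (\<Prod>a<n. ?c (int (q a) - int (p a)) / (2 * of_real pi * \<i>)))"
  proof -
   have "(\<Prod>i = 0..<n. mat n n (%(i,j). ?A $$ (p i, j)) $$ (i, q i)) = (\<Prod>a<n. ?c (int (q a) - int (p a)) / (2 * of_real pi * \<i>))"
    if "q permutes {0..<n}" for q
    using permutes_in_image[OF that] pl by (auto simp: lessThan_atLeast0 toep_def intro!: prod.cong)
   thus ?thesis unfolding Determinant.det_def by (auto intro!: sum.cong)
  qed
  ultimately have e: "(SUM q:?S. signof q * (\<Prod>a<n. ?c (int (q a) - int (p a)) / (2 * of_real pi * \<i>))) = signof p * Det ?A" by simp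
  have ss: "signof p * signof p = (1::complex)" by (simp add: sign_def)
  have "(SUM q:?S. (signof p * signof q) * (\<Prod>a<n. ?c (int (q a) - int (p a))))
    = (2 * of_real pi * \<i>) ^ n * signof p * (SUM q:?S. signof q * (\<Prod>a<n. ?c (int (q a) - int (p a)) / (2 * of_real pi * \<i>)))"
   unfolding sum_distrib_left by (intro sum.cong refl) (simp add: prod_dividef)
  also have "... = (2 * of_real pi * \<i>) ^ n * (signof p * signof p) * Det ?A" unfolding e by (simp only: mult_ac)
  finally show "(SUM q:?S. (signof p * signof q) * (\<Prod>a<n. ?c (int (q a) - int (p a)))) = (2 * of_real pi * \<i>) ^ n * Det ?A"
   by (simp only: ss mult_1_right)
 qed
 also have "... = fact n * (2 * of_real pi * \<i>) ^ n * Det (toep h n)"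
  by (simp add: card_permutations[of _ n])
 finally show ?thesis .
qed

section \<open>Evaluation of the Toeplitz determinant\<close>

definition phi :: "nat => (nat => complex) => (nat => complex) => complex => complex" where
 "phi N u w z = (\<Prod>i<N. 1 / (1 - u i * inverse z)) * (\<Prod>j<N. 1 / (1 - w j * z))"

lemma one_minus_nz: "cmod a < 1 ==> cmod z = 1 ==> 1 - a * z ~= 0" for a z :: complex
 by (metis eq_iff_diff_eq_0 less_irrefl mult.right_neutral norm_mult norm_one)

lemma phi_cont: assumes "!!i. i < N ==> cmod (u i) < 1" "!!i. i < N ==> cmod (w i) < 1" shows "ccont (phi N u w)"
proof -
 have "1 - u i * inverse z ~= 0" "1 - w i * z ~= 0" if "i < N" "z : sphere 0 1" for i z
  using one_minus_nz[of "u i" "inverse z"] one_minus_nz[of "w i" z] assms that by (auto simp: norm_inverse)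
 thus ?thesis unfolding phi_def by (intro continuous_intros) auto
qed

text \<open>After division by z the integrand is 1/(1 - b z) over z - a, whose only pole in the disc
  is a; Cauchy's formula evaluates it there.\<close>

lemma oint_kernel: assumes "cmod a < 1" "cmod b < 1"
 shows "oint (%z. 1 / (1 - a * inverse z) * (1 / (1 - b * z))) = 2 * of_real pi * \<i> * (1 / (1 - a * b))"
proof -
 have nz: "1 - b * z ~= 0" if "cmod z <= 1" for z
 proof
  assume "1 - b * z = 0"
  hence "cmod (b * z) = 1" by (metis eq_iff_diff_eq_0 norm_one)
  moreover have "cmod (b * z) <= cmod b * 1" unfolding norm_mult using that by (intro mult_left_mono) auto
  ultimately show False using assms(2) by simp
 qed
 have "((%z. (1 / (1 - b * z)) / (z - a)) has_contour_integral (2 * of_real pi * \<i> * (1 / (1 - b * a)))) ccirc"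
  by (rule Cauchy_integral_circlepath_simple) (use assms nz in \<open>auto intro!: holomorphic_intros\<close>)
 hence "contour_integral ccirc (%z. (1 / (1 - b * z)) / (z - a)) = 2 * of_real pi * \<i> * (1 / (1 - b * a))"
  by (rule contour_integral_unique)
 moreover have "oint (%z. 1 / (1 - a * inverse z) * (1 / (1 - b * z))) = contour_integral ccirc (%z. (1 / (1 - b * z)) / (z - a))"
  unfolding oint_def
 proof (rule contour_integral_eq)
  fix z assume "z : path_image ccirc"
  hence z: "cmod z = 1" "z ~= 0" by auto
  have "(1 - a * inverse z) * z = z - a" using z by (simp add: field_simps)
  thus "1 / (1 - a * inverse z) * (1 / (1 - b * z)) / z = (1 / (1 - b * z)) / (z - a)" by (metis divide_divide_eq_left mult.commute times_divide_eq_left mult_1)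
 qed
 ultimately show ?thesis by (simp add: mult.commute)
qed

text \<open>With E the product of all factors 1 - u j z, this is E divided by its i-th
  factor.\<close>

definition coefE :: "nat => (nat => complex) => nat => complex poly" where
 "coefE N u i = (PROD j:{..<N} - {i}. [:1, - u j:])"

definition Mm :: "nat => (nat => complex) => complex mat" where
 "Mm N u = mat N N (%(i,k). poly.coeff (coefE N u i) k)"

lemma degree_coefE: "i < N ==> degree (coefE N u i) < N"
proof -
 assume i: "i < N"
 have "degree (coefE N u i) <= (SUM j:{..<N} - {i}. degree [:1, - u j:])" unfolding coefE_def
  using degree_prod_sum_le[of "{..<N} - {i}" "%j. [:1, - u j:]"] by (simp add: comp_def)
 also have "... <= (SUM j:{..<N} - {i}. 1)" by (intro sum_mono) simp
 also have "... < N" using i by simp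
 finally show ?thesis .
qed

lemma poly_coefE: "i < N ==> (\<Sum>k<N. poly.coeff (coefE N u i) k * z ^ k) = (PROD j:{..<N} - {i}. 1 - u j * z)"
proof -
 assume i: "i < N"
 have "(PROD j:{..<N} - {i}. 1 - u j * z) = poly (coefE N u i) z" by (simp add: coefE_def poly_prod mult.commute)
 also have "... = (\<Sum>k\<le>degree (coefE N u i). poly.coeff (coefE N u i) k * z ^ k)" by (rule poly_altdef)
 also have "... = (\<Sum>k<N. poly.coeff (coefE N u i) k * z ^ k)"
  using degree_coefE[OF i, of u] by (intro sum.mono_neutral_left) (auto simp: coeff_eq_0)
 finally show ?thesis by simp
qed

lemma coefE_0: "poly.coeff (coefE N u i) 0 = 1"
 unfolding poly_0_coeff_0[symmetric] by (simp add: coefE_def poly_prod)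

lemma Mm_carrier [simp]: "Mm N u : carrier_mat N N" by (simp add: Mm_def)

lemma det_mat_mult: "Det (mat n n f * mat n n g) = Det (mat n n f) * Det (mat n n g)" for f :: "_ => complex"
 by (rule det_mult) auto

lemma det_diag_mat: "Det (mat n n (%(i,j). if i = j then f i else 0)) = (\<Prod>i<n. f i :: complex)"
proof -
 let ?A = "mat n n (%(i,j). if i = j then f i else 0)"
 have "Det ?A = prod_list (diag_mat ?A)" by (rule det_lower_triangular[of n]) auto
 thus ?thesis by (simp add: diag_prod_list)
qed

text \<open>Multiplication by the Vandermonde matrix of the inverses evaluates the polynomials at
  1/u l. The i-th polynomial contains the factor 1 - u l z unless l = i, so the product is
  diagonal.\<close>

lemma Mm_det_nz: assumes d: "!!i. i < N ==> u i ~= 0" "inj_on u {..<N}" shows "Det (Mm N u) ~= 0"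
proof -
 let ?W = "mat N N (%(k,l). inverse (u l) ^ k)" and ?f = "%i. PROD j:{..<N} - {i}. 1 - u j * inverse (u i)"
 have "Mm N u * ?W = mat N N (%(i,j). if i = j then ?f i else 0)"
 proof (rule eq_matI)
  fix i l assume il: "i < dim_row (mat N N (%(i,j). if i = j then ?f i else 0))" "l < dim_col (mat N N (%(i,j). if i = j then ?f i else 0))"
  hence il: "i < N" "l < N" by auto
  have "(Mm N u * ?W) $$ (i,l) = (\<Sum>k<N. poly.coeff (coefE N u i) k * inverse (u l) ^ k)"
   using il by (simp add: Mm_def scalar_prod_def lessThan_atLeast0)
  also have "... = (PROD j:{..<N} - {i}. 1 - u j * inverse (u l))" by (rule poly_coefE[OF il(1)])
  also have "... = (if i = l then ?f i else 0)"
   using il d(1)[OF il(2)] by (auto intro!: prod_zero bexI[of _ l])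
  finally show "(Mm N u * ?W) $$ (i,l) = mat N N (%(i,j). if i = j then ?f i else 0) $$ (i,l)" using il by simp
 qed (auto simp: Mm_def)
 hence "Det (Mm N u) * Det ?W = (\<Prod>i<N. ?f i)"
  unfolding det_diag_mat[symmetric] Mm_def det_mat_mult[symmetric] by simp
 moreover have "?f i ~= 0" if i: "i < N" for i
 proof -
  have "1 - u j * inverse (u i) ~= 0" if "j : {..<N} - {i}" for j
  proof
   assume "1 - u j * inverse (u i) = 0"
   hence "u j = u i" using d(1)[OF i] by (simp add: field_simps)
   thus False using d(2) i that by (auto simp: inj_on_def)
  qed
  thus ?thesis by simp
 qed
 ultimately show ?thesis by auto
qed

definition vand :: "nat => (nat => complex) => complex mat" where "vand N u = mat N N (%(i,k). u i ^ k)"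

text \<open>The coefficients of E(\<zeta>)/(1 - u_i \<zeta>) are partial convolutions of those of E with the powers of u_i, whence M = V U with U unitriangular.\<close>

lemma Mm_vand: "Det (Mm N u) = Det (vand N u)"
proof -
 define E where "E = (\<Prod>j<N. [:1, - u j:])"
 have E0: "poly.coeff E 0 = 1" unfolding poly_0_coeff_0[symmetric] by (simp add: E_def poly_prod)
 have fac: "E = [:1, - u i:] * coefE N u i" if "i < N" for i
  unfolding E_def coefE_def using that by (intro prod.remove) auto
 have co: "poly.coeff (coefE N u i) k = (\<Sum>m\<le>k. u i ^ m * poly.coeff E (k - m))" if i: "i < N" for i k
 proof (induction k)
  case 0
  show ?case by (simp add: coefE_0 E0)
 next
  case (Suc k)
  have "poly.coeff E (Suc k) = poly.coeff (coefE N u i) (Suc k) - u i * poly.coeff (coefE N u i) k"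
   unfolding fac[OF i] by (simp add: coeff_pCons)
  hence "poly.coeff (coefE N u i) (Suc k) = poly.coeff E (Suc k) + u i * (\<Sum>m\<le>k. u i ^ m * poly.coeff E (k - m))"
   using Suc by simp
  also have "... = (\<Sum>m\<le>Suc k. u i ^ m * poly.coeff E (Suc k - m))"
   unfolding sum.atMost_Suc_shift by (simp add: sum_distrib_left mult.assoc)
  finally show ?case .
 qed
 let ?U = "%(m,k). if m <= k then poly.coeff E (k - m) else 0"
 have "Mm N u = vand N u * mat N N ?U"
 proof (rule eq_matI)
  fix i k assume "i < dim_row (vand N u * mat N N ?U)" "k < dim_col (vand N u * mat N N ?U)"
  hence ik: "i < N" "k < N" by (auto simp: vand_def)
  have "(\<Sum>m<N. u i ^ m * (if m <= k then poly.coeff E (k - m) else 0)) = (\<Sum>m\<le>k. u i ^ m * poly.coeff E (k - m))"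
   using ik by (intro sum.mono_neutral_cong_right) auto
  thus "Mm N u $$ (i,k) = (vand N u * mat N N ?U) $$ (i,k)"
   using ik by (simp add: Mm_def co vand_def scalar_prod_def lessThan_atLeast0)
 qed (auto simp: Mm_def vand_def)
 moreover have "Det (mat N N ?U) = 1" by (rule det_unitriangular) (auto simp: E0)
 ultimately show ?thesis unfolding vand_def by (simp add: det_mat_mult)
qed

context
 fixes N :: nat and u w :: "nat => complex"
 assumes u1: "!!i. i < N ==> cmod (u i) < 1" and w1: "!!i. i < N ==> cmod (w i) < 1"
begin

abbreviation "tti == 2 * complex_of_real pi * \<i>"
definition "tt k l = oint (%z. z powi (int l - int k) * phi N u w z) / tti"
definition "Mt = mat N N (%(l,j). poly.coeff (coefE N w j) l)"
definition "Cm = mat N N (%(i,j). 1 / (1 - u i * w j))"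

lemma Mt_det: "Det Mt = Det (Mm N w)"
proof -
 have "Mt = transpose_mat (Mm N w)" by (rule eq_matI) (auto simp: Mt_def Mm_def)
 thus ?thesis by (simp add: det_transpose[of _ N])
qed

lemma uw_nz: "i < N ==> j < N ==> 1 - u i * w j ~= 0"
proof
 assume ij: "i < N" "j < N" and e: "1 - u i * w j = 0"
 have "cmod (u i * w j) < 1 * 1" unfolding norm_mult using u1[OF ij(1)] w1[OF ij(2)] by (intro mult_strict_mono) auto
 moreover have "cmod (u i * w j) = 1" using e by (metis eq_iff_diff_eq_0 norm_one)
 ultimately show False by simp
qed

text \<open>The coefficients combine to polynomials in 1/z and z that cancel all factors of
  \<open>phi N u w\<close> except the i-th on one side and the j-th on the other, which leaves the
  integral of \<open>oint_kernel\<close>.\<close>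

lemma kernel_entry: assumes i: "i < N" and j: "j < N"
 shows "(\<Sum>k<N. \<Sum>l<N. poly.coeff (coefE N u i) k * poly.coeff (coefE N w j) l * tt k l) = 1 / (1 - u i * w j)"
proof -
 let ?a = "%k. poly.coeff (coefE N u i) k" and ?b = "%l. poly.coeff (coefE N w j) l"
 have "(\<Sum>k<N. \<Sum>l<N. ?a k * ?b l * tt k l) = (SUM x:{..<N} \<times> {..<N}. (?a (fst x) * ?b (snd x)) * oint (%z. z powi (int (snd x) - int (fst x)) * phi N u w z)) / tti"
  by (simp add: tt_def sum.cartesian_product case_prod_beta sum_divide_distrib)
 also have "(SUM x:{..<N} \<times> {..<N}. (?a (fst x) * ?b (snd x)) * oint (%z. z powi (int (snd x) - int (fst x)) * phi N u w z))
   = oint (%z. SUM x:{..<N} \<times> {..<N}. (?a (fst x) * ?b (snd x)) * (z powi (int (snd x) - int (fst x)) * phi N u w z))"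
  by (rule oint_sum[symmetric]) (auto intro!: continuous_intros ccont_powi phi_cont u1 w1)
 also have "... = oint (%z. 1 / (1 - u i * inverse z) * (1 / (1 - w j * z)))"
 proof (rule oint_cong)
  fix z assume z: "cmod z = 1"
  hence z0: "z ~= 0" by auto
  have nzu: "1 - u k * inverse z ~= 0" if "k < N" for k using one_minus_nz[of "u k" "inverse z"] u1[OF that] z by (simp add: norm_inverse)
  have nzw: "1 - w k * z ~= 0" if "k < N" for k using one_minus_nz[of "w k" z] w1[OF that] z by simp
  have "(SUM x:{..<N} \<times> {..<N}. (?a (fst x) * ?b (snd x)) * (z powi (int (snd x) - int (fst x)) * phi N u w z))
   = (\<Sum>k<N. \<Sum>l<N. (?a k * inverse z ^ k) * (?b l * z ^ l)) * phi N u w z"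
   unfolding sum_distrib_right sum.cartesian_product
   using z0 by (intro sum.cong refl) (simp add: case_prod_beta power_int_diff power_inverse divide_inverse mult_ac)
  also have "(\<Sum>k<N. \<Sum>l<N. (?a k * inverse z ^ k) * (?b l * z ^ l)) = (PROD k:{..<N} - {i}. 1 - u k * inverse z) * (PROD k:{..<N} - {j}. 1 - w k * z)"
   by (simp only: sum_product[symmetric] poly_coefE[OF i] poly_coefE[OF j])
  also have "(PROD k:{..<N} - {i}. 1 - u k * inverse z) * (PROD k:{..<N} - {j}. 1 - w k * z) * phi N u w z
    = (PROD k:{..<N} - {i}. 1 - u k * inverse z) * (PROD k:{..<N} - {j}. 1 - w k * z) * ((1 / (1 - u i * inverse z) * (PROD k:{..<N} - {i}. 1 / (1 - u k * inverse z))) * (1 / (1 - w j * z) * (PROD k:{..<N} - {j}. 1 / (1 - w k * z))))"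
  proof -
   have rem: "(\<Prod>k<N. f k) = f m * (PROD k:{..<N} - {m}. f k)" if "m < N" for f :: "nat => complex" and m
    using that by (intro prod.remove) auto
   show ?thesis unfolding phi_def rem[OF i, of "%k. 1 / (1 - u k * inverse z)"] rem[OF j, of "%k. 1 / (1 - w k * z)"] ..
  qed
  also have "... = (PROD k:{..<N} - {i}. (1 - u k * inverse z) * (1 / (1 - u k * inverse z))) * (PROD k:{..<N} - {j}. (1 - w k * z) * (1 / (1 - w k * z))) * (1 / (1 - u i * inverse z) * (1 / (1 - w j * z)))"
   unfolding prod.distrib by (simp only: mult_ac)
  also have "(PROD k:{..<N} - {i}. (1 - u k * inverse z) * (1 / (1 - u k * inverse z))) = 1" using nzu by (intro prod.neutral) auto
  also have "(PROD k:{..<N} - {j}. (1 - w k * z) * (1 / (1 - w k * z))) = 1" using nzw by (intro prod.neutral) auto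
  finally show "(SUM x:{..<N} \<times> {..<N}. (?a (fst x) * ?b (snd x)) * (z powi (int (snd x) - int (fst x)) * phi N u w z)) = 1 / (1 - u i * inverse z) * (1 / (1 - w j * z))" by simp
 qed
 also have "... / tti = 1 / (1 - u i * w j)" unfolding oint_kernel[OF u1[OF i] w1[OF j]] by simp
 finally show ?thesis .
qed

lemma sandwich: assumes e: "!!i j. i < N ==> j < N ==> (\<Sum>k<N. \<Sum>l<N. poly.coeff (coefE N u i) k * poly.coeff (coefE N w j) l * f k l) = g i j"
 shows "Det (Mm N u) * Det (mat N N (%(k,l). f k l)) * Det (Mm N w) = Det (mat N N (%(i,j). g i j))"
proof -
 let ?F = "mat N N (%(k,l). f k l)"
 have "Mm N u * ?F * Mt = mat N N (%(i,j). g i j)"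
 proof (rule eq_matI)
  fix i j assume "i < dim_row (mat N N (%(i,j). g i j))" "j < dim_col (mat N N (%(i,j). g i j))"
  hence ij: "i < N" "j < N" by auto
  have "(Mm N u * ?F * Mt) $$ (i,j) = (\<Sum>l<N. (\<Sum>k<N. poly.coeff (coefE N u i) k * f k l) * poly.coeff (coefE N w j) l)"
   using ij by (simp add: Mm_def Mt_def scalar_prod_def lessThan_atLeast0)
  also have "... = g i j" unfolding e[OF ij, symmetric] sum_distrib_right by (subst sum.swap) (simp add: mult_ac)
  finally show "(Mm N u * ?F * Mt) $$ (i,j) = mat N N (%(i,j). g i j) $$ (i,j)" using ij by simp
 qed (auto simp: Mm_def Mt_def)
 hence "Det (Mm N u * ?F * Mt) = Det (mat N N (%(i,j). g i j))" by simp
 moreover have "Det (Mm N u * ?F * Mt) = Det (Mm N u) * Det ?F * Det Mt"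
 proof -
  have F: "?F : carrier_mat N N" and T: "Mt : carrier_mat N N" by (auto simp: Mt_def)
  show ?thesis by (simp only: det_mult[OF mult_carrier_mat[OF Mm_carrier F] T] det_mult[OF Mm_carrier F])
 qed
 ultimately show ?thesis by (simp add: Mt_det)
qed

text \<open>Multiplying row i of the Cauchy matrix by all factors 1 - u i w k turns its entries into
  the polynomials \<open>coefE N w j\<close> evaluated at u i, a Vandermonde matrix times a
  coefficient matrix.\<close>

lemma cauchy_det: "(\<Prod>i<N. \<Prod>k<N. 1 - u i * w k) * Det Cm = Det (Mm N u) * Det (Mm N w)"
proof -
 let ?D = "mat N N (%(i,j). if i = j then \<Prod>k<N. 1 - u i * w k else 0)"
 have "?D * Cm = vand N u * Mt"
 proof (rule eq_matI)
  fix i j assume "i < dim_row (vand N u * Mt)" "j < dim_col (vand N u * Mt)"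
  hence ij: "i < N" "j < N" by (auto simp: vand_def Mt_def)
  have "(?D * Cm) $$ (i,j) = (\<Sum>k<N. (if i = k then \<Prod>k<N. 1 - u i * w k else 0) * (1 / (1 - u k * w j)))"
   using ij by (simp add: Cm_def scalar_prod_def lessThan_atLeast0)
  also have "... = (\<Sum>k<N. if k = i then (\<Prod>k<N. 1 - u i * w k) * (1 / (1 - u i * w j)) else 0)" by (intro sum.cong refl) auto
  also have "... = (\<Prod>k<N. 1 - u i * w k) * (1 / (1 - u i * w j))" using ij by simp
  also have "(\<Prod>k<N. 1 - u i * w k) = (1 - u i * w j) * (PROD k:{..<N} - {j}. 1 - u i * w k)" using ij by (intro prod.remove) auto
  also have "... * (1 / (1 - u i * w j)) = (PROD k:{..<N} - {j}. 1 - u i * w k)" using uw_nz[OF ij] by simp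
  also have "... = (\<Sum>l<N. poly.coeff (coefE N w j) l * u i ^ l)" unfolding poly_coefE[OF ij(2)] by (simp only: mult.commute)
  also have "... = (vand N u * Mt) $$ (i,j)"
   using ij by (simp add: vand_def Mt_def scalar_prod_def lessThan_atLeast0 mult.commute)
  finally show "(?D * Cm) $$ (i,j) = (vand N u * Mt) $$ (i,j)" .
 qed (auto simp: Cm_def vand_def Mt_def)
 hence "Det (?D * Cm) = Det (vand N u * Mt)" by simp
 thus ?thesis
  unfolding Cm_def vand_def Mt_def det_mat_mult det_diag_mat by (simp add: Mt_det[unfolded Mt_def] Mm_vand[of N u, unfolded vand_def])
qed

lemma toep_tt: "toep (phi N u w) m = mat m m (%(k,l). tt k l)" unfolding toep_def tt_def by simp

lemma toeplitz_generic:
 assumes N: "N = Suc n" and d: "!!i. i < N ==> u i ~= 0" "inj_on u {..<N}" "!!i. i < N ==> w i ~= 0" "inj_on w {..<N}"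
 shows "Det (toep (phi N u w) n) * (\<Prod>i<N. \<Prod>k<N. 1 - u i * w k) = 1 - (\<Prod>i<N. u i) * (\<Prod>i<N. w i)"
proof -
 let ?T = "mat N N (%(k,l). tt k l)" and ?T' = "mat N N (%(k,l). tt k l - (if k = 0 & l = 0 then 1 else 0))"
 let ?dM = "Det (Mm N u)" and ?dM' = "Det (Mm N w)" and ?P = "\<Prod>i<N. \<Prod>k<N. 1 - u i * w k"
 have nz: "?dM * ?dM' ~= 0" using Mm_det_nz[OF d(1,2)] Mm_det_nz[OF d(3,4)] by simp
 have 1: "?dM * Det ?T * ?dM' = Det Cm" unfolding Cm_def by (rule sandwich) (rule kernel_entry)
 have T1: "?P * Det ?T = 1"
 proof -
  have "(?dM * ?dM') * (?P * Det ?T) = ?P * (?dM * Det ?T * ?dM')" by (simp only: mult_ac)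
  also have "... = (?dM * ?dM') * 1" unfolding 1 cauchy_det by simp
  finally show ?thesis using nz by (simp only: mult_cancel_left) simp
 qed
 \<comment> \<open>All the polynomials have constant term 1, so lowering the corner entry by 1
   lowers every entry of the Cauchy matrix by 1.\<close>
 have 2: "?dM * Det ?T' * ?dM' = Det (mat N N (%(i,j). 1 / (1 - u i * w j) - 1))"
 proof (rule sandwich)
  fix i j assume ij: "i < N" "j < N"
  let ?a = "%k. poly.coeff (coefE N u i) k" and ?b = "%l. poly.coeff (coefE N w j) l"
  have "(\<Sum>k<N. \<Sum>l<N. ?a k * ?b l * (if k = 0 & l = 0 then 1 else 0)) = (\<Sum>k<N. \<Sum>l<N. if l = 0 then (if k = 0 then 1 else 0) else 0)"
   by (intro sum.cong refl) (auto simp: coefE_0)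
  also have "... = 1" using N by (simp add: sum.delta)
  finally show "(\<Sum>k<N. \<Sum>l<N. ?a k * ?b l * (tt k l - (if k = 0 & l = 0 then 1 else 0))) = 1 / (1 - u i * w j) - 1"
   using kernel_entry[OF ij] by (simp only: right_diff_distrib sum_subtractf)
 qed
 have "mat N N (%(i,j). 1 / (1 - u i * w j) - 1) = mat N N (%(i,j). u i * w j * (%(i,j). 1 / (1 - u i * w j)) (i,j))"
  by (rule eq_matI) (use uw_nz in \<open>auto simp: field_simps\<close>)
 hence "Det (mat N N (%(i,j). 1 / (1 - u i * w j) - 1)) = (\<Prod>i<N. u i) * (\<Prod>i<N. w i) * Det Cm"
  using minor_scale[of N u w "%(i,j). 1 / (1 - u i * w j)"] unfolding minor_def Cm_def by simp
 hence "(?dM * ?dM') * Det ?T' = (?dM * ?dM') * ((\<Prod>i<N. u i) * (\<Prod>i<N. w i) * Det ?T)"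
  using 1 2 by (simp add: mult_ac)
 hence T': "Det ?T' = (\<Prod>i<N. u i) * (\<Prod>i<N. w i) * Det ?T" using nz by (simp only: mult_cancel_left) simp
 \<comment> \<open>The two matrices differ only in row 0, so their expansions along it have the same
   cofactors and differ in the corner term alone.\<close>
 have cof: "cofactor ?T' 0 j = cofactor ?T 0 j" for j
 proof -
  have "mat_delete ?T' 0 j = mat_delete ?T 0 j" unfolding mat_delete_def by (rule eq_matI) auto
  thus ?thesis by (simp add: cofactor_def)
 qed
 have "Det ?T = (\<Sum>j<N. ?T $$ (0,j) * cofactor ?T 0 j)" by (rule laplace_expansion_row) (auto simp: N)
 moreover have "Det ?T' = (\<Sum>j<N. ?T' $$ (0,j) * cofactor ?T' 0 j)" by (rule laplace_expansion_row) (auto simp: N)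
 ultimately have "Det ?T - Det ?T' = (\<Sum>j<N. (?T $$ (0,j) - ?T' $$ (0,j)) * cofactor ?T 0 j)"
  by (simp only: cof left_diff_distrib sum_subtractf)
 also have "... = (\<Sum>j<N. if j = 0 then cofactor ?T 0 0 else 0)" using N by (intro sum.cong refl) auto
 also have "... = cofactor ?T 0 0" using N by simp
 also have "... = Det (toep (phi N u w) n)"
 proof -
  \<comment> \<open>Entries depend on the difference of the indices only, so deleting row and column
    0 gives the Toeplitz matrix of the next smaller size.\<close>
  have s: "tt (Suc i) (Suc j) = tt i j" for i j by (simp add: tt_def)
  have "mat_delete ?T 0 0 = toep (phi N u w) n"
   unfolding toep_tt mat_delete_def by (rule eq_matI) (use N s in auto)
  thus ?thesis by (simp add: cofactor_def)
 qed
 finally have "Det (toep (phi N u w) n) = (1 - (\<Prod>i<N. u i) * (\<Prod>i<N. w i)) * Det ?T" unfolding T' by (simp add: algebra_simps)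
 thus ?thesis using T1 by (simp add: mult_ac)
qed

end

section \<open>From generic to arbitrary fugacities\<close>

lemma oint_circ_mean: "oint h = 2 * of_real pi * \<i> * circ_mean h"
proof -
 have c: "ccirc x = cis (2 * pi * x)" for x by (simp add: circlepath cis_conv_exp mult_ac)
 have "oint h = integral {0..1} (%x. h (ccirc x) / ccirc x * vector_derivative ccirc (at x))"
  unfolding oint_def by (rule contour_integral_integral)
 also have "... = integral {0..1} (%x. 2 * of_real pi * \<i> * h (cis (2 * pi * x)))"
 proof (rule integral_cong)
  fix x :: real
  have "vector_derivative ccirc (at x) = 2 * of_real pi * \<i> * ccirc x" unfolding vector_derivative_circlepath by (simp add: circlepath)
  thus "h (ccirc x) / ccirc x * vector_derivative ccirc (at x) = 2 * of_real pi * \<i> * h (cis (2 * pi * x))" unfolding c by simp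
 qed
 finally show ?thesis by (simp add: circ_mean_def)
qed

lemma finite_affine_zeros: fixes a b :: complex assumes "b ~= 0" shows "finite {ep::real. a + of_real ep * b = 0}"
proof (rule finite_subset)
 show "{ep::real. a + of_real ep * b = 0} \<subseteq> {Re (- a / b)}"
 proof
  fix ep :: real assume "ep : {ep::real. a + of_real ep * b = 0}"
  hence "of_real ep * b = - a" by (simp add: eq_neg_iff_add_eq_0 add.commute)
  hence "of_real ep = - a / b" using assms by (subst nonzero_eq_divide_eq)
  hence "Re (of_real ep) = Re (- a / b)" by (rule arg_cong)
  thus "ep : {Re (- a / b)}" by simp
 qed
qed simp

text \<open>The slopes i + 1 are nonzero and pairwise different, so every failing condition excludes
  at most one value of \<open>ep\<close>.\<close>

lemma generic_perturbation:
 fixes u :: "nat => complex"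
 shows "finite {ep::real. ~ ((ALL i<N. u i + of_real ep * of_nat (Suc i) ~= 0) & inj_on (%i. u i + of_real ep * of_nat (Suc i)) {..<N})}"
proof (rule finite_subset)
 let ?Z = "%a b. {ep::real. a + of_real ep * (b::complex) = 0}"
 show "{ep::real. ~ ((ALL i<N. u i + of_real ep * of_nat (Suc i) ~= 0) & inj_on (%i. u i + of_real ep * of_nat (Suc i)) {..<N})}
  \<subseteq> (\<Union>i<N. ?Z (u i) (of_nat (Suc i))) \<union> (\<Union>i<N. \<Union>j\<in>{..<N} - {i}. ?Z (u i - u j) (of_nat (Suc i) - of_nat (Suc j)))"
  by (auto simp: inj_on_def algebra_simps)
 have "of_nat (Suc i) - of_nat (Suc j) ~= (0 :: complex)" if "j ~= i" for i j using that by simp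
 moreover have "of_nat (Suc i) ~= (0 :: complex)" for i by (simp only: of_nat_eq_0_iff)
 ultimately show "finite ((\<Union>i<N. ?Z (u i) (of_nat (Suc i))) \<union> (\<Union>i<N. \<Union>j\<in>{..<N} - {i}. ?Z (u i - u j) (of_nat (Suc i) - of_nat (Suc j))))"
  by (intro finite_UnI finite_UN_I finite_lessThan finite_Diff finite_affine_zeros) auto
qed

lemma zero_at_0:
 fixes h :: "real => complex"
 assumes h: "continuous_on {0..de} h" and d: "de > 0" and F: "finite F" and z: "!!ep. 0 < ep ==> ep <= de ==> ep \<notin> F ==> h ep = 0"
 shows "h 0 = 0"
proof -
 have "(h \<longlongrightarrow> h 0) (at 0 within {0..de})" using h d by (simp add: continuous_on_def)
 moreover have "\<forall>\<^sub>F ep in at 0 within {0..de}. h ep = 0"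
 proof -
  have "\<forall>\<^sub>F ep in at 0 within {0..de}. ep \<notin> F - {0}"
  proof -
   have "open (- (F - {0}))" using F by (intro open_Compl finite_imp_closed finite_Diff)
   thus ?thesis unfolding eventually_at_topological by (intro exI[of _ "- (F - {0})"]) simp
  qed
  moreover have "\<forall>\<^sub>F ep in at 0 within {0..de}. ep : {0..de} & ep ~= 0" by (auto simp: eventually_at_filter)
  ultimately show ?thesis by eventually_elim (auto intro: z)
 qed
 hence "(h \<longlongrightarrow> 0) (at 0 within {0..de})" by (rule tendsto_eventually)
 moreover have "at 0 within {0..de} ~= bot" using d by (simp add: at_within_Icc_at_right)
 ultimately show ?thesis using tendsto_unique by blast
qed

text \<open>\<open>toeplitz_generic\<close> asks for nonzero and distinct entries, which fails for
  instance at t = 0 or when all fugacities are 1. Both sides are continuous in the perturbation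
  parameter, and all but finitely many small positive values are generic.\<close>

theorem toeplitz_det:
 fixes u w :: "nat => complex"
 assumes u: "!!i. i < Suc n ==> cmod (u i) < 1" and w: "!!i. i < Suc n ==> cmod (w i) < 1"
 shows "Det (toep (phi (Suc n) u w) n) * (\<Prod>i<Suc n. \<Prod>k<Suc n. 1 - u i * w k) = 1 - (\<Prod>i<Suc n. u i) * (\<Prod>i<Suc n. w i)"
proof -
 let ?N = "Suc n"
 define U W where "U ep i = u i + of_real ep * of_nat (Suc i)" and "W ep i = w i + of_real ep * of_nat (Suc i)" for ep :: real and i
 define M where "M = Max ((%i. cmod (u i)) ` {..<?N} \<union> (%i. cmod (w i)) ` {..<?N})"
 have M: "cmod (u i) <= M" "cmod (w i) <= M" if "i < ?N" for i unfolding M_def using that by (auto intro!: Max_ge)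
 have M1: "M < 1" unfolding M_def using u w by (subst Max_less_iff) auto
 \<comment> \<open>Moves the largest modulus at most halfway from M to 1, so the poles stay on their
   side of the circle.\<close>
 define de where "de = (1 - M) / (2 * real ?N)"
 have d: "de > 0" using M1 by (simp add: de_def)
 have pert: "cmod (v i + of_real ep * of_nat (Suc i)) < 1" if "cmod (v i) <= M" "0 <= ep" "ep <= de" "i < ?N" for v :: "nat => complex" and ep i
 proof -
  have "cmod (v i + of_real ep * of_nat (Suc i)) <= M + ep * real (Suc i)"
   using norm_triangle_ineq[of "v i" "of_real ep * of_nat (Suc i)"] that by (simp add: norm_mult del: of_nat_Suc)
  also have "ep * real (Suc i) <= de * real ?N" using that by (intro mult_mono) auto
  also have "M + de * real ?N < 1" using M1 by (simp add: de_def field_simps del: of_nat_Suc)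
  finally show ?thesis by simp
 qed
 have U1: "cmod (U ep i) < 1" "cmod (W ep i) < 1" if "0 <= ep" "ep <= de" "i < ?N" for ep i
  using pert[of u, OF M(1)] pert[of w, OF M(2)] that by (auto simp: U_def W_def)
 have cont: "continuous_on {0..de} (%ep. oint (%z. z powi k * phi ?N (U ep) (W ep) z))" for k :: int
 proof -
  have "continuous_on ({0..de} \<times> cbox 0 (1::real)) (%(ep, th). cis (2 * pi * th) powi k * phi ?N (U ep) (W ep) (cis (2 * pi * th)))"
  proof -
   have nz: "1 - U ep i * inverse (cis (2 * pi * th)) ~= 0" "1 - W ep i * cis (2 * pi * th) ~= 0"
    if "ep : {0..de}" "i < ?N" for ep i th
    using one_minus_nz[OF U1(1), of ep i "inverse (cis (2 * pi * th))"] one_minus_nz[OF U1(2), of ep i "cis (2 * pi * th)"] that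
    by (auto simp: norm_inverse)
   show ?thesis unfolding phi_def case_prod_beta
    unfolding U_def W_def by (intro continuous_intros continuous_on_power_int) (use nz in \<open>auto simp: U_def W_def\<close>)
  qed
  hence "continuous_on {0..de} (%ep. integral (cbox 0 1) (%th. cis (2 * pi * th) powi k * phi ?N (U ep) (W ep) (cis (2 * pi * th))))"
   by (rule integral_continuous_on_param)
  thus ?thesis unfolding oint_circ_mean circ_mean_def by (intro continuous_on_mult_left) simp
 qed
 define h where "h ep = Det (toep (phi ?N (U ep) (W ep)) n) * (\<Prod>i<?N. \<Prod>k<?N. 1 - U ep i * W ep k) - (1 - (\<Prod>i<?N. U ep i) * (\<Prod>i<?N. W ep i))" for ep
 have "h 0 = 0"
 proof (rule zero_at_0)
  have "continuous_on {0..de} (%ep. Det (toep (phi ?N (U ep) (W ep)) n))"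
  proof -
   have L: "Det (toep (phi ?N (U ep) (W ep)) n) = (\<Sum>p | p permutes {0..<n}. signof p * (\<Prod>i = 0..<n. oint (%z. z powi (int (p i) - int i) * phi ?N (U ep) (W ep) z) / (2 * of_real pi * \<i>)))" for ep
    using minor_Leibniz[of n "%(i,j). oint (%z. z powi (int j - int i) * phi ?N (U ep) (W ep) z) / (2 * of_real pi * \<i>)"] by (simp add: minor_def toep_def)
   show ?thesis unfolding L by (intro continuous_intros cont) auto
  qed
  thus "continuous_on {0..de} h" unfolding h_def U_def W_def by (intro continuous_intros) auto
  show "de > 0" by (rule d)
  let ?bad = "%v. {ep::real. ~ ((ALL i<?N. v i + of_real ep * of_nat (Suc i) ~= (0::complex)) & inj_on (%i. v i + of_real ep * of_nat (Suc i)) {..<?N})}"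
  show "finite (?bad u \<union> ?bad w)" by (intro finite_UnI generic_perturbation)
  fix ep assume e: "0 < ep" "ep <= de" "ep \<notin> ?bad u \<union> ?bad w"
  hence g: "!!i. i < ?N ==> U ep i ~= 0" "inj_on (U ep) {..<?N}" "!!i. i < ?N ==> W ep i ~= 0" "inj_on (W ep) {..<?N}"
   unfolding U_def W_def by blast+
  show "h ep = 0" unfolding h_def using toeplitz_generic[OF U1 refl g] e by simp
 qed
 moreover have "U 0 = u" "W 0 = w" by (auto simp: U_def W_def)
 ultimately show ?thesis by (simp add: h_def)
qed

section \<open>The fundamental character and the plethystic exponential\<close>

lemma irrep_char_cong:
 assumes "!!k. k : {1..N - 1} ==> a k = a' k" "!!k. k : {1..N - 1} ==> b k = b' k"
 shows "irrep_char N a b x y = irrep_char N a' b' x y"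
proof -
 have "is_weight N d rh (%k. int (a k)) (%k. int (b k)) = is_weight N d rh (%k. int (a' k)) (%k. int (b' k))" for d rh
 proof -
  have "(\<Prod>k=1..N - 1. x k powi int (a k)) = (\<Prod>k=1..N - 1. x k powi int (a' k))"
   "(\<Prod>k=1..N - 1. x k powi int (b k)) = (\<Prod>k=1..N - 1. x k powi int (b' k))" for x :: "nat => complex"
   by (auto intro!: prod.cong simp: assms)
  thus ?thesis unfolding is_weight_def by simp
 qed
 moreover have "weight_le N p (%k. int (a k)) = weight_le N p (%k. int (a' k))" "weight_le N p (%k. int (b k)) = weight_le N p (%k. int (b' k))" for p
  unfolding weight_le_def using assms by simp_all
 ultimately have "is_irrep N a b d rh = is_irrep N a' b' d rh" for d rh unfolding is_irrep_def by simp
 thus ?thesis unfolding irrep_char_def by simp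
qed

context fug_chars
begin

text \<open>The bifundamental is the part of degree 1: the only labels of degree 1 are
  [1, 0, ..., 0], and the symmetric polynomial of degree 1 is the sum of the weights.\<close>

lemma fundamental_char:
 "irrep_char N (%k. if k = 1 then 1 else 0) (%k. if k = N - 1 then 1 else 0) x y = (SUM a:{..<N} \<times> {..<N}. cc a)"
proof -
 define n where "n = restrict (%k. if k = 1 then 1 else 0 :: nat) {1..N - 1}"
 have m1: "1 : {1..N - 1}" using N2 by auto
 have E: "Edeg N 1 = {n}"
 proof (rule Set.set_eqI)
  fix n' :: "nat => nat"
  have dec: "wdeg N n' = n' 1 + (SUM m:{1..N - 1} - {1}. m * n' m)" for n' unfolding wdeg_def using m1 by (subst sum.remove[of _ 1]) auto
  show "n' : Edeg N 1 \<longleftrightarrow> n' : {n}"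
  proof
   assume n': "n' : Edeg N 1"
   hence d: "n' 1 + (SUM m:{1..N - 1} - {1}. m * n' m) = 1" using dec by (simp add: Edeg_def)
   have z: "n' m = 0" if m: "m : {1..N - 1} - {1}" for m
   proof (rule ccontr)
    assume "n' m ~= 0"
    hence "2 <= m * n' m" using m by (cases "n' m") auto
    also have "... <= (SUM m:{1..N - 1} - {1}. m * n' m)" using m by (intro member_le_sum) auto
    finally show False using d by simp
   qed
   hence "n' 1 = 1" using d by simp
   hence "n' = n" using n' z by (intro PiE_ext[of n' "{1..N - 1}" "%_. UNIV" n]) (auto simp: Edeg_def n_def)
   thus "n' : {n}" by simp
  next
   have "(SUM m:{1..N - 1} - {1}. m * n m) = 0" by (intro sum.neutral) (auto simp: n_def)
   hence "wdeg N n = 1" unfolding dec using m1 by (simp add: n_def)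
   thus "n' : {n} ==> n' : Edeg N 1" by (auto simp: Edeg_def n_def)
  qed
 qed
 have "irrep_char N (%k. if k = 1 then 1 else 0) (%k. if k = N - 1 then 1 else 0) x y = GC n"
  by (rule irrep_char_cong) (auto simp: n_def)
 also have "... = hh 1" using hh_Edeg[of 1] N2 unfolding E by simp
 also have "... = (SUM m:(%a. {#a#}) ` ({..<N} \<times> {..<N}). prod_mset (image_mset cc m))"
 proof -
  have "m : (%a. {#a#}) ` L" if m: "set_mset m \<subseteq> L" "size m = 1" for m :: "(nat \<times> nat) multiset" and L
  proof -
   obtain a where "m = {#a#}" using size_1_singleton_mset[OF m(2)] by blast
   thus ?thesis using m(1) by auto
  qed
  hence "{m. set_mset m \<subseteq> {..<N} \<times> {..<N} & size m = 1} = (%a. {#a#}) ` ({..<N} \<times> {..<N})" by auto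
  thus ?thesis unfolding hh_def hsym_def by simp
 qed
 also have "... = (SUM a:{..<N} \<times> {..<N}. cc a)" by (subst sum.reindex) (auto simp: inj_on_def)
 finally show ?thesis .
qed

end

lemma log_series_sums: assumes "cmod w < 1" shows "(%r. w ^ Suc r / of_nat (Suc r)) sums (- ln (1 - w))"
proof -
 have "(%n. - ((- (- w)) ^ n) / of_nat n) sums ln (1 + - w)" using assms by (intro Ln_series') simp
 hence "(%n. - (- ((- (- w)) ^ n) / of_nat n)) sums (- ln (1 + - w))" by (rule sums_minus)
 hence "(%n. w ^ n / of_nat n) sums (- ln (1 - w))" by simp
 thus ?thesis by (subst sums_Suc_iff) simp
qed

lemma fugacities_power: "fugacities N x ==> fugacities N (%k. x k ^ r)"
 by (simp add: fugacities_def norm_power)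

lemma fug_power: "fug N (%k. x k ^ r) i = fug N x i ^ r" by (simp add: fug_def power_divide)

text \<open>Powers of fugacities are again fugacities, and their diagonal entries are the powers of
  the original ones. Each term of the exponent is thus a sum over the weights, and the logarithm
  series is summed weight by weight.\<close>

lemma PE_fundamental:
 assumes N: "N >= 2" and f: "fugacities N x" "fugacities N y" and q: "cmod (t * s) < 1"
 shows "PE (%t s x y. irrep_char N (%k. if k = 1 then 1 else 0) (%k. if k = N - 1 then 1 else 0) x y * (t * s)) t s x y
  = (PROD a:{..<N} \<times> {..<N}. 1 / (1 - fug_chars.cc N x y a * (t * s)))"
proof -
 interpret C: fug_chars N x y by (simp add: fug_chars_def N f)
 let ?L = "{..<N} \<times> {..<N}" and ?q = "t * s"
 have c1: "cmod (C.cc a * ?q) < 1" if "a : ?L" for a using C.cc_unit[OF that] q by (simp add: norm_mult)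
 have trm: "irrep_char N (%k. if k = 1 then 1 else 0) (%k. if k = N - 1 then 1 else 0) (%k. x k ^ Suc r) (%k. y k ^ Suc r) * (t ^ Suc r * s ^ Suc r) / of_nat (Suc r)
   = (SUM a:?L. (C.cc a * ?q) ^ Suc r / of_nat (Suc r))" for r
 proof -
  interpret P: fug_chars N "%k. x k ^ Suc r" "%k. y k ^ Suc r" unfolding fug_chars_def by (intro conjI N fugacities_power f)
  have "P.cc a = C.cc a ^ Suc r" for a by (simp only: P.cc_def C.cc_def case_prod_beta fug_power power_mult_distrib complex_cnj_power)
  hence "irrep_char N (%k. if k = 1 then 1 else 0) (%k. if k = N - 1 then 1 else 0) (%k. x k ^ Suc r) (%k. y k ^ Suc r) = (SUM a:?L. C.cc a ^ Suc r)"
   by (simp only: P.fundamental_char)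
  thus ?thesis by (simp only: sum_distrib_right sum_divide_distrib power_mult_distrib)
 qed
 have "(%r. SUM a:?L. (C.cc a * ?q) ^ Suc r / of_nat (Suc r)) sums (SUM a:?L. - ln (1 - C.cc a * ?q))"
  by (intro sums_sum log_series_sums c1)
 hence "PE (%t s x y. irrep_char N (%k. if k = 1 then 1 else 0) (%k. if k = N - 1 then 1 else 0) x y * (t * s)) t s x y
   = exp (SUM a:?L. - ln (1 - C.cc a * ?q))"
  unfolding PE_def trm by (simp only: sums_unique[symmetric])
 also have "... = (PROD a:?L. exp (- ln (1 - C.cc a * ?q)))" by (rule exp_sum) simp
 also have "... = (PROD a:?L. 1 / (1 - C.cc a * ?q))"
 proof (rule prod.cong[OF refl])
  fix a assume "a : ?L"
  hence "1 - C.cc a * ?q ~= 0" using c1[of a] by (metis eq_iff_diff_eq_0 norm_one less_irrefl)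
  thus "exp (- ln (1 - C.cc a * ?q)) = 1 / (1 - C.cc a * ?q)" by (simp add: exp_minus divide_inverse)
 qed
 finally show ?thesis .
qed

lemma fug_prod_1: assumes "fugacities N x" "N >= 2" shows "(\<Prod>i<N. fug N x (i + 1)) = 1"
 using fug_prod[OF assms order_refl] by simp

lemma prod_1_N: "(\<Prod>i=1..N. f i) = (\<Prod>i<N. f (i + 1))" for f :: "nat => complex"
 by (rule prod.reindex_bij_witness[of _ "%i. i + 1" "%i. i - 1"]) auto

text \<open>The diagonal entries of each special unitary factor multiply to 1, so the products of
  the u and of the w reduce to powers of t and s.\<close>

lemma hilbert_product:
 fixes t s :: complex
 assumes Nc: "Nc >= 1" "N = Suc Nc" and t: "cmod t < 1" "cmod s < 1" and f: "fugacities N x" "fugacities N y"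
 shows "hilbert_U N Nc t s x y = (1 - (t * s) ^ N) * (PROD a:{..<N} \<times> {..<N}. 1 / (1 - fug_chars.cc N x y a * (t * s)))"
proof -
 have N: "N >= 2" using Nc by simp
 interpret C: fug_chars N x y by (simp add: fug_chars_def N f)
 define u where "u i = t * fug N x (i + 1)" for i
 define w where "w i = s * inverse (fug N y (i + 1))" for i
 have un: "cmod (fug N x (i + 1)) = 1" "cmod (fug N y (i + 1)) = 1" if "i < N" for i
  by (rule fug_unit[OF f(1) N that], rule fug_unit[OF f(2) N that])
 have uw: "cmod (u i) < 1" "cmod (w i) < 1" if "i < N" for i
  using un[OF that] t by (simp_all add: u_def w_def norm_mult norm_inverse)
 have cphi: "ccont (phi N u w)" by (rule phi_cont[OF uw])
 have fl: "flavour_factor N t s x y = phi N u w"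
  by (rule ext) (simp only: flavour_factor_def phi_def prod_1_N u_def w_def)
 have "hilbert_U N Nc t s x y = Det (toep (phi N u w) Nc)"
  unfolding hilbert_U_def fl integral_toeplitz[OF cphi] by simp
 moreover have "Det (toep (phi N u w) Nc) * (\<Prod>i<N. \<Prod>k<N. 1 - u i * w k) = 1 - (\<Prod>i<N. u i) * (\<Prod>i<N. w i)"
  using toeplitz_det[of Nc u w] uw Nc(2) by simp
 moreover have "(\<Prod>i<N. u i) * (\<Prod>i<N. w i) = (t * s) ^ N"
 proof -
  have "(\<Prod>i<N. inverse (fug N y (i + 1))) = inverse (\<Prod>i<N. fug N y (i + 1))"
   using prod_inversef[of "%i. fug N y (i + 1)" "{..<N}"] by (simp add: comp_def)
  thus ?thesis unfolding u_def w_def prod.distrib using fug_prod_1[OF f(1) N] fug_prod_1[OF f(2) N]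
   by (simp add: power_mult_distrib)
 qed
 moreover have "(\<Prod>i<N. \<Prod>k<N. 1 - u i * w k) = (PROD a:{..<N} \<times> {..<N}. 1 - C.cc a * (t * s))"
 proof -
  have "(\<Prod>k<N. 1 - u i * w k) = (\<Prod>j<N. 1 - C.cc (i, j) * (t * s))" for i
  \<comment> \<open>\<open>C.cc\<close> counts the second block from its end, \<open>w\<close> from
    its beginning.\<close>
  proof (rule prod.reindex_bij_witness[of _ "%j. N - 1 - j" "%j. N - 1 - j"])
   fix k assume k: "k : {..<N}"
   hence e: "N - (N - 1 - k) = k + 1" by auto
   have "fug N y (k + 1) * cnj (fug N y (k + 1)) = 1" using complex_norm_square[of "fug N y (k + 1)"] un(2)[of k] k by simp
   hence "inverse (fug N y (k + 1)) = cnj (fug N y (k + 1))" by (rule inverse_unique)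
   thus "1 - C.cc (i, N - 1 - k) * (t * s) = 1 - u i * w k" by (simp only: C.cc_def prod.case e u_def w_def mult_ac)
  qed auto
  thus ?thesis by (simp add: prod.cartesian_product case_prod_beta)
 qed
 moreover have "(PROD a:{..<N} \<times> {..<N}. 1 - C.cc a * (t * s)) ~= 0"
 proof -
  have "1 - C.cc a * (t * s) ~= 0" if "a : {..<N} \<times> {..<N}" for a
  proof -
   have "cmod t * cmod s < 1 * 1" using t by (intro mult_strict_mono) auto
   hence "cmod (C.cc a * (t * s)) < 1" using C.cc_unit[OF that] by (simp add: norm_mult)
   thus ?thesis by (metis eq_iff_diff_eq_0 norm_one less_irrefl)
  qed
  thus ?thesis by simp
 qed
 ultimately show ?thesis by (simp add: prod_dividef field_simps)
qed

theorem mainTheorem4: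
  fixes Nc Nf :: nat and t s :: real and x y :: "nat \<Rightarrow> complex"
  assumes "Nc \<ge> 1" and "Nf = Nc + 1"
    and "0 \<le> t" "t < 1" and "0 \<le> s" "s < 1"
    and "fugacities Nf x" and "fugacities Nf y"
  shows "hilbert_U Nf Nc t s x y =
           (1 - (complex_of_real t * complex_of_real s) ^ Nf) *
           PE (\<lambda>t s x y. irrep_char Nf (\<lambda>k. if k = 1 then 1 else 0)
                                       (\<lambda>k. if k = Nf - 1 then 1 else 0) x y * (t * s)) t s x y
       \<and> ((\<lambda>n. irrep_char Nf n (\<lambda>k. n (Nf - k)) x y *
               (complex_of_real t * complex_of_real s) ^ (\<Sum>j=1..Nf - 1. j * n j))
            has_sum hilbert_U Nf Nc t s x y) ({1..Nf - 1} \<rightarrow>\<^sub>E (UNIV :: nat set))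
       \<and> hilbert_U Nf Nc t s (\<lambda>_. 1) (\<lambda>_. 1) =
           (1 - (complex_of_real t * complex_of_real s) ^ Nf) /
           (1 - complex_of_real t * complex_of_real s) ^ (Nf\<^sup>2)"
proof -
 have N: "Nf >= 2" "Nf = Suc Nc" using assms(1,2) by auto
 have c: "cmod (of_real t) < 1" "cmod (of_real s) < 1" using assms(3-6) by auto
 have q: "cmod (of_real t * of_real s) < 1"
 proof -
  have "cmod (of_real t) * cmod (of_real s) < 1 * 1" using c by (intro mult_strict_mono) auto
  thus ?thesis by (simp add: norm_mult)
 qed
 have f1: "fugacities Nf (%_. 1)" by (simp add: fugacities_def)
 note H = hilbert_product[OF assms(1) N(2) c]
 interpret C1: fug_chars Nf "%_. 1" "%_. 1" unfolding fug_chars_def by (intro conjI N(1) f1)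
 have "C1.cc a = 1" for a by (cases a) (simp add: C1.cc_def fug_def)
 hence "hilbert_U Nf Nc t s (%_. 1) (%_. 1) =
      (1 - (complex_of_real t * complex_of_real s) ^ Nf) / (1 - complex_of_real t * complex_of_real s) ^ (Nf\<^sup>2)"
  unfolding H[OF f1 f1] by (simp add: power2_eq_square power_divide)
 thus ?thesis
  using character_sum[OF N(1) assms(7,8) q] unfolding PE_fundamental[OF N(1) assms(7,8) q] H[OF assms(7,8)] by blast
qed

end
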